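(* Let $H=(H_1,\ldots,H_{N_1})\in(0,1)^{N_1}$ and $K=(K_1,\ldots,K_{N_2})\in(0,1)^{N_2}$. Let $X^H=\{X^H(s),s\in\mathbb{R}^{N_1}\}$ be an $(N_1,d)$-Gaussian random field and $X^K=\{X^K(t),t\in\mathbb{R}^{N_2}\}$ an $(N_2,d)$-Gaussian random field, independent of each other, whose associated real-valued random fields $X_0^H$ and $X_0^K$ satisfy Conditions (C1) and (C2), respectively, on $I_{N_1}=[0,1]^{N_1}$ with index $H$ and on $I_{N_2}=[0,1]^{N_2}$ with index $K$. Let $L_I(X^H,X^K)$ be the intersection local time of $X^H$ and $X^K$. Then: (i) $L_I(X^H,X^K)\in L^2(\Omega,\mathbb{P})$ if and only if $\sum_{j=1}^{N_1}\frac1{H_j}+\sum_{j=1}^{N_2}\frac1{K_j}>d$. (ii) $L_I(X^H,X^K)\in D_1$ if and only if $\sum_{j=1}^{N_1}\frac1{H_j}+\sum_{j=1}^{N_2}\frac1{K_j}>d+2$.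
   Context: $N_1,N_2,d\ge1$ are integers and $I_{M}=[0,1]^{M}$. An $(M,d)$-Gaussian random field is $X(t)=(X_1(t),\ldots,X_d(t))\in\mathbb{R}^d$, $t\in\mathbb{R}^M$, where $X_1,\ldots,X_d$ are independent copies of a real-valued centered Gaussian random field $X_0$ (the associated real-valued field) with continuous covariance function. Sample paths are taken to be continuous on $I_M$. Condition (C1) on $I_M$ with index $H\in(0,1)^M$: there is a constant $0<c_1<\infty$ such that $\mathbb{E}[(X_0(s)-X_0(t))^2]\le c_1\sum_{j=1}^M|s_j-t_j|^{2H_j}$ for all $s,t\in I_M$. Condition (C2) on $I_M$ with index $H$: there is a constant $c_2>0$ such that $\mathrm{Var}(X_0(t)\mid X_0(s))\ge c_2\sum_{j=1}^M\min\{|s_j-t_j|^{2H_j},|t_j|^{2H_j}\}$ for all $s,t\in I_M$ (conditional variance of $X_0(t)$ given $X_0(s)$). The intersection local time is formally $L_I(X^H,X^K)=\int_{I_{N_1}\times I_{N_2}}\delta(X^H(s)-X^K(t))\,ds\,dt$; that is, it is the local time at $x=0$ on $I_{N_1}\times I_{N_2}$ of the field $U(s,t)=X^H(s)-X^K(t)$, defined as the limit in $L^2(\Omega,\mathbb{P})$ as $\varepsilon\to0$ of $\int_{I_{N_1}\times I_{N_2}}p_\varepsilon(X^H(s)-X^K(t))\,ds\,dt$, where $p_\varepsilon(x)=(2\pi\varepsilon)^{-d/2}\exp(-\|x\|^2/(2\varepsilon))$. The assertion $L_I(X^H,X^K)\in L^2(\Omega,\mathbb{P})$ means that this $L^2$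 limit exists, and $L_I(X^H,X^K)\in D_1$ means that it exists and belongs to $D_1$. Chaos expansion and $D_1$: let $\mathcal{P}_n$ be the closure in $L^2(\Omega,\mathbb{P})$ of the set of all polynomials of degree at most $n$ in finitely many of the underlying Gaussian variables (the values of the coordinates of $U$), and let $\mathcal{C}_n$ be the orthogonal complement of $\mathcal{P}_{n-1}$ in $\mathcal{P}_n$ (with $\mathcal{C}_0$ the constants). Every square-integrable functional $F$ of the field has a unique chaos expansion $F=\sum_{n\ge0}F_n$, $F_n\in\mathcal{C}_n$, and $D_1=\{F\in L^2(\Omega,\mathbb{P}):\ \sum_{n\ge0}n\,\mathbb{E}(|F_n|^2)<\infty\}$. *)

theory Defs
  imports "HOL-Probability.Probability"
begin

text \<open>
  Parameter space and state space dimensions are the cardinalities of finite index types,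
  so that a field \<open>X\<close> on \<open>\<real>\<^sup>N\<close> with values in \<open>\<real>\<^sup>d\<close> is a function of type
  \<open>real ^ 'n \<Rightarrow> 'w \<Rightarrow> real ^ 'd\<close>.
\<close>

definition unit_cube :: "(real ^ 'n) set" where
  "unit_cube = cbox 0 1"

section \<open>Gaussian random fields\<close>

text \<open>Point masses at 0 count as (degenerate) centered Gaussian laws.\<close>

definition centered_gaussian_rv :: "'w measure \<Rightarrow> ('w \<Rightarrow> real) \<Rightarrow> bool" where
  "centered_gaussian_rv M Y \<longleftrightarrow> Y \<in> borel_measurable M \<and>
     ((AE \<omega> in M. Y \<omega> = 0) \<or> (\<exists>\<sigma>>0. distributed M lborel Y (normal_density 0 \<sigma>)))"

definition centered_gaussian_field :: "'w measure \<Rightarrow> (real ^ 'n \<Rightarrow> 'w \<Rightarrow> real) \<Rightarrow> bool" where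
  "centered_gaussian_field M X \<longleftrightarrow> prob_space M \<and>
     (\<forall>T c. finite T \<longrightarrow> centered_gaussian_rv M (\<lambda>\<omega>. \<Sum>t\<in>T. c t * X t \<omega>))"

definition continuous_covariance :: "'w measure \<Rightarrow> (real ^ 'n \<Rightarrow> 'w \<Rightarrow> real) \<Rightarrow> bool" where
  "continuous_covariance M X \<longleftrightarrow>
     continuous_on UNIV (\<lambda>(s, t). \<integral>\<omega>. X s \<omega> * X t \<omega> \<partial>M)"

text \<open>
  \<open>X\<close> is a Gaussian random field with associated real-valued field \<open>X0\<close>: its coordinates are
  independent, and each has the law of \<open>X0\<close> on the product sigma-algebra.  The field \<open>X0\<close> may
  live on a probability space \<open>M0\<close> of its own.
\<close>

definition gaussian_random_field ::
  "'w measure \<Rightarrow> (real ^ 'n \<Rightarrow> 'w \<Rightarrow> real ^ 'd) \<Rightarrow>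
   'v measure \<Rightarrow> (real ^ 'n \<Rightarrow> 'v \<Rightarrow> real) \<Rightarrow> bool" where
  "gaussian_random_field M X M0 X0 \<longleftrightarrow>
     prob_space M \<and>
     centered_gaussian_field M0 X0 \<and>
     continuous_covariance M0 X0 \<and>
     prob_space.indep_vars M (\<lambda>_. PiM UNIV (\<lambda>_. borel)) (\<lambda>i \<omega> t. X t \<omega> $ i) UNIV \<and>
     (\<forall>i. distr M (PiM UNIV (\<lambda>_. borel)) (\<lambda>\<omega> t. X t \<omega> $ i) =
          distr M0 (PiM UNIV (\<lambda>_. borel)) (\<lambda>\<omega> t. X0 t \<omega>)) \<and>
     (\<forall>\<omega>\<in>space M. continuous_on unit_cube (\<lambda>t. X t \<omega>))"

definition field_sigma :: "'w measure \<Rightarrow> ('i \<Rightarrow> 'w \<Rightarrow> real ^ 'd) \<Rightarrow> 'w set set" where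
  "field_sigma M X = sets (vimage_algebra (space M) (\<lambda>\<omega> t. X t \<omega>) (PiM UNIV (\<lambda>_. borel)))"

text \<open>
  The library constant \<open>indep_var\<close> requires both random elements to have the same type, so
  independence is stated for the generated sigma-algebras.
\<close>

definition independent_fields ::
  "'w measure \<Rightarrow> (real ^ 'n \<Rightarrow> 'w \<Rightarrow> real ^ 'd) \<Rightarrow> (real ^ 'm \<Rightarrow> 'w \<Rightarrow> real ^ 'd) \<Rightarrow> bool" where
  "independent_fields M X Y \<longleftrightarrow>
     prob_space.indep_set M (field_sigma M X) (field_sigma M Y)"

definition cond_variance :: "'w measure \<Rightarrow> ('w \<Rightarrow> real) \<Rightarrow> ('w \<Rightarrow> real) \<Rightarrow> 'w \<Rightarrow> real" where
  "cond_variance M Y Z =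
     (let F = vimage_algebra (space M) Z borel
      in real_cond_exp M F (\<lambda>\<omega>. (Y \<omega> - real_cond_exp M F Y \<omega>)\<^sup>2))"

definition condition_C1 ::
  "'w measure \<Rightarrow> (real ^ 'n \<Rightarrow> 'w \<Rightarrow> real) \<Rightarrow> real ^ 'n \<Rightarrow> bool" where
  "condition_C1 M X0 H \<longleftrightarrow>
     (\<exists>c1>0. \<forall>s\<in>unit_cube. \<forall>t\<in>unit_cube.
        (\<integral>\<omega>. (X0 s \<omega> - X0 t \<omega>)\<^sup>2 \<partial>M) \<le> c1 * (\<Sum>j\<in>UNIV. \<bar>s $ j - t $ j\<bar> powr (2 * H $ j)))"

definition condition_C2 ::
  "'w measure \<Rightarrow> (real ^ 'n \<Rightarrow> 'w \<Rightarrow> real) \<Rightarrow> real ^ 'n \<Rightarrow> bool" where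
  "condition_C2 M X0 H \<longleftrightarrow>
     (\<exists>c2>0. \<forall>s\<in>unit_cube. \<forall>t\<in>unit_cube.
        AE \<omega> in M. cond_variance M (X0 t) (X0 s) \<omega> \<ge>
          c2 * (\<Sum>j\<in>UNIV. min (\<bar>s $ j - t $ j\<bar> powr (2 * H $ j)) (\<bar>t $ j\<bar> powr (2 * H $ j))))"

section \<open>Convergence in \<open>L\<^sup>2\<close>\<close>

text \<open>
  Elements of \<open>L\<^sup>2\<close> are represented by functions; all notions below are invariant under almost
  sure equality.
\<close>

definition L2 :: "'w measure \<Rightarrow> ('w \<Rightarrow> real) set" where
  "L2 M = {F \<in> borel_measurable M. integrable M (\<lambda>\<omega>. (F \<omega>)\<^sup>2)}"

text \<open>
  The membership conditions are needed because the Bochner integral of a non-integrable function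
  is 0.
\<close>

definition L2_tendsto ::
  "'w measure \<Rightarrow> ('i \<Rightarrow> 'w \<Rightarrow> real) \<Rightarrow> ('w \<Rightarrow> real) \<Rightarrow> 'i filter \<Rightarrow> bool" where
  "L2_tendsto M f F \<F> \<longleftrightarrow>
     F \<in> L2 M \<and> eventually (\<lambda>i. f i \<in> L2 M) \<F> \<and>
     ((\<lambda>i. \<integral>\<omega>. (f i \<omega> - F \<omega>)\<^sup>2 \<partial>M) \<longlongrightarrow> 0) \<F>"

definition L2_closure :: "'w measure \<Rightarrow> ('w \<Rightarrow> real) set \<Rightarrow> ('w \<Rightarrow> real) set" where
  "L2_closure M A = {F. \<exists>f. (\<forall>k. f k \<in> A) \<and> L2_tendsto M f F sequentially}"

section \<open>Intersection local time\<close>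

definition heat_kernel :: "real \<Rightarrow> real ^ 'd \<Rightarrow> real" where
  "heat_kernel \<epsilon> x =
     (2 * pi * \<epsilon>) powr (- real CARD('d) / 2) * exp (- (norm x)\<^sup>2 / (2 * \<epsilon>))"

definition difference_field ::
  "(real ^ 'n \<Rightarrow> 'w \<Rightarrow> real ^ 'd) \<Rightarrow> (real ^ 'm \<Rightarrow> 'w \<Rightarrow> real ^ 'd) \<Rightarrow>
   (real ^ 'n) \<times> (real ^ 'm) \<Rightarrow> 'w \<Rightarrow> real ^ 'd" where
  "difference_field X Y = (\<lambda>(s, t) \<omega>. X s \<omega> - Y t \<omega>)"

definition approx_local_time ::
  "('i::euclidean_space \<Rightarrow> 'w \<Rightarrow> real ^ 'd) \<Rightarrow> 'i set \<Rightarrow> real \<Rightarrow> 'w \<Rightarrow> real" where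
  "approx_local_time U I \<epsilon> \<omega> = (LINT z:I|lborel. heat_kernel \<epsilon> (U z \<omega>))"

text \<open>The random variable \<open>L\<close> is (a version of) the local time of \<open>U\<close> at 0 on \<open>I\<close>.\<close>

definition is_local_time_at_0 ::
  "'w measure \<Rightarrow> ('i::euclidean_space \<Rightarrow> 'w \<Rightarrow> real ^ 'd) \<Rightarrow> 'i set \<Rightarrow> ('w \<Rightarrow> real) \<Rightarrow> bool" where
  "is_local_time_at_0 M U I L \<longleftrightarrow> L2_tendsto M (approx_local_time U I) L (at_right 0)"

definition is_intersection_local_time ::
  "'w measure \<Rightarrow> (real ^ 'n \<Rightarrow> 'w \<Rightarrow> real ^ 'd) \<Rightarrow> (real ^ 'm \<Rightarrow> 'w \<Rightarrow> real ^ 'd) \<Rightarrow>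
   ('w \<Rightarrow> real) \<Rightarrow> bool" where
  "is_intersection_local_time M X Y L \<longleftrightarrow>
     is_local_time_at_0 M (difference_field X Y) (unit_cube \<times> unit_cube) L"

section \<open>Chaos expansion and the space \<open>D\<^sub>1\<close>\<close>

definition coordinate_values :: "('i \<Rightarrow> 'w \<Rightarrow> real ^ 'd) \<Rightarrow> ('w \<Rightarrow> real) set" where
  "coordinate_values U = {\<lambda>\<omega>. U z \<omega> $ i | z i. True}"

text \<open>
  Polynomials of degree at most \<open>n\<close> in finitely many elements of \<open>G\<close>: finite linear combinations
  of monomials, a monomial being encoded by the list of its factors.
\<close>

definition polynomials_in :: "('w \<Rightarrow> real) set \<Rightarrow> nat \<Rightarrow> ('w \<Rightarrow> real) set" where
  "polynomials_in G n =
     {\<lambda>\<omega>. \<Sum>l\<in>S. c l * (\<Prod>g\<leftarrow>l. g \<omega>) | S c.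
        finite S \<and> S \<subseteq> {l. set l \<subseteq> G \<and> length l \<le> n}}"

definition poly_space :: "'w measure \<Rightarrow> ('w \<Rightarrow> real) set \<Rightarrow> nat \<Rightarrow> ('w \<Rightarrow> real) set" where
  "poly_space M G n = L2_closure M (polynomials_in G n)"

primrec chaos :: "'w measure \<Rightarrow> ('w \<Rightarrow> real) set \<Rightarrow> nat \<Rightarrow> ('w \<Rightarrow> real) set" where
  \<comment> \<open>The polynomials of degree 0 are the constants.\<close>
  "chaos M G 0 = poly_space M G 0"
| "chaos M G (Suc n) =
     {F \<in> poly_space M G (Suc n). \<forall>P\<in>poly_space M G n. (\<integral>\<omega>. F \<omega> * P \<omega> \<partial>M) = 0}"

definition chaos_expansion ::
  "'w measure \<Rightarrow> ('w \<Rightarrow> real) set \<Rightarrow> ('w \<Rightarrow> real) \<Rightarrow> (nat \<Rightarrow> 'w \<Rightarrow> real) \<Rightarrow> bool" where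
  "chaos_expansion M G F Fn \<longleftrightarrow>
     (\<forall>n. Fn n \<in> chaos M G n) \<and>
     L2_tendsto M (\<lambda>m \<omega>. \<Sum>n<m. Fn n \<omega>) F sequentially"

text \<open>The components of a chaos expansion are unique up to almost sure equality.\<close>

definition D1 :: "'w measure \<Rightarrow> ('w \<Rightarrow> real) set \<Rightarrow> ('w \<Rightarrow> real) set" where
  "D1 M G = {F \<in> L2 M. \<exists>Fn. chaos_expansion M G F Fn \<and>
     summable (\<lambda>n. real n * (\<integral>\<omega>. \<bar>Fn n \<omega>\<bar>\<^sup>2 \<partial>M))}"

end

theory Submission
  imports Defs
begin

text \<open>
  The difference field \<open>U(s, t) = X\<^sup>H(s) - X\<^sup>K(t)\<close> is Gaussian on the unit cube, with independent
  coordinates of covariance \<open>R(z, z') = R\<^sup>H(s, s') + R\<^sup>K(t, t')\<close>.  Let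
  \<open>D(z, z') = R(z, z) R(z', z') - R(z, z')\<^sup>2\<close> be the covariance determinant of one coordinate at two
  points, and let \<open>hdim\<close> be the sum of all \<open>1 / H\<^sub>j\<close> and \<open>1 / K\<^sub>j\<close>.  The proof turns both
  statements into the convergence of an integral:
  \<open>E[L\<^sup>2] = (2 \<pi>)\<^sup>-\<^sup>d \<integral>\<integral> D\<^sup>-\<^sup>d\<^sup>/\<^sup>2\<close> and
  \<open>\<Sum> n E[L\<^sub>n\<^sup>2] = (2 \<pi>)\<^sup>-\<^sup>d \<integral>\<integral> d R\<^sup>2 D\<^sup>-\<^sup>d\<^sup>/\<^sup>2\<^sup>-\<^sup>1\<close>.

  Existence.  Up to a constant, the heat kernel at \<open>x\<close> is the mean of \<open>cos (\<zeta> \<bullet> x / sqrt \<epsilon>)\<close> over a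
  standard normal vector \<open>\<zeta>\<close>.  Hence the regularised local time \<open>L\<^sub>\<epsilon>\<close> is an average of cosines of
  Gaussian variables, and \<open>E[L\<^sub>\<epsilon> L\<^sub>\<delta>]\<close> is the first integral with \<open>\<epsilon>\<close> and \<open>\<delta>\<close> added to the variances
  (\<open>approx_local_time_inner\<close>).  These inner products increase to a common limit as \<open>\<epsilon>\<close> and \<open>\<delta>\<close>
  decrease to 0, so \<open>L\<^sub>\<epsilon>\<close> converges in \<open>L\<^sup>2\<close> if and only if the limit is finite
  (\<open>local_time_second_moment\<close>, \<open>local_time_exists\<close>).

  Chaos components.  The component of degree \<open>n\<close> of \<open>cos g\<close> is a multiple of a Hermite polynomial in
  \<open>g\<close> alone.  Summing the explicit inner products of these components with weights \<open>\<rho>\<^sup>n\<close> amounts to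
  multiplying the covariance between two distinct points by \<open>\<rho>\<close>, with the variances unchanged.  Thus
  \<open>\<Sum> \<rho>\<^sup>n E[L\<^sub>n\<^sup>2]\<close> is \<open>(2 \<pi>)\<^sup>-\<^sup>d\<close> times the double integral of \<open>(R(z, z) R(z', z') - \<rho>\<^sup>2 R(z, z')\<^sup>2)\<^sup>-\<^sup>d\<^sup>/\<^sup>2\<close> (\<open>local_time_chaos_sums\<close>), and the sum
  \<open>\<Sum> n E[L\<^sub>n\<^sup>2]\<close> is its left derivative at \<open>\<rho> = 1\<close>.  The mean value theorem bounds the difference
  quotients of the integrand from both sides by its derivative, at \<open>\<rho>\<close> and at 1; with monotone
  convergence this decides when the derivative is finite, and gives membership in \<open>D\<^sub>1\<close>.

  The integral.  The double integral of \<open>D\<^sup>-\<^sup>p\<^sup>/\<^sup>2\<close> is finite if and only if \<open>p < hdim\<close>; part one is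
  \<open>p = d\<close> and part two is \<open>p = d + 2\<close>.  The factor \<open>R\<^sup>2\<close> is harmless: it is bounded, and bounded away
  from 0 near those diagonal points that stay away from the coordinate hyperplanes.  For finiteness,
  the second condition bounds every variance and every linear prediction error from below, hence
  bounds \<open>D\<close> from below by a product of two sums of powers.  A sum of powers of \<open>y\<^sub>b\<close>
  with exponents \<open>2 h\<^sub>b\<close> is at least the product of all \<open>y\<^sub>b\<close> to the power \<open>2 / hdim\<close>, which reduces the integral to one-dimensional integrals of
  \<open>\<bar>x\<bar>\<close> to the power \<open>- p / hdim > -1\<close> (\<open>cdet_integral_finite\<close>).  For divergence, the first
  condition gives \<open>D \<le> A 4\<^sup>-\<^sup>k\<close> when \<open>z' - z\<close> lies in a box with sides of order
  \<open>2\<close> to the power \<open>- k / h\<^sub>b\<close>.  The box has volume of order \<open>2\<close> to the power \<open>- k hdim\<close>, so for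
  \<open>p \<ge> hdim\<close> every dyadic shell around \<open>z\<close> contributes at least a fixed positive amount
  (\<open>cdet_integral_infinite\<close>).
\<close>

section \<open>Square-integrable random variables\<close>

lemma L2_borel [measurable_dest]: "F \<in> L2 M \<Longrightarrow> F \<in> borel_measurable M"
  by (simp add: L2_def)

lemma L2_square_integrable: "F \<in> L2 M \<Longrightarrow> integrable M (\<lambda>\<omega>. (F \<omega>)\<^sup>2)"
  by (simp add: L2_def)

lemma L2_mult_integrable:
  assumes "F \<in> L2 M" "G \<in> L2 M"
  shows "integrable M (\<lambda>\<omega>. F \<omega> * G \<omega>)"
proof (rule Bochner_Integration.integrable_bound)
  show "integrable M (\<lambda>\<omega>. (F \<omega>)\<^sup>2 + (G \<omega>)\<^sup>2)"
    using assms by (simp add: L2_def)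
  have *: "\<bar>a * b\<bar> \<le> a\<^sup>2 + b\<^sup>2" for a b :: real
  proof -
    have "0 \<le> \<bar>a\<bar> * \<bar>b\<bar>" by simp
    then show ?thesis
      using sum_squares_bound[of "\<bar>a\<bar>" "\<bar>b\<bar>"] unfolding abs_mult power2_abs by linarith
  qed
  show "AE \<omega> in M. norm (F \<omega> * G \<omega>) \<le> norm ((F \<omega>)\<^sup>2 + (G \<omega>)\<^sup>2)"
    using * by (intro AE_I2) (simp add: order_trans[OF _ abs_ge_self])
qed (use assms in \<open>auto simp: L2_def\<close>)

lemma L2_scale: "F \<in> L2 M \<Longrightarrow> (\<lambda>\<omega>. c * F \<omega>) \<in> L2 M"
  by (auto simp: L2_def power_mult_distrib)

lemma L2_add:
  assumes "F \<in> L2 M" "G \<in> L2 M" shows "(\<lambda>\<omega>. F \<omega> + G \<omega>) \<in> L2 M"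
  using assms L2_mult_integrable[OF assms] by (auto simp: L2_def power2_sum mult.assoc)

lemma L2_diff:
  assumes "F \<in> L2 M" "G \<in> L2 M" shows "(\<lambda>\<omega>. F \<omega> - G \<omega>) \<in> L2 M"
  using L2_add[OF assms(1) L2_scale[OF assms(2), of "-1"]] by simp

lemma L2_zero: "(\<lambda>\<omega>. 0) \<in> L2 M"
  by (simp add: L2_def)

lemma L2_sum: "finite S \<Longrightarrow> (\<And>i. i \<in> S \<Longrightarrow> F i \<in> L2 M) \<Longrightarrow> (\<lambda>\<omega>. \<Sum>i\<in>S. F i \<omega>) \<in> L2 M"
  by (induction S rule: finite_induct) (auto intro: L2_zero L2_add)

lemma (in finite_measure) L2_integrable:
  assumes "F \<in> L2 M" shows "integrable M F"
proof -
  have "(\<lambda>\<omega>. 1) \<in> L2 M" by (simp add: L2_def)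
  from L2_mult_integrable[OF assms this] show ?thesis by simp
qed

definition l2norm :: "'w measure \<Rightarrow> ('w \<Rightarrow> real) \<Rightarrow> real" where
  "l2norm M F = sqrt (\<integral>\<omega>. (F \<omega>)\<^sup>2 \<partial>M)"

lemma l2norm_nonneg: "0 \<le> l2norm M F"
  by (simp add: l2norm_def)

lemma l2norm_power2: "(l2norm M F)\<^sup>2 = (\<integral>\<omega>. (F \<omega>)\<^sup>2 \<partial>M)"
  by (simp add: l2norm_def)

lemma L2_integral_square_add:
  assumes "F \<in> L2 M" "G \<in> L2 M"
  shows "(\<integral>\<omega>. (F \<omega> + t * G \<omega>)\<^sup>2 \<partial>M)
    = (\<integral>\<omega>. (F \<omega>)\<^sup>2 \<partial>M) + 2 * t * (\<integral>\<omega>. F \<omega> * G \<omega> \<partial>M) + t\<^sup>2 * (\<integral>\<omega>. (G \<omega>)\<^sup>2 \<partial>M)"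
proof -
  have "(\<integral>\<omega>. (F \<omega> + t * G \<omega>)\<^sup>2 \<partial>M)
      = (\<integral>\<omega>. (F \<omega>)\<^sup>2 + (2 * t) * (F \<omega> * G \<omega>) + t\<^sup>2 * (G \<omega>)\<^sup>2 \<partial>M)"
    by (intro Bochner_Integration.integral_cong) (auto simp: power2_eq_square algebra_simps)
  also have "\<dots> = (\<integral>\<omega>. (F \<omega>)\<^sup>2 \<partial>M) + 2 * t * (\<integral>\<omega>. F \<omega> * G \<omega> \<partial>M) + t\<^sup>2 * (\<integral>\<omega>. (G \<omega>)\<^sup>2 \<partial>M)"
    using assms L2_mult_integrable[OF assms] by (simp add: L2_def)
  finally show ?thesis .
qed

text \<open>
  The form in which Cauchy-Schwarz and the projection theorem are obtained: the quadratic is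
  \<open>t \<mapsto> \<parallel>F + t G\<parallel>\<^sup>2\<close>, and \<open>c = 0\<close> is allowed because \<open>G\<close> may vanish almost surely.
\<close>

lemma nonneg_quadratic_discriminant:
  fixes a b c :: real
  assumes "\<And>t. 0 \<le> a + 2 * t * b + t\<^sup>2 * c" and "0 \<le> c"
  shows "b\<^sup>2 \<le> a * c"
proof (cases "c = 0")
  case True
  have "b = 0"
  proof (rule ccontr)
    assume "b \<noteq> 0"
    with assms(1)[of "- (a + 1) / (2 * b)"] True show False by (simp add: field_simps)
  qed
  then show ?thesis using True by simp
next
  case False
  with assms(2) have c: "c > 0" by simp
  have "0 \<le> a + 2 * (- b / c) * b + (- b / c)\<^sup>2 * c" by (rule assms(1))
  also have "\<dots> = a - b\<^sup>2 / c" using c by (simp add: power2_eq_square field_simps)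
  finally show ?thesis using c by (simp add: field_simps)
qed

lemma L2_Cauchy_Schwarz:
  assumes "F \<in> L2 M" "G \<in> L2 M"
  shows "\<bar>\<integral>\<omega>. F \<omega> * G \<omega> \<partial>M\<bar> \<le> l2norm M F * l2norm M G"
proof -
  have "(\<integral>\<omega>. F \<omega> * G \<omega> \<partial>M)\<^sup>2 \<le> (\<integral>\<omega>. (F \<omega>)\<^sup>2 \<partial>M) * (\<integral>\<omega>. (G \<omega>)\<^sup>2 \<partial>M)"
    by (rule nonneg_quadratic_discriminant) (auto simp: L2_integral_square_add[OF assms, symmetric])
  then show ?thesis
    unfolding l2norm_def real_sqrt_mult[symmetric] by (metis real_sqrt_abs real_sqrt_le_iff)
qed

lemma l2norm_triangle:
  assumes "F \<in> L2 M" "G \<in> L2 M"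
  shows "l2norm M (\<lambda>\<omega>. F \<omega> + G \<omega>) \<le> l2norm M F + l2norm M G"
proof (rule power2_le_imp_le)
  have "(l2norm M (\<lambda>\<omega>. F \<omega> + G \<omega>))\<^sup>2
      = (l2norm M F)\<^sup>2 + 2 * (\<integral>\<omega>. F \<omega> * G \<omega> \<partial>M) + (l2norm M G)\<^sup>2"
    using L2_integral_square_add[OF assms, of 1] by (simp add: l2norm_power2)
  also have "\<dots> \<le> (l2norm M F + l2norm M G)\<^sup>2"
    using L2_Cauchy_Schwarz[OF assms] by (simp add: power2_sum)
  finally show "(l2norm M (\<lambda>\<omega>. F \<omega> + G \<omega>))\<^sup>2 \<le> (l2norm M F + l2norm M G)\<^sup>2" .
qed (simp add: l2norm_nonneg)

lemma l2norm_commute: "l2norm M (\<lambda>\<omega>. F \<omega> - G \<omega>) = l2norm M (\<lambda>\<omega>. G \<omega> - F \<omega>)"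
  by (simp add: l2norm_def power2_commute)

lemma l2norm_triangle_diff:
  assumes "F \<in> L2 M" "G \<in> L2 M" "K \<in> L2 M"
  shows "l2norm M (\<lambda>\<omega>. F \<omega> - K \<omega>) \<le> l2norm M (\<lambda>\<omega>. F \<omega> - G \<omega>) + l2norm M (\<lambda>\<omega>. G \<omega> - K \<omega>)"
  using l2norm_triangle[OF L2_diff[OF assms(1,2)] L2_diff[OF assms(2,3)]] by simp

lemma L2_tendsto_iff_l2norm:
  "L2_tendsto M f F \<F> \<longleftrightarrow>
     F \<in> L2 M \<and> eventually (\<lambda>i. f i \<in> L2 M) \<F> \<and> ((\<lambda>i. l2norm M (\<lambda>\<omega>. f i \<omega> - F \<omega>)) \<longlongrightarrow> 0) \<F>"
proof -
  have "((\<lambda>i. l2norm M (\<lambda>\<omega>. f i \<omega> - F \<omega>)) \<longlongrightarrow> 0) \<F>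
      \<longleftrightarrow> ((\<lambda>i. \<integral>\<omega>. (f i \<omega> - F \<omega>)\<^sup>2 \<partial>M) \<longlongrightarrow> 0) \<F>"
    using tendsto_real_sqrt[of "\<lambda>i. \<integral>\<omega>. (f i \<omega> - F \<omega>)\<^sup>2 \<partial>M" 0 \<F>]
      tendsto_power[of "\<lambda>i. l2norm M (\<lambda>\<omega>. f i \<omega> - F \<omega>)" 0 \<F> 2]
    by (auto simp: l2norm_power2) (simp add: l2norm_def)
  then show ?thesis by (simp add: L2_tendsto_def)
qed

text \<open>
  Expand \<open>f g - F G = (f - F) (g - G) + (f - F) G + F (g - G)\<close> and apply Cauchy-Schwarz to each term.
\<close>

lemma L2_tendsto_inner:
  assumes f: "L2_tendsto M f F \<F>" and g: "L2_tendsto M g G \<F>"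
  shows "((\<lambda>i. \<integral>\<omega>. f i \<omega> * g i \<omega> \<partial>M) \<longlongrightarrow> (\<integral>\<omega>. F \<omega> * G \<omega> \<partial>M)) \<F>"
proof -
  have FG: "F \<in> L2 M" "G \<in> L2 M" using f g by (auto simp: L2_tendsto_def)
  define a where "a i = l2norm M (\<lambda>\<omega>. f i \<omega> - F \<omega>)" for i
  define b where "b i = l2norm M (\<lambda>\<omega>. g i \<omega> - G \<omega>)" for i
  have a: "(a \<longlongrightarrow> 0) \<F>" and b: "(b \<longlongrightarrow> 0) \<F>"
    using f g unfolding L2_tendsto_iff_l2norm a_def b_def by auto
  have ev: "eventually (\<lambda>i. f i \<in> L2 M \<and> g i \<in> L2 M) \<F>"
    using f g unfolding L2_tendsto_def by (auto elim: eventually_elim2)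
  have lim: "((\<lambda>i. a i * b i + a i * l2norm M G + l2norm M F * b i) \<longlongrightarrow> 0) \<F>"
    by (rule tendsto_eq_intros a b refl)+ simp
  have "((\<lambda>i. (\<integral>\<omega>. f i \<omega> * g i \<omega> \<partial>M) - (\<integral>\<omega>. F \<omega> * G \<omega> \<partial>M)) \<longlongrightarrow> 0) \<F>"
  proof (rule Lim_null_comparison[OF _ lim], use ev in eventually_elim)
    case (elim i)
    then have fi: "f i \<in> L2 M" and gi: "g i \<in> L2 M" by auto
    note d = L2_diff[OF fi FG(1)] L2_diff[OF gi FG(2)]
    have "(\<integral>\<omega>. f i \<omega> * g i \<omega> \<partial>M) - (\<integral>\<omega>. F \<omega> * G \<omega> \<partial>M) =
       (\<integral>\<omega>. f i \<omega> * g i \<omega> - F \<omega> * G \<omega> \<partial>M)"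
      using L2_mult_integrable[OF fi gi] L2_mult_integrable[OF FG] by simp
    also have "\<dots> = (\<integral>\<omega>. (f i \<omega> - F \<omega>) * (g i \<omega> - G \<omega>) + (f i \<omega> - F \<omega>) * G \<omega> + F \<omega> * (g i \<omega> - G \<omega>) \<partial>M)"
      by (intro Bochner_Integration.integral_cong) (auto simp: algebra_simps)
    also have "\<dots> = (\<integral>\<omega>. (f i \<omega> - F \<omega>) * (g i \<omega> - G \<omega>) \<partial>M) + (\<integral>\<omega>. (f i \<omega> - F \<omega>) * G \<omega> \<partial>M)
       + (\<integral>\<omega>. F \<omega> * (g i \<omega> - G \<omega>) \<partial>M)"
      using L2_mult_integrable[OF d(1) d(2)] L2_mult_integrable[OF d(1) FG(2)]
        L2_mult_integrable[OF FG(1) d(2)] by simp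
    finally show ?case
      using L2_Cauchy_Schwarz[OF d] L2_Cauchy_Schwarz[OF d(1) FG(2)] L2_Cauchy_Schwarz[OF FG(1) d(2)]
      by (simp add: a_def b_def)
  qed
  then show ?thesis by (simp add: LIM_zero_iff)
qed

lemma L2_tendsto_const: "F \<in> L2 M \<Longrightarrow> L2_tendsto M (\<lambda>_. F) F \<F>"
  by (simp add: L2_tendsto_def)

lemma L2_tendsto_square:
  assumes "L2_tendsto M f F \<F>"
  shows "((\<lambda>i. \<integral>\<omega>. (f i \<omega>)\<^sup>2 \<partial>M) \<longlongrightarrow> (\<integral>\<omega>. (F \<omega>)\<^sup>2 \<partial>M)) \<F>"
  using L2_tendsto_inner[OF assms assms] by (simp add: power2_eq_square)

lemma L2_tendsto_lincomb:
  assumes f: "L2_tendsto M f F \<F>" and g: "L2_tendsto M g G \<F>"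
  shows "L2_tendsto M (\<lambda>i \<omega>. a * f i \<omega> + b * g i \<omega>) (\<lambda>\<omega>. a * F \<omega> + b * G \<omega>) \<F>"
  unfolding L2_tendsto_iff_l2norm
proof (intro conjI)
  have FG: "F \<in> L2 M" "G \<in> L2 M" using f g by (auto simp: L2_tendsto_def)
  then show "(\<lambda>\<omega>. a * F \<omega> + b * G \<omega>) \<in> L2 M" by (intro L2_add L2_scale)
  have ev: "eventually (\<lambda>i. f i \<in> L2 M \<and> g i \<in> L2 M) \<F>"
    using f g unfolding L2_tendsto_def by (auto elim: eventually_elim2)
  then show "\<forall>\<^sub>F i in \<F>. (\<lambda>\<omega>. a * f i \<omega> + b * g i \<omega>) \<in> L2 M"
    by eventually_elim (auto intro!: L2_add L2_scale)
  have *: "l2norm M (\<lambda>\<omega>. c * h \<omega>) = \<bar>c\<bar> * l2norm M h" for c h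
    by (simp add: l2norm_def power_mult_distrib real_sqrt_mult)
  have lim: "((\<lambda>i. \<bar>a\<bar> * l2norm M (\<lambda>\<omega>. f i \<omega> - F \<omega>) + \<bar>b\<bar> * l2norm M (\<lambda>\<omega>. g i \<omega> - G \<omega>)) \<longlongrightarrow> 0) \<F>"
    using f g unfolding L2_tendsto_iff_l2norm by (auto intro!: tendsto_eq_intros)
  show "((\<lambda>i. l2norm M (\<lambda>\<omega>. (a * f i \<omega> + b * g i \<omega>) - (a * F \<omega> + b * G \<omega>))) \<longlongrightarrow> 0) \<F>"
  proof (rule Lim_null_comparison[OF _ lim], use ev in eventually_elim)
    case (elim i)
    have "l2norm M (\<lambda>\<omega>. (a * f i \<omega> + b * g i \<omega>) - (a * F \<omega> + b * G \<omega>))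
      = l2norm M (\<lambda>\<omega>. a * (f i \<omega> - F \<omega>) + b * (g i \<omega> - G \<omega>))"
      by (simp add: algebra_simps)
    also have "\<dots> \<le> l2norm M (\<lambda>\<omega>. a * (f i \<omega> - F \<omega>)) + l2norm M (\<lambda>\<omega>. b * (g i \<omega> - G \<omega>))"
      using elim FG by (intro l2norm_triangle L2_scale L2_diff) auto
    finally show ?case by (simp add: * l2norm_nonneg)
  qed
qed

lemma L2_tendsto_subseq:
  assumes "L2_tendsto M f F \<F>" "filterlim r \<F> \<G>"
  shows "L2_tendsto M (\<lambda>i. f (r i)) F \<G>"
  using assms unfolding L2_tendsto_def
  by (auto intro: filterlim_compose[of _ "nhds 0" \<F> r] dest: eventually_compose_filterlim)

subsection \<open>Completeness\<close>

text \<open>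
  The weights \<open>2\<^sup>k\<close> leave a convergent series of expectations, so \<open>\<Sum> 2\<^sup>k (f\<^sub>k\<^sub>+\<^sub>1 - f\<^sub>k)\<^sup>2\<close> is finite
  almost surely, and there the increments decay geometrically.
\<close>

lemma L2_Cauchy_fast_subsequence_AE_convergent:
  assumes f: "\<And>k. f k \<in> L2 M"
    and fast: "\<And>k. (\<integral>\<omega>. (f (Suc k) \<omega> - f k \<omega>)\<^sup>2 \<partial>M) \<le> (1/4) ^ k"
  shows "AE \<omega> in M. convergent (\<lambda>k. f k \<omega>)"
proof -
  note [measurable] = L2_borel[OF f]
  define g where "g k \<omega> = f (Suc k) \<omega> - f k \<omega>" for k \<omega>
  have [measurable]: "g k \<in> borel_measurable M" for k unfolding g_def by measurable
  have gi: "integrable M (\<lambda>\<omega>. (g k \<omega>)\<^sup>2)" for k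
    using L2_diff[OF f f] by (simp add: g_def L2_def)
  have "(\<integral>\<^sup>+\<omega>. (\<Sum>k. ennreal (2 ^ k * (g k \<omega>)\<^sup>2)) \<partial>M) = (\<Sum>k. \<integral>\<^sup>+\<omega>. ennreal (2 ^ k * (g k \<omega>)\<^sup>2) \<partial>M)"
    by (rule nn_integral_suminf) simp
  also have "\<dots> = (\<Sum>k. ennreal (2 ^ k * (\<integral>\<omega>. (g k \<omega>)\<^sup>2 \<partial>M)))"
    using gi by (subst nn_integral_eq_integral) auto
  also have "\<dots> \<le> (\<Sum>k. ennreal ((1/2) ^ k))"
  proof (intro suminf_le allI ennreal_leI)
    fix k
    have "2 ^ k * (\<integral>\<omega>. (g k \<omega>)\<^sup>2 \<partial>M) \<le> 2 ^ k * (1/4) ^ k"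
      using fast[of k] by (simp add: g_def)
    also have "\<dots> = (1/2) ^ k" by (simp add: power_mult_distrib[symmetric])
    finally show "2 ^ k * (\<integral>\<omega>. (g k \<omega>)\<^sup>2 \<partial>M) \<le> (1/2) ^ k" .
  qed auto
  also have "\<dots> < \<infinity>"
    by (subst suminf_ennreal2) (auto simp: summable_geometric)
  finally have "AE \<omega> in M. (\<Sum>k. ennreal (2 ^ k * (g k \<omega>)\<^sup>2)) \<noteq> \<infinity>"
    by (intro nn_integral_PInf_AE) auto
  then show ?thesis
  proof eventually_elim
    case (elim \<omega>)
    then have "summable (\<lambda>k. 2 ^ k * (g k \<omega>)\<^sup>2)"
      by (intro summable_suminf_not_top) auto
    then have "Bseq (\<lambda>k. 2 ^ k * (g k \<omega>)\<^sup>2)"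
      by (intro convergent_imp_Bseq convergentI[OF summable_LIMSEQ_zero])
    then obtain C where C: "C > 0" "\<And>k. norm (2 ^ k * (g k \<omega>)\<^sup>2) \<le> C"
      by (auto elim: BseqE)
    have "summable (\<lambda>k. g k \<omega>)"
    proof (rule summable_comparison_test)
      show "summable (\<lambda>k. sqrt C * (1 / sqrt 2) ^ k)"
        by (intro summable_mult summable_geometric) simp
      have "norm (g k \<omega>) \<le> sqrt C * (1 / sqrt 2) ^ k" for k
      proof -
        have "(g k \<omega>)\<^sup>2 \<le> C / 2 ^ k" using C(2)[of k] by (simp add: field_simps)
        then have "sqrt ((g k \<omega>)\<^sup>2) \<le> sqrt (C / 2 ^ k)" by (rule real_sqrt_le_mono)
        also have "sqrt (C / 2 ^ k) = sqrt C * (1 / sqrt 2) ^ k"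
          by (simp add: real_sqrt_divide real_sqrt_power power_one_over)
        finally show ?thesis unfolding real_sqrt_abs by simp
      qed
      then show "\<exists>N. \<forall>n\<ge>N. norm (g n \<omega>) \<le> sqrt C * (1 / sqrt 2) ^ n" by blast
    qed
    then have "convergent (\<lambda>n. \<Sum>k<n. g k \<omega>)" by (simp add: summable_iff_convergent)
    moreover have "(\<Sum>k<n. g k \<omega>) = f n \<omega> - f 0 \<omega>" for n
      unfolding g_def by (rule sum_lessThan_telescope)
    ultimately have "convergent (\<lambda>n. f n \<omega> - f 0 \<omega>)" by simp
    then show ?case by (simp add: convergent_diff_const_right_iff)
  qed
qed

text \<open>
  A fast subsequence converges almost surely, and by Fatou's lemma its limit is also the limit in
  mean square of the whole sequence.
\<close>

lemma L2_complete:
  assumes f: "\<And>k. f k \<in> L2 M"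
    and cau: "\<And>e. e > 0 \<Longrightarrow> \<exists>N. \<forall>m\<ge>N. \<forall>n\<ge>N. (\<integral>\<omega>. (f m \<omega> - f n \<omega>)\<^sup>2 \<partial>M) \<le> e"
  shows "\<exists>F. L2_tendsto M f F sequentially"
proof -
  note [measurable] = L2_borel[OF f]
  obtain N0 where N0: "\<And>k m n. m \<ge> N0 k \<Longrightarrow> n \<ge> N0 k \<Longrightarrow> (\<integral>\<omega>. (f m \<omega> - f n \<omega>)\<^sup>2 \<partial>M) \<le> (1/4) ^ k"
    using cau[of "(1/4) ^ k" for k] by (metis zero_less_divide_1_iff zero_less_numeral zero_less_power)
  define r where "r k = (\<Sum>j\<le>k. N0 j) + k" for k
  have r1: "r k \<ge> N0 k" for k
    unfolding r_def using member_le_sum[of k "{..k}" N0] by auto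
  have r2: "r (Suc k) \<ge> N0 k" for k
    unfolding r_def using member_le_sum[of k "{..Suc k}" N0] by auto
  have r3: "strict_mono r" by (rule strict_monoI_Suc) (simp add: r_def)
  have "AE \<omega> in M. convergent (\<lambda>k. f (r k) \<omega>)"
    by (rule L2_Cauchy_fast_subsequence_AE_convergent) (auto intro: f N0 r1 r2)
  then have lim: "AE \<omega> in M. (\<lambda>k. f (r k) \<omega>) \<longlonglongrightarrow> lim (\<lambda>k. f (r k) \<omega>)"
    by eventually_elim (simp add: convergent_LIMSEQ_iff)
  define F where "F \<omega> = lim (\<lambda>k. f (r k) \<omega>)" for \<omega>
  have [measurable]: "F \<in> borel_measurable M" unfolding F_def by measurable
  have dist: "(\<integral>\<^sup>+\<omega>. ennreal ((f m \<omega> - F \<omega>)\<^sup>2) \<partial>M) \<le> ennreal e"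
    if e: "e \<ge> 0" and N: "\<forall>m\<ge>N. \<forall>n\<ge>N. (\<integral>\<omega>. (f m \<omega> - f n \<omega>)\<^sup>2 \<partial>M) \<le> e" and m: "m \<ge> N" for e N m
  proof -
    have "(\<integral>\<^sup>+\<omega>. ennreal ((f m \<omega> - F \<omega>)\<^sup>2) \<partial>M)
        = (\<integral>\<^sup>+\<omega>. liminf (\<lambda>k. ennreal ((f m \<omega> - f (r k) \<omega>)\<^sup>2)) \<partial>M)"
    proof (rule nn_integral_cong_AE, use lim in eventually_elim)
      case (elim \<omega>)
      then have "(\<lambda>k. ennreal ((f m \<omega> - f (r k) \<omega>)\<^sup>2)) \<longlonglongrightarrow> ennreal ((f m \<omega> - F \<omega>)\<^sup>2)"
        unfolding F_def by (intro tendsto_intros tendsto_ennrealI)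
      then show ?case by (metis lim_imp_Liminf trivial_limit_sequentially)
    qed
    also have "\<dots> \<le> liminf (\<lambda>k. \<integral>\<^sup>+\<omega>. ennreal ((f m \<omega> - f (r k) \<omega>)\<^sup>2) \<partial>M)"
      by (rule nn_integral_liminf) simp
    also have "\<dots> \<le> ennreal e"
    proof (rule Liminf_le)
      show "\<forall>\<^sub>F k in sequentially. (\<integral>\<^sup>+\<omega>. ennreal ((f m \<omega> - f (r k) \<omega>)\<^sup>2) \<partial>M) \<le> ennreal e"
        using eventually_ge_at_top[of N]
      proof eventually_elim
        case (elim k)
        then have "r k \<ge> N" using strict_mono_imp_increasing[OF r3, of k] by simp
        then have "(\<integral>\<omega>. (f m \<omega> - f (r k) \<omega>)\<^sup>2 \<partial>M) \<le> e" using N m by auto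
        then show ?case
          using L2_diff[OF f f, of m "r k"]
          by (subst nn_integral_eq_integral) (auto simp: L2_def intro: ennreal_leI)
      qed
    qed simp
    finally show ?thesis .
  qed
  have FL2: "F \<in> L2 M"
  proof -
    obtain N where N: "\<forall>m\<ge>N. \<forall>n\<ge>N. (\<integral>\<omega>. (f m \<omega> - f n \<omega>)\<^sup>2 \<partial>M) \<le> 1" using cau[of 1] by auto
    have "(\<integral>\<^sup>+\<omega>. ennreal ((f N \<omega> - F \<omega>)\<^sup>2) \<partial>M) < \<infinity>"
      using dist[OF _ N order.refl] by (auto intro: le_less_trans)
    then have "(\<lambda>\<omega>. f N \<omega> - F \<omega>) \<in> L2 M"
      unfolding L2_def by (auto simp: integrable_iff_bounded)
    from L2_diff[OF f[of N] this] show ?thesis by simp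
  qed
  moreover have "(\<lambda>i. \<integral>\<omega>. (f i \<omega> - F \<omega>)\<^sup>2 \<partial>M) \<longlonglongrightarrow> 0"
  proof (rule LIMSEQ_I)
    fix e :: real assume e: "e > 0"
    obtain N where N: "\<forall>m\<ge>N. \<forall>n\<ge>N. (\<integral>\<omega>. (f m \<omega> - f n \<omega>)\<^sup>2 \<partial>M) \<le> e / 2" using cau[of "e / 2"] e by auto
    have "norm ((\<integral>\<omega>. (f n \<omega> - F \<omega>)\<^sup>2 \<partial>M) - 0) < e" if "n \<ge> N" for n
    proof -
      have "ennreal (\<integral>\<omega>. (f n \<omega> - F \<omega>)\<^sup>2 \<partial>M) \<le> ennreal (e / 2)"
        using dist[OF _ N that] e L2_diff[OF f FL2, of n]
        by (subst nn_integral_eq_integral[symmetric]) (auto simp: L2_def)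
      then show ?thesis using e by simp
    qed
    then show "\<exists>N. \<forall>n\<ge>N. norm ((\<integral>\<omega>. (f n \<omega> - F \<omega>)\<^sup>2 \<partial>M) - 0) < e" by blast
  qed
  ultimately have "L2_tendsto M f F sequentially" using f by (simp add: L2_tendsto_def)
  then show ?thesis by blast
qed

subsection \<open>Closed subspaces and orthogonal projection\<close>

definition closed_subspace :: "'w measure \<Rightarrow> ('w \<Rightarrow> real) set \<Rightarrow> bool" where
  "closed_subspace M V \<longleftrightarrow> V \<subseteq> L2 M \<and> (\<lambda>_. 0) \<in> V \<and>
     (\<forall>F\<in>V. \<forall>G\<in>V. \<forall>a b. (\<lambda>\<omega>. a * F \<omega> + b * G \<omega>) \<in> V) \<and>
     (\<forall>f F. (\<forall>k. f k \<in> V) \<longrightarrow> L2_tendsto M f F sequentially \<longrightarrow> F \<in> V)"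

text \<open>
  The projection is characterised by its inner products with the subspace, since functions that agree
  almost surely are not identified.
\<close>

definition is_projection :: "'w measure \<Rightarrow> ('w \<Rightarrow> real) set \<Rightarrow> ('w \<Rightarrow> real) \<Rightarrow> ('w \<Rightarrow> real) \<Rightarrow> bool" where
  "is_projection M V F P \<longleftrightarrow> F \<in> L2 M \<and> P \<in> V \<and> (\<forall>W\<in>V. (\<integral>\<omega>. F \<omega> * W \<omega> \<partial>M) = (\<integral>\<omega>. P \<omega> * W \<omega> \<partial>M))"

text \<open>
  A minimising sequence is Cauchy by the parallelogram identity.  Its limit attains the distance to the
  subspace, so the first variation in every direction \<open>W\<close> vanishes.
\<close>

lemma projection_exists:
  assumes V: "closed_subspace M V" and F: "F \<in> L2 M"
  shows "\<exists>P. is_projection M V F P"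
proof -
  have VL: "W \<in> V \<Longrightarrow> W \<in> L2 M" for W using V by (auto simp: closed_subspace_def)
  have lin: "W \<in> V \<Longrightarrow> W' \<in> V \<Longrightarrow> (\<lambda>\<omega>. a * W \<omega> + b * W' \<omega>) \<in> V" for W W' a b
    using V by (auto simp: closed_subspace_def)
  define q where "q W = (\<integral>\<omega>. (F \<omega> - W \<omega>)\<^sup>2 \<partial>M)" for W
  define d where "d = (INF W\<in>V. q W)"
  have bdd: "bdd_below (q ` V)" by (rule bdd_belowI2[of _ 0]) (simp add: q_def)
  have ne: "V \<noteq> {}" using V by (auto simp: closed_subspace_def)
  have dle: "d \<le> q W" if "W \<in> V" for W unfolding d_def using bdd that by (rule cINF_lower)
  have "\<exists>W\<in>V. q W < d + 1 / Suc k" for k :: nat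
    using cInf_lessD[of "q ` V" "d + 1 / Suc k"] ne unfolding d_def by auto
  then obtain w where w: "\<And>k. w k \<in> V" "\<And>k. q (w k) < d + 1 / Suc k" by metis
  \<comment> \<open>Parallelogram identity: the midpoint of \<open>w m\<close> and \<open>w n\<close> is in the subspace, hence no closer than \<open>d\<close>.\<close>
  have par: "(\<integral>\<omega>. (w m \<omega> - w n \<omega>)\<^sup>2 \<partial>M) \<le> 2 / Suc m + 2 / Suc n" for m n
  proof -
    define A where "A \<omega> = F \<omega> - w m \<omega>" for \<omega>
    define B where "B \<omega> = F \<omega> - w n \<omega>" for \<omega>
    have AB: "A \<in> L2 M" "B \<in> L2 M" unfolding A_def B_def using F VL w by (auto intro: L2_diff)
    have "(\<integral>\<omega>. (A \<omega> + 1 * B \<omega>)\<^sup>2 \<partial>M) + (\<integral>\<omega>. (A \<omega> + (-1) * B \<omega>)\<^sup>2 \<partial>M) = 2 * q (w m) + 2 * q (w n)"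
      unfolding L2_integral_square_add[OF AB] by (simp add: q_def A_def B_def)
    moreover have "(\<integral>\<omega>. (A \<omega> + 1 * B \<omega>)\<^sup>2 \<partial>M) = (\<integral>\<omega>. 4 * (F \<omega> - (1/2 * w m \<omega> + 1/2 * w n \<omega>))\<^sup>2 \<partial>M)"
      by (intro Bochner_Integration.integral_cong) (auto simp: A_def B_def power2_eq_square field_simps)
    moreover have "\<dots> = 4 * q (\<lambda>\<omega>. 1/2 * w m \<omega> + 1/2 * w n \<omega>)"
      unfolding q_def by simp
    moreover have "d \<le> q (\<lambda>\<omega>. 1/2 * w m \<omega> + 1/2 * w n \<omega>)"
      by (intro dle lin w)
    moreover have "(\<integral>\<omega>. (A \<omega> + (-1) * B \<omega>)\<^sup>2 \<partial>M) = (\<integral>\<omega>. (w m \<omega> - w n \<omega>)\<^sup>2 \<partial>M)"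
      by (intro Bochner_Integration.integral_cong) (auto simp: A_def B_def power2_eq_square field_simps)
    ultimately show ?thesis using w(2)[of m] w(2)[of n] by linarith
  qed
  have "\<exists>P. L2_tendsto M w P sequentially"
  proof (rule L2_complete)
    fix e :: real assume e: "e > 0"
    obtain N :: nat where N: "4 / e < real N" using reals_Archimedean2 by blast
    have "(\<integral>\<omega>. (w m \<omega> - w n \<omega>)\<^sup>2 \<partial>M) \<le> e" if "m \<ge> N" "n \<ge> N" for m n
    proof -
      have "2 / real (Suc k) \<le> e / 2" if "k \<ge> N" for k
      proof -
        have "4 / e < real (Suc k)" using N that by linarith
        then show ?thesis using e by (simp add: field_simps)
      qed
      from this[OF that(1)] this[OF that(2)] show ?thesis using par[of m n] by linarith
    qed
    then show "\<exists>N. \<forall>m\<ge>N. \<forall>n\<ge>N. (\<integral>\<omega>. (w m \<omega> - w n \<omega>)\<^sup>2 \<partial>M) \<le> e" by blast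
  qed (use VL w in auto)
  then obtain P where P: "L2_tendsto M w P sequentially" ..
  have PV: "P \<in> V" using V w(1) P unfolding closed_subspace_def by blast
  have "L2_tendsto M (\<lambda>k \<omega>. 1 * F \<omega> + (-1) * w k \<omega>) (\<lambda>\<omega>. 1 * F \<omega> + (-1) * P \<omega>) sequentially"
    by (intro L2_tendsto_lincomb L2_tendsto_const F P)
  from L2_tendsto_square[OF this] have "(\<lambda>k. q (w k)) \<longlonglongrightarrow> q P" by (simp add: q_def)
  moreover have "(\<lambda>k. d + 1 / Suc k) \<longlonglongrightarrow> d + 0"
    unfolding divide_inverse mult_1 by (intro tendsto_intros LIMSEQ_inverse_real_of_nat)
  ultimately have qP: "q P \<le> d" using w(2) by (intro LIMSEQ_le) (auto intro: less_imp_le)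
  have "(\<integral>\<omega>. F \<omega> * W \<omega> \<partial>M) = (\<integral>\<omega>. P \<omega> * W \<omega> \<partial>M)" if W: "W \<in> V" for W
  proof -
    have FP: "(\<lambda>\<omega>. F \<omega> - P \<omega>) \<in> L2 M" using F VL PV by (intro L2_diff) auto
    define b where "b = (\<integral>\<omega>. (F \<omega> - P \<omega>) * W \<omega> \<partial>M)"
    have "0 \<le> 0 + 2 * t * b + t\<^sup>2 * (\<integral>\<omega>. (W \<omega>)\<^sup>2 \<partial>M)" for t
    proof -
      have "(\<lambda>\<omega>. 1 * P \<omega> + (- t) * W \<omega>) \<in> V" by (intro lin PV W)
      then have "q P \<le> q (\<lambda>\<omega>. 1 * P \<omega> + (- t) * W \<omega>)" using dle qP by force
      also have "\<dots> = (\<integral>\<omega>. ((F \<omega> - P \<omega>) + t * W \<omega>)\<^sup>2 \<partial>M)"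
        unfolding q_def by (simp add: algebra_simps)
      finally show ?thesis
        unfolding L2_integral_square_add[OF FP VL[OF W]] q_def b_def by simp
    qed
    then have "b\<^sup>2 \<le> 0 * (\<integral>\<omega>. (W \<omega>)\<^sup>2 \<partial>M)"
      by (rule nonneg_quadratic_discriminant) simp
    then have "b = 0" by simp
    moreover have "b = (\<integral>\<omega>. F \<omega> * W \<omega> \<partial>M) - (\<integral>\<omega>. P \<omega> * W \<omega> \<partial>M)"
      unfolding b_def left_diff_distrib
      using L2_mult_integrable[OF F VL[OF W]] L2_mult_integrable[OF VL[OF PV] VL[OF W]] by simp
    ultimately show ?thesis by simp
  qed
  then show ?thesis using PV F by (auto simp: is_projection_def)
qed

section \<open>Pairs of Gaussian variables and Hermite polynomials\<close>

text \<open>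
  Extracts expectations from their generating functions, which here converge on the whole line.
\<close>

lemma power_series_unique:
  fixes a b :: "nat \<Rightarrow> real"
  assumes a: "\<And>y. (\<lambda>n. a n * y ^ n) sums s y" and b: "\<And>y. (\<lambda>n. b n * y ^ n) sums s y"
  shows "a n = b n"
proof -
  have c: "(\<lambda>n. (a n - b n) * y ^ n) sums 0" for y
    using sums_diff[OF a[of y] b[of y]] by (simp add: left_diff_distrib)
  have "a n - b n = 0"
  proof (induction n rule: less_induct)
    case (less n)
    have "(\<lambda>m. (a (m + n) - b (m + n)) * y ^ m) sums 0" if "y \<noteq> 0" for y
    proof -
      have "(\<lambda>m. (a (m + n) - b (m + n)) * y ^ (m + n)) sums 0"
        by (subst sums_zero_iff_shift) (use less.IH c in auto)
      from sums_mult2[OF this, of "1 / y ^ n"] show ?thesis using that by (simp add: power_add)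
    qed
    then have "((\<lambda>_. 0) \<longlongrightarrow> a (0 + n) - b (0 + n)) (at (0::real))"
      by (intro powser_limit_0_strong[of 1]) auto
    then show ?case by (simp add: tendsto_const_iff)
  qed
  then show ?thesis by simp
qed

lemma sum_le_sums:
  fixes f :: "nat \<Rightarrow> real"
  assumes "f sums s" "\<And>n. 0 \<le> f n"
  shows "sum f {..<N} \<le> s"
  using sum_le_suminf[of f "{..<N}"] assms by (simp add: sums_iff)

lemma exp_sums: "(\<lambda>n. (x :: real) ^ n / fact n) sums exp x"
  using exp_converges[of x] by (simp add: field_simps)

text \<open>
  Term by term integration with an integrable bound on the absolute partial sums.
\<close>

lemma sums_integral_dominated:
  fixes h :: "nat \<Rightarrow> 'w \<Rightarrow> real"
  assumes meas: "\<And>n. h n \<in> borel_measurable M" and w: "integrable M w"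
    and S: "\<And>\<omega>. \<omega> \<in> space M \<Longrightarrow> (\<lambda>n. h n \<omega>) sums S \<omega>"
    and bound: "\<And>\<omega> N. \<omega> \<in> space M \<Longrightarrow> (\<Sum>n<N. \<bar>h n \<omega>\<bar>) \<le> w \<omega>"
  shows "integrable M (h n)" and "(\<lambda>n. \<integral>\<omega>. h n \<omega> \<partial>M) sums (\<integral>\<omega>. S \<omega> \<partial>M)"
proof -
  note [measurable] = meas
  have int: "integrable M (h n)" for n
  proof (rule Bochner_Integration.integrable_bound[OF w])
    show "AE \<omega> in M. norm (h n \<omega>) \<le> norm (w \<omega>)"
    proof (rule AE_I2)
      fix \<omega> assume "\<omega> \<in> space M"
      from bound[OF this, of "Suc n"] have "\<bar>h n \<omega>\<bar> \<le> w \<omega>"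
        using sum_nonneg[of "{..<n}" "\<lambda>n. \<bar>h n \<omega>\<bar>"] unfolding sum.lessThan_Suc by linarith
      then show "norm (h n \<omega>) \<le> norm (w \<omega>)" by simp
    qed
  qed simp
  then show "integrable M (h n)" .
  have "(\<lambda>N. \<integral>\<omega>. (\<Sum>n<N. h n \<omega>) \<partial>M) \<longlonglongrightarrow> (\<integral>\<omega>. S \<omega> \<partial>M)"
  proof (rule integral_dominated_convergence[OF _ _ w])
    have "(\<lambda>\<omega>. suminf (\<lambda>n. h n \<omega>)) \<in> borel_measurable M" by measurable
    then show "S \<in> borel_measurable M"
      by (rule measurable_cong[THEN iffD1, rotated]) (use S in \<open>auto simp: sums_iff\<close>)
    show "AE \<omega> in M. (\<lambda>N. \<Sum>n<N. h n \<omega>) \<longlonglongrightarrow> S \<omega>"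
      using S by (auto simp: sums_def)
    show "AE \<omega> in M. norm (\<Sum>n<N. h n \<omega>) \<le> w \<omega>" for N
      using bound[of _ N] by (intro AE_I2) (metis order_trans real_norm_def sum_abs)
  qed simp
  then show "(\<lambda>n. \<integral>\<omega>. h n \<omega> \<partial>M) sums (\<integral>\<omega>. S \<omega> \<partial>M)"
    using int by (simp add: sums_def)
qed

text \<open>
  The coefficients of \<open>exp (- v x\<^sup>2 / 2)\<close> as a power series in \<open>x\<close>.
\<close>

definition gauss_coeff :: "real \<Rightarrow> nat \<Rightarrow> real" where
  "gauss_coeff v m = (if even m then (- v / 2) ^ (m div 2) / fact (m div 2) else 0)"

text \<open>
  The Hermite polynomials of variance \<open>v\<close> divided by \<open>n!\<close>, the coefficients of the generating function
  \<open>exp (x g - x\<^sup>2 v / 2)\<close>.  The case \<open>v = 0\<close> covers degenerate Gaussian variables.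
\<close>

definition herm :: "real \<Rightarrow> nat \<Rightarrow> real \<Rightarrow> real" where
  "herm v n g = (\<Sum>i\<le>n. g ^ i / fact i * gauss_coeff v (n - i))"

lemma gauss_coeff_sums: "(\<lambda>m. gauss_coeff v m * x ^ m) sums exp (- x\<^sup>2 * v / 2)"
proof -
  have "(\<lambda>j. (- x\<^sup>2 * v / 2) ^ j / fact j) sums exp (- x\<^sup>2 * v / 2)"
    by (rule exp_sums)
  moreover have "(- x\<^sup>2 * v / 2) ^ j / fact j = gauss_coeff v (2 * j) * x ^ (2 * j)" for j
  proof -
    have "- x\<^sup>2 * v / 2 = (- v / 2) * x\<^sup>2" by simp
    then have "(- x\<^sup>2 * v / 2) ^ j = (- v / 2) ^ j * x ^ (2 * j)"
      by (simp only: power_mult_distrib power_mult)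
    then show ?thesis by (simp add: gauss_coeff_def)
  qed
  ultimately have "(\<lambda>j. gauss_coeff v (2 * j) * x ^ (2 * j)) sums exp (- x\<^sup>2 * v / 2)" by simp
  moreover have "gauss_coeff v n * x ^ n = 0" if "n \<notin> range (\<lambda>j. 2 * j)" for n :: nat
    using that by (auto simp: gauss_coeff_def elim!: evenE)
  ultimately show ?thesis
    by (subst (asm) sums_mono_reindex) (auto simp: strict_mono_def)
qed

lemma abs_gauss_coeff: "\<bar>gauss_coeff v m\<bar> = gauss_coeff (- \<bar>v\<bar>) m"
  by (simp add: gauss_coeff_def abs_mult power_abs)

lemma herm_sums: "(\<lambda>n. herm v n g * x ^ n) sums exp (x * g - x\<^sup>2 * v / 2)"
proof -
  have a: "(\<lambda>n. (x * g) ^ n / fact n) sums exp (x * g)" for x g :: real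
    by (rule exp_sums)
  have "(\<lambda>n. norm (gauss_coeff v n * x ^ n)) sums exp (- \<bar>x\<bar>\<^sup>2 * (- \<bar>v\<bar>) / 2)"
    using gauss_coeff_sums[of "- \<bar>v\<bar>" "\<bar>x\<bar>"] by (simp add: abs_mult abs_gauss_coeff power_abs)
  moreover have "(\<lambda>n. norm ((x * g) ^ n / fact n)) sums exp (\<bar>x\<bar> * \<bar>g\<bar>)"
    using a[of "\<bar>x\<bar>" "\<bar>g\<bar>"] by (simp add: abs_mult power_abs)
  ultimately have "(\<lambda>k. \<Sum>i\<le>k. (x * g) ^ i / fact i * (gauss_coeff v (k - i) * x ^ (k - i)))
     sums ((\<Sum>n. (x * g) ^ n / fact n) * (\<Sum>n. gauss_coeff v n * x ^ n))"
    by (intro Cauchy_product_sums) (auto simp: sums_iff)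
  moreover have "(\<Sum>i\<le>k. (x * g) ^ i / fact i * (gauss_coeff v (k - i) * x ^ (k - i))) = herm v k g * x ^ k" for k
  proof -
    have "x ^ k = x ^ i * x ^ (k - i)" if "i \<le> k" for i
      using that by (simp flip: power_add)
    then show ?thesis
      unfolding herm_def sum_distrib_right by (intro sum.cong) (auto simp: power_mult_distrib)
  qed
  moreover have "(\<Sum>n. (x * g) ^ n / fact n) * (\<Sum>n. gauss_coeff v n * x ^ n) = exp (x * g - x\<^sup>2 * v / 2)"
    using a[of x g] gauss_coeff_sums[of v x] by (simp add: sums_iff exp_add[symmetric])
  ultimately show ?thesis by simp
qed

text \<open>
  With the sign of \<open>v\<close> reversed all coefficients become nonnegative, so the generating function at
  \<open>- \<bar>v\<bar>\<close> dominates all partial sums.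
\<close>

lemma abs_herm_le: "\<bar>herm v n g\<bar> \<le> herm (- \<bar>v\<bar>) n \<bar>g\<bar>"
  unfolding herm_def by (rule order_trans[OF sum_abs]) (simp add: abs_mult abs_gauss_coeff power_abs)

lemma herm_partial_sum_le: "(\<Sum>n<N. \<bar>herm v n g * x ^ n\<bar>) \<le> exp (\<bar>x\<bar> * \<bar>g\<bar> + x\<^sup>2 * \<bar>v\<bar> / 2)"
proof -
  have s: "(\<lambda>n. herm (- \<bar>v\<bar>) n \<bar>g\<bar> * \<bar>x\<bar> ^ n) sums exp (\<bar>x\<bar> * \<bar>g\<bar> + x\<^sup>2 * \<bar>v\<bar> / 2)"
    using herm_sums[of "- \<bar>v\<bar>" "\<bar>g\<bar>" "\<bar>x\<bar>"] by simp
  have "(\<Sum>n<N. \<bar>herm v n g * x ^ n\<bar>) \<le> (\<Sum>n<N. herm (- \<bar>v\<bar>) n \<bar>g\<bar> * \<bar>x\<bar> ^ n)"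
    by (intro sum_mono) (simp add: abs_mult power_abs abs_herm_le mult_right_mono)
  also have "\<dots> \<le> exp (\<bar>x\<bar> * \<bar>g\<bar> + x\<^sup>2 * \<bar>v\<bar> / 2)"
    using s by (intro sum_le_sums) (auto intro!: mult_nonneg_nonneg order_trans[OF abs_ge_zero abs_herm_le])
  finally show ?thesis .
qed

lemma abs_herm_le_exp: "\<bar>herm v n g\<bar> \<le> exp (\<bar>g\<bar> + \<bar>v\<bar> / 2)"
proof -
  have "\<bar>herm v n g\<bar> \<le> (\<Sum>k<Suc n. \<bar>herm v k g * 1 ^ k\<bar>)"
    by (simp add: sum_nonneg)
  also have "\<dots> \<le> exp (\<bar>1\<bar> * \<bar>g\<bar> + 1\<^sup>2 * \<bar>v\<bar> / 2)"
    by (rule herm_partial_sum_le)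
  finally show ?thesis by simp
qed

lemma borel_measurable_herm [measurable]: "herm v n \<in> borel_measurable borel"
  unfolding herm_def[abs_def] by measurable

text \<open>
  A centered, possibly degenerate, jointly Gaussian pair with variances \<open>v\<close>, \<open>u\<close> and covariance \<open>c\<close>,
  described by its moment generating function. The
  chaos calculus starts from this property.
\<close>

definition gauss_pair :: "'w measure \<Rightarrow> ('w \<Rightarrow> real) \<Rightarrow> ('w \<Rightarrow> real) \<Rightarrow> real \<Rightarrow> real \<Rightarrow> real \<Rightarrow> bool" where
  "gauss_pair M g f v c u \<longleftrightarrow> g \<in> borel_measurable M \<and> f \<in> borel_measurable M \<and>
     (\<forall>x y. integrable M (\<lambda>\<omega>. exp (x * g \<omega> + y * f \<omega>)) \<and>
       (\<integral>\<omega>. exp (x * g \<omega> + y * f \<omega>) \<partial>M) = exp ((x\<^sup>2 * v + 2 * x * y * c + y\<^sup>2 * u) / 2))"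

lemma gauss_pair_lincomb:
  assumes "gauss_pair M g f v c u"
  shows "gauss_pair M (\<lambda>\<omega>. a * g \<omega> + b * f \<omega>) (\<lambda>\<omega>. a' * g \<omega> + b' * f \<omega>)
     (a\<^sup>2 * v + 2 * a * b * c + b\<^sup>2 * u) (a * a' * v + (a * b' + a' * b) * c + b * b' * u)
     (a'\<^sup>2 * v + 2 * a' * b' * c + b'\<^sup>2 * u)"
proof -
  have [measurable]: "g \<in> borel_measurable M" "f \<in> borel_measurable M"
    using assms by (auto simp: gauss_pair_def)
  have *: "x * (a * g \<omega> + b * f \<omega>) + y * (a' * g \<omega> + b' * f \<omega>)
     = (x * a + y * a') * g \<omega> + (x * b + y * b') * f \<omega>" for x y \<omega>
    by (simp add: algebra_simps)
  have **: "integrable M (\<lambda>\<omega>. exp (x * g \<omega> + y * f \<omega>))"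
    "(\<integral>\<omega>. exp (x * g \<omega> + y * f \<omega>) \<partial>M) = exp ((x\<^sup>2 * v + 2 * x * y * c + y\<^sup>2 * u) / 2)" for x y
    using assms by (auto simp: gauss_pair_def)
  show ?thesis
    unfolding gauss_pair_def * ** by (auto simp: **(1)) (simp add: power2_eq_square algebra_simps)
qed

lemma gauss_pair_same:
  assumes "gauss_pair M g f v c u"
  shows "gauss_pair M g g v v v"
  using gauss_pair_lincomb[OF assms, of 1 0 1 0] by simp

lemma exp_abs_le: "exp \<bar>x :: real\<bar> \<le> exp x + exp (- x)"
  by (cases "x \<ge> 0") auto

lemma gauss_pair_exp_abs_integrable:
  assumes "gauss_pair M g f v c u"
  shows "integrable M (\<lambda>\<omega>. exp (\<bar>x * g \<omega>\<bar> + \<bar>y * f \<omega>\<bar>))"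
proof (rule Bochner_Integration.integrable_bound)
  have [measurable]: "g \<in> borel_measurable M" "f \<in> borel_measurable M"
    using assms by (auto simp: gauss_pair_def)
  have **: "integrable M (\<lambda>\<omega>. exp (x * g \<omega> + y * f \<omega>))" for x y
    using assms by (auto simp: gauss_pair_def)
  show "integrable M (\<lambda>\<omega>. (exp (x * g \<omega> + y * f \<omega>) + exp (x * g \<omega> + (-y) * f \<omega>))
     + (exp ((-x) * g \<omega> + y * f \<omega>) + exp ((-x) * g \<omega> + (-y) * f \<omega>)))"
    by (intro Bochner_Integration.integrable_add **)
  show "AE \<omega> in M. norm (exp (\<bar>x * g \<omega>\<bar> + \<bar>y * f \<omega>\<bar>))
     \<le> norm ((exp (x * g \<omega> + y * f \<omega>) + exp (x * g \<omega> + (-y) * f \<omega>))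
     + (exp ((-x) * g \<omega> + y * f \<omega>) + exp ((-x) * g \<omega> + (-y) * f \<omega>)))"
  proof (rule AE_I2)
    fix \<omega>
    have "exp (\<bar>x * g \<omega>\<bar> + \<bar>y * f \<omega>\<bar>)
      \<le> (exp (x * g \<omega>) + exp (- (x * g \<omega>))) * (exp (y * f \<omega>) + exp (- (y * f \<omega>)))"
      unfolding exp_add by (intro mult_mono exp_abs_le) (auto simp: add_nonneg_nonneg)
    also have "\<dots> = (exp (x * g \<omega> + y * f \<omega>) + exp (x * g \<omega> + (-y) * f \<omega>))
     + (exp ((-x) * g \<omega> + y * f \<omega>) + exp ((-x) * g \<omega> + (-y) * f \<omega>))"
      by (simp add: algebra_simps exp_add exp_diff exp_minus divide_inverse)
    finally show "norm (exp (\<bar>x * g \<omega>\<bar> + \<bar>y * f \<omega>\<bar>))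
     \<le> norm ((exp (x * g \<omega> + y * f \<omega>) + exp (x * g \<omega> + (-y) * f \<omega>))
     + (exp ((-x) * g \<omega> + y * f \<omega>) + exp ((-x) * g \<omega> + (-y) * f \<omega>)))" by simp
  qed
  show "(\<lambda>\<omega>. exp (\<bar>x * g \<omega>\<bar> + \<bar>y * f \<omega>\<bar>)) \<in> borel_measurable M" by measurable
qed

text \<open>
  Both sides are the coefficients in \<open>x\<close> of
  \<open>E[exp (x g - x\<^sup>2 v / 2) exp (y f)] = exp (y\<^sup>2 u / 2 + x y c)\<close>.
\<close>

lemma gauss_pair_herm_exp:
  assumes G: "gauss_pair M g f v c u"
  shows "(\<integral>\<omega>. herm v n (g \<omega>) * exp (y * f \<omega>) \<partial>M) = exp (y\<^sup>2 * u / 2) * (y * c) ^ n / fact n"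
proof (rule power_series_unique[where s = "\<lambda>x. exp (y\<^sup>2 * u / 2 + x * (y * c))"])
  have [measurable]: "g \<in> borel_measurable M" "f \<in> borel_measurable M"
    using G by (auto simp: gauss_pair_def)
  show "(\<lambda>n. exp (y\<^sup>2 * u / 2) * (y * c) ^ n / fact n * x ^ n) sums exp (y\<^sup>2 * u / 2 + x * (y * c))" for x
    using sums_mult[OF exp_sums[of "x * (y * c)"], of "exp (y\<^sup>2 * u / 2)"]
    unfolding exp_add by (simp add: power_mult_distrib mult_ac)
  show "(\<lambda>n. (\<integral>\<omega>. herm v n (g \<omega>) * exp (y * f \<omega>) \<partial>M) * x ^ n) sums exp (y\<^sup>2 * u / 2 + x * (y * c))" for x
  proof -
    have "(\<lambda>n. \<integral>\<omega>. herm v n (g \<omega>) * x ^ n * exp (y * f \<omega>) \<partial>M) sums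
       (\<integral>\<omega>. exp (x * g \<omega> - x\<^sup>2 * v / 2) * exp (y * f \<omega>) \<partial>M)"
    proof (rule sums_integral_dominated(2))
      show "integrable M (\<lambda>\<omega>. exp (x\<^sup>2 * \<bar>v\<bar> / 2) * exp (\<bar>x * g \<omega>\<bar> + \<bar>y * f \<omega>\<bar>))"
        by (intro integrable_mult_right gauss_pair_exp_abs_integrable[OF G])
      show "(\<lambda>n. herm v n (g \<omega>) * x ^ n * exp (y * f \<omega>)) sums (exp (x * g \<omega> - x\<^sup>2 * v / 2) * exp (y * f \<omega>))" for \<omega>
        by (intro sums_mult2 herm_sums)
      show "(\<Sum>n<N. \<bar>herm v n (g \<omega>) * x ^ n * exp (y * f \<omega>)\<bar>) \<le> exp (x\<^sup>2 * \<bar>v\<bar> / 2) * exp (\<bar>x * g \<omega>\<bar> + \<bar>y * f \<omega>\<bar>)" for \<omega> N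
      proof -
        have "(\<Sum>n<N. \<bar>herm v n (g \<omega>) * x ^ n * exp (y * f \<omega>)\<bar>)
            = (\<Sum>n<N. \<bar>herm v n (g \<omega>) * x ^ n\<bar>) * exp (y * f \<omega>)"
          by (simp add: abs_mult sum_distrib_right)
        also have "\<dots> \<le> exp (\<bar>x\<bar> * \<bar>g \<omega>\<bar> + x\<^sup>2 * \<bar>v\<bar> / 2) * exp \<bar>y * f \<omega>\<bar>"
          by (intro mult_mono herm_partial_sum_le) (auto simp: sum_nonneg)
        finally show ?thesis by (simp add: exp_add abs_mult algebra_simps)
      qed
    qed simp
    also have "(\<integral>\<omega>. exp (x * g \<omega> - x\<^sup>2 * v / 2) * exp (y * f \<omega>) \<partial>M)
      = exp (- x\<^sup>2 * v / 2) * (\<integral>\<omega>. exp (x * g \<omega> + y * f \<omega>) \<partial>M)"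
    proof -
      have "exp (x * g \<omega> - x\<^sup>2 * v / 2) * exp (y * f \<omega>) = exp (- x\<^sup>2 * v / 2) * exp (x * g \<omega> + y * f \<omega>)" for \<omega>
        unfolding exp_add[symmetric] by (simp add: algebra_simps)
      then show ?thesis by simp
    qed
    also have "\<dots> = exp (y\<^sup>2 * u / 2 + x * (y * c))"
      using G unfolding gauss_pair_def by (simp add: exp_add[symmetric] field_simps)
    finally show ?thesis by (simp add: mult.assoc mult.left_commute mult.commute)
  qed
qed

text \<open>
  Comparing coefficients in \<open>y\<close> in the previous identity gives all mixed moments.  The vanishing ones
  say that the Hermite polynomial is orthogonal to all lower powers of \<open>f\<close>.
\<close>

lemma gauss_pair_herm_power:
  assumes G: "gauss_pair M g f v c u"
  shows "integrable M (\<lambda>\<omega>. herm v n (g \<omega>) * f \<omega> ^ m)"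
    and "(\<integral>\<omega>. herm v n (g \<omega>) * f \<omega> ^ m \<partial>M) =
      (if n \<le> m then fact m * (c ^ n / fact n * gauss_coeff (- u) (m - n)) else 0)"
proof -
  have [measurable]: "g \<in> borel_measurable M" "f \<in> borel_measurable M"
    using G by (auto simp: gauss_pair_def)
  have S: "(\<lambda>m. herm v n (g \<omega>) * ((y * f \<omega>) ^ m / fact m)) sums (herm v n (g \<omega>) * exp (y * f \<omega>))" for \<omega> y
    by (intro sums_mult exp_sums)
  have W: "integrable M (\<lambda>\<omega>. exp (\<bar>v\<bar> / 2) * exp (\<bar>1 * g \<omega>\<bar> + \<bar>y * f \<omega>\<bar>))" for y
    by (intro integrable_mult_right gauss_pair_exp_abs_integrable[OF G])
  have B: "(\<Sum>m<N. \<bar>herm v n (g \<omega>) * ((y * f \<omega>) ^ m / fact m)\<bar>) \<le> exp (\<bar>v\<bar> / 2) * exp (\<bar>1 * g \<omega>\<bar> + \<bar>y * f \<omega>\<bar>)" for \<omega> y N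
  proof -
    have s: "(\<lambda>m. \<bar>y * f \<omega>\<bar> ^ m / fact m) sums exp \<bar>y * f \<omega>\<bar>"
      by (rule exp_sums)
    have "(\<Sum>m<N. \<bar>herm v n (g \<omega>) * ((y * f \<omega>) ^ m / fact m)\<bar>)
      = \<bar>herm v n (g \<omega>)\<bar> * (\<Sum>m<N. \<bar>y * f \<omega>\<bar> ^ m / fact m)"
      by (simp add: sum_distrib_left abs_mult power_abs)
    also have "\<dots> \<le> exp (\<bar>g \<omega>\<bar> + \<bar>v\<bar> / 2) * exp \<bar>y * f \<omega>\<bar>"
      using s by (intro mult_mono abs_herm_le_exp sum_le_sums) (auto intro: sum_nonneg)
    finally show ?thesis by (simp add: exp_add algebra_simps)
  qed
  have I: "integrable M (\<lambda>\<omega>. herm v n (g \<omega>) * ((y * f \<omega>) ^ m / fact m))" for y m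
    by (rule sums_integral_dominated(1)[where S = "\<lambda>\<omega>. herm v n (g \<omega>) * exp (y * f \<omega>)", OF _ W S B]) measurable
  from integrable_mult_right[OF I[of 1 m], of "fact m"]
  show "integrable M (\<lambda>\<omega>. herm v n (g \<omega>) * f \<omega> ^ m)" by simp
  have "(\<integral>\<omega>. herm v n (g \<omega>) * f \<omega> ^ m \<partial>M) / fact m
     = (if n \<le> m then c ^ n / fact n * gauss_coeff (- u) (m - n) else 0)"
  proof (rule power_series_unique[where s = "\<lambda>y. exp (y\<^sup>2 * u / 2) * (y * c) ^ n / fact n" and n = m
      and a = "\<lambda>m. (\<integral>\<omega>. herm v n (g \<omega>) * f \<omega> ^ m \<partial>M) / fact m"
      and b = "\<lambda>m. if n \<le> m then c ^ n / fact n * gauss_coeff (- u) (m - n) else 0"])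
    fix y
    have "(\<lambda>m. \<integral>\<omega>. herm v n (g \<omega>) * ((y * f \<omega>) ^ m / fact m) \<partial>M) sums (\<integral>\<omega>. herm v n (g \<omega>) * exp (y * f \<omega>) \<partial>M)"
      by (rule sums_integral_dominated(2)[OF _ W S B]) measurable
    moreover have "(\<integral>\<omega>. herm v n (g \<omega>) * ((y * f \<omega>) ^ m / fact m) \<partial>M)
       = (\<integral>\<omega>. herm v n (g \<omega>) * f \<omega> ^ m \<partial>M) / fact m * y ^ m" for m
    proof -
      have "(\<integral>\<omega>. herm v n (g \<omega>) * ((y * f \<omega>) ^ m / fact m) \<partial>M)
         = (\<integral>\<omega>. (y ^ m / fact m) * (herm v n (g \<omega>) * f \<omega> ^ m) \<partial>M)"
        by (simp add: power_mult_distrib mult_ac)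
      then show ?thesis by (simp only: Bochner_Integration.integral_mult_right_zero) simp
    qed
    ultimately show "(\<lambda>m. (\<integral>\<omega>. herm v n (g \<omega>) * f \<omega> ^ m \<partial>M) / fact m * y ^ m) sums (exp (y\<^sup>2 * u / 2) * (y * c) ^ n / fact n)"
      by (simp only: gauss_pair_herm_exp[OF G])
    have "(\<lambda>k. (c ^ n / fact n * y ^ n) * (gauss_coeff (- u) k * y ^ k)) sums ((c ^ n / fact n * y ^ n) * exp (- y\<^sup>2 * (- u) / 2))"
      by (intro sums_mult gauss_coeff_sums)
    then have "(\<lambda>k. (if n \<le> k + n then c ^ n / fact n * gauss_coeff (- u) (k + n - n) else 0) * y ^ (k + n))
      sums (exp (y\<^sup>2 * u / 2) * (y * c) ^ n / fact n)"
      by (simp add: power_add power_mult_distrib mult_ac)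
    then show "(\<lambda>m. (if n \<le> m then c ^ n / fact n * gauss_coeff (- u) (m - n) else 0) * y ^ m)
      sums (exp (y\<^sup>2 * u / 2) * (y * c) ^ n / fact n)"
      by (subst (asm) sums_zero_iff_shift) auto
  qed
  then have "(\<integral>\<omega>. herm v n (g \<omega>) * f \<omega> ^ m \<partial>M)
     = fact m * (if n \<le> m then c ^ n / fact n * gauss_coeff (- u) (m - n) else 0)"
    by (subst (asm) divide_eq_eq) (simp add: mult.commute)
  then show "(\<integral>\<omega>. herm v n (g \<omega>) * f \<omega> ^ m \<partial>M) =
      (if n \<le> m then fact m * (c ^ n / fact n * gauss_coeff (- u) (m - n)) else 0)"
    by simp
qed

text \<open>
  Insert the cosine series and the mixed moments: the remaining sum over powers of \<open>f\<close> is the series of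
  \<open>exp (- u / 2)\<close>, shifted by \<open>n\<close>.
\<close>

lemma gauss_pair_herm_cos:
  assumes G: "gauss_pair M g f v c u"
  shows "(\<integral>\<omega>. herm v n (g \<omega>) * cos (f \<omega>) \<partial>M) =
    (if even n then (-1) ^ (n div 2) * c ^ n / fact n * exp (- u / 2) else 0)"
proof -
  have [measurable]: "g \<in> borel_measurable M" "f \<in> borel_measurable M"
    using G by (auto simp: gauss_pair_def)
  have "(\<lambda>m. \<integral>\<omega>. herm v n (g \<omega>) * (cos_coeff m * f \<omega> ^ m) \<partial>M) sums (\<integral>\<omega>. herm v n (g \<omega>) * cos (f \<omega>) \<partial>M)"
  proof (rule sums_integral_dominated(2))
    show "integrable M (\<lambda>\<omega>. exp (\<bar>v\<bar> / 2) * exp (\<bar>1 * g \<omega>\<bar> + \<bar>1 * f \<omega>\<bar>))"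
      by (intro integrable_mult_right gauss_pair_exp_abs_integrable[OF G])
    show "(\<lambda>m. herm v n (g \<omega>) * (cos_coeff m * f \<omega> ^ m)) sums (herm v n (g \<omega>) * cos (f \<omega>))" for \<omega>
      using cos_converges[of "f \<omega>"] by (intro sums_mult) simp
    show "(\<Sum>m<N. \<bar>herm v n (g \<omega>) * (cos_coeff m * f \<omega> ^ m)\<bar>) \<le> exp (\<bar>v\<bar> / 2) * exp (\<bar>1 * g \<omega>\<bar> + \<bar>1 * f \<omega>\<bar>)" for \<omega> N
    proof -
      have s: "(\<lambda>m. \<bar>f \<omega>\<bar> ^ m / fact m) sums exp \<bar>f \<omega>\<bar>"
        by (rule exp_sums)
      have "(\<Sum>m<N. \<bar>herm v n (g \<omega>) * (cos_coeff m * f \<omega> ^ m)\<bar>)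
        = \<bar>herm v n (g \<omega>)\<bar> * (\<Sum>m<N. \<bar>cos_coeff m\<bar> * \<bar>f \<omega>\<bar> ^ m)"
        by (simp add: sum_distrib_left abs_mult power_abs)
      also have "\<dots> \<le> \<bar>herm v n (g \<omega>)\<bar> * (\<Sum>m<N. \<bar>f \<omega>\<bar> ^ m / fact m)"
        by (intro mult_left_mono sum_mono) (auto simp: cos_coeff_def power_abs)
      also have "\<dots> \<le> exp (\<bar>g \<omega>\<bar> + \<bar>v\<bar> / 2) * exp \<bar>f \<omega>\<bar>"
        using s by (intro mult_mono abs_herm_le_exp sum_le_sums) (auto intro: sum_nonneg)
      finally show ?thesis by (simp add: exp_add algebra_simps)
    qed
  qed measurable
  moreover have "(\<integral>\<omega>. herm v n (g \<omega>) * (cos_coeff m * f \<omega> ^ m) \<partial>M)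
     = cos_coeff m * (\<integral>\<omega>. herm v n (g \<omega>) * f \<omega> ^ m \<partial>M)" for m
    by (subst Bochner_Integration.integral_mult_right_zero[symmetric]) (simp add: mult_ac)
  ultimately have 1: "(\<lambda>m. cos_coeff m * (\<integral>\<omega>. herm v n (g \<omega>) * f \<omega> ^ m \<partial>M))
     sums (\<integral>\<omega>. herm v n (g \<omega>) * cos (f \<omega>) \<partial>M)" by simp
  define C where "C = (if even n then (-1) ^ (n div 2) * c ^ n / fact n else 0)"
  have "(\<lambda>k. C * (gauss_coeff u k * 1 ^ k)) sums (C * exp (- 1\<^sup>2 * u / 2))"
    by (intro sums_mult gauss_coeff_sums)
  moreover have "C * (gauss_coeff u k * 1 ^ k) = cos_coeff (k + n) * (\<integral>\<omega>. herm v n (g \<omega>) * f \<omega> ^ (k + n) \<partial>M)" for k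
  proof (cases "even k \<and> even n")
    case True
    then obtain j i where k: "k = 2 * j" "n = 2 * i" by (auto elim!: evenE)
    have u: "(u / 2) ^ j = (-1) ^ j * (- u / 2) ^ j" by (simp add: power_mult_distrib[symmetric])
    have "(2 * j + 2 * i) div 2 = j + i" by simp
    then show ?thesis
      unfolding gauss_pair_herm_power(2)[OF G] k cos_coeff_def gauss_coeff_def C_def
      by (simp add: power_add u)
  next
    case False
    then show ?thesis
      unfolding gauss_pair_herm_power(2)[OF G] C_def by (auto simp: gauss_coeff_def cos_coeff_def)
  qed
  ultimately have "(\<lambda>k. cos_coeff (k + n) * (\<integral>\<omega>. herm v n (g \<omega>) * f \<omega> ^ (k + n) \<partial>M)) sums (C * exp (- 1\<^sup>2 * u / 2))"
    by (simp only:)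
  then have "(\<lambda>m. cos_coeff m * (\<integral>\<omega>. herm v n (g \<omega>) * f \<omega> ^ m \<partial>M)) sums (C * exp (- 1\<^sup>2 * u / 2))"
    by (subst (asm) sums_zero_iff_shift) (auto simp: gauss_pair_herm_power(2)[OF G])
  moreover have "C * exp (- 1\<^sup>2 * u / 2) = (if even n then (-1) ^ (n div 2) * c ^ n / fact n * exp (- u / 2) else 0)"
    by (simp add: C_def)
  ultimately have 2: "(\<lambda>m. cos_coeff m * (\<integral>\<omega>. herm v n (g \<omega>) * f \<omega> ^ m \<partial>M)) sums
     (if even n then (-1) ^ (n div 2) * c ^ n / fact n * exp (- u / 2) else 0)" by (simp only:)
  show ?thesis by (rule sums_unique2[OF 1 2])
qed

lemma herm_0 [simp]: "herm v 0 g = 1"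
  by (simp add: herm_def gauss_coeff_def)

lemma gauss_pair_cos:
  assumes G: "gauss_pair M g f v c u"
  shows "(\<integral>\<omega>. cos (f \<omega>) \<partial>M) = exp (- u / 2)"
  using gauss_pair_herm_cos[OF G, of 0] by simp

lemma (in finite_measure) cos_L2:
  assumes "f \<in> borel_measurable M"
  shows "(\<lambda>\<omega>. cos (f \<omega>)) \<in> L2 M"
proof -
  have "integrable M (\<lambda>\<omega>. (cos (f \<omega>))\<^sup>2)"
    using assms by (intro integrable_const_bound[of _ 1]) (auto simp: abs_square_le_1)
  with assms show ?thesis by (simp add: L2_def)
qed

text \<open>
  Product formula for cosines, applied to the Gaussian variables \<open>g - f\<close> and \<open>g + f\<close>.
\<close>

lemma (in finite_measure) gauss_pair_cos_cos:
  assumes G: "gauss_pair M g f v c u"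
  shows "(\<integral>\<omega>. cos (g \<omega>) * cos (f \<omega>) \<partial>M) = exp (- (v + u) / 2) * cosh c"
proof -
  have [measurable]: "g \<in> borel_measurable M" "f \<in> borel_measurable M"
    using G by (auto simp: gauss_pair_def)
  have int: "integrable M (\<lambda>\<omega>. cos (h \<omega>))" if "h \<in> borel_measurable M" for h :: "_ \<Rightarrow> real"
    by (intro L2_integrable cos_L2 that)
  have "(\<integral>\<omega>. cos (g \<omega>) * cos (f \<omega>) \<partial>M) = (\<integral>\<omega>. (cos (g \<omega> - f \<omega>) + cos (g \<omega> + f \<omega>)) / 2 \<partial>M)"
    by (simp add: cos_times_cos)
  also have "\<dots> = ((\<integral>\<omega>. cos (g \<omega> - f \<omega>) \<partial>M) + (\<integral>\<omega>. cos (g \<omega> + f \<omega>) \<partial>M)) / 2"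
    by (subst integral_divide_zero, subst Bochner_Integration.integral_add) (auto intro!: int)
  also have "\<dots> = (exp (- (v - 2 * c + u) / 2) + exp (- (v + 2 * c + u) / 2)) / 2"
    using gauss_pair_cos[OF gauss_pair_lincomb[OF G, of 0 0 1 "-1"]]
      gauss_pair_cos[OF gauss_pair_lincomb[OF G, of 0 0 1 1]] by simp
  also have "exp (- (v - 2 * c + u) / 2) = exp (- (v + u) / 2) * exp c"
    unfolding exp_add[symmetric] by (simp add: field_simps)
  also have "exp (- (v + 2 * c + u) / 2) = exp (- (v + u) / 2) * exp (- c)"
    unfolding exp_add[symmetric] by (simp add: field_simps)
  finally show ?thesis by (simp add: cosh_def field_simps)
qed

lemma gauss_pair_herm_herm:
  assumes G: "gauss_pair M g f v c u"
  shows "integrable M (\<lambda>\<omega>. herm v n (g \<omega>) * herm v m (g \<omega>))"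
    and "(\<integral>\<omega>. herm v n (g \<omega>) * herm v m (g \<omega>) \<partial>M) = (if n = m then v ^ n / fact n else 0)"
proof -
  note G' = gauss_pair_same[OF G]
  have eq: "herm v n (g \<omega>) * herm v m (g \<omega>)
      = (\<Sum>i\<le>m. (gauss_coeff v (m - i) / fact i) * (herm v n (g \<omega>) * g \<omega> ^ i))" for \<omega> n m
    by (subst (2) herm_def) (simp add: sum_distrib_left mult_ac)
  show "integrable M (\<lambda>\<omega>. herm v n (g \<omega>) * herm v m (g \<omega>))"
    unfolding eq by (intro Bochner_Integration.integrable_sum integrable_mult_right gauss_pair_herm_power(1)[OF G'])
  have *: "(\<integral>\<omega>. herm v n (g \<omega>) * herm v m (g \<omega>) \<partial>M) = (if n = m then v ^ n / fact n else 0)" if "m \<le> n" for n m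
  proof -
    have "(\<integral>\<omega>. herm v n (g \<omega>) * herm v m (g \<omega>) \<partial>M)
      = (\<Sum>i\<le>m. (gauss_coeff v (m - i) / fact i) * (\<integral>\<omega>. herm v n (g \<omega>) * g \<omega> ^ i \<partial>M))"
      unfolding eq
      by (subst Bochner_Integration.integral_sum)
         (auto intro!: integrable_mult_right gauss_pair_herm_power(1)[OF G'])
    also have "\<dots> = (\<Sum>i\<in>{m}. (gauss_coeff v (m - i) / fact i) * (\<integral>\<omega>. herm v n (g \<omega>) * g \<omega> ^ i \<partial>M))"
      by (rule sum.mono_neutral_right) (use that in \<open>auto simp: gauss_pair_herm_power(2)[OF G']\<close>)
    also have "\<dots> = (if n = m then v ^ n / fact n else 0)"
      using that by (auto simp: gauss_pair_herm_power(2)[OF G'] gauss_coeff_def)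
    finally show ?thesis .
  qed
  show "(\<integral>\<omega>. herm v n (g \<omega>) * herm v m (g \<omega>) \<partial>M) = (if n = m then v ^ n / fact n else 0)"
    using *[of m n] *[of n m] by (cases "m \<le> n") (auto simp: mult.commute)
qed

lemma gauss_pair_herm_L2:
  assumes G: "gauss_pair M g f v c u"
  shows "(\<lambda>\<omega>. herm v n (g \<omega>)) \<in> L2 M"
proof -
  have [measurable]: "g \<in> borel_measurable M" using G by (auto simp: gauss_pair_def)
  show ?thesis using gauss_pair_herm_herm(1)[OF G, of n n] by (simp add: L2_def power2_eq_square)
qed

text \<open>
  The component of degree \<open>n\<close> of the variable \<open>cos g\<close>, for \<open>g\<close> Gaussian of variance \<open>v\<close>: the
  coefficient is what the inner products of \<open>cos g\<close> with Hermite polynomials dictate.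
\<close>

definition cos_chaos :: "real \<Rightarrow> nat \<Rightarrow> real \<Rightarrow> real" where
  "cos_chaos v n g = (if even n then (-1) ^ (n div 2) * exp (- v / 2) else 0) * herm v n g"

lemma gauss_pair_cos_chaos_cos:
  assumes G: "gauss_pair M g f v c u"
  shows "(\<integral>\<omega>. cos_chaos v n (g \<omega>) * cos (f \<omega>) \<partial>M)
    = (if even n then exp (- (v + u) / 2) * c ^ n / fact n else 0)"
proof -
  have 1: "exp (- v / 2) * exp (- u / 2) = exp (- (v + u) / 2)"
    unfolding exp_add[symmetric] by (simp add: field_simps)
  have 2: "(-1 :: real) ^ k * (-1) ^ k = 1" for k by (simp flip: power_add)
  have "(\<integral>\<omega>. cos_chaos v n (g \<omega>) * cos (f \<omega>) \<partial>M)
     = (if even n then (-1) ^ (n div 2) * exp (- v / 2) else 0) * (\<integral>\<omega>. herm v n (g \<omega>) * cos (f \<omega>) \<partial>M)"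
    unfolding cos_chaos_def mult.assoc by (rule Bochner_Integration.integral_mult_right_zero)
  also have "\<dots> = (if even n then ((-1) ^ (n div 2) * (-1) ^ (n div 2)) * (exp (- v / 2) * exp (- u / 2)) * c ^ n / fact n else 0)"
    unfolding gauss_pair_herm_cos[OF G] by simp
  finally show ?thesis unfolding 1 2 by simp
qed

lemma cosh_sums: "(\<lambda>n. if even n then (x :: real) ^ n / fact n else 0) sums cosh x"
proof -
  have "(\<lambda>n. (x ^ n / fact n + (- x) ^ n / fact n) / 2) sums ((exp x + exp (- x)) / 2)"
    by (intro sums_divide sums_add exp_sums)
  moreover have "(x ^ n / fact n + (- x) ^ n / fact n) / 2 = (if even n then x ^ n / fact n else 0)" for n
    by auto
  ultimately show ?thesis by (simp add: cosh_def)
qed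

text \<open>
  The components are orthogonal, and their squared norms are the terms of the series of
  \<open>exp (- v) cosh v = E[(cos g)\<^sup>2]\<close>.  By this Parseval identity the components exhaust \<open>cos g\<close>.
\<close>

lemma (in finite_measure) gauss_pair_cos_chaos_tendsto:
  assumes G: "gauss_pair M g f v c u"
  shows "L2_tendsto M (\<lambda>N \<omega>. \<Sum>n<N. cos_chaos v n (g \<omega>)) (\<lambda>\<omega>. cos (g \<omega>)) sequentially"
  unfolding L2_tendsto_def
proof (intro conjI always_eventually allI)
  have [measurable]: "g \<in> borel_measurable M" using G by (auto simp: gauss_pair_def)
  note G' = gauss_pair_same[OF G]
  show cosL2: "(\<lambda>\<omega>. cos (g \<omega>)) \<in> L2 M" by (rule cos_L2) simp
  have cc: "(\<lambda>\<omega>. cos_chaos v n (g \<omega>)) \<in> L2 M" for n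
    unfolding cos_chaos_def by (intro L2_scale gauss_pair_herm_L2[OF G])
  show sL2: "(\<lambda>\<omega>. \<Sum>n<N. cos_chaos v n (g \<omega>)) \<in> L2 M" for N
    by (intro L2_sum cc) simp
  define a where "a n = (if even n then v ^ n / fact n else 0)" for n
  have cross: "(\<integral>\<omega>. cos_chaos v n (g \<omega>) * cos (g \<omega>) \<partial>M) = exp (- v) * a n" for n
    unfolding gauss_pair_cos_chaos_cos[OF G'] a_def by simp
  have sq: "(\<integral>\<omega>. cos_chaos v n (g \<omega>) * cos_chaos v m (g \<omega>) \<partial>M) = (if n = m then exp (- v) * a n else 0)" for n m
  proof -
    have 1: "exp (- v / 2) * exp (- v / 2) = exp (- v)"
      unfolding exp_add[symmetric] by (simp add: field_simps)
    have 2: "(-1 :: real) ^ k * (-1) ^ k = 1" for k by (simp flip: power_add)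
    define l where "l n = (if even n then (-1) ^ (n div 2) * exp (- v / 2) else 0)" for n :: nat
    have "(\<integral>\<omega>. cos_chaos v n (g \<omega>) * cos_chaos v m (g \<omega>) \<partial>M)
       = (\<integral>\<omega>. (l n * l m) * (herm v n (g \<omega>) * herm v m (g \<omega>)) \<partial>M)"
      by (simp add: cos_chaos_def l_def mult_ac)
    also have "\<dots> = (l n * l m) * (if n = m then v ^ n / fact n else 0)"
      by (simp only: Bochner_Integration.integral_mult_right_zero gauss_pair_herm_herm(2)[OF G])
    also have "\<dots> = (if n = m then exp (- v) * a n else 0)"
    proof (cases "n = m \<and> even n")
      case True
      then have "l n * l m = ((-1) ^ (n div 2) * (-1) ^ (n div 2)) * (exp (- v / 2) * exp (- v / 2))"
        by (auto simp: l_def)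
      then show ?thesis using conjunct1[OF True] conjunct2[OF True] unfolding 1 2 by (simp add: a_def)
    qed (auto simp: l_def a_def)
    finally show ?thesis .
  qed
  have "(\<integral>\<omega>. ((\<Sum>n<N. cos_chaos v n (g \<omega>)) - cos (g \<omega>))\<^sup>2 \<partial>M) = exp (- v) * (cosh v - (\<Sum>n<N. a n))" for N
  proof -
    define S where "S \<omega> = (\<Sum>n<N. cos_chaos v n (g \<omega>))" for \<omega>
    have SL: "S \<in> L2 M" using sL2 by (simp add: S_def[abs_def])
    have "(\<integral>\<omega>. (S \<omega> - cos (g \<omega>))\<^sup>2 \<partial>M) = (\<integral>\<omega>. (S \<omega> + (-1) * cos (g \<omega>))\<^sup>2 \<partial>M)" by simp
    also have "\<dots> = (\<integral>\<omega>. (S \<omega>)\<^sup>2 \<partial>M) - 2 * (\<integral>\<omega>. S \<omega> * cos (g \<omega>) \<partial>M) + (\<integral>\<omega>. (cos (g \<omega>))\<^sup>2 \<partial>M)"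
      by (subst L2_integral_square_add[OF SL cosL2]) simp
    also have "(\<integral>\<omega>. S \<omega> * cos (g \<omega>) \<partial>M) = (\<Sum>n<N. exp (- v) * a n)"
      unfolding S_def sum_distrib_right cross[symmetric]
      by (rule Bochner_Integration.integral_sum) (rule L2_mult_integrable[OF cc cosL2])
    also have "(\<integral>\<omega>. (S \<omega>)\<^sup>2 \<partial>M) = (\<Sum>n<N. exp (- v) * a n)"
    proof -
      have "(\<integral>\<omega>. (S \<omega>)\<^sup>2 \<partial>M) = (\<integral>\<omega>. (\<Sum>n<N. \<Sum>m<N. cos_chaos v n (g \<omega>) * cos_chaos v m (g \<omega>)) \<partial>M)"
        by (simp add: S_def power2_eq_square sum_product)
      also have "\<dots> = (\<Sum>n<N. \<Sum>m<N. \<integral>\<omega>. cos_chaos v n (g \<omega>) * cos_chaos v m (g \<omega>) \<partial>M)"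
        by (simp add: Bochner_Integration.integral_sum Bochner_Integration.integrable_sum L2_mult_integrable[OF cc cc])
      also have "\<dots> = (\<Sum>n<N. exp (- v) * a n)"
        unfolding sq by (simp add: sum.delta)
      finally show ?thesis .
    qed
    also have "(\<integral>\<omega>. (cos (g \<omega>))\<^sup>2 \<partial>M) = exp (- v) * cosh v"
      using gauss_pair_cos_cos[OF G'] by (simp add: power2_eq_square)
    finally show ?thesis unfolding S_def sum_distrib_left[symmetric] by (simp add: algebra_simps)
  qed
  moreover have "(\<lambda>N. exp (- v) * (cosh v - (\<Sum>n<N. a n))) \<longlonglongrightarrow> exp (- v) * (cosh v - cosh v)"
    using cosh_sums[of v] unfolding a_def sums_def by (intro tendsto_intros)
  ultimately show "(\<lambda>N. \<integral>\<omega>. ((\<Sum>n<N. cos_chaos v n (g \<omega>)) - cos (g \<omega>))\<^sup>2 \<partial>M) \<longlonglongrightarrow> 0"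
    by simp
qed

section \<open>Gaussian spaces and their chaos decomposition\<close>

lemma closed_subspace_lincomb:
  "closed_subspace M V \<Longrightarrow> F \<in> V \<Longrightarrow> G \<in> V \<Longrightarrow> (\<lambda>\<omega>. a * F \<omega> + b * G \<omega>) \<in> V"
  unfolding closed_subspace_def by blast

lemma L2_closure_approx:
  assumes "F \<in> L2_closure M A" "e > 0"
  shows "\<exists>P\<in>A. P \<in> L2 M \<and> l2norm M (\<lambda>\<omega>. P \<omega> - F \<omega>) < e"
proof -
  obtain f where f: "\<And>k. f k \<in> A" "L2_tendsto M f F sequentially"
    using assms(1) by (auto simp: L2_closure_def)
  have 1: "eventually (\<lambda>k. f k \<in> L2 M) sequentially"
    and lim: "(\<lambda>k. l2norm M (\<lambda>\<omega>. f k \<omega> - F \<omega>)) \<longlonglongrightarrow> 0"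
    using f(2) unfolding L2_tendsto_iff_l2norm by auto
  have 2: "eventually (\<lambda>k. l2norm M (\<lambda>\<omega>. f k \<omega> - F \<omega>) < e) sequentially"
    by (rule order_tendstoD(2)[OF lim assms(2)])
  obtain k where "f k \<in> L2 M \<and> l2norm M (\<lambda>\<omega>. f k \<omega> - F \<omega>) < e"
    using eventually_happens'[OF sequentially_bot eventually_conj[OF 1 2]] by blast
  with f(1) show ?thesis by blast
qed

lemma L2_closure_superset: "F \<in> A \<Longrightarrow> F \<in> L2 M \<Longrightarrow> F \<in> L2_closure M A"
  unfolding L2_closure_def using L2_tendsto_const by fastforce

text \<open>
  An element of the closure has approximants of any accuracy, so a diagonal sequence leads from limits
  of limits back to the original set.
\<close>

lemma closed_subspace_L2_closure:
  assumes A: "A \<subseteq> L2 M" "(\<lambda>_. 0) \<in> A"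
    and lin: "\<And>F G a b. F \<in> A \<Longrightarrow> G \<in> A \<Longrightarrow> (\<lambda>\<omega>. a * F \<omega> + b * G \<omega>) \<in> A"
  shows "closed_subspace M (L2_closure M A)"
  unfolding closed_subspace_def
proof (intro conjI ballI allI impI subsetI)
  show "F \<in> L2 M" if "F \<in> L2_closure M A" for F
    using that by (auto simp: L2_closure_def L2_tendsto_def)
  show "(\<lambda>_. 0) \<in> L2_closure M A" using A by (intro L2_closure_superset) auto
  show "(\<lambda>\<omega>. a * F \<omega> + b * G \<omega>) \<in> L2_closure M A" if FG: "F \<in> L2_closure M A" "G \<in> L2_closure M A" for F G a b
  proof -
    obtain f where f: "\<And>k. f k \<in> A" "L2_tendsto M f F sequentially"
      using FG(1) by (auto simp: L2_closure_def)
    obtain g where g: "\<And>k. g k \<in> A" "L2_tendsto M g G sequentially"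
      using FG(2) by (auto simp: L2_closure_def)
    show ?thesis unfolding L2_closure_def
      using L2_tendsto_lincomb[OF f(2) g(2), of a b] lin[OF f(1) g(1), of a _ b] by fast
  qed
  show "F \<in> L2_closure M A" if f: "\<forall>k. f k \<in> L2_closure M A" and F: "L2_tendsto M f F sequentially" for f F
  proof -
    have "\<exists>P\<in>A. P \<in> L2 M \<and> l2norm M (\<lambda>\<omega>. P \<omega> - f k \<omega>) < 1 / real (Suc k)" for k
      using f by (intro L2_closure_approx) auto
    then obtain p where p: "\<And>k. p k \<in> A" "\<And>k. p k \<in> L2 M" "\<And>k. l2norm M (\<lambda>\<omega>. p k \<omega> - f k \<omega>) < 1 / real (Suc k)"
      by metis
    have FL: "F \<in> L2 M" using F by (auto simp: L2_tendsto_def)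
    have "L2_tendsto M p F sequentially"
      unfolding L2_tendsto_iff_l2norm
    proof (intro conjI always_eventually allI p FL)
      have "(\<lambda>k. 1 / real (Suc k) + l2norm M (\<lambda>\<omega>. f k \<omega> - F \<omega>)) \<longlonglongrightarrow> 0 + 0"
        using F unfolding L2_tendsto_iff_l2norm divide_inverse mult_1
        by (intro tendsto_intros LIMSEQ_inverse_real_of_nat) auto
      then have lim: "(\<lambda>k. 1 / real (Suc k) + l2norm M (\<lambda>\<omega>. f k \<omega> - F \<omega>)) \<longlonglongrightarrow> 0" by simp
      have ev: "eventually (\<lambda>k. f k \<in> L2 M) sequentially" using F by (simp add: L2_tendsto_def)
      show "(\<lambda>i. l2norm M (\<lambda>\<omega>. p i \<omega> - F \<omega>)) \<longlonglongrightarrow> 0"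
      proof (rule Lim_null_comparison[OF _ lim], use ev in eventually_elim)
        case (elim k)
        from l2norm_triangle_diff[OF p(2) elim FL, of k] p(3)[of k] show ?case
          by (simp add: l2norm_nonneg)
      qed
    qed
    then show ?thesis using p(1) by (auto simp: L2_closure_def)
  qed
qed

lemma closed_subspace_orth:
  assumes V: "closed_subspace M V" and A: "A \<subseteq> L2 M"
  shows "closed_subspace M {F \<in> V. \<forall>P\<in>A. (\<integral>\<omega>. F \<omega> * P \<omega> \<partial>M) = 0}"
proof -
  have VL: "F \<in> V \<Longrightarrow> F \<in> L2 M" for F using V by (auto simp: closed_subspace_def)
  show ?thesis
    unfolding closed_subspace_def
  proof (intro conjI ballI allI impI subsetI; (elim CollectE conjE)?; (intro CollectI conjI)?)
    show "F \<in> V" if "\<forall>k. f k \<in> {F \<in> V. \<forall>P\<in>A. (\<integral>\<omega>. F \<omega> * P \<omega> \<partial>M) = 0}" "L2_tendsto M f F sequentially" for f F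
      using that V unfolding closed_subspace_def by blast
    show "\<forall>P\<in>A. (\<integral>\<omega>. F \<omega> * P \<omega> \<partial>M) = 0"
      if f: "\<forall>k. f k \<in> {F \<in> V. \<forall>P\<in>A. (\<integral>\<omega>. F \<omega> * P \<omega> \<partial>M) = 0}" "L2_tendsto M f F sequentially" for f F
    proof
      fix P assume P: "P \<in> A"
      have "(\<lambda>k. \<integral>\<omega>. f k \<omega> * P \<omega> \<partial>M) \<longlonglongrightarrow> (\<integral>\<omega>. F \<omega> * P \<omega> \<partial>M)"
        using P A by (intro L2_tendsto_inner f L2_tendsto_const) auto
      moreover have "(\<lambda>k. \<integral>\<omega>. f k \<omega> * P \<omega> \<partial>M) = (\<lambda>k. 0)" using f P by auto
      ultimately show "(\<integral>\<omega>. F \<omega> * P \<omega> \<partial>M) = 0" by (simp add: LIMSEQ_const_iff)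
    qed
    show "\<forall>P\<in>A. (\<integral>\<omega>. (a * F \<omega> + b * G \<omega>) * P \<omega> \<partial>M) = 0"
      if "F \<in> V" "G \<in> V" "\<forall>P\<in>A. (\<integral>\<omega>. F \<omega> * P \<omega> \<partial>M) = 0" "\<forall>P\<in>A. (\<integral>\<omega>. G \<omega> * P \<omega> \<partial>M) = 0" for F G a b
    proof
      fix P assume P: "P \<in> A"
      then have "P \<in> L2 M" using A by auto
      then have "(\<integral>\<omega>. (a * F \<omega> + b * G \<omega>) * P \<omega> \<partial>M) = a * (\<integral>\<omega>. F \<omega> * P \<omega> \<partial>M) + b * (\<integral>\<omega>. G \<omega> * P \<omega> \<partial>M)"
        using L2_mult_integrable[OF VL[OF that(1)]] L2_mult_integrable[OF VL[OF that(2)]]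
        by (simp add: distrib_right mult.assoc)
      then show "(\<integral>\<omega>. (a * F \<omega> + b * G \<omega>) * P \<omega> \<partial>M) = 0" using that P by simp
    qed
  qed (use V in \<open>auto simp: closed_subspace_def\<close>)
qed

subsection \<open>Polynomials\<close>

lemma polynomials_inE:
  assumes "P \<in> polynomials_in G n"
  obtains S c where "P = (\<lambda>\<omega>. \<Sum>l\<in>S. c l * (\<Prod>g\<leftarrow>l. g \<omega>))" "finite S"
    "S \<subseteq> {l. set l \<subseteq> G \<and> length l \<le> n}"
  using assms unfolding polynomials_in_def by blast

lemma polynomials_in_monomial:
  assumes "set l \<subseteq> G" "length l \<le> n"
  shows "(\<lambda>\<omega>. \<Prod>g\<leftarrow>l. g \<omega>) \<in> polynomials_in G n"
  unfolding polynomials_in_def using assms by (intro CollectI exI[of _ "{l}"] exI[of _ "\<lambda>_. 1"]) auto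

lemma polynomials_in_lincomb:
  assumes "P \<in> polynomials_in G n" "Q \<in> polynomials_in G n"
  shows "(\<lambda>\<omega>. a * P \<omega> + b * Q \<omega>) \<in> polynomials_in G n"
proof -
  obtain S c where P: "P = (\<lambda>\<omega>. \<Sum>l\<in>S. c l * (\<Prod>g\<leftarrow>l. g \<omega>))" "finite S" "S \<subseteq> {l. set l \<subseteq> G \<and> length l \<le> n}"
    using assms(1) by (auto simp: polynomials_in_def)
  obtain T d where Q: "Q = (\<lambda>\<omega>. \<Sum>l\<in>T. d l * (\<Prod>g\<leftarrow>l. g \<omega>))" "finite T" "T \<subseteq> {l. set l \<subseteq> G \<and> length l \<le> n}"
    using assms(2) by (auto simp: polynomials_in_def)
  define e where "e l = a * (if l \<in> S then c l else 0) + b * (if l \<in> T then d l else 0)" for l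
  have "a * P \<omega> + b * Q \<omega> = (\<Sum>l\<in>S \<union> T. e l * (\<Prod>g\<leftarrow>l. g \<omega>))" for \<omega>
  proof -
    have "P \<omega> = (\<Sum>l\<in>S \<union> T. (if l \<in> S then c l else 0) * (\<Prod>g\<leftarrow>l. g \<omega>))"
      unfolding P(1) using P(2) Q(2) by (intro sum.mono_neutral_cong_left) auto
    moreover have "Q \<omega> = (\<Sum>l\<in>S \<union> T. (if l \<in> T then d l else 0) * (\<Prod>g\<leftarrow>l. g \<omega>))"
      unfolding Q(1) using P(2) Q(2) by (intro sum.mono_neutral_cong_left) auto
    ultimately show ?thesis
      by (simp only: e_def sum_distrib_left sum.distrib[symmetric] distrib_right mult.assoc)
  qed
  then show ?thesis
    unfolding polynomials_in_def using P(2,3) Q(2,3) by (intro CollectI exI[of _ "S \<union> T"] exI[of _ e]) auto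
qed

lemma polynomials_in_zero: "(\<lambda>_. 0) \<in> polynomials_in G n"
  unfolding polynomials_in_def by (intro CollectI exI[of _ "{}"] exI[of _ "\<lambda>_. 0"]) auto

lemma polynomials_in_sum:
  assumes "finite T" "\<And>i. i \<in> T \<Longrightarrow> P i \<in> polynomials_in G n"
  shows "(\<lambda>\<omega>. \<Sum>i\<in>T. c i * P i \<omega>) \<in> polynomials_in G n"
  using assms
proof (induction T rule: finite_induct)
  case (insert i T)
  then show ?case
    using polynomials_in_lincomb[of "P i" G n "\<lambda>\<omega>. \<Sum>i\<in>T. c i * P i \<omega>" "c i" 1] by simp
qed (simp add: polynomials_in_zero)

lemma polynomials_in_mono: "m \<le> n \<Longrightarrow> polynomials_in G m \<subseteq> polynomials_in G n"
  unfolding polynomials_in_def by fastforce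

lemma polynomials_in_const: "(\<lambda>_. a) \<in> polynomials_in G n"
  using polynomials_in_lincomb[OF polynomials_in_monomial[of "[]" G n] polynomials_in_zero, of a 0] by simp

lemma polynomials_in_mult_generator:
  assumes P: "P \<in> polynomials_in G n" and g: "g \<in> G"
  shows "(\<lambda>\<omega>. g \<omega> * P \<omega>) \<in> polynomials_in G (Suc n)"
proof -
  obtain S c where P: "P = (\<lambda>\<omega>. \<Sum>l\<in>S. c l * (\<Prod>g\<leftarrow>l. g \<omega>))" "finite S" "S \<subseteq> {l. set l \<subseteq> G \<and> length l \<le> n}"
    using assms(1) by (auto simp: polynomials_in_def)
  have "(\<lambda>\<omega>. \<Sum>l\<in>S. c l * (\<Prod>h\<leftarrow>g # l. h \<omega>)) \<in> polynomials_in G (Suc n)"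
    using P(2,3) g by (intro polynomials_in_sum polynomials_in_monomial) auto
  also have "(\<lambda>\<omega>. \<Sum>l\<in>S. c l * (\<Prod>h\<leftarrow>g # l. h \<omega>)) = (\<lambda>\<omega>. g \<omega> * P \<omega>)"
    by (simp add: P(1) sum_distrib_left mult_ac)
  finally show ?thesis .
qed

definition lin_span :: "('w \<Rightarrow> real) set \<Rightarrow> ('w \<Rightarrow> real) set" where
  "lin_span G = {\<lambda>\<omega>. \<Sum>g\<in>S. c g * g \<omega> | S c. finite S \<and> S \<subseteq> G}"

lemma lin_span_superset: "g \<in> G \<Longrightarrow> g \<in> lin_span G"
  unfolding lin_span_def by (intro CollectI exI[of _ "{g}"] exI[of _ "\<lambda>_. 1"]) auto

lemma lin_span_lincomb:
  assumes "f \<in> lin_span G" "h \<in> lin_span G"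
  shows "(\<lambda>\<omega>. a * f \<omega> + b * h \<omega>) \<in> lin_span G"
proof -
  obtain S c where P: "f = (\<lambda>\<omega>. \<Sum>g\<in>S. c g * g \<omega>)" "finite S" "S \<subseteq> G"
    using assms(1) by (auto simp: lin_span_def)
  obtain T d where Q: "h = (\<lambda>\<omega>. \<Sum>g\<in>T. d g * g \<omega>)" "finite T" "T \<subseteq> G"
    using assms(2) by (auto simp: lin_span_def)
  define e where "e l = a * (if l \<in> S then c l else 0) + b * (if l \<in> T then d l else 0)" for l
  have "a * f \<omega> + b * h \<omega> = (\<Sum>g\<in>S \<union> T. e g * g \<omega>)" for \<omega>
  proof -
    have "f \<omega> = (\<Sum>g\<in>S \<union> T. (if g \<in> S then c g else 0) * g \<omega>)"
      unfolding P(1) using P(2) Q(2) by (intro sum.mono_neutral_cong_left) auto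
    moreover have "h \<omega> = (\<Sum>g\<in>S \<union> T. (if g \<in> T then d g else 0) * g \<omega>)"
      unfolding Q(1) using P(2) Q(2) by (intro sum.mono_neutral_cong_left) auto
    ultimately show ?thesis
      by (simp only: e_def sum_distrib_left sum.distrib[symmetric] distrib_right mult.assoc)
  qed
  then show ?thesis
    unfolding lin_span_def using P(2,3) Q(2,3) by (intro CollectI exI[of _ "S \<union> T"] exI[of _ e]) auto
qed

lemma lin_span_sum:
  assumes "finite T" "\<And>i. i \<in> T \<Longrightarrow> f i \<in> lin_span G"
  shows "(\<lambda>\<omega>. \<Sum>i\<in>T. c i * f i \<omega>) \<in> lin_span G"
  using assms
proof (induction T rule: finite_induct)
  case empty
  show ?case unfolding lin_span_def by (intro CollectI exI[of _ "{}"] exI[of _ "\<lambda>_. 0"]) auto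
next
  case (insert i T)
  then show ?case
    using lin_span_lincomb[of "f i" G "\<lambda>\<omega>. \<Sum>i\<in>T. c i * f i \<omega>" "c i" 1] by simp
qed

lemma polynomials_in_mult_lin_span:
  assumes P: "P \<in> polynomials_in G n" and f: "f \<in> lin_span G"
  shows "(\<lambda>\<omega>. f \<omega> * P \<omega>) \<in> polynomials_in G (Suc n)"
proof -
  obtain S c where S: "f = (\<lambda>\<omega>. \<Sum>g\<in>S. c g * g \<omega>)" "finite S" "S \<subseteq> G"
    using f by (auto simp: lin_span_def)
  have "(\<lambda>\<omega>. \<Sum>g\<in>S. c g * (g \<omega> * P \<omega>)) \<in> polynomials_in G (Suc n)"
    using S by (intro polynomials_in_sum polynomials_in_mult_generator P) auto
  then show ?thesis by (simp add: S(1) sum_distrib_right mult.assoc)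
qed

lemma polynomials_in_power:
  assumes "f \<in> lin_span G"
  shows "(\<lambda>\<omega>. f \<omega> ^ n) \<in> polynomials_in G n"
proof (induction n)
  case 0 show ?case by (simp add: polynomials_in_const)
next
  case (Suc n) from polynomials_in_mult_lin_span[OF this assms] show ?case by simp
qed

lemma polynomials_in_herm:
  assumes "f \<in> lin_span G"
  shows "(\<lambda>\<omega>. herm v n (f \<omega>)) \<in> polynomials_in G n"
proof -
  have "(\<lambda>\<omega>. \<Sum>i\<le>n. (gauss_coeff v (n - i) / fact i) * f \<omega> ^ i) \<in> polynomials_in G n"
    using polynomials_in_power[OF assms] polynomials_in_mono by (intro polynomials_in_sum) blast+
  then show ?thesis by (simp add: herm_def mult.commute)
qed

subsection \<open>Variables with moments of all orders\<close>

text \<open>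
  An algebra of square-integrable variables: products of Gaussian variables stay in it, which keeps all
  polynomials integrable.
\<close>

definition all_moments :: "'w measure \<Rightarrow> ('w \<Rightarrow> real) set" where
  "all_moments M = {Y \<in> borel_measurable M. \<forall>k::nat. integrable M (\<lambda>\<omega>. \<bar>Y \<omega>\<bar> ^ k)}"

lemma all_moments_L2: "Y \<in> all_moments M \<Longrightarrow> Y \<in> L2 M"
proof -
  assume "Y \<in> all_moments M"
  then have "Y \<in> borel_measurable M" "integrable M (\<lambda>\<omega>. \<bar>Y \<omega>\<bar> ^ 2)"
    unfolding all_moments_def by blast+
  then show "Y \<in> L2 M" by (simp add: L2_def)
qed

lemma all_moments_mult:
  assumes "X \<in> all_moments M" "Y \<in> all_moments M"
  shows "(\<lambda>\<omega>. X \<omega> * Y \<omega>) \<in> all_moments M"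
  unfolding all_moments_def
proof (intro CollectI conjI allI)
  have [measurable]: "X \<in> borel_measurable M" "Y \<in> borel_measurable M"
    using assms by (auto simp: all_moments_def)
  show "(\<lambda>\<omega>. X \<omega> * Y \<omega>) \<in> borel_measurable M" by measurable
  fix k
  have "(\<lambda>\<omega>. \<bar>Z \<omega>\<bar> ^ k) \<in> L2 M" if "Z \<in> all_moments M" for Z
  proof -
    have "Z \<in> borel_measurable M" "integrable M (\<lambda>\<omega>. \<bar>Z \<omega>\<bar> ^ (k * 2))"
      using that unfolding all_moments_def by blast+
    then show ?thesis by (simp add: L2_def power_mult)
  qed
  from L2_mult_integrable[OF this[OF assms(1)] this[OF assms(2)]]
  show "integrable M (\<lambda>\<omega>. \<bar>X \<omega> * Y \<omega>\<bar> ^ k)" by (simp add: abs_mult power_mult_distrib)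
qed

lemma (in finite_measure) all_moments_const: "(\<lambda>_. a) \<in> all_moments M"
  by (simp add: all_moments_def)

lemma (in finite_measure) all_moments_power: "Y \<in> all_moments M \<Longrightarrow> (\<lambda>\<omega>. Y \<omega> ^ n) \<in> all_moments M"
  by (induction n) (auto intro: all_moments_const all_moments_mult)

lemma (in finite_measure) all_moments_prod_list:
  "(\<And>g. g \<in> set l \<Longrightarrow> g \<in> all_moments M) \<Longrightarrow> (\<lambda>\<omega>. \<Prod>g\<leftarrow>l. g \<omega>) \<in> all_moments M"
  by (induction l) (auto intro: all_moments_const all_moments_mult)

subsection \<open>Gaussian spaces\<close>

text \<open>
  Every finite linear combination of generators has the moment generating function of a centered
  Gaussian variable; the variance \<open>q\<close> may be 0.
\<close>

locale gaussian_space = prob_space M for M :: "'w measure" +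
  fixes G :: "('w \<Rightarrow> real) set"
  assumes generator_borel: "g \<in> G \<Longrightarrow> g \<in> borel_measurable M"
    and mgf: "f \<in> lin_span G \<Longrightarrow>
      \<exists>q. \<forall>t. integrable M (\<lambda>\<omega>. exp (t * f \<omega>)) \<and> (\<integral>\<omega>. exp (t * f \<omega>) \<partial>M) = exp (t\<^sup>2 * q / 2)"
begin

lemma lin_span_borel: "f \<in> lin_span G \<Longrightarrow> f \<in> borel_measurable M"
  unfolding lin_span_def using generator_borel by (auto intro!: borel_measurable_sum borel_measurable_times)

definition cov :: "('w \<Rightarrow> real) \<Rightarrow> ('w \<Rightarrow> real) \<Rightarrow> real" where
  "cov f g = (\<integral>\<omega>. f \<omega> * g \<omega> \<partial>M)"

text \<open>
  The constant \<open>q\<close> in the moment generating function is identified as the second moment.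
\<close>

lemma gauss_pair_diag:
  assumes f: "f \<in> lin_span G"
  shows "gauss_pair M f f (cov f f) (cov f f) (cov f f)"
proof -
  obtain q where q: "\<And>t. integrable M (\<lambda>\<omega>. exp (t * f \<omega>))"
    "\<And>t. (\<integral>\<omega>. exp (t * f \<omega>) \<partial>M) = exp (t\<^sup>2 * q / 2)"
    using mgf[OF f] by blast
  have "gauss_pair M f f q q q"
    unfolding gauss_pair_def distrib_right[symmetric] q
    by (intro conjI allI lin_span_borel[OF f] q(1)) (simp add: power2_sum algebra_simps)
  moreover from gauss_pair_herm_power(2)[OF this, of 0 2] have "q = cov f f"
    by (simp add: cov_def power2_eq_square gauss_coeff_def)
  ultimately show ?thesis by simp
qed

lemma lin_span_all_moments:
  assumes "f \<in> lin_span G"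
  shows "f \<in> all_moments M"
  using gauss_pair_herm_power(1)[OF gauss_pair_diag[OF assms], of 0] lin_span_borel[OF assms]
  by (simp add: all_moments_def power_abs[symmetric] integrable_abs)

lemma cov_lincomb:
  assumes "g \<in> lin_span G" "f \<in> lin_span G"
  shows "cov (\<lambda>\<omega>. x * g \<omega> + y * f \<omega>) (\<lambda>\<omega>. x * g \<omega> + y * f \<omega>) = x\<^sup>2 * cov g g + 2 * x * y * cov g f + y\<^sup>2 * cov f f"
proof -
  have L: "g \<in> L2 M" "f \<in> L2 M" using assms lin_span_all_moments all_moments_L2 by blast+
  have "cov (\<lambda>\<omega>. x * g \<omega> + y * f \<omega>) (\<lambda>\<omega>. x * g \<omega> + y * f \<omega>)
     = (\<integral>\<omega>. x\<^sup>2 * (g \<omega> * g \<omega>) + (2 * x * y) * (g \<omega> * f \<omega>) + y\<^sup>2 * (f \<omega> * f \<omega>) \<partial>M)"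
    unfolding cov_def by (intro Bochner_Integration.integral_cong) (auto simp: power2_eq_square algebra_simps)
  then show ?thesis
    using L2_mult_integrable[OF L(1) L(1)] L2_mult_integrable[OF L] L2_mult_integrable[OF L(2) L(2)]
    by (simp add: cov_def)
qed

text \<open>
  Any combination \<open>x g + y f\<close> is again in the span, so its one-dimensional law gives the joint moment
  generating function of the pair.
\<close>

lemma gauss_pair_lin_span:
  assumes g: "g \<in> lin_span G" and f: "f \<in> lin_span G"
  shows "gauss_pair M g f (cov g g) (cov g f) (cov f f)"
  unfolding gauss_pair_def
proof (intro conjI allI)
  fix x y
  note * = gauss_pair_diag[OF lin_span_lincomb[OF g f, of x y], unfolded gauss_pair_def]
  from conjunct2[OF conjunct2[OF *], THEN spec, of 1, THEN spec, of 0]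
  show "integrable M (\<lambda>\<omega>. exp (x * g \<omega> + y * f \<omega>))"
    and "(\<integral>\<omega>. exp (x * g \<omega> + y * f \<omega>) \<partial>M) = exp ((x\<^sup>2 * cov g g + 2 * x * y * cov g f + y\<^sup>2 * cov f f) / 2)"
    by (auto simp: cov_lincomb[OF g f])
qed (use g f lin_span_borel in auto)

lemma polynomials_in_L2: "polynomials_in G n \<subseteq> L2 M"
proof
  fix P assume "P \<in> polynomials_in G n"
  then obtain S c where P: "P = (\<lambda>\<omega>. \<Sum>l\<in>S. c l * (\<Prod>g\<leftarrow>l. g \<omega>))" "finite S" "S \<subseteq> {l. set l \<subseteq> G \<and> length l \<le> n}"
    by (auto simp: polynomials_in_def)
  show "P \<in> L2 M"
    unfolding P(1) using P(2,3)
    by (intro L2_sum L2_scale all_moments_L2 all_moments_prod_list lin_span_all_moments lin_span_superset) auto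
qed

lemma closed_subspace_poly_space: "closed_subspace M (poly_space M G n)"
  unfolding poly_space_def
  by (intro closed_subspace_L2_closure polynomials_in_L2 polynomials_in_zero polynomials_in_lincomb)

lemma poly_space_L2: "poly_space M G n \<subseteq> L2 M"
  using closed_subspace_poly_space[of n] unfolding closed_subspace_def by blast

lemma poly_space_mono: "m \<le> n \<Longrightarrow> poly_space M G m \<subseteq> poly_space M G n"
  unfolding poly_space_def L2_closure_def using polynomials_in_mono by blast

lemma closed_subspace_chaos: "closed_subspace M (chaos M G n)"
  by (cases n) (auto intro!: closed_subspace_poly_space closed_subspace_orth poly_space_L2)

lemma chaos_L2: "F \<in> chaos M G n \<Longrightarrow> F \<in> L2 M"
  using closed_subspace_chaos[of n] unfolding closed_subspace_def by blast

lemma chaos_poly_space: "F \<in> chaos M G n \<Longrightarrow> F \<in> poly_space M G n"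
  by (cases n) auto

lemma chaos_orthogonal_less:
  assumes "F \<in> chaos M G n" "P \<in> chaos M G m" "m < n"
  shows "(\<integral>\<omega>. F \<omega> * P \<omega> \<partial>M) = 0"
proof -
  obtain k where k: "n = Suc k" "m \<le> k" using assms(3) by (cases n) auto
  have "P \<in> poly_space M G k"
    using chaos_poly_space[OF assms(2)] poly_space_mono[OF k(2)] by blast
  then show ?thesis using assms(1) unfolding k(1) by simp
qed

lemma chaos_orthogonal:
  assumes "F \<in> chaos M G n" "P \<in> chaos M G m" "m \<noteq> n"
  shows "(\<integral>\<omega>. F \<omega> * P \<omega> \<partial>M) = 0"
  using chaos_orthogonal_less[OF assms(1,2)] chaos_orthogonal_less[OF assms(2,1)] assms(3)
  by (cases "m < n") (auto simp: mult.commute)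

text \<open>
  Orthogonality to powers of a single variable is known for every element of the span, in particular
  for \<open>t x + f\<close>.  As the integral with \<open>(t x + f)\<^sup>m\<^sup>+\<^sup>1\<close> vanishes for all \<open>t\<close>, so does the coefficient of
  \<open>t\<close>, which is \<open>m + 1\<close> times the integral with \<open>x f\<^sup>m\<close>.  This polarisation replaces the factors of a
  monomial one by one.
\<close>

lemma herm_orthogonal_monomial:
  assumes g: "g \<in> lin_span G"
  shows "set l \<subseteq> lin_span G \<Longrightarrow> f \<in> lin_span G \<Longrightarrow> length l + m < n \<Longrightarrow>
    (\<integral>\<omega>. herm (cov g g) n (g \<omega>) * (\<Prod>h\<leftarrow>l. h \<omega>) * f \<omega> ^ m \<partial>M) = 0"
proof (induction l arbitrary: f m)
  case Nil
  then show ?case using gauss_pair_herm_power(2)[OF gauss_pair_lin_span[OF g Nil(2)], of n m] by simp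
next
  case (Cons x l)
  then have x: "x \<in> lin_span G" by simp
  define A where "A \<omega> = herm (cov g g) n (g \<omega>) * (\<Prod>h\<leftarrow>l. h \<omega>)" for \<omega>
  have hL: "(\<lambda>\<omega>. herm (cov g g) n (g \<omega>)) \<in> L2 M"
    by (rule gauss_pair_herm_L2[OF gauss_pair_diag[OF g]])
  have int: "integrable M (\<lambda>\<omega>. A \<omega> * (x \<omega> ^ j * f \<omega> ^ i))" for i j
  proof -
    have "(\<lambda>\<omega>. (\<Prod>h\<leftarrow>l. h \<omega>) * (x \<omega> ^ j * f \<omega> ^ i)) \<in> L2 M"
      using Cons.prems
      by (intro all_moments_L2 all_moments_mult all_moments_power all_moments_prod_list lin_span_all_moments) auto
    from L2_mult_integrable[OF hL this] show ?thesis by (simp add: A_def mult.assoc)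
  qed
  define a where "a j = real (Suc m choose j) * (\<integral>\<omega>. A \<omega> * (x \<omega> ^ j * f \<omega> ^ (Suc m - j)) \<partial>M)" for j
  have "(\<Sum>j\<le>Suc m. a j * t ^ j) = 0" for t
  proof -
    have "(\<lambda>\<omega>. t * x \<omega> + 1 * f \<omega>) \<in> lin_span G" by (intro lin_span_lincomb x Cons.prems)
    from Cons.IH[OF _ this, of "Suc m"] Cons.prems
    have "0 = (\<integral>\<omega>. A \<omega> * (t * x \<omega> + f \<omega>) ^ Suc m \<partial>M)" by (simp add: A_def)
    also have "\<dots> = (\<integral>\<omega>. (\<Sum>j\<le>Suc m. (real (Suc m choose j) * t ^ j) * (A \<omega> * (x \<omega> ^ j * f \<omega> ^ (Suc m - j)))) \<partial>M)"
      unfolding binomial_ring sum_distrib_left power_mult_distrib by (simp only: mult_ac)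
    also have "\<dots> = (\<Sum>j\<le>Suc m. (real (Suc m choose j) * t ^ j) * (\<integral>\<omega>. A \<omega> * (x \<omega> ^ j * f \<omega> ^ (Suc m - j)) \<partial>M))"
      by (subst Bochner_Integration.integral_sum) (auto intro!: int integrable_mult_right)
    also have "\<dots> = (\<Sum>j\<le>Suc m. a j * t ^ j)" by (simp only: a_def mult_ac)
    finally show ?thesis by simp
  qed
  then have "a 1 = 0" using polyfun_eq_0[of a "Suc m"] by simp
  then have "(\<integral>\<omega>. A \<omega> * (x \<omega> * f \<omega> ^ m) \<partial>M) = 0" by (simp add: a_def)
  then show ?case by (simp add: A_def mult_ac)
qed

lemma herm_in_chaos:
  assumes g: "g \<in> lin_span G"
  shows "(\<lambda>\<omega>. herm (cov g g) n (g \<omega>)) \<in> chaos M G n"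
proof -
  have p: "(\<lambda>\<omega>. herm (cov g g) n (g \<omega>)) \<in> poly_space M G n"
    unfolding poly_space_def
    by (rule L2_closure_superset[OF polynomials_in_herm[OF g] subsetD[OF polynomials_in_L2 polynomials_in_herm[OF g]]])
  show ?thesis
  proof (cases n)
    case 0 with p show ?thesis by simp
  next
    case (Suc k)
    have hL: "(\<lambda>\<omega>. herm (cov g g) n (g \<omega>)) \<in> L2 M"
      by (rule gauss_pair_herm_L2[OF gauss_pair_diag[OF g]])
    have zero: "(\<integral>\<omega>. herm (cov g g) n (g \<omega>) * P \<omega> \<partial>M) = 0" if mem: "P \<in> polynomials_in G k" for P
    proof -
      obtain S c where P: "P = (\<lambda>\<omega>. \<Sum>l\<in>S. c l * (\<Prod>g\<leftarrow>l. g \<omega>))" "finite S" "S \<subseteq> {l. set l \<subseteq> G \<and> length l \<le> k}"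
        by (rule polynomials_inE[OF mem])
      have int: "integrable M (\<lambda>\<omega>. herm (cov g g) n (g \<omega>) * (\<Prod>g\<leftarrow>l. g \<omega>))" if "l \<in> S" for l
        using that P(3)
        by (intro L2_mult_integrable[OF hL] all_moments_L2 all_moments_prod_list lin_span_all_moments lin_span_superset) auto
      have "(\<integral>\<omega>. herm (cov g g) n (g \<omega>) * P \<omega> \<partial>M)
         = (\<integral>\<omega>. (\<Sum>l\<in>S. c l * (herm (cov g g) n (g \<omega>) * (\<Prod>g\<leftarrow>l. g \<omega>))) \<partial>M)"
        by (simp add: P(1) sum_distrib_left mult_ac)
      also have "\<dots> = (\<Sum>l\<in>S. c l * (\<integral>\<omega>. herm (cov g g) n (g \<omega>) * (\<Prod>g\<leftarrow>l. g \<omega>) \<partial>M))"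
        by (subst Bochner_Integration.integral_sum) (auto intro!: int integrable_mult_right)
      also have "\<dots> = 0"
      proof (rule sum.neutral, rule ballI)
        fix l assume l: "l \<in> S"
        have "(\<integral>\<omega>. herm (cov g g) n (g \<omega>) * (\<Prod>h\<leftarrow>l. h \<omega>) * g \<omega> ^ 0 \<partial>M) = 0"
          using l P(3) Suc by (intro herm_orthogonal_monomial g) (auto intro: lin_span_superset)
        then show "c l * (\<integral>\<omega>. herm (cov g g) n (g \<omega>) * (\<Prod>g\<leftarrow>l. g \<omega>) \<partial>M) = 0" by simp
      qed
      finally show ?thesis .
    qed
    have orth: "(\<integral>\<omega>. herm (cov g g) n (g \<omega>) * P \<omega> \<partial>M) = 0" if mem: "P \<in> poly_space M G k" for P
    proof -
      obtain p where p: "\<And>i. p i \<in> polynomials_in G k" "L2_tendsto M p P sequentially"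
        using mem unfolding poly_space_def L2_closure_def by blast
      have "(\<lambda>i::nat. 0 :: real) \<longlonglongrightarrow> (\<integral>\<omega>. herm (cov g g) n (g \<omega>) * P \<omega> \<partial>M)"
        using L2_tendsto_inner[OF L2_tendsto_const[OF hL] p(2)] unfolding zero[OF p(1)] .
      then show ?thesis by (simp only: LIMSEQ_const_iff)
    qed
    show ?thesis
      unfolding Suc chaos.simps
      by (intro CollectI conjI ballI p[unfolded Suc] orth[unfolded Suc])
  qed
qed

lemma cos_chaos_in_chaos:
  assumes g: "g \<in> lin_span G"
  shows "(\<lambda>\<omega>. cos_chaos (cov g g) n (g \<omega>)) \<in> chaos M G n"
proof -
  define a where "a = (if even n then (-1) ^ (n div 2) * exp (- cov g g / 2) else 0)"
  have "(\<lambda>\<omega>. a * herm (cov g g) n (g \<omega>) + 0 * herm (cov g g) n (g \<omega>)) \<in> chaos M G n"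
    by (intro closed_subspace_lincomb[OF closed_subspace_chaos] herm_in_chaos g)
  then show ?thesis by (simp add: cos_chaos_def a_def)
qed

text \<open>
  Expanding the cosine, all components except the one of the same degree are orthogonal to \<open>F\<close>.
\<close>

lemma chaos_inner_cos:
  assumes g: "g \<in> lin_span G" and F: "F \<in> chaos M G n"
  shows "(\<integral>\<omega>. F \<omega> * cos (g \<omega>) \<partial>M) = (\<integral>\<omega>. F \<omega> * cos_chaos (cov g g) n (g \<omega>) \<partial>M)"
proof -
  note FL = chaos_L2[OF F]
  have cc: "(\<lambda>\<omega>. cos_chaos (cov g g) k (g \<omega>)) \<in> L2 M" for k
    using chaos_L2 cos_chaos_in_chaos[OF g] by blast
  have "(\<lambda>N. \<integral>\<omega>. F \<omega> * (\<Sum>k<N. cos_chaos (cov g g) k (g \<omega>)) \<partial>M) \<longlonglongrightarrow> (\<integral>\<omega>. F \<omega> * cos (g \<omega>) \<partial>M)"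
    by (intro L2_tendsto_inner L2_tendsto_const FL gauss_pair_cos_chaos_tendsto[OF gauss_pair_diag[OF g]])
  moreover have "(\<integral>\<omega>. F \<omega> * (\<Sum>k<N. cos_chaos (cov g g) k (g \<omega>)) \<partial>M) = (\<integral>\<omega>. F \<omega> * cos_chaos (cov g g) n (g \<omega>) \<partial>M)"
    if "N > n" for N
  proof -
    have "(\<integral>\<omega>. F \<omega> * (\<Sum>k<N. cos_chaos (cov g g) k (g \<omega>)) \<partial>M)
       = (\<Sum>k<N. \<integral>\<omega>. F \<omega> * cos_chaos (cov g g) k (g \<omega>) \<partial>M)"
      unfolding sum_distrib_left by (rule Bochner_Integration.integral_sum) (rule L2_mult_integrable[OF FL cc])
    also have "\<dots> = (\<Sum>k\<in>{n}. \<integral>\<omega>. F \<omega> * cos_chaos (cov g g) k (g \<omega>) \<partial>M)"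
      using that chaos_orthogonal[OF F cos_chaos_in_chaos[OF g]] by (intro sum.mono_neutral_right) auto
    finally show ?thesis by simp
  qed
  then have "eventually (\<lambda>N. (\<integral>\<omega>. F \<omega> * (\<Sum>k<N. cos_chaos (cov g g) k (g \<omega>)) \<partial>M) = (\<integral>\<omega>. F \<omega> * cos_chaos (cov g g) n (g \<omega>) \<partial>M)) sequentially"
    by (rule eventually_mono[OF eventually_gt_at_top[of n]])
  ultimately have "(\<lambda>N::nat. \<integral>\<omega>. F \<omega> * cos_chaos (cov g g) n (g \<omega>) \<partial>M) \<longlonglongrightarrow> (\<integral>\<omega>. F \<omega> * cos (g \<omega>) \<partial>M)"
    by (rule Lim_transform_eventually)
  then show ?thesis by (simp add: LIMSEQ_const_iff)
qed

end

section \<open>Averages of cosines of Gaussian variables\<close>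

definition cos_average :: "'a measure \<Rightarrow> ('a \<Rightarrow> 'w \<Rightarrow> real) \<Rightarrow> 'w \<Rightarrow> real" where
  "cos_average A g \<omega> = (\<integral>a. cos (g a \<omega>) \<partial>A)"

lemma (in finite_measure) cos_average_L2:
  assumes A: "finite_measure A" and g: "(\<lambda>(a, \<omega>). g a \<omega>) \<in> borel_measurable (A \<Otimes>\<^sub>M M)"
  shows "cos_average A g \<in> L2 M"
proof -
  interpret A: finite_measure A by (rule A)
  note [measurable] = g
  have [measurable]: "(\<lambda>(\<omega>, a). g a \<omega>) \<in> borel_measurable (M \<Otimes>\<^sub>M A)"
    by (rule measurable_pair_swap_iff[THEN iffD2]) (simp add: g)
  have m [measurable]: "cos_average A g \<in> borel_measurable M"
    unfolding cos_average_def[abs_def] by measurable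
  have b: "\<bar>cos_average A g \<omega>\<bar> \<le> measure A (space A)" for \<omega>
  proof -
    have "norm (\<integral>a. cos (g a \<omega>) \<partial>A) \<le> (\<integral>a. norm (cos (g a \<omega>)) \<partial>A)" by (rule integral_norm_bound)
    also have "\<dots> \<le> (\<integral>a. 1 \<partial>A)" by (rule integral_mono') auto
    finally show ?thesis by (simp add: cos_average_def)
  qed
  have "integrable M (\<lambda>\<omega>. (cos_average A g \<omega>)\<^sup>2)"
    by (rule integrable_const_bound[of _ "(measure A (space A))\<^sup>2"])
      (use b in \<open>auto simp: abs_le_square_iff[symmetric]\<close>)
  with m show ?thesis by (simp add: L2_def)
qed

lemma (in finite_measure) cos_average_inner:
  assumes A: "finite_measure A" and g: "(\<lambda>(a, \<omega>). g a \<omega>) \<in> borel_measurable (A \<Otimes>\<^sub>M M)" and Y: "Y \<in> L2 M"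
  shows "(\<integral>\<omega>. Y \<omega> * cos_average A g \<omega> \<partial>M) = (\<integral>a. (\<integral>\<omega>. Y \<omega> * cos (g a \<omega>) \<partial>M) \<partial>A)"
proof -
  interpret A: finite_measure A by (rule A)
  interpret P: pair_sigma_finite A M ..
  note [measurable] = g
  have [measurable]: "Y \<in> borel_measurable M" using Y by (rule L2_borel)
  have Yi: "integrable M Y" by (rule L2_integrable[OF Y])
  have "integrable (A \<Otimes>\<^sub>M M) (\<lambda>z. Y (snd z))"
    by (rule P.Fubini_integrable) (auto simp: Yi)
  then have "integrable (A \<Otimes>\<^sub>M M) (\<lambda>(a, \<omega>). Y \<omega> * cos (g a \<omega>))"
  proof (rule Bochner_Integration.integrable_bound)
    show "(\<lambda>(a, \<omega>). Y \<omega> * cos (g a \<omega>)) \<in> borel_measurable (A \<Otimes>\<^sub>M M)" by measurable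
    show "AE z in A \<Otimes>\<^sub>M M. norm (case z of (a, \<omega>) \<Rightarrow> Y \<omega> * cos (g a \<omega>)) \<le> norm (Y (snd z))"
      by (auto simp: abs_mult mult_left_le)
  qed
  from P.Fubini_integral[OF this]
  show ?thesis by (simp add: cos_average_def)
qed

context gaussian_space
begin

text \<open>
  By Fubini's theorem, the inner product of two averages is the average of the inner products.
\<close>

lemma cos_average_inner_cos_average:
  assumes A: "finite_measure A"
    and g: "(\<lambda>(a, \<omega>). g a \<omega>) \<in> borel_measurable (A \<Otimes>\<^sub>M M)" "\<And>a. a \<in> space A \<Longrightarrow> g a \<in> lin_span G"
    and h: "(\<lambda>(a, \<omega>). h a \<omega>) \<in> borel_measurable (A \<Otimes>\<^sub>M M)" "\<And>a. a \<in> space A \<Longrightarrow> h a \<in> lin_span G"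
  shows "(\<integral>\<omega>. cos_average A g \<omega> * cos_average A h \<omega> \<partial>M)
    = (\<integral>a. (\<integral>b. exp (- (cov (g a) (g a) + cov (h b) (h b)) / 2) * cosh (cov (g a) (h b)) \<partial>A) \<partial>A)"
proof -
  have "(\<integral>\<omega>. cos_average A g \<omega> * cos_average A h \<omega> \<partial>M) = (\<integral>\<omega>. cos_average A h \<omega> * cos_average A g \<omega> \<partial>M)"
    by (simp add: mult.commute)
  also have "\<dots> = (\<integral>a. (\<integral>\<omega>. cos_average A h \<omega> * cos (g a \<omega>) \<partial>M) \<partial>A)"
    by (rule cos_average_inner[OF A g(1) cos_average_L2[OF A h(1)]])
  also have "\<dots> = (\<integral>a. (\<integral>b. (\<integral>\<omega>. cos (g a \<omega>) * cos (h b \<omega>) \<partial>M) \<partial>A) \<partial>A)"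
  proof (rule Bochner_Integration.integral_cong[OF refl])
    fix a assume a: "a \<in> space A"
    show "(\<integral>\<omega>. cos_average A h \<omega> * cos (g a \<omega>) \<partial>M) = (\<integral>b. (\<integral>\<omega>. cos (g a \<omega>) * cos (h b \<omega>) \<partial>M) \<partial>A)"
      using cos_average_inner[OF A h(1) cos_L2[OF lin_span_borel[OF g(2)[OF a]]]]
      by (simp add: mult.commute)
  qed
  also have "\<dots> = (\<integral>a. (\<integral>b. exp (- (cov (g a) (g a) + cov (h b) (h b)) / 2) * cosh (cov (g a) (h b)) \<partial>A) \<partial>A)"
    by (intro Bochner_Integration.integral_cong refl gauss_pair_cos_cos gauss_pair_lin_span g h)
  finally show ?thesis .
qed

text \<open>
  The squared norm of the projection is its inner product with the average itself.  Replacing each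
  cosine by its component of degree \<open>n\<close> then allows the projection to be replaced by the average, which
  leaves explicit inner products of \<open>cos_chaos\<close> with cosines.
\<close>

lemma chaos_projection_cos_average:
  assumes A: "finite_measure A"
    and g: "(\<lambda>(a, \<omega>). g a \<omega>) \<in> borel_measurable (A \<Otimes>\<^sub>M M)" "\<And>a. a \<in> space A \<Longrightarrow> g a \<in> lin_span G"
    and P: "is_projection M (chaos M G n) (cos_average A g) P"
  shows "(\<integral>\<omega>. (P \<omega>)\<^sup>2 \<partial>M) = (\<integral>a. (\<integral>b. (if even n then
      exp (- (cov (g a) (g a) + cov (g b) (g b)) / 2) * cov (g a) (g b) ^ n / fact n else 0) \<partial>A) \<partial>A)"
proof -
  define F where "F = cos_average A g"
  have FL: "F \<in> L2 M" unfolding F_def by (rule cos_average_L2[OF A g(1)])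
  have PC: "P \<in> chaos M G n" and orth: "\<And>W. W \<in> chaos M G n \<Longrightarrow> (\<integral>\<omega>. F \<omega> * W \<omega> \<partial>M) = (\<integral>\<omega>. P \<omega> * W \<omega> \<partial>M)"
    using P by (auto simp: is_projection_def F_def)
  note PL = chaos_L2[OF PC]
  have "(\<integral>\<omega>. (P \<omega>)\<^sup>2 \<partial>M) = (\<integral>\<omega>. P \<omega> * F \<omega> \<partial>M)"
    using orth[OF PC] by (simp add: power2_eq_square mult.commute)
  also have "\<dots> = (\<integral>a. (\<integral>\<omega>. P \<omega> * cos (g a \<omega>) \<partial>M) \<partial>A)"
    unfolding F_def by (rule cos_average_inner[OF A g(1) PL])
  also have "\<dots> = (\<integral>a. (\<integral>\<omega>. cos_chaos (cov (g a) (g a)) n (g a \<omega>) * F \<omega> \<partial>M) \<partial>A)"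
  proof (rule Bochner_Integration.integral_cong[OF refl])
    fix a assume "a \<in> space A"
    note ga = g(2)[OF this]
    show "(\<integral>\<omega>. P \<omega> * cos (g a \<omega>) \<partial>M) = (\<integral>\<omega>. cos_chaos (cov (g a) (g a)) n (g a \<omega>) * F \<omega> \<partial>M)"
      using chaos_inner_cos[OF ga PC] orth[OF cos_chaos_in_chaos[OF ga]] by (simp add: mult.commute)
  qed
  also have "\<dots> = (\<integral>a. (\<integral>b. (\<integral>\<omega>. cos_chaos (cov (g a) (g a)) n (g a \<omega>) * cos (g b \<omega>) \<partial>M) \<partial>A) \<partial>A)"
    unfolding F_def
    by (intro Bochner_Integration.integral_cong refl cos_average_inner A g(1) chaos_L2[OF cos_chaos_in_chaos] g(2))
  also have "\<dots> = (\<integral>a. (\<integral>b. (if even n then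
      exp (- (cov (g a) (g a) + cov (g b) (g b)) / 2) * cov (g a) (g b) ^ n / fact n else 0) \<partial>A) \<partial>A)"
    by (intro Bochner_Integration.integral_cong refl gauss_pair_cos_chaos_cos gauss_pair_lin_span g)
  finally show ?thesis .
qed

lemma borel_measurable_cov:
  assumes g: "(\<lambda>(a, \<omega>). g a \<omega>) \<in> borel_measurable (A \<Otimes>\<^sub>M M)"
    and h: "(\<lambda>(a, \<omega>). h a \<omega>) \<in> borel_measurable (A \<Otimes>\<^sub>M M)"
  shows "(\<lambda>(a, b). cov (g a) (h b)) \<in> borel_measurable (A \<Otimes>\<^sub>M A)"
    and "(\<lambda>a. cov (g a) (g a)) \<in> borel_measurable A"
proof -
  note [measurable] = g h
  show "(\<lambda>(a, b). cov (g a) (h b)) \<in> borel_measurable (A \<Otimes>\<^sub>M A)"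
    unfolding cov_def split_beta' by measurable
  show "(\<lambda>a. cov (g a) (g a)) \<in> borel_measurable A"
    unfolding cov_def by measurable
qed

text \<open>
  At \<open>\<rho> = 1\<close> the left-hand side is the expectation of a product of cosines.  The uniform bound 1
  dominates the series in the next lemma.
\<close>

lemma exp_cov_cosh_le_1:
  assumes f: "f \<in> lin_span G" "h \<in> lin_span G" and \<rho>: "0 \<le> \<rho>" "\<rho> \<le> 1"
  shows "exp (- (cov f f + cov h h) / 2) * cosh (\<rho> * cov f h) \<le> 1"
proof -
  have "\<bar>\<rho> * cov f h\<bar> \<le> \<bar>cov f h\<bar>"
    using \<rho> by (simp add: abs_mult mult_left_le_one_le)
  then have "cosh \<bar>\<rho> * cov f h\<bar> \<le> cosh \<bar>cov f h\<bar>"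
    by (subst cosh_real_nonneg_le_iff) auto
  then have "cosh (\<rho> * cov f h) \<le> cosh (cov f h)" by simp
  then have "exp (- (cov f f + cov h h) / 2) * cosh (\<rho> * cov f h) \<le> exp (- (cov f f + cov h h) / 2) * cosh (cov f h)"
    by (intro mult_left_mono) auto
  also have "exp (- (cov f f + cov h h) / 2) * cosh (cov f h) = (\<integral>\<omega>. cos (f \<omega>) * cos (h \<omega>) \<partial>M)"
    by (rule gauss_pair_cos_cos[OF gauss_pair_lin_span[OF f], symmetric])
  also have "\<dots> \<le> (\<integral>\<omega>. 1 \<partial>M)"
  proof (rule integral_mono')
    show "cos (f \<omega>) * cos (h \<omega>) \<le> 1" for \<omega>
      using mult_mono[of "\<bar>cos (f \<omega>)\<bar>" 1 "\<bar>cos (h \<omega>)\<bar>" 1] by (simp add: abs_mult[symmetric])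
  qed auto
  finally show ?thesis by (simp add: prob_space)
qed

text \<open>
  The even terms of the exponential series add up to the hyperbolic cosine.  A weight \<open>\<rho>\<^sup>n\<close> multiplies
  the covariance of \<open>g a\<close> and \<open>g b\<close> by \<open>\<rho>\<close> and leaves the variances alone.
\<close>

lemma chaos_projection_cos_average_sums:
  assumes A: "finite_measure A"
    and g: "(\<lambda>(a, \<omega>). g a \<omega>) \<in> borel_measurable (A \<Otimes>\<^sub>M M)" "\<And>a. a \<in> space A \<Longrightarrow> g a \<in> lin_span G"
    and P: "\<And>n. is_projection M (chaos M G n) (cos_average A g) (P n)"
    and \<rho>: "0 \<le> \<rho>" "\<rho> \<le> 1"
  shows "(\<lambda>n. \<rho> ^ n * (\<integral>\<omega>. (P n \<omega>)\<^sup>2 \<partial>M)) sums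
    (\<integral>a. (\<integral>b. exp (- (cov (g a) (g a) + cov (g b) (g b)) / 2) * cosh (\<rho> * cov (g a) (g b)) \<partial>A) \<partial>A)"
proof -
  interpret A: finite_measure A by (rule A)
  define t where "t n a b = (if even n then
      exp (- (cov (g a) (g a) + cov (g b) (g b)) / 2) * (\<rho> * cov (g a) (g b)) ^ n / fact n else 0)" for n :: nat and a b
  define S where "S a b = exp (- (cov (g a) (g a) + cov (g b) (g b)) / 2) * cosh (\<rho> * cov (g a) (g b))" for a b
  note m = borel_measurable_cov[OF g(1) g(1)]
  have [measurable]: "(\<lambda>(a, b). t n a b) \<in> borel_measurable (A \<Otimes>\<^sub>M A)" for n
    using m by (cases "even n") (simp_all add: t_def[abs_def])
  have tn: "\<bar>t n a b\<bar> = t n a b" for n a b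
    by (auto simp: t_def intro!: divide_nonneg_nonneg mult_nonneg_nonneg zero_le_even_power)
  have sums: "(\<lambda>n. t n a b) sums S a b" for a b
  proof -
    have "(\<lambda>n. exp (- (cov (g a) (g a) + cov (g b) (g b)) / 2) * (if even n then (\<rho> * cov (g a) (g b)) ^ n / fact n else 0)) sums S a b"
      unfolding S_def by (intro sums_mult cosh_sums)
    then show ?thesis by (rule sums_cong[THEN iffD1, rotated]) (simp add: t_def)
  qed
  have S1: "S a b \<le> 1" if "a \<in> space A" "b \<in> space A" for a b
    unfolding S_def by (intro exp_cov_cosh_le_1 g that \<rho>)
  have part: "(\<Sum>n<N. \<bar>t n a b\<bar>) \<le> 1" if "a \<in> space A" "b \<in> space A" for a b N
    using sum_le_sums[OF sums[of a b], of N] tn S1[OF that] by (metis (no_types, lifting) abs_ge_zero order_trans sum.cong)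
  have inner: "(\<lambda>n. \<integral>b. t n a b \<partial>A) sums (\<integral>b. S a b \<partial>A)" "integrable A (t n a)" if a: "a \<in> space A" for a n
  proof -
    have 1: "t n a \<in> borel_measurable A" for n
      using measurable_compose[OF measurable_Pair1'[OF a, of A], of "\<lambda>(a, b). t n a b" borel] by simp
    note * = sums_integral_dominated[where M = A and h = "\<lambda>n. t n a" and w = "\<lambda>_. 1" and S = "S a"]
    show "(\<lambda>n. \<integral>b. t n a b \<partial>A) sums (\<integral>b. S a b \<partial>A)" by (rule *(2)) (use 1 sums part[OF a] in auto)
    show "integrable A (t n a)" by (rule *(1)) (use 1 sums part[OF a] in auto)
  qed
  have outer: "(\<lambda>n. \<integral>a. (\<integral>b. t n a b \<partial>A) \<partial>A) sums (\<integral>a. (\<integral>b. S a b \<partial>A) \<partial>A)"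
  proof (rule sums_integral_dominated(2))
    show "integrable A (\<lambda>_. measure A (space A))" by simp
    show "(\<lambda>a. \<integral>b. t n a b \<partial>A) \<in> borel_measurable A" for n by measurable
    show "(\<lambda>n. \<integral>b. t n a b \<partial>A) sums (\<integral>b. S a b \<partial>A)" if "a \<in> space A" for a by (rule inner(1)[OF that])
    show "(\<Sum>n<N. \<bar>\<integral>b. t n a b \<partial>A\<bar>) \<le> measure A (space A)" if a: "a \<in> space A" for a N
    proof -
      have "\<bar>\<integral>b. t n a b \<partial>A\<bar> = (\<integral>b. \<bar>t n a b\<bar> \<partial>A)" for n
      proof -
        have "0 \<le> (\<integral>b. t n a b \<partial>A)"
          by (rule Bochner_Integration.integral_nonneg) (metis tn abs_ge_zero)
        then show ?thesis unfolding tn by simp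
      qed
      then have "(\<Sum>n<N. \<bar>\<integral>b. t n a b \<partial>A\<bar>) = (\<Sum>n<N. \<integral>b. \<bar>t n a b\<bar> \<partial>A)" by simp
      also have "\<dots> = (\<integral>b. (\<Sum>n<N. \<bar>t n a b\<bar>) \<partial>A)"
        by (rule Bochner_Integration.integral_sum[symmetric]) (rule integrable_abs[OF inner(2)[OF a]])
      also have "\<dots> \<le> (\<integral>b. 1 \<partial>A)"
        by (rule integral_mono_AE') (use part[OF a] in \<open>auto simp: sum_nonneg\<close>)
      finally show ?thesis by simp
    qed
  qed
  have "\<rho> ^ n * (\<integral>\<omega>. (P n \<omega>)\<^sup>2 \<partial>M) = (\<integral>a. (\<integral>b. t n a b \<partial>A) \<partial>A)" for n
  proof -
    have "(\<integral>a. (\<integral>b. t n a b \<partial>A) \<partial>A) = (\<integral>a. (\<integral>b. \<rho> ^ n * (if even n then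
      exp (- (cov (g a) (g a) + cov (g b) (g b)) / 2) * cov (g a) (g b) ^ n / fact n else 0) \<partial>A) \<partial>A)"
      by (intro Bochner_Integration.integral_cong refl) (simp add: t_def power_mult_distrib)
    then show ?thesis
      by (simp only: Bochner_Integration.integral_mult_right_zero chaos_projection_cos_average[OF A g P])
  qed
  then show ?thesis using outer by (simp add: S_def)
qed

end

section \<open>Gaussian integrals\<close>

abbreviation std_normal :: "real measure" where
  "std_normal \<equiv> density lborel std_normal_density"

lemma prob_space_std_normal: "prob_space std_normal"
  by (rule prob_space_normal_density) simp

definition std_normal_vec :: "('d::finite \<Rightarrow> real) measure" where
  "std_normal_vec = Pi\<^sub>M UNIV (\<lambda>_. std_normal)"

lemma prob_space_std_normal_vec: "prob_space std_normal_vec"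
  unfolding std_normal_vec_def by (intro prob_space_PiM prob_space_std_normal)

lemma sets_std_normal_vec [measurable_cong]: "sets std_normal_vec = sets (Pi\<^sub>M UNIV (\<lambda>_. borel))"
  unfolding std_normal_vec_def by (intro sets_PiM_cong) auto

lemma product_sigma_finite_std_normal: "product_sigma_finite (\<lambda>_. std_normal)"
proof -
  interpret prob_space std_normal by (rule prob_space_std_normal)
  show ?thesis by standard
qed

lemma std_normal_vec_integral_prod:
  fixes f :: "'d::finite \<Rightarrow> real \<Rightarrow> complex"
  assumes "\<And>i. integrable std_normal (f i)"
  shows "(\<integral>\<zeta>. (\<Prod>i\<in>UNIV. f i (\<zeta> i)) \<partial>std_normal_vec) = (\<Prod>i\<in>UNIV. \<integral>y. f i y \<partial>std_normal)"
  unfolding std_normal_vec_def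
  using product_sigma_finite.product_integral_prod[OF product_sigma_finite_std_normal, of UNIV f] assms by simp

lemma std_normal_vec_nn_integral_prod:
  fixes f :: "'d::finite \<Rightarrow> real \<Rightarrow> ennreal"
  assumes "\<And>i. f i \<in> borel_measurable borel"
  shows "(\<integral>\<^sup>+\<zeta>. (\<Prod>i\<in>UNIV. f i (\<zeta> i)) \<partial>std_normal_vec) = (\<Prod>i\<in>UNIV. \<integral>\<^sup>+y. f i y \<partial>std_normal)"
  unfolding std_normal_vec_def
  using product_sigma_finite.product_nn_integral_prod[OF product_sigma_finite_std_normal, of UNIV f] assms by simp

text \<open>
  The characteristic function of a standard normal vector.  Read from right to left, it writes the heat
  kernel as an average of cosines.
\<close>

lemma std_normal_vec_integral_cos:
  fixes x :: "'d::finite \<Rightarrow> real"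
  shows "(\<integral>\<zeta>. cos (\<Sum>i\<in>UNIV. \<zeta> i * x i) \<partial>std_normal_vec) = exp (- (\<Sum>i\<in>UNIV. (x i)\<^sup>2) / 2)"
proof -
  interpret N: prob_space "std_normal_vec :: ('d \<Rightarrow> real) measure" by (rule prob_space_std_normal_vec)
  interpret n: prob_space std_normal by (rule prob_space_std_normal)
  have int: "integrable std_normal (\<lambda>y. iexp (x i * y))" for i
    by (rule n.integrable_const_bound[of _ 1]) auto
  have "(\<integral>y. iexp (x i * y) \<partial>std_normal) = complex_of_real (exp (- (x i)\<^sup>2 / 2))" for i
    using fun_cong[OF char_std_normal_distribution, of "x i"] by (simp add: char_def)
  then have "(\<integral>\<zeta>. (\<Prod>i\<in>UNIV. iexp (x i * \<zeta> i)) \<partial>std_normal_vec) = complex_of_real (exp (- (\<Sum>i\<in>UNIV. (x i)\<^sup>2) / 2))"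
    by (subst std_normal_vec_integral_prod[OF int])
      (simp add: exp_sum[symmetric] sum_negf sum_divide_distrib flip: of_real_prod)
  moreover have "(\<Prod>i\<in>UNIV. iexp (x i * \<zeta> i)) = iexp (\<Sum>i\<in>UNIV. \<zeta> i * x i)" for \<zeta> :: "'d \<Rightarrow> real"
    by (simp add: exp_sum[symmetric] sum_distrib_left mult_ac)
  ultimately have e: "(\<integral>\<zeta>. iexp (\<Sum>i\<in>UNIV. \<zeta> i * x i) \<partial>std_normal_vec) = complex_of_real (exp (- (\<Sum>i\<in>UNIV. (x i)\<^sup>2) / 2))"
    by simp
  have "integrable std_normal_vec (\<lambda>\<zeta> :: 'd \<Rightarrow> real. iexp (\<Sum>i\<in>UNIV. \<zeta> i * x i))"
    by (rule N.integrable_const_bound[of _ 1]) auto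
  from integral_Re[OF this]
  have "(\<integral>\<zeta>. Re (iexp (\<Sum>i\<in>UNIV. \<zeta> i * x i)) \<partial>std_normal_vec) = exp (- (\<Sum>i\<in>UNIV. (x i)\<^sup>2) / 2)"
    unfolding e by simp
  moreover have "Re (iexp t) = cos t" for t by (simp add: Re_exp)
  ultimately show ?thesis by (simp only:)
qed

text \<open>
  Completing the square turns the integrand into a multiple of the normal density of mean
  \<open>\<beta> / (1 + \<alpha>)\<close> and variance \<open>1 / (1 + \<alpha>)\<close>.
\<close>

lemma std_normal_nn_integral_exp_quadratic:
  assumes \<alpha>: "1 + \<alpha> > 0"
  shows "(\<integral>\<^sup>+y. ennreal (exp (- \<alpha> * y\<^sup>2 / 2 + \<beta> * y)) \<partial>std_normal)
    = ennreal ((1 + \<alpha>) powr (- 1 / 2) * exp (\<beta>\<^sup>2 / (2 * (1 + \<alpha>))))"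
proof -
  define \<sigma> where "\<sigma> = 1 / sqrt (1 + \<alpha>)"
  define \<mu> where "\<mu> = \<beta> / (1 + \<alpha>)"
  have \<sigma>: "\<sigma> > 0" "\<sigma>\<^sup>2 = 1 / (1 + \<alpha>)" using \<alpha> by (auto simp: \<sigma>_def power_divide)
  have eq: "std_normal_density y * exp (- \<alpha> * y\<^sup>2 / 2 + \<beta> * y)
      = (\<sigma> * exp (\<beta>\<^sup>2 / (2 * (1 + \<alpha>)))) * normal_density \<mu> \<sigma> y" for y
  proof -
    have "- y\<^sup>2 / 2 + (- \<alpha> * y\<^sup>2 / 2 + \<beta> * y) = \<beta>\<^sup>2 / (2 * (1 + \<alpha>)) + (- (y - \<mu>)\<^sup>2 / (2 * \<sigma>\<^sup>2))"
    proof -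
      define a where "a = 1 + \<alpha>"
      have a: "a > 0" using \<alpha> by (simp add: a_def)
      have t1: "a * (y - \<mu>)\<^sup>2 = a * y\<^sup>2 - 2 * \<beta> * y + \<beta>\<^sup>2 / a"
        using a unfolding \<mu>_def a_def[symmetric] by (simp add: power2_eq_square field_simps)
      have t2: "- (y - \<mu>)\<^sup>2 / (2 * \<sigma>\<^sup>2) = - (a * (y - \<mu>)\<^sup>2) / 2"
        unfolding \<sigma>(2) a_def[symmetric] using a by simp
      have t3: "\<beta>\<^sup>2 / (2 * (1 + \<alpha>)) = (\<beta>\<^sup>2 / a) / 2" by (simp add: a_def)
      have t4: "- \<alpha> * y\<^sup>2 / 2 = - a * y\<^sup>2 / 2 + y\<^sup>2 / 2" by (simp add: a_def field_simps)
      show ?thesis unfolding t2 t1 t3 t4 by (simp add: diff_divide_distrib add_divide_distrib)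
    qed
    then have e: "exp (- y\<^sup>2 / 2) * exp (- \<alpha> * y\<^sup>2 / 2 + \<beta> * y)
        = exp (\<beta>\<^sup>2 / (2 * (1 + \<alpha>))) * exp (- (y - \<mu>)\<^sup>2 / (2 * \<sigma>\<^sup>2))"
      unfolding exp_add[symmetric] by simp
    have s: "1 / sqrt (2 * pi) = \<sigma> * (1 / sqrt (2 * pi * \<sigma>\<^sup>2))"
      using \<sigma>(1) by (simp add: real_sqrt_mult)
    have "std_normal_density y * exp (- \<alpha> * y\<^sup>2 / 2 + \<beta> * y)
        = 1 / sqrt (2 * pi) * (exp (- y\<^sup>2 / 2) * exp (- \<alpha> * y\<^sup>2 / 2 + \<beta> * y))"
      by (simp add: std_normal_density_def)
    also have "\<dots> = \<sigma> * (1 / sqrt (2 * pi * \<sigma>\<^sup>2)) * (exp (\<beta>\<^sup>2 / (2 * (1 + \<alpha>))) * exp (- (y - \<mu>)\<^sup>2 / (2 * \<sigma>\<^sup>2)))"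
      unfolding e s ..
    finally show ?thesis by (simp only: normal_density_def mult_ac)
  qed
  interpret n: prob_space "density lborel (normal_density \<mu> \<sigma>)"
    by (rule prob_space_normal_density) (rule \<sigma>)
  have one: "(\<integral>\<^sup>+y. ennreal (normal_density \<mu> \<sigma> y) \<partial>lborel) = 1"
    using n.emeasure_space_1 by (simp add: emeasure_density)
  have "(\<integral>\<^sup>+y. ennreal (exp (- \<alpha> * y\<^sup>2 / 2 + \<beta> * y)) \<partial>std_normal)
     = (\<integral>\<^sup>+y. ennreal (std_normal_density y * exp (- \<alpha> * y\<^sup>2 / 2 + \<beta> * y)) \<partial>lborel)"
    by (subst nn_integral_density) (auto simp: ennreal_mult)
  also have "\<dots> = (\<integral>\<^sup>+y. ennreal (\<sigma> * exp (\<beta>\<^sup>2 / (2 * (1 + \<alpha>)))) * ennreal (normal_density \<mu> \<sigma> y) \<partial>lborel)"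
    unfolding eq using \<sigma>(1) by (intro nn_integral_cong ennreal_mult) auto
  also have "\<dots> = ennreal (\<sigma> * exp (\<beta>\<^sup>2 / (2 * (1 + \<alpha>))))"
    by (subst nn_integral_cmult) (auto simp: one)
  also have "\<sigma> = (1 + \<alpha>) powr (- 1 / 2)"
    using \<alpha> by (simp add: \<sigma>_def powr_half_sqrt powr_minus_divide)
  finally show ?thesis .
qed

lemma std_normal_nn_integral_exp_quadratic2:
  assumes \<alpha>: "\<alpha> \<ge> 0" and \<beta>: "\<beta> \<ge> 0" and \<gamma>: "\<gamma>\<^sup>2 < (1 + \<alpha>) * (1 + \<beta>)"
  shows "(\<integral>\<^sup>+x. (\<integral>\<^sup>+y. ennreal (exp (- (\<alpha> * x\<^sup>2 + \<beta> * y\<^sup>2) / 2 + \<gamma> * (x * y))) \<partial>std_normal) \<partial>std_normal)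
    = ennreal (((1 + \<alpha>) * (1 + \<beta>) - \<gamma>\<^sup>2) powr (- 1 / 2))"
proof -
  have inner: "(\<integral>\<^sup>+y. ennreal (exp (- (\<alpha> * x\<^sup>2 + \<beta> * y\<^sup>2) / 2 + \<gamma> * (x * y))) \<partial>std_normal)
     = ennreal ((1 + \<beta>) powr (- 1 / 2)) * ennreal (exp (- (\<alpha> - \<gamma>\<^sup>2 / (1 + \<beta>)) * x\<^sup>2 / 2 + 0 * x))" for x
  proof -
    have "exp (- (\<alpha> * x\<^sup>2 + \<beta> * y\<^sup>2) / 2 + \<gamma> * (x * y)) = exp (- \<alpha> * x\<^sup>2 / 2) * exp (- \<beta> * y\<^sup>2 / 2 + (\<gamma> * x) * y)" for y
      unfolding exp_add[symmetric] by (simp add: field_simps)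
    then have "(\<integral>\<^sup>+y. ennreal (exp (- (\<alpha> * x\<^sup>2 + \<beta> * y\<^sup>2) / 2 + \<gamma> * (x * y))) \<partial>std_normal)
       = (\<integral>\<^sup>+y. ennreal (exp (- \<alpha> * x\<^sup>2 / 2)) * ennreal (exp (- \<beta> * y\<^sup>2 / 2 + (\<gamma> * x) * y)) \<partial>std_normal)"
      by (simp only: ennreal_mult[OF exp_ge_zero exp_ge_zero])
    also have "\<dots> = ennreal (exp (- \<alpha> * x\<^sup>2 / 2)) * (\<integral>\<^sup>+y. ennreal (exp (- \<beta> * y\<^sup>2 / 2 + (\<gamma> * x) * y)) \<partial>std_normal)"
      by (rule nn_integral_cmult) simp
    also have "\<dots> = ennreal (exp (- \<alpha> * x\<^sup>2 / 2)) * ennreal ((1 + \<beta>) powr (- 1 / 2) * exp ((\<gamma> * x)\<^sup>2 / (2 * (1 + \<beta>))))"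
      using \<beta> by (subst std_normal_nn_integral_exp_quadratic) auto
    also have "\<dots> = ennreal ((1 + \<beta>) powr (- 1 / 2) * (exp (- \<alpha> * x\<^sup>2 / 2) * exp ((\<gamma> * x)\<^sup>2 / (2 * (1 + \<beta>)))))"
      by (simp add: ennreal_mult'[symmetric] mult_ac)
    also have "exp (- \<alpha> * x\<^sup>2 / 2) * exp ((\<gamma> * x)\<^sup>2 / (2 * (1 + \<beta>))) = exp (- (\<alpha> - \<gamma>\<^sup>2 / (1 + \<beta>)) * x\<^sup>2 / 2 + 0 * x)"
      unfolding exp_add[symmetric] using \<beta> by (simp add: field_simps power_mult_distrib)
    finally show ?thesis by (simp add: ennreal_mult')
  qed
  have pos: "1 + (\<alpha> - \<gamma>\<^sup>2 / (1 + \<beta>)) > 0" using \<beta> \<gamma> by (simp add: field_simps)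
  have "(\<integral>\<^sup>+x. (\<integral>\<^sup>+y. ennreal (exp (- (\<alpha> * x\<^sup>2 + \<beta> * y\<^sup>2) / 2 + \<gamma> * (x * y))) \<partial>std_normal) \<partial>std_normal)
    = ennreal ((1 + \<beta>) powr (- 1 / 2)) * ennreal ((1 + (\<alpha> - \<gamma>\<^sup>2 / (1 + \<beta>))) powr (- 1 / 2) * exp (0\<^sup>2 / (2 * (1 + (\<alpha> - \<gamma>\<^sup>2 / (1 + \<beta>))))))"
    unfolding inner std_normal_nn_integral_exp_quadratic[OF pos, symmetric]
    by (rule nn_integral_cmult) simp
  also have "\<dots> = ennreal ((1 + \<beta>) powr (- 1 / 2) * (1 + (\<alpha> - \<gamma>\<^sup>2 / (1 + \<beta>))) powr (- 1 / 2))"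
    by (simp add: ennreal_mult')
  also have "(1 + \<beta>) powr (- 1 / 2) * (1 + (\<alpha> - \<gamma>\<^sup>2 / (1 + \<beta>))) powr (- 1 / 2)
     = ((1 + \<beta>) * (1 + (\<alpha> - \<gamma>\<^sup>2 / (1 + \<beta>)))) powr (- 1 / 2)"
    by (rule powr_mult[symmetric])
  also have "(1 + \<beta>) * (1 + (\<alpha> - \<gamma>\<^sup>2 / (1 + \<beta>))) = (1 + \<alpha>) * (1 + \<beta>) - \<gamma>\<^sup>2"
    using \<beta> by (simp add: field_simps)
  finally show ?thesis .
qed

text \<open>
  The integrand factorises over the coordinates, so the vector case is the \<open>d\<close>-th power of the
  two-dimensional Gaussian integral.
\<close>

lemma std_normal_vec_nn_integral_exp_quadratic:
  fixes \<alpha> \<beta> \<gamma> :: real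
  assumes \<alpha>: "\<alpha> \<ge> 0" and \<beta>: "\<beta> \<ge> 0" and \<gamma>: "\<gamma>\<^sup>2 < (1 + \<alpha>) * (1 + \<beta>)"
  shows "(\<integral>\<^sup>+\<zeta>. (\<integral>\<^sup>+\<eta>. ennreal (exp (- (\<alpha> * (\<Sum>i\<in>UNIV. (\<zeta> i)\<^sup>2) + \<beta> * (\<Sum>i\<in>UNIV. (\<eta> i)\<^sup>2)) / 2
      + \<gamma> * (\<Sum>i\<in>UNIV. \<zeta> i * \<eta> i))) \<partial>std_normal_vec) \<partial>(std_normal_vec :: ('d::finite \<Rightarrow> real) measure))
    = ennreal (((1 + \<alpha>) * (1 + \<beta>) - \<gamma>\<^sup>2) powr (- real CARD('d) / 2))"
proof -
  define f where "f x y = ennreal (exp (- (\<alpha> * x\<^sup>2 + \<beta> * y\<^sup>2) / 2 + \<gamma> * (x * y)))" for x y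
  have "ennreal (exp (- (\<alpha> * (\<Sum>i\<in>UNIV. (\<zeta> i)\<^sup>2) + \<beta> * (\<Sum>i\<in>UNIV. (\<eta> i)\<^sup>2)) / 2
      + \<gamma> * (\<Sum>i\<in>UNIV. \<zeta> i * \<eta> i))) = (\<Prod>i\<in>UNIV. f (\<zeta> i) (\<eta> i))" for \<zeta> \<eta> :: "'d \<Rightarrow> real"
  proof -
    have "- (\<alpha> * (\<Sum>i\<in>UNIV. (\<zeta> i)\<^sup>2) + \<beta> * (\<Sum>i\<in>UNIV. (\<eta> i)\<^sup>2)) / 2 + \<gamma> * (\<Sum>i\<in>UNIV. \<zeta> i * \<eta> i)
      = (\<Sum>i\<in>UNIV. - (\<alpha> * (\<zeta> i)\<^sup>2 + \<beta> * (\<eta> i)\<^sup>2) / 2 + \<gamma> * (\<zeta> i * \<eta> i))"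
      by (simp only: sum.distrib sum_distrib_left sum_divide_distrib[symmetric] sum_negf)
    then show ?thesis unfolding f_def by (simp only: exp_sum[OF finite] prod_ennreal[OF exp_ge_zero])
  qed
  then have "(\<integral>\<^sup>+\<zeta>. (\<integral>\<^sup>+\<eta>. ennreal (exp (- (\<alpha> * (\<Sum>i\<in>UNIV. (\<zeta> i)\<^sup>2) + \<beta> * (\<Sum>i\<in>UNIV. (\<eta> i)\<^sup>2)) / 2
      + \<gamma> * (\<Sum>i\<in>UNIV. \<zeta> i * \<eta> i))) \<partial>std_normal_vec) \<partial>(std_normal_vec :: ('d::finite \<Rightarrow> real) measure))
    = (\<integral>\<^sup>+\<zeta>. (\<integral>\<^sup>+\<eta>. (\<Prod>i\<in>UNIV. f (\<zeta> i) (\<eta> i)) \<partial>std_normal_vec) \<partial>(std_normal_vec :: ('d::finite \<Rightarrow> real) measure))"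
    by simp
  also have "\<dots> = (\<integral>\<^sup>+\<zeta>. (\<Prod>i\<in>UNIV. (\<integral>\<^sup>+y. f (\<zeta> i) y \<partial>std_normal)) \<partial>(std_normal_vec :: ('d::finite \<Rightarrow> real) measure))"
    by (intro nn_integral_cong std_normal_vec_nn_integral_prod) (simp add: f_def)
  also have "\<dots> = (\<Prod>i\<in>(UNIV :: 'd set). (\<integral>\<^sup>+x. (\<integral>\<^sup>+y. f x y \<partial>std_normal) \<partial>std_normal))"
  proof (rule std_normal_vec_nn_integral_prod)
    interpret n: prob_space std_normal by (rule prob_space_std_normal)
    show "(\<lambda>x. \<integral>\<^sup>+y. f x y \<partial>std_normal) \<in> borel_measurable borel" unfolding f_def by measurable
  qed
  also have "\<dots> = ennreal (((1 + \<alpha>) * (1 + \<beta>) - \<gamma>\<^sup>2) powr (- 1 / 2)) ^ CARD('d)"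
    unfolding f_def std_normal_nn_integral_exp_quadratic2[OF assms] by simp
  also have "\<dots> = ennreal (((1 + \<alpha>) * (1 + \<beta>) - \<gamma>\<^sup>2) powr (- real CARD('d) / 2))"
    using \<gamma> by (simp add: ennreal_power powr_realpow[symmetric] powr_powr)
  finally show ?thesis .
qed

text \<open>
  The integral above depends on \<open>\<gamma>\<close> only through \<open>\<gamma>\<^sup>2\<close>, so the two exponentials in the hyperbolic
  cosine contribute equally.
\<close>

lemma std_normal_vec_nn_integral_exp_cosh:
  fixes \<alpha> \<beta> \<gamma> :: real
  assumes \<alpha>: "\<alpha> \<ge> 0" and \<beta>: "\<beta> \<ge> 0" and \<gamma>: "\<gamma>\<^sup>2 < (1 + \<alpha>) * (1 + \<beta>)"
  shows "(\<integral>\<^sup>+\<zeta>. (\<integral>\<^sup>+\<eta>. ennreal (exp (- (\<alpha> * (\<Sum>i\<in>UNIV. (\<zeta> i)\<^sup>2) + \<beta> * (\<Sum>i\<in>UNIV. (\<eta> i)\<^sup>2)) / 2)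
      * cosh (\<gamma> * (\<Sum>i\<in>UNIV. \<zeta> i * \<eta> i))) \<partial>std_normal_vec) \<partial>(std_normal_vec :: ('d::finite \<Rightarrow> real) measure))
    = ennreal (((1 + \<alpha>) * (1 + \<beta>) - \<gamma>\<^sup>2) powr (- real CARD('d) / 2))"
proof -
  interpret N: prob_space "std_normal_vec :: ('d \<Rightarrow> real) measure" by (rule prob_space_std_normal_vec)
  define e where "e c \<zeta> \<eta> = ennreal (exp (- (\<alpha> * (\<Sum>i\<in>UNIV. (\<zeta> i)\<^sup>2) + \<beta> * (\<Sum>i\<in>UNIV. (\<eta> i)\<^sup>2)) / 2
      + c * (\<Sum>i\<in>UNIV. \<zeta> i * \<eta> i)))" for c and \<zeta> \<eta> :: "'d \<Rightarrow> real"
  define v where "v = ennreal (((1 + \<alpha>) * (1 + \<beta>) - \<gamma>\<^sup>2) powr (- real CARD('d) / 2))"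
  have m [measurable]: "(\<lambda>(\<zeta>, \<eta>). e c \<zeta> \<eta>) \<in> borel_measurable (std_normal_vec \<Otimes>\<^sub>M std_normal_vec)" for c
    unfolding e_def by measurable
  have m' [measurable]: "e c \<zeta> \<in> borel_measurable std_normal_vec" for c \<zeta>
    unfolding e_def[abs_def] by measurable
  have "ennreal (exp (- (\<alpha> * (\<Sum>i\<in>UNIV. (\<zeta> i)\<^sup>2) + \<beta> * (\<Sum>i\<in>UNIV. (\<eta> i)\<^sup>2)) / 2)
      * cosh (\<gamma> * (\<Sum>i\<in>UNIV. \<zeta> i * \<eta> i))) = ennreal (1/2) * (e \<gamma> \<zeta> \<eta> + e (- \<gamma>) \<zeta> \<eta>)" for \<zeta> \<eta> :: "'d \<Rightarrow> real"
  proof -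
    have "exp s * cosh (\<gamma> * x) = (1/2) * (exp (s + \<gamma> * x) + exp (s + (- \<gamma>) * x))" for s x :: real
      unfolding exp_add by (simp add: cosh_def exp_minus algebra_simps)
    then show ?thesis
      unfolding e_def by (simp only: ennreal_plus[symmetric] exp_ge_zero) (rule ennreal_mult, auto)
  qed
  then have "(\<integral>\<^sup>+\<zeta>. (\<integral>\<^sup>+\<eta>. ennreal (exp (- (\<alpha> * (\<Sum>i\<in>UNIV. (\<zeta> i)\<^sup>2) + \<beta> * (\<Sum>i\<in>UNIV. (\<eta> i)\<^sup>2)) / 2)
      * cosh (\<gamma> * (\<Sum>i\<in>UNIV. \<zeta> i * \<eta> i))) \<partial>std_normal_vec) \<partial>(std_normal_vec :: ('d::finite \<Rightarrow> real) measure))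
    = (\<integral>\<^sup>+\<zeta>. (\<integral>\<^sup>+\<eta>. ennreal (1/2) * (e \<gamma> \<zeta> \<eta> + e (- \<gamma>) \<zeta> \<eta>) \<partial>std_normal_vec) \<partial>std_normal_vec)"
    by simp
  also have "\<dots> = ennreal (1/2) * ((\<integral>\<^sup>+\<zeta>. (\<integral>\<^sup>+\<eta>. e \<gamma> \<zeta> \<eta> \<partial>std_normal_vec) \<partial>std_normal_vec)
     + (\<integral>\<^sup>+\<zeta>. (\<integral>\<^sup>+\<eta>. e (- \<gamma>) \<zeta> \<eta> \<partial>std_normal_vec) \<partial>std_normal_vec))"
    by (subst nn_integral_cmult, measurable)+ (subst nn_integral_add, measurable)+
  also have "\<dots> = ennreal (1/2) * (v + v)"
    using std_normal_vec_nn_integral_exp_quadratic[where 'd = 'd, OF \<alpha> \<beta>, of \<gamma>]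
      std_normal_vec_nn_integral_exp_quadratic[where 'd = 'd, OF \<alpha> \<beta>, of "- \<gamma>"] \<gamma>
    unfolding e_def v_def by simp
  also have "\<dots> = v"
  proof -
    have "ennreal (1/2) * (ennreal r + ennreal r) = ennreal r" if "r \<ge> 0" for r
    proof -
      have "ennreal (1/2) * (ennreal r + ennreal r) = ennreal (1/2) * ennreal (r + r)"
        using that by (simp only: ennreal_plus)
      also have "\<dots> = ennreal (1/2 * (r + r))" using that by (subst ennreal_mult) auto
      finally show ?thesis by simp
    qed
    then show ?thesis by (simp add: v_def del: ennreal_plus)
  qed
  finally show ?thesis by (simp add: v_def)
qed

section \<open>Gaussian vector fields with continuous paths\<close>

lemma borel_measurable_vec_nth [measurable]: "(\<lambda>x :: real ^ 'n. x $ i) \<in> borel_measurable borel"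
  by (intro borel_measurable_continuous_onI continuous_intros)

text \<open>
  Evaluating the paths at simple functions that converge to the identity gives measurable
  approximations.  The retraction onto the closed convex set \<open>K\<close> keeps the evaluation points where the
  paths are known to be continuous.
\<close>

lemma continuous_paths_jointly_measurable:
  fixes X :: "'e::euclidean_space \<Rightarrow> 'w \<Rightarrow> 'b::{metric_space, second_countable_topology}"
  assumes K: "closed K" "convex K" "K \<noteq> {}"
    and X: "\<And>z. z \<in> K \<Longrightarrow> X z \<in> borel_measurable M"
    and cont: "\<And>\<omega>. \<omega> \<in> space M \<Longrightarrow> continuous_on K (\<lambda>z. X z \<omega>)"
  shows "(\<lambda>(z, \<omega>). X z \<omega>) \<in> borel_measurable (restrict_space lborel K \<Otimes>\<^sub>M M)"
proof -
  define r where "r = closest_point K"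
  have rK: "r z \<in> K" for z unfolding r_def using K by (intro closest_point_in_set) auto
  have r_id: "r z = z" if "z \<in> K" for z using that by (simp add: r_def closest_point_self)
  have rc: "continuous_on UNIV r"
    unfolding r_def using K by (intro continuous_on_closest_point) auto
  obtain F :: "nat \<Rightarrow> 'e \<Rightarrow> 'e" where F: "\<And>n. simple_function borel (F n)" "\<And>z. (\<lambda>n. F n z) \<longlonglongrightarrow> z"
    using borel_measurable_implies_sequence_metric[of "\<lambda>z::'e. z" borel 0] by auto
  have approx: "(\<lambda>p. X (r (F n (fst p))) (snd p)) \<in> borel_measurable (borel \<Otimes>\<^sub>M M)" for n
  proof (rule measurable_compose_countable'[where I = "range (F n)" and f = "\<lambda>i p. X (r i) (snd p)" and g = "\<lambda>p. F n (fst p)"])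
    show "(\<lambda>p. X (r i) (snd p)) \<in> borel_measurable (borel \<Otimes>\<^sub>M M)" for i
      using X[OF rK[of i]] by measurable
    have "F n \<in> measurable borel (count_space (range (F n)))"
      using measurable_simple_function[OF F(1)[of n]] by (auto simp: measurable_def)
    then show "(\<lambda>p. F n (fst p)) \<in> measurable (borel \<Otimes>\<^sub>M M) (count_space (range (F n)))"
      by (rule measurable_compose[OF measurable_fst])
    show "countable (range (F n))"
      using simple_functionD(1)[OF F(1)[of n]] by (simp add: countable_finite)
  qed
  have "(\<lambda>p. X (r (fst p)) (snd p)) \<in> borel_measurable (borel \<Otimes>\<^sub>M M)"
  proof (rule borel_measurable_LIMSEQ_metric[OF approx])
    fix p :: "'e \<times> 'w" assume "p \<in> space (borel \<Otimes>\<^sub>M M)"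
    then have "snd p \<in> space M" by (auto simp: space_pair_measure)
    have "isCont r (fst p)" using rc by (simp add: continuous_on_eq_continuous_at)
    then have "(\<lambda>n. r (F n (fst p))) \<longlonglongrightarrow> r (fst p)" by (rule isCont_tendsto_compose[OF _ F(2)])
    then show "(\<lambda>n. X (r (F n (fst p))) (snd p)) \<longlonglongrightarrow> X (r (fst p)) (snd p)"
      by (rule continuous_on_tendsto_compose[OF cont[OF \<open>snd p \<in> space M\<close>]]) (auto simp: rK)
  qed
  moreover have "(\<lambda>p. p) \<in> measurable (restrict_space lborel K \<Otimes>\<^sub>M M) (borel \<Otimes>\<^sub>M M)"
  proof -
    have "(\<lambda>z. z) \<in> measurable (restrict_space lborel K) borel"
      by (rule measurable_restrict_space1) simp
    then show ?thesis by (subst measurable_pair_iff) (auto simp: comp_def intro: measurable_compose[OF measurable_fst])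
  qed
  ultimately have "(\<lambda>p. X (r (fst p)) (snd p)) \<in> borel_measurable (restrict_space lborel K \<Otimes>\<^sub>M M)"
    by (rule measurable_compose[rotated])
  then show ?thesis
    by (rule measurable_cong[THEN iffD1, rotated])
      (auto simp: space_pair_measure space_restrict_space r_id)
qed

text \<open>
  A bounded nonnegative integrand on a finite measure space allows the real iterated integral to be
  computed as a nonnegative one, in any order.  The auxiliary variables \<open>\<zeta>\<close>, \<open>\<eta>\<close> are integrated first,
  because that integral is explicit.
\<close>

lemma ennreal_iterated_integral_pair:
  fixes S :: "('a \<times> 'b) \<Rightarrow> ('a \<times> 'b) \<Rightarrow> real"
  assumes Q: "finite_measure Q" and N: "finite_measure N"
    and m: "(\<lambda>(a, b). S a b) \<in> borel_measurable ((Q \<Otimes>\<^sub>M N) \<Otimes>\<^sub>M (Q \<Otimes>\<^sub>M N))"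
    and S0: "\<And>a b. 0 \<le> S a b"
    and S1: "\<And>a b. a \<in> space (Q \<Otimes>\<^sub>M N) \<Longrightarrow> b \<in> space (Q \<Otimes>\<^sub>M N) \<Longrightarrow> S a b \<le> 1"
  shows "ennreal (\<integral>a. (\<integral>b. S a b \<partial>(Q \<Otimes>\<^sub>M N)) \<partial>(Q \<Otimes>\<^sub>M N))
    = (\<integral>\<^sup>+z. (\<integral>\<^sup>+z'. (\<integral>\<^sup>+\<zeta>. (\<integral>\<^sup>+\<eta>. ennreal (S (z, \<zeta>) (z', \<eta>)) \<partial>N) \<partial>N) \<partial>Q) \<partial>Q)"
proof -
  interpret Q: finite_measure Q by (rule Q)
  interpret N: finite_measure N by (rule N)
  interpret P: pair_sigma_finite Q N ..
  define A where "A = Q \<Otimes>\<^sub>M N"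
  interpret A: finite_measure A
    unfolding A_def by (rule finite_measure_pair_measure[OF N Q])
  have m1 [measurable]: "(\<lambda>(a, b). S a b) \<in> borel_measurable (A \<Otimes>\<^sub>M A)" using m by (simp add: A_def)
  have m2 [measurable]: "S a \<in> borel_measurable A" if "a \<in> space A" for a
    using measurable_compose[OF measurable_Pair1'[OF that, of A] m1] by simp
  have i1: "integrable A (S a)" if "a \<in> space A" for a
  proof (rule A.integrable_const_bound[of _ 1])
    show "AE b in A. norm (S a b) \<le> 1"
      using that S1 unfolding A_def by (intro AE_I2) (simp add: abs_of_nonneg S0)
  qed (rule m2[OF that])
  have b: "0 \<le> (\<integral>b. S a b \<partial>A)" "(\<integral>b. S a b \<partial>A) \<le> measure A (space A)" if "a \<in> space A" for a
  proof -
    show "0 \<le> (\<integral>b. S a b \<partial>A)" by (simp add: S0)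
    have "(\<integral>b. S a b \<partial>A) \<le> (\<integral>b. 1 \<partial>A)"
      by (rule integral_mono[OF i1[OF that]]) (simp, rule S1[folded A_def, OF that])
    then show "(\<integral>b. S a b \<partial>A) \<le> measure A (space A)" by simp
  qed
  have "integrable A (\<lambda>a. \<integral>b. S a b \<partial>A)"
    using b by (intro A.integrable_const_bound[of _ "measure A (space A)"]) auto
  then have "ennreal (\<integral>a. (\<integral>b. S a b \<partial>A) \<partial>A) = (\<integral>\<^sup>+a. ennreal (\<integral>b. S a b \<partial>A) \<partial>A)"
    by (rule nn_integral_eq_integral[symmetric]) (simp add: S0)
  also have "\<dots> = (\<integral>\<^sup>+a. (\<integral>\<^sup>+b. ennreal (S a b) \<partial>A) \<partial>A)"
    by (intro nn_integral_cong nn_integral_eq_integral[symmetric] i1) (auto simp: S0)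
  also have "\<dots> = (\<integral>\<^sup>+z. (\<integral>\<^sup>+\<zeta>. (\<integral>\<^sup>+b. ennreal (S (z, \<zeta>) b) \<partial>A) \<partial>N) \<partial>Q)"
    unfolding A_def by (rule N.nn_integral_fst[symmetric]) (simp add: A_def[symmetric])
  also have "\<dots> = (\<integral>\<^sup>+z. (\<integral>\<^sup>+\<zeta>. (\<integral>\<^sup>+z'. (\<integral>\<^sup>+\<eta>. ennreal (S (z, \<zeta>) (z', \<eta>)) \<partial>N) \<partial>Q) \<partial>N) \<partial>Q)"
  proof (intro nn_integral_cong)
    fix z \<zeta> assume "z \<in> space Q" "\<zeta> \<in> space N"
    then have "(z, \<zeta>) \<in> space A" by (simp add: A_def space_pair_measure)
    from m2[OF this] show "(\<integral>\<^sup>+b. ennreal (S (z, \<zeta>) b) \<partial>A) = (\<integral>\<^sup>+z'. (\<integral>\<^sup>+\<eta>. ennreal (S (z, \<zeta>) (z', \<eta>)) \<partial>N) \<partial>Q)"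
      unfolding A_def by (intro N.nn_integral_fst[symmetric]) simp
  qed
  also have "\<dots> = (\<integral>\<^sup>+z. (\<integral>\<^sup>+z'. (\<integral>\<^sup>+\<zeta>. (\<integral>\<^sup>+\<eta>. ennreal (S (z, \<zeta>) (z', \<eta>)) \<partial>N) \<partial>N) \<partial>Q) \<partial>Q)"
  proof (intro nn_integral_cong)
    fix z assume z: "z \<in> space Q"
    have "(\<lambda>q. (((z, snd (fst q)), (fst (fst q), snd q)))) \<in> measurable ((Q \<Otimes>\<^sub>M N) \<Otimes>\<^sub>M N) (A \<Otimes>\<^sub>M A)"
      unfolding A_def using z by measurable
    from measurable_compose[OF this m1]
    have [measurable]: "(\<lambda>q. S (z, snd (fst q)) (fst (fst q), snd q)) \<in> borel_measurable ((Q \<Otimes>\<^sub>M N) \<Otimes>\<^sub>M N)"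
      by (simp add: split_beta')
    have "(\<lambda>p. \<integral>\<^sup>+\<eta>. ennreal (S (z, snd p) (fst p, \<eta>)) \<partial>N) \<in> borel_measurable (Q \<Otimes>\<^sub>M N)"
      by (rule N.borel_measurable_nn_integral) (simp add: split_beta')
    from P.Fubini[OF this]
    show "(\<integral>\<^sup>+\<zeta>. (\<integral>\<^sup>+z'. (\<integral>\<^sup>+\<eta>. ennreal (S (z, \<zeta>) (z', \<eta>)) \<partial>N) \<partial>Q) \<partial>N)
        = (\<integral>\<^sup>+z'. (\<integral>\<^sup>+\<zeta>. (\<integral>\<^sup>+\<eta>. ennreal (S (z, \<zeta>) (z', \<eta>)) \<partial>N) \<partial>N) \<partial>Q)"
      by simp
  qed
  finally show ?thesis by (simp add: A_def)
qed

text \<open>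
  The joint moment generating function says that the coordinates are independent centered Gaussian
  fields with covariance \<open>R\<close>.
\<close>

locale gaussian_vector_field = prob_space M for M :: "'w measure" +
  fixes U :: "'e::euclidean_space \<Rightarrow> 'w \<Rightarrow> real ^ 'd" and R :: "'e \<Rightarrow> 'e \<Rightarrow> real" and I :: "'e set"
  assumes U_borel: "U z \<in> borel_measurable M"
    and U_mgf: "finite T \<Longrightarrow> integrable M (\<lambda>\<omega>. exp (\<Sum>z\<in>T. \<Sum>i\<in>UNIV. c z i * U z \<omega> $ i))"
      "finite T \<Longrightarrow> (\<integral>\<omega>. exp (\<Sum>z\<in>T. \<Sum>i\<in>UNIV. c z i * U z \<omega> $ i) \<partial>M)
        = exp ((\<Sum>i\<in>UNIV. \<Sum>z\<in>T. \<Sum>z'\<in>T. c z i * c z' i * R z z') / 2)"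
    and R_sym: "R z z' = R z' z"
    and R_cont: "continuous_on UNIV (\<lambda>(z, z'). R z z')"
    and U_cont: "\<omega> \<in> space M \<Longrightarrow> continuous_on I (\<lambda>z. U z \<omega>)"
    and I: "compact I" "convex I" "I \<noteq> {}"
begin

lemma lin_span_coordinate_valuesE:
  assumes "f \<in> lin_span (coordinate_values U)"
  obtains T c where "finite T" "f = (\<lambda>\<omega>. \<Sum>z\<in>T. \<Sum>i\<in>UNIV. c z i * U z \<omega> $ i)"
proof -
  obtain S b where S: "f = (\<lambda>\<omega>. \<Sum>g\<in>S. b g * g \<omega>)" "finite S" "S \<subseteq> coordinate_values U"
    using assms unfolding lin_span_def by blast
  have "\<forall>g\<in>S. \<exists>z i. g = (\<lambda>\<omega>. U z \<omega> $ i)" using S(3) unfolding coordinate_values_def by blast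
  then obtain z i where zi: "\<And>g. g \<in> S \<Longrightarrow> g = (\<lambda>\<omega>. U (z g) \<omega> $ i g)" by metis
  define c where "c x k = (\<Sum>g\<in>S. if z g = x \<and> i g = k then b g else 0)" for x k
  have "f \<omega> = (\<Sum>x\<in>z ` S. \<Sum>k\<in>UNIV. c x k * U x \<omega> $ k)" for \<omega>
  proof -
    have "(\<Sum>x\<in>z ` S. \<Sum>k\<in>UNIV. c x k * U x \<omega> $ k)
      = (\<Sum>x\<in>z ` S. \<Sum>k\<in>UNIV. \<Sum>g\<in>S. if z g = x \<and> i g = k then b g * U x \<omega> $ k else 0)"
      unfolding c_def sum_distrib_right by (intro sum.cong refl) auto
    also have "\<dots> = (\<Sum>x\<in>z ` S. \<Sum>g\<in>S. \<Sum>k\<in>UNIV. if z g = x \<and> i g = k then b g * U x \<omega> $ k else 0)"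
      by (intro sum.cong refl sum.swap)
    also have "\<dots> = (\<Sum>g\<in>S. \<Sum>x\<in>z ` S. \<Sum>k\<in>UNIV. if z g = x \<and> i g = k then b g * U x \<omega> $ k else 0)"
      by (rule sum.swap)
    also have "\<dots> = (\<Sum>g\<in>S. b g * U (z g) \<omega> $ i g)"
    proof (rule sum.cong[OF refl])
      fix g assume g: "g \<in> S"
      have "(\<Sum>x\<in>z ` S. \<Sum>k\<in>UNIV. if z g = x \<and> i g = k then b g * U x \<omega> $ k else 0)
         = (\<Sum>x\<in>z ` S. if z g = x then \<Sum>k\<in>UNIV. if i g = k then b g * U x \<omega> $ k else 0 else 0)"
        by (intro sum.cong refl) auto
      also have "\<dots> = b g * U (z g) \<omega> $ i g"
        using g S(2) by (simp add: sum.delta')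
      finally show "(\<Sum>x\<in>z ` S. \<Sum>k\<in>UNIV. if z g = x \<and> i g = k then b g * U x \<omega> $ k else 0) = b g * U (z g) \<omega> $ i g" .
    qed
    also have "\<dots> = f \<omega>"
      unfolding S(1) by (intro sum.cong refl) (metis zi)
    finally show ?thesis by simp
  qed
  with S(2) show ?thesis by (intro that[of "z ` S" c]) auto
qed

lemma U_mgf_scaled:
  assumes "finite T"
  shows "integrable M (\<lambda>\<omega>. exp (t * (\<Sum>z\<in>T. \<Sum>i\<in>UNIV. c z i * U z \<omega> $ i)))"
    and "(\<integral>\<omega>. exp (t * (\<Sum>z\<in>T. \<Sum>i\<in>UNIV. c z i * U z \<omega> $ i)) \<partial>M)
       = exp (t\<^sup>2 * (\<Sum>i\<in>UNIV. \<Sum>z\<in>T. \<Sum>z'\<in>T. c z i * c z' i * R z z') / 2)"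
proof -
  have eq: "t * (\<Sum>z\<in>T. \<Sum>i\<in>UNIV. c z i * U z \<omega> $ i) = (\<Sum>z\<in>T. \<Sum>i\<in>UNIV. (t * c z i) * U z \<omega> $ i)" for \<omega>
    by (simp add: sum_distrib_left mult.assoc)
  have eq2: "(\<Sum>i\<in>UNIV. \<Sum>z\<in>T. \<Sum>z'\<in>T. (t * c z i) * (t * c z' i) * R z z')
    = t\<^sup>2 * (\<Sum>i\<in>UNIV. \<Sum>z\<in>T. \<Sum>z'\<in>T. c z i * c z' i * R z z')"
    by (simp add: sum_distrib_left power2_eq_square mult_ac)
  show "integrable M (\<lambda>\<omega>. exp (t * (\<Sum>z\<in>T. \<Sum>i\<in>UNIV. c z i * U z \<omega> $ i)))"
    and "(\<integral>\<omega>. exp (t * (\<Sum>z\<in>T. \<Sum>i\<in>UNIV. c z i * U z \<omega> $ i)) \<partial>M)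
       = exp (t\<^sup>2 * (\<Sum>i\<in>UNIV. \<Sum>z\<in>T. \<Sum>z'\<in>T. c z i * c z' i * R z z') / 2)"
    using U_mgf[OF assms, of "\<lambda>z i. t * c z i"] unfolding eq eq2 by auto
qed

lemma gaussian_space_coordinate_values: "gaussian_space M (coordinate_values U)"
proof
  show "g \<in> borel_measurable M" if "g \<in> coordinate_values U" for g
    using that measurable_compose[OF U_borel borel_measurable_vec_nth] unfolding coordinate_values_def by auto
  fix f assume "f \<in> lin_span (coordinate_values U)"
  then obtain T c where T: "finite T" and f: "f = (\<lambda>\<omega>. \<Sum>z\<in>T. \<Sum>i\<in>UNIV. c z i * U z \<omega> $ i)"
    by (rule lin_span_coordinate_valuesE)
  show "\<exists>q. \<forall>t. integrable M (\<lambda>\<omega>. exp (t * f \<omega>)) \<and> (\<integral>\<omega>. exp (t * f \<omega>) \<partial>M) = exp (t\<^sup>2 * q / 2)"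
    unfolding f using U_mgf_scaled[OF T] by blast
qed

end

sublocale gaussian_vector_field \<subseteq> gaussian_space M "coordinate_values U"
  by (rule gaussian_space_coordinate_values)

context gaussian_vector_field
begin

text \<open>
  The variable \<open>s (\<zeta> \<bullet> U z)\<close> for \<open>a = (z, \<zeta>)\<close>; with \<open>s = 1 / sqrt \<epsilon>\<close> the mean over \<open>\<zeta>\<close> of its cosine is
  proportional to the heat kernel at \<open>U z\<close>.
\<close>

definition scaled_dot :: "real \<Rightarrow> 'e \<times> ('d \<Rightarrow> real) \<Rightarrow> 'w \<Rightarrow> real" where
  "scaled_dot s a \<omega> = (\<Sum>i\<in>UNIV. (s * snd a i) * U (fst a) \<omega> $ i)"

lemma scaled_dot_lin_span: "scaled_dot s a \<in> lin_span (coordinate_values U)"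
  unfolding scaled_dot_def[abs_def]
  by (intro lin_span_sum lin_span_superset) (auto simp: coordinate_values_def)

lemma cov_self:
  assumes T: "finite T" and f: "f = (\<lambda>\<omega>. \<Sum>z\<in>T. \<Sum>i\<in>UNIV. c z i * U z \<omega> $ i)"
  shows "cov f f = (\<Sum>i\<in>UNIV. \<Sum>z\<in>T. \<Sum>z'\<in>T. c z i * c z' i * R z z')"
proof -
  have "f \<in> lin_span (coordinate_values U)"
    unfolding f
  proof (rule lin_span_sum[where c = "\<lambda>_. 1", simplified, OF T])
    show "(\<lambda>\<omega>. \<Sum>i\<in>UNIV. c z i * U z \<omega> $ i) \<in> lin_span (coordinate_values U)" for z
      by (intro lin_span_sum lin_span_superset) (auto simp: coordinate_values_def)
  qed
  from gauss_pair_diag[OF this] have "(\<integral>\<omega>. exp (1 * f \<omega> + 0 * f \<omega>) \<partial>M)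
     = exp ((1\<^sup>2 * cov f f + 2 * 1 * 0 * cov f f + 0\<^sup>2 * cov f f) / 2)"
    unfolding gauss_pair_def by blast
  with U_mgf(2)[OF T, of c] show ?thesis unfolding f[symmetric] by (simp add: f)
qed

lemma cov_scaled_dot:
  "cov (scaled_dot s a) (scaled_dot s' b) = s * s' * R (fst a) (fst b) * (\<Sum>i\<in>UNIV. snd a i * snd b i)"
proof -
  note sp = scaled_dot_lin_span
  have self: "cov (scaled_dot s a) (scaled_dot s a) = s * s * R (fst a) (fst a) * (\<Sum>i\<in>UNIV. (snd a i)\<^sup>2)" for s a
    by (subst cov_self[of "{fst a}" _ "\<lambda>z i. s * snd a i"])
      (auto simp: scaled_dot_def fun_eq_iff sum_distrib_left power2_eq_square mult_ac)
  define f where "f \<omega> = 1 * scaled_dot s a \<omega> + 1 * scaled_dot s' b \<omega>" for \<omega>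
  have "cov f f = s * s * R (fst a) (fst a) * (\<Sum>i\<in>UNIV. (snd a i)\<^sup>2)
     + 2 * (s * s' * R (fst a) (fst b) * (\<Sum>i\<in>UNIV. snd a i * snd b i))
     + s' * s' * R (fst b) (fst b) * (\<Sum>i\<in>UNIV. (snd b i)\<^sup>2)"
  proof (cases "fst a = fst b")
    case True
    have "f = (\<lambda>\<omega>. \<Sum>z\<in>{fst b}. \<Sum>i\<in>UNIV. (s * snd a i + s' * snd b i) * U z \<omega> $ i)"
      by (simp add: f_def scaled_dot_def True fun_eq_iff distrib_right sum.distrib)
    from cov_self[OF _ this] show ?thesis
      by (simp add: True power2_eq_square sum_distrib_left sum.distrib[symmetric] algebra_simps)
  next
    case False
    have "f = (\<lambda>\<omega>. \<Sum>z\<in>{fst a, fst b}. \<Sum>i\<in>UNIV. (if z = fst a then s * snd a i else s' * snd b i) * U z \<omega> $ i)"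
      using False by (auto simp add: f_def scaled_dot_def fun_eq_iff)
    from cov_self[OF _ this] show ?thesis
      using False R_sym[of "fst b" "fst a"]
      by (simp add: power2_eq_square sum_distrib_left sum.distrib[symmetric] algebra_simps)
  qed
  moreover have "cov f f = cov (scaled_dot s a) (scaled_dot s a) + 2 * cov (scaled_dot s a) (scaled_dot s' b)
     + cov (scaled_dot s' b) (scaled_dot s' b)"
    using cov_lincomb[OF sp sp, of 1 s a 1 s' b] by (simp add: f_def[abs_def])
  ultimately show ?thesis by (simp add: self)
qed

text \<open>
  \<open>R z z\<close> is the variance of any single coordinate of \<open>U z\<close>.
\<close>

lemma R_nonneg: "0 \<le> R z z"
proof -
  obtain i0 :: 'd where True by blast
  have "cov (scaled_dot 1 (z, \<lambda>i. if i = i0 then 1 else 0)) (scaled_dot 1 (z, \<lambda>i. if i = i0 then 1 else 0)) = R z z"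
    by (simp add: cov_scaled_dot if_distrib cong: if_cong)
  moreover have "cov f f \<ge> 0" for f by (simp add: cov_def)
  ultimately show ?thesis by metis
qed

lemma R_Cauchy_Schwarz: "(R z z')\<^sup>2 \<le> R z z * R z' z'"
proof -
  obtain i0 :: 'd where True by blast
  define f where "f z = scaled_dot 1 (z, \<lambda>i. if i = i0 then 1 else 0)" for z
  have c: "cov (f z) (f z') = R z z'" for z z'
    by (simp add: f_def cov_scaled_dot if_distrib cong: if_cong)
  have L: "f z \<in> L2 M" for z
    unfolding f_def by (intro all_moments_L2 lin_span_all_moments scaled_dot_lin_span)
  have "\<bar>R z z'\<bar> \<le> sqrt (R z z) * sqrt (R z' z')"
    using L2_Cauchy_Schwarz[OF L L, of z z'] c
    unfolding l2norm_def cov_def power2_eq_square by metis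
  then have "\<bar>R z z'\<bar>\<^sup>2 \<le> (sqrt (R z z) * sqrt (R z' z'))\<^sup>2" by (rule power_mono) simp
  then show ?thesis by (simp add: power_mult_distrib R_nonneg)
qed

definition Q :: "'e measure" where "Q = restrict_space lborel I"

lemma I_sets: "I \<in> sets lborel"
  using I(1) by (simp add: borel_compact)

lemma finite_measure_Q: "finite_measure Q"
proof
  have "emeasure Q (space Q) = emeasure lborel I"
    unfolding Q_def using I_sets by (subst emeasure_restrict_space) (auto simp: space_restrict_space)
  also have "\<dots> < \<infinity>" by (rule emeasure_bounded_finite[OF compact_imp_bounded[OF I(1)]])
  finally show "emeasure Q (space Q) \<noteq> \<infinity>" by simp
qed

lemma measurable_Q_borel [measurable]: "(\<lambda>z. z) \<in> measurable Q borel"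
  unfolding Q_def by (rule measurable_restrict_space1) simp

lemma R_measurable [measurable (raw)]:
  assumes "f \<in> measurable N borel" "g \<in> measurable N borel"
  shows "(\<lambda>x. R (f x) (g x)) \<in> borel_measurable N"
proof -
  have "(\<lambda>(z, z'). R z z') \<in> borel_measurable borel"
    using R_cont by (rule borel_measurable_continuous_onI)
  then have "(\<lambda>(z, z'). R z z') \<in> borel_measurable (borel \<Otimes>\<^sub>M borel)" by (simp add: borel_prod)
  from measurable_compose[OF measurable_Pair[OF assms] this] show ?thesis by simp
qed

lemma U_jointly_measurable: "(\<lambda>(z, \<omega>). U z \<omega>) \<in> borel_measurable (Q \<Otimes>\<^sub>M M)"
  unfolding Q_def using I U_cont U_borel
  by (intro continuous_paths_jointly_measurable) (auto intro: compact_imp_closed)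

lemma scaled_dot_jointly_measurable:
  "(\<lambda>(a, \<omega>). scaled_dot s a \<omega>) \<in> borel_measurable ((Q \<Otimes>\<^sub>M std_normal_vec) \<Otimes>\<^sub>M M)"
proof -
  note [measurable] = U_jointly_measurable
  have [measurable]: "(\<lambda>p. U (fst (fst p)) (snd p)) \<in> borel_measurable ((Q \<Otimes>\<^sub>M std_normal_vec) \<Otimes>\<^sub>M M)"
    using measurable_compose[of "\<lambda>p. (fst (fst p), snd p)" "(Q \<Otimes>\<^sub>M std_normal_vec) \<Otimes>\<^sub>M M" "Q \<Otimes>\<^sub>M M" "\<lambda>(z, \<omega>). U z \<omega>" borel]
    by (simp add: split_beta' U_jointly_measurable)
  show ?thesis unfolding scaled_dot_def split_beta' by measurable
qed

end

section \<open>Second moments and chaos components of the regularised local time\<close>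

lemma L2_cong: "(\<And>\<omega>. \<omega> \<in> space M \<Longrightarrow> F \<omega> = G \<omega>) \<Longrightarrow> F \<in> L2 M \<longleftrightarrow> G \<in> L2 M"
  unfolding L2_def by (auto cong: measurable_cong Bochner_Integration.integrable_cong)

context gaussian_vector_field
begin

text \<open>
  The inner product of two heat kernels of widths \<open>\<epsilon>\<close> and \<open>\<delta>\<close> at the points \<open>U z\<close> and \<open>U z'\<close>, with the
  covariance between the two points multiplied by \<open>\<rho>\<close>.
\<close>

definition kernel :: "real \<Rightarrow> real \<Rightarrow> real \<Rightarrow> 'e \<Rightarrow> 'e \<Rightarrow> real" where
  "kernel \<epsilon> \<delta> \<rho> z z' = (2 * pi) powr (- real CARD('d)) *
     ((R z z + \<epsilon>) * (R z' z' + \<delta>) - \<rho>\<^sup>2 * (R z z')\<^sup>2) powr (- real CARD('d) / 2)"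

abbreviation randomisation :: "('e \<times> ('d \<Rightarrow> real)) measure" where
  "randomisation \<equiv> Q \<Otimes>\<^sub>M std_normal_vec"

lemma finite_measure_randomisation: "finite_measure randomisation"
  by (intro finite_measure_pair_measure finite_measure_Q prob_space.finite_measure prob_space_std_normal_vec)

text \<open>
  The heat kernel is an average of cosines by the characteristic function of the standard normal law,
  and Fubini's theorem combines this average with the integral over the parameter set.
\<close>

lemma approx_local_time_eq:
  assumes \<omega>: "\<omega> \<in> space M" and \<epsilon>: "\<epsilon> > 0"
  shows "approx_local_time U I \<epsilon> \<omega> =
    (2 * pi * \<epsilon>) powr (- real CARD('d) / 2) * cos_average randomisation (scaled_dot (1 / sqrt \<epsilon>)) \<omega>"
proof -
  define C where "C = (2 * pi * \<epsilon>) powr (- real CARD('d) / 2)"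
  interpret N: prob_space "std_normal_vec :: ('d \<Rightarrow> real) measure" by (rule prob_space_std_normal_vec)
  interpret Q: finite_measure Q by (rule finite_measure_Q)
  interpret P: pair_sigma_finite Q "std_normal_vec :: ('d \<Rightarrow> real) measure" ..
  interpret A: finite_measure randomisation by (rule finite_measure_randomisation)
  have heat: "heat_kernel \<epsilon> x = C * (\<integral>\<zeta>. cos (\<Sum>i\<in>UNIV. \<zeta> i * (1 / sqrt \<epsilon> * x $ i)) \<partial>std_normal_vec)" for x :: "real ^ 'd"
  proof -
    have "(norm x)\<^sup>2 = (\<Sum>i\<in>UNIV. (x $ i)\<^sup>2)"
      unfolding power2_norm_eq_inner inner_vec_def by (simp add: power2_eq_square)
    then have "(norm x)\<^sup>2 / \<epsilon> = (\<Sum>i\<in>UNIV. (1 / sqrt \<epsilon> * x $ i)\<^sup>2)"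
      using \<epsilon> by (simp add: power_divide sum_divide_distrib)
    then show ?thesis
      unfolding std_normal_vec_integral_cos heat_kernel_def C_def by simp
  qed
  have "approx_local_time U I \<epsilon> \<omega> = (\<integral>z. heat_kernel \<epsilon> (U z \<omega>) \<partial>Q)"
    unfolding approx_local_time_def set_lebesgue_integral_def Q_def
    using I_sets by (subst integral_restrict_space) auto
  also have "\<dots> = C * (\<integral>z. (\<integral>\<zeta>. cos (scaled_dot (1 / sqrt \<epsilon>) (z, \<zeta>) \<omega>) \<partial>std_normal_vec) \<partial>Q)"
    unfolding heat scaled_dot_def Bochner_Integration.integral_mult_right_zero[symmetric]
    by (simp add: mult_ac)
  also have "(\<integral>z. (\<integral>\<zeta>. cos (scaled_dot (1 / sqrt \<epsilon>) (z, \<zeta>) \<omega>) \<partial>std_normal_vec) \<partial>Q)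
    = (\<integral>a. cos (scaled_dot (1 / sqrt \<epsilon>) a \<omega>) \<partial>randomisation)"
  proof (rule P.integral_fst')
    have [measurable]: "(\<lambda>a. scaled_dot (1 / sqrt \<epsilon>) a \<omega>) \<in> borel_measurable randomisation"
      using measurable_compose[OF measurable_Pair2'[OF \<omega>] scaled_dot_jointly_measurable] by simp
    show "integrable randomisation (\<lambda>a. cos (scaled_dot (1 / sqrt \<epsilon>) a \<omega>))"
      by (rule A.integrable_const_bound[of _ 1]) auto
  qed
  finally show ?thesis by (simp add: C_def cos_average_def)
qed

lemma approx_local_time_L2:
  assumes "\<epsilon> > 0" shows "approx_local_time U I \<epsilon> \<in> L2 M"
proof (rule L2_cong[THEN iffD2])
  show "(\<lambda>\<omega>. (2 * pi * \<epsilon>) powr (- real CARD('d) / 2) * cos_average randomisation (scaled_dot (1 / sqrt \<epsilon>)) \<omega>) \<in> L2 M"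
    by (intro L2_scale cos_average_L2 finite_measure_randomisation scaled_dot_jointly_measurable)
qed (rule approx_local_time_eq[OF _ assms])

definition cos_kernel :: "real \<Rightarrow> real \<Rightarrow> real \<Rightarrow> 'e \<times> ('d \<Rightarrow> real) \<Rightarrow> 'e \<times> ('d \<Rightarrow> real) \<Rightarrow> real" where
  "cos_kernel s s' \<rho> a b = exp (- (cov (scaled_dot s a) (scaled_dot s a) + cov (scaled_dot s' b) (scaled_dot s' b)) / 2)
     * cosh (\<rho> * cov (scaled_dot s a) (scaled_dot s' b))"

lemma regularised_Cauchy_Schwarz:
  assumes "\<epsilon> > 0" "\<delta> > 0" "0 \<le> \<rho>" "\<rho> \<le> 1"
  shows "\<rho>\<^sup>2 * (R z z')\<^sup>2 < (R z z + \<epsilon>) * (R z' z' + \<delta>)"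
proof -
  have "\<rho>\<^sup>2 * (R z z')\<^sup>2 \<le> 1 * (R z z * R z' z')"
    using assms R_Cauchy_Schwarz[of z z'] by (intro mult_mono) (auto simp: power_le_one)
  also have "\<dots> < (R z z + \<epsilon>) * (R z' z' + \<delta>)"
  proof -
    have "0 \<le> R z z * \<delta>" "0 \<le> \<epsilon> * R z' z'" "0 < \<epsilon> * \<delta>" using assms R_nonneg by auto
    then show ?thesis by (simp add: algebra_simps)
  qed
  finally show ?thesis .
qed

text \<open>
  Given \<open>\<zeta>\<close> and \<open>\<eta>\<close>, the variances are multiples of \<open>\<parallel>\<zeta>\<parallel>\<^sup>2\<close> and \<open>\<parallel>\<eta>\<parallel>\<^sup>2\<close> and the covariance is a multiple of
  \<open>\<zeta> \<bullet> \<eta>\<close>, so the Gaussian integral over both vectors applies; the powers of \<open>\<epsilon>\<close> and \<open>\<delta>\<close> cancel.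
\<close>

lemma nn_integral_cos_kernel:
  assumes \<epsilon>: "\<epsilon> > 0" "\<delta> > 0" and \<rho>: "0 \<le> \<rho>" "\<rho> \<le> 1"
  shows "ennreal ((2 * pi * \<epsilon>) powr (- real CARD('d) / 2) * (2 * pi * \<delta>) powr (- real CARD('d) / 2)) *
     (\<integral>\<^sup>+\<zeta>. (\<integral>\<^sup>+\<eta>. ennreal (cos_kernel (1 / sqrt \<epsilon>) (1 / sqrt \<delta>) \<rho> (z, \<zeta>) (z', \<eta>)) \<partial>std_normal_vec) \<partial>std_normal_vec)
    = ennreal (kernel \<epsilon> \<delta> \<rho> z z')"
proof -
  define \<alpha> where "\<alpha> = R z z / \<epsilon>"
  define \<beta> where "\<beta> = R z' z' / \<delta>"
  define \<gamma> where "\<gamma> = \<rho> * R z z' / sqrt (\<epsilon> * \<delta>)"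
  define D where "D = (R z z + \<epsilon>) * (R z' z' + \<delta>) - \<rho>\<^sup>2 * (R z z')\<^sup>2"
  have Dpos: "D > 0" unfolding D_def using regularised_Cauchy_Schwarz[OF assms] by simp
  have ab: "\<alpha> \<ge> 0" "\<beta> \<ge> 0" using \<epsilon> R_nonneg by (auto simp: \<alpha>_def \<beta>_def)
  have \<gamma>2: "\<gamma>\<^sup>2 = \<rho>\<^sup>2 * (R z z')\<^sup>2 / (\<epsilon> * \<delta>)"
    using \<epsilon> by (simp add: \<gamma>_def power_mult_distrib power_divide)
  have D: "(1 + \<alpha>) * (1 + \<beta>) - \<gamma>\<^sup>2 = D / (\<epsilon> * \<delta>)"
    unfolding \<gamma>2 D_def \<alpha>_def \<beta>_def using \<epsilon> by (simp add: field_simps)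
  have pos: "(1 + \<alpha>) * (1 + \<beta>) - \<gamma>\<^sup>2 > 0" unfolding D using Dpos \<epsilon> by simp
  have "cos_kernel (1 / sqrt \<epsilon>) (1 / sqrt \<delta>) \<rho> (z, \<zeta>) (z', \<eta>) =
     exp (- (\<alpha> * (\<Sum>i\<in>UNIV. (\<zeta> i)\<^sup>2) + \<beta> * (\<Sum>i\<in>UNIV. (\<eta> i)\<^sup>2)) / 2) * cosh (\<gamma> * (\<Sum>i\<in>UNIV. \<zeta> i * \<eta> i))"
    for \<zeta> \<eta> :: "'d \<Rightarrow> real"
    unfolding cos_kernel_def cov_scaled_dot \<alpha>_def \<beta>_def \<gamma>_def using \<epsilon>
    by (simp add: real_sqrt_mult power2_eq_square mult_ac)
  note eq = this
  have "(\<integral>\<^sup>+\<zeta>. (\<integral>\<^sup>+\<eta>. ennreal (cos_kernel (1 / sqrt \<epsilon>) (1 / sqrt \<delta>) \<rho> (z, \<zeta>) (z', \<eta>)) \<partial>std_normal_vec) \<partial>std_normal_vec)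
    = ennreal ((D / (\<epsilon> * \<delta>)) powr (- real CARD('d) / 2))"
  proof -
    have g: "\<gamma>\<^sup>2 < (1 + \<alpha>) * (1 + \<beta>)" using pos by simp
    show ?thesis by (simp only: eq std_normal_vec_nn_integral_exp_cosh[OF ab g] D)
  qed
  moreover have "(2 * pi * \<epsilon>) powr (- real CARD('d) / 2) * (2 * pi * \<delta>) powr (- real CARD('d) / 2) * (D / (\<epsilon> * \<delta>)) powr (- real CARD('d) / 2)
     = kernel \<epsilon> \<delta> \<rho> z z'"
  proof -
    have "(2 * pi * \<epsilon>) powr (- real CARD('d) / 2) * (2 * pi * \<delta>) powr (- real CARD('d) / 2) * (D / (\<epsilon> * \<delta>)) powr (- real CARD('d) / 2)
      = ((2 * pi * \<epsilon>) * (2 * pi * \<delta>) * (D / (\<epsilon> * \<delta>))) powr (- real CARD('d) / 2)"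
      by (simp only: powr_mult)
    also have "(2 * pi * \<epsilon>) * (2 * pi * \<delta>) * (D / (\<epsilon> * \<delta>)) = (2 * pi)\<^sup>2 * D"
      using \<epsilon> by (simp add: power2_eq_square)
    also have "((2 * pi)\<^sup>2 * D) powr (- real CARD('d) / 2) = ((2 * pi) powr 2) powr (- real CARD('d) / 2) * D powr (- real CARD('d) / 2)"
      by (simp add: powr_mult)
    finally show ?thesis unfolding kernel_def D_def[symmetric] powr_powr by simp
  qed
  ultimately show ?thesis by (simp add: ennreal_mult'[symmetric])
qed

lemma ennreal_iterated_integral_cos_kernel:
  assumes \<epsilon>: "\<epsilon> > 0" "\<delta> > 0" and \<rho>: "0 \<le> \<rho>" "\<rho> \<le> 1"
  shows "ennreal ((2 * pi * \<epsilon>) powr (- real CARD('d) / 2) * (2 * pi * \<delta>) powr (- real CARD('d) / 2) *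
      (\<integral>a. (\<integral>b. cos_kernel (1 / sqrt \<epsilon>) (1 / sqrt \<delta>) \<rho> a b \<partial>randomisation) \<partial>randomisation))
    = (\<integral>\<^sup>+z. (\<integral>\<^sup>+z'. ennreal (kernel \<epsilon> \<delta> \<rho> z z') \<partial>Q) \<partial>Q)"
proof -
  define C where "C = (2 * pi * \<epsilon>) powr (- real CARD('d) / 2) * (2 * pi * \<delta>) powr (- real CARD('d) / 2)"
  define S where "S = cos_kernel (1 / sqrt \<epsilon>) (1 / sqrt \<delta>) \<rho>"
  interpret N: prob_space "std_normal_vec :: ('d \<Rightarrow> real) measure" by (rule prob_space_std_normal_vec)
  interpret Q: finite_measure Q by (rule finite_measure_Q)
  note m = borel_measurable_cov[OF scaled_dot_jointly_measurable scaled_dot_jointly_measurable]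
  note [measurable] = m(1) m(2)
  have [measurable]: "(\<lambda>(a, b). S a b) \<in> borel_measurable (randomisation \<Otimes>\<^sub>M randomisation)"
    unfolding S_def cos_kernel_def split_beta'
    by (intro borel_measurable_times borel_measurable_exp borel_measurable_divide borel_measurable_uminus
        borel_measurable_add measurable_compose[OF measurable_fst m(2)] measurable_compose[OF measurable_snd m(2)]
        measurable_compose[OF _ borel_measurable_continuous_onI[OF continuous_on_cosh[OF continuous_on_id]]]
        m(1)[unfolded split_beta']) auto
  have "ennreal (\<integral>a. (\<integral>b. S a b \<partial>randomisation) \<partial>randomisation)
    = (\<integral>\<^sup>+z. (\<integral>\<^sup>+z'. (\<integral>\<^sup>+\<zeta>. (\<integral>\<^sup>+\<eta>. ennreal (S (z, \<zeta>) (z', \<eta>)) \<partial>std_normal_vec) \<partial>std_normal_vec) \<partial>Q) \<partial>Q)"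
  proof (rule ennreal_iterated_integral_pair[OF finite_measure_Q N.finite_measure_axioms])
    show "0 \<le> S a b" for a b by (simp add: S_def cos_kernel_def)
    show "S a b \<le> 1" for a b
      unfolding S_def cos_kernel_def by (intro exp_cov_cosh_le_1 scaled_dot_lin_span \<rho>)
  qed measurable
  then have "ennreal (C * (\<integral>a. (\<integral>b. S a b \<partial>randomisation) \<partial>randomisation))
    = ennreal C * (\<integral>\<^sup>+z. (\<integral>\<^sup>+z'. (\<integral>\<^sup>+\<zeta>. (\<integral>\<^sup>+\<eta>. ennreal (S (z, \<zeta>) (z', \<eta>)) \<partial>std_normal_vec) \<partial>std_normal_vec) \<partial>Q) \<partial>Q)"
    by (subst ennreal_mult') (auto simp: C_def)
  also have "\<dots> = ennreal C * (\<integral>\<^sup>+z. (\<integral>\<^sup>+z'. ennreal (1 / C) * ennreal (kernel \<epsilon> \<delta> \<rho> z z') \<partial>Q) \<partial>Q)"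
  proof -
    have C: "C > 0" using \<epsilon> by (simp add: C_def)
    have "ennreal (1 / C) * ennreal (kernel \<epsilon> \<delta> \<rho> z z')
      = (\<integral>\<^sup>+\<zeta>. (\<integral>\<^sup>+\<eta>. ennreal (S (z, \<zeta>) (z', \<eta>)) \<partial>std_normal_vec) \<partial>std_normal_vec)" for z z'
      unfolding nn_integral_cos_kernel[OF assms, symmetric] C_def[symmetric] S_def mult.assoc[symmetric]
      using C by (simp add: ennreal_mult'[symmetric])
    then show ?thesis by simp
  qed
  also have "\<dots> = ennreal C * (ennreal (1 / C) * (\<integral>\<^sup>+z. (\<integral>\<^sup>+z'. ennreal (kernel \<epsilon> \<delta> \<rho> z z') \<partial>Q) \<partial>Q))"
  proof -
    have [measurable]: "(\<lambda>p. kernel \<epsilon> \<delta> \<rho> (fst p) (snd p)) \<in> borel_measurable (Q \<Otimes>\<^sub>M Q)"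
      unfolding kernel_def by measurable
    have [measurable]: "(\<lambda>z'. kernel \<epsilon> \<delta> \<rho> z z') \<in> borel_measurable Q" for z
      unfolding kernel_def by measurable
    have "(\<lambda>z. \<integral>\<^sup>+z'. ennreal (kernel \<epsilon> \<delta> \<rho> z z') \<partial>Q) \<in> borel_measurable Q"
      by (rule Q.borel_measurable_nn_integral) (simp add: split_beta')
    then show ?thesis by (simp add: nn_integral_cmult)
  qed
  also have "\<dots> = (\<integral>\<^sup>+z. (\<integral>\<^sup>+z'. ennreal (kernel \<epsilon> \<delta> \<rho> z z') \<partial>Q) \<partial>Q)"
    unfolding mult.assoc[symmetric] using \<epsilon> by (simp add: ennreal_mult'[symmetric] C_def)
  finally show ?thesis by (simp add: C_def S_def)
qed

lemma approx_local_time_inner: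
  assumes \<epsilon>: "\<epsilon> > 0" "\<delta> > 0"
  shows "ennreal (\<integral>\<omega>. approx_local_time U I \<epsilon> \<omega> * approx_local_time U I \<delta> \<omega> \<partial>M)
    = (\<integral>\<^sup>+z. (\<integral>\<^sup>+z'. ennreal (kernel \<epsilon> \<delta> 1 z z') \<partial>Q) \<partial>Q)"
proof -
  define C where "C \<epsilon> = (2 * pi * \<epsilon>) powr (- real CARD('d) / 2)" for \<epsilon>
  have "(\<integral>\<omega>. approx_local_time U I \<epsilon> \<omega> * approx_local_time U I \<delta> \<omega> \<partial>M)
    = (\<integral>\<omega>. (C \<epsilon> * C \<delta>) * (cos_average randomisation (scaled_dot (1 / sqrt \<epsilon>)) \<omega>
         * cos_average randomisation (scaled_dot (1 / sqrt \<delta>)) \<omega>) \<partial>M)"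
    by (intro Bochner_Integration.integral_cong refl) (simp add: approx_local_time_eq[OF _ \<epsilon>(1)] approx_local_time_eq[OF _ \<epsilon>(2)] C_def)
  also have "\<dots> = (C \<epsilon> * C \<delta>) * (\<integral>a. (\<integral>b. cos_kernel (1 / sqrt \<epsilon>) (1 / sqrt \<delta>) 1 a b \<partial>randomisation) \<partial>randomisation)"
    by (subst Bochner_Integration.integral_mult_right_zero,
        subst cos_average_inner_cos_average[OF finite_measure_randomisation scaled_dot_jointly_measurable _ scaled_dot_jointly_measurable])
      (auto simp: scaled_dot_lin_span cos_kernel_def[abs_def])
  finally show ?thesis
    using ennreal_iterated_integral_cos_kernel[OF \<epsilon>, of 1] by (simp add: C_def)
qed

text \<open>
  The regularised local time is a constant multiple of an average of cosines, and so are its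
  projections; the constant is absorbed into the kernel.
\<close>

lemma approx_local_time_chaos_sums:
  assumes \<epsilon>: "\<epsilon> > 0" and \<rho>: "0 \<le> \<rho>" "\<rho> \<le> 1"
    and P: "\<And>n. is_projection M (chaos M (coordinate_values U) n) (approx_local_time U I \<epsilon>) (P n)"
  obtains s where "(\<lambda>n. \<rho> ^ n * (\<integral>\<omega>. (P n \<omega>)\<^sup>2 \<partial>M)) sums s" "0 \<le> s"
    "ennreal s = (\<integral>\<^sup>+z. (\<integral>\<^sup>+z'. ennreal (kernel \<epsilon> \<epsilon> \<rho> z z') \<partial>Q) \<partial>Q)"
proof -
  define C where "C = (2 * pi * \<epsilon>) powr (- real CARD('d) / 2)"
  have C: "C > 0" using \<epsilon> by (simp add: C_def)
  define F where "F = cos_average randomisation (scaled_dot (1 / sqrt \<epsilon>))"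
  define P' where "P' n \<omega> = 1 / C * P n \<omega> + 0 * P n \<omega>" for n \<omega>
  have FL: "F \<in> L2 M"
    unfolding F_def by (intro cos_average_L2 finite_measure_randomisation scaled_dot_jointly_measurable)
  have "is_projection M (chaos M (coordinate_values U) n) F (P' n)" for n
    unfolding is_projection_def
  proof (intro conjI ballI FL)
    have PC: "P n \<in> chaos M (coordinate_values U) n" using P[of n] by (simp add: is_projection_def)
    then show "P' n \<in> chaos M (coordinate_values U) n"
      unfolding P'_def[abs_def] by (intro closed_subspace_lincomb[OF closed_subspace_chaos])
    fix W assume "W \<in> chaos M (coordinate_values U) n"
    then have "(\<integral>\<omega>. approx_local_time U I \<epsilon> \<omega> * W \<omega> \<partial>M) = (\<integral>\<omega>. P n \<omega> * W \<omega> \<partial>M)"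
      using P[of n] by (simp add: is_projection_def)
    moreover have "(\<integral>\<omega>. approx_local_time U I \<epsilon> \<omega> * W \<omega> \<partial>M) = C * (\<integral>\<omega>. F \<omega> * W \<omega> \<partial>M)"
      unfolding Bochner_Integration.integral_mult_right_zero[symmetric]
      by (intro Bochner_Integration.integral_cong refl) (simp add: approx_local_time_eq[OF _ \<epsilon>] C_def F_def)
    moreover have "(\<integral>\<omega>. P n \<omega> * W \<omega> \<partial>M) = C * (\<integral>\<omega>. P' n \<omega> * W \<omega> \<partial>M)"
      unfolding Bochner_Integration.integral_mult_right_zero[symmetric] using C by (simp add: P'_def)
    ultimately show "(\<integral>\<omega>. F \<omega> * W \<omega> \<partial>M) = (\<integral>\<omega>. P' n \<omega> * W \<omega> \<partial>M)" using C by simp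
  qed
  from chaos_projection_cos_average_sums[OF finite_measure_randomisation scaled_dot_jointly_measurable scaled_dot_lin_span this[unfolded F_def] \<rho>]
  have "(\<lambda>n. \<rho> ^ n * (\<integral>\<omega>. (P' n \<omega>)\<^sup>2 \<partial>M)) sums
     (\<integral>a. (\<integral>b. cos_kernel (1 / sqrt \<epsilon>) (1 / sqrt \<epsilon>) \<rho> a b \<partial>randomisation) \<partial>randomisation)"
    by (simp add: cos_kernel_def)
  then have "(\<lambda>n. C * C * (\<rho> ^ n * (\<integral>\<omega>. (P' n \<omega>)\<^sup>2 \<partial>M))) sums
     (C * C * (\<integral>a. (\<integral>b. cos_kernel (1 / sqrt \<epsilon>) (1 / sqrt \<epsilon>) \<rho> a b \<partial>randomisation) \<partial>randomisation))"
    by (rule sums_mult)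
  moreover have "C * C * (\<rho> ^ n * (\<integral>\<omega>. (P' n \<omega>)\<^sup>2 \<partial>M)) = \<rho> ^ n * (\<integral>\<omega>. (P n \<omega>)\<^sup>2 \<partial>M)" for n
  proof -
    have "(\<integral>\<omega>. (P' n \<omega>)\<^sup>2 \<partial>M) = (\<integral>\<omega>. (P n \<omega>)\<^sup>2 \<partial>M) / (C * C)"
      by (simp add: P'_def power_divide power2_eq_square)
    then show ?thesis using C by simp
  qed
  ultimately have "(\<lambda>n. \<rho> ^ n * (\<integral>\<omega>. (P n \<omega>)\<^sup>2 \<partial>M)) sums
     (C * C * (\<integral>a. (\<integral>b. cos_kernel (1 / sqrt \<epsilon>) (1 / sqrt \<epsilon>) \<rho> a b \<partial>randomisation) \<partial>randomisation))" by (simp only:)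
  moreover have "0 \<le> C * C * (\<integral>a. (\<integral>b. cos_kernel (1 / sqrt \<epsilon>) (1 / sqrt \<epsilon>) \<rho> a b \<partial>randomisation) \<partial>randomisation)"
    by (simp add: cos_kernel_def)
  moreover have "ennreal (C * C * (\<integral>a. (\<integral>b. cos_kernel (1 / sqrt \<epsilon>) (1 / sqrt \<epsilon>) \<rho> a b \<partial>randomisation) \<partial>randomisation))
     = (\<integral>\<^sup>+z. (\<integral>\<^sup>+z'. ennreal (kernel \<epsilon> \<epsilon> \<rho> z z') \<partial>Q) \<partial>Q)"
    unfolding C_def by (rule ennreal_iterated_integral_cos_kernel[OF \<epsilon> \<epsilon> \<rho>])
  ultimately show thesis by (rule that)
qed

end

section \<open>Singular integrals of anisotropic covariance determinants\<close>

text \<open>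
  The power \<open>x\<^sup>-\<^sup>q\<close>.  The value infinity at 0 makes it decreasing and continuous on the half line, so that
  monotone convergence applies on the set where a covariance determinant vanishes.
\<close>

definition sing_powr :: "real \<Rightarrow> real \<Rightarrow> ennreal" where
  "sing_powr x q = (if x > 0 then ennreal (x powr (- q)) else \<infinity>)"

lemma sing_powr_nonzero: "sing_powr x q \<noteq> 0"
  by (auto simp: sing_powr_def)

lemma sing_powr_antimono:
  assumes "x \<le> y" "q \<ge> 0" shows "sing_powr y q \<le> sing_powr x q"
  using assms by (auto simp: sing_powr_def intro!: ennreal_leI powr_mono2')

lemma sing_powr_mult_le:
  assumes "x \<ge> 0" "y \<ge> 0" shows "sing_powr (x * y) q \<le> sing_powr x q * sing_powr y q"
proof (cases "x > 0 \<and> y > 0")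
  case True
  then show ?thesis by (simp add: sing_powr_def powr_mult ennreal_mult)
next
  case False
  then have "sing_powr x q = \<infinity> \<or> sing_powr y q = \<infinity>" by (auto simp: sing_powr_def)
  then have "sing_powr x q * sing_powr y q = \<infinity>"
    using sing_powr_nonzero by (auto simp: ennreal_top_mult ennreal_mult_top)
  then show ?thesis by simp
qed

lemma sing_powr_min_le: "sing_powr (min x y) q \<le> sing_powr x q + sing_powr y q"
  by (cases "x \<le> y") (simp_all add: min_def)

lemma borel_measurable_sing_powr [measurable]: "(\<lambda>x. sing_powr x q) \<in> borel_measurable borel"
  unfolding sing_powr_def by measurable

text \<open>
  An explicit antiderivative on each side of the singularity.
\<close>

lemma nn_integral_sing_powr_finite:
  assumes a: "a < 1"
  shows "(\<integral>\<^sup>+x. sing_powr \<bar>x\<bar> a * indicator {-1..1} x \<partial>lborel) < \<infinity>"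
proof -
  have 1: "((\<lambda>x. \<bar>x\<bar> powr (- a)) has_integral (1 powr (- a + 1) / (- a + 1))) {0..1}"
  proof (rule has_integral_eq)
    show "((\<lambda>x. x powr (- a)) has_integral (1 powr (- a + 1) / (- a + 1))) {0..1}"
      using has_integral_powr_from_0[of "- a" 1] a by simp
  qed auto
  have 2: "((\<lambda>x. \<bar>x\<bar> powr (- a)) has_integral (1 powr (- a + 1) / (- a + 1))) {-1..0}"
    using has_integral_reflect_real[where a = 0 and b = 1 and f = "\<lambda>x. \<bar>x\<bar> powr (- a)" and i = "1 powr (- a + 1) / (- a + 1)"] 1 by simp
  define r where "r = 1 powr (- a + 1) / (- a + 1) + 1 powr (- a + 1) / (- a + 1)"
  have r: "((\<lambda>x. \<bar>x\<bar> powr (- a)) has_integral r) {-1..1::real}"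
    unfolding r_def by (rule has_integral_combine[OF _ _ 2 1]) simp_all
  have "(\<integral>\<^sup>+x. sing_powr \<bar>x\<bar> a * indicator {-1..1} x \<partial>lborel) = (\<integral>\<^sup>+x. ennreal (\<bar>x\<bar> powr (- a)) * indicator {-1..1} x \<partial>lborel)"
    using AE_lborel_singleton[of "0::real"]
    by (intro nn_integral_cong_AE) (auto simp: sing_powr_def elim!: eventually_mono)
  also have "\<dots> = (\<integral>\<^sup>+x. ennreal (indicator {-1..1} x * \<bar>x\<bar> powr (- a)) \<partial>lborel)"
    by (intro nn_integral_cong) (auto split: split_indicator)
  also have "\<dots> = ennreal r"
  proof (rule nn_integral_has_integral_lborel)
    have "(\<lambda>x. indicator {-1..1} x * \<bar>x\<bar> powr (- a)) = (\<lambda>x. if x \<in> {-1..1} then \<bar>x\<bar> powr (- a) else 0)"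
      by (auto simp: indicator_def)
    then show "((\<lambda>x. indicator {-1..1} x * \<bar>x\<bar> powr (- a)) has_integral r) UNIV"
      using r by (simp only: has_integral_restrict_UNIV)
  qed auto
  also have "\<dots> < \<infinity>" by simp
  finally show ?thesis .
qed

text \<open>
  The two conditions in terms of the covariance alone.  The lower bound on conditional variances takes the
  form of a lower bound on the error of every linear predictor \<open>\<alpha>\<close>, which makes sense also where the
  variance \<open>R z z\<close> vanishes.
\<close>

locale anisotropic_kernel =
  fixes R :: "'e::euclidean_space \<Rightarrow> 'e \<Rightarrow> real" and h :: "'e \<Rightarrow> real" and c1 c2 :: real
  assumes R_continuous: "continuous_on UNIV (\<lambda>(z, z'). R z z')"
    and R_diag_nonneg: "0 \<le> R z z"
    and R_CS: "(R z z')\<^sup>2 \<le> R z z * R z' z'"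
    and h_pos: "b \<in> Basis \<Longrightarrow> 0 < h b"
    and c1_pos: "0 < c1" and c2_pos: "0 < c2"
    and increment_le: "z \<in> cbox 0 One \<Longrightarrow> z' \<in> cbox 0 One \<Longrightarrow>
      R z z - 2 * R z z' + R z' z' \<le> c1 * (\<Sum>b\<in>Basis. \<bar>(z - z') \<bullet> b\<bar> powr (2 * h b))"
    and prediction_ge: "z \<in> cbox 0 One \<Longrightarrow> z' \<in> cbox 0 One \<Longrightarrow>
      c2 * (\<Sum>b\<in>Basis. min (\<bar>(z - z') \<bullet> b\<bar> powr (2 * h b)) (\<bar>z' \<bullet> b\<bar> powr (2 * h b)))
        \<le> R z' z' - 2 * \<alpha> * R z z' + \<alpha>\<^sup>2 * R z z"
begin

text \<open>
  The homogeneous dimension of the anisotropic dilations \<open>z\<^sub>b \<mapsto> r\<^sup>1\<^sup>/\<^sup>h\<^sup>b z\<^sub>b\<close>: they multiply volumes by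
  \<open>r\<close> to this power.
\<close>

definition hdim :: real where "hdim = (\<Sum>b\<in>Basis. 1 / h b)"

text \<open>
  The determinant of the covariance matrix of one coordinate at two points.
\<close>

definition cdet :: "'e \<Rightarrow> 'e \<Rightarrow> real" where "cdet z z' = R z z * R z' z' - (R z z')\<^sup>2"

lemma hdim_pos: "hdim > 0"
  unfolding hdim_def using h_pos by (intro sum_pos) auto

text \<open>
  Predicting by nothing (\<open>\<alpha> = 0\<close>) from the point 0, where the two terms of each minimum agree.
\<close>

lemma diag_ge:
  assumes "z \<in> cbox 0 One"
  shows "c2 * (\<Sum>b\<in>Basis. \<bar>z \<bullet> b\<bar> powr (2 * h b)) \<le> R z z"
  using prediction_ge[of 0 z 0] assms by (simp add: mem_box)

text \<open>
  The determinant is \<open>R z z\<close> times the error of the best linear predictor, \<open>\<alpha> = R z z' / R z z\<close>.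
\<close>

lemma cdet_ge:
  assumes "z \<in> cbox 0 One" "z' \<in> cbox 0 One"
  shows "R z z * (c2 * (\<Sum>b\<in>Basis. min (\<bar>(z - z') \<bullet> b\<bar> powr (2 * h b)) (\<bar>z' \<bullet> b\<bar> powr (2 * h b)))) \<le> cdet z z'"
proof (cases "R z z = 0")
  case True
  with R_CS[of z z'] show ?thesis by (simp add: cdet_def)
next
  case False
  with R_diag_nonneg[of z] have pos: "R z z > 0" by simp
  have "R z z * (c2 * (\<Sum>b\<in>Basis. min (\<bar>(z - z') \<bullet> b\<bar> powr (2 * h b)) (\<bar>z' \<bullet> b\<bar> powr (2 * h b))))
    \<le> R z z * (R z' z' - 2 * (R z z' / R z z) * R z z' + (R z z' / R z z)\<^sup>2 * R z z)"
    by (intro mult_left_mono prediction_ge assms) (use pos in simp)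
  also have "\<dots> = cdet z z'" using pos by (simp add: cdet_def power2_eq_square field_simps)
  finally show ?thesis .
qed

text \<open>
  Each \<open>y\<^sub>b\<close> is at most \<open>S\<close> to the power \<open>1 / (2 h\<^sub>b)\<close>, so the product of all \<open>y\<^sub>b\<close> is at most \<open>S\<close> to the
  power \<open>hdim / 2\<close>.  This distributes the singularity evenly: every coordinate gets the exponent
  \<open>p / hdim\<close>.
\<close>

lemma sing_powr_le_prod:
  assumes y: "\<And>b. b \<in> Basis \<Longrightarrow> 0 \<le> y b" "\<And>b. b \<in> Basis \<Longrightarrow> y b powr (2 * h b) \<le> S" and p: "p > 0"
  shows "sing_powr S (p / 2) \<le> (\<Prod>b\<in>Basis. sing_powr (y b) (p / hdim))"
proof (cases "\<forall>b\<in>Basis. y b > 0")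
  case False
  then have "\<exists>b\<in>Basis. sing_powr (y b) (p / hdim) = \<infinity>" by (auto simp: sing_powr_def)
  then have "(\<Prod>b\<in>Basis. sing_powr (y b) (p / hdim)) = \<infinity>"
    using sing_powr_nonzero by (auto simp: ennreal_prod_eq_top)
  then show ?thesis by simp
next
  case True
  obtain b0 :: 'e where b0: "b0 \<in> Basis" using nonempty_Basis by blast
  have S: "S > 0" using y(2)[OF b0] True b0 by (metis less_le_trans powr_gt_zero order_less_irrefl)
  have "(\<Prod>b\<in>Basis. y b) \<le> (\<Prod>b\<in>Basis. S powr (1 / (2 * h b)))"
  proof (rule prod_mono, intro conjI y(1))
    fix b :: 'e assume b: "b \<in> Basis"
    have "(y b powr (2 * h b)) powr (1 / (2 * h b)) \<le> S powr (1 / (2 * h b))"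
      using h_pos[OF b] y(2)[OF b] by (intro powr_mono2) auto
    then show "y b \<le> S powr (1 / (2 * h b))" using h_pos[OF b] True b by (simp add: powr_powr)
  qed
  also have "\<dots> = S powr (\<Sum>b\<in>Basis. 1 / (2 * h b))" using S by (simp add: powr_sum)
  also have "(\<Sum>b\<in>Basis. 1 / (2 * h b)) = hdim / 2" by (simp add: hdim_def sum_divide_distrib mult.commute)
  finally have le: "(\<Prod>b\<in>Basis. y b) \<le> S powr (hdim / 2)" .
  have "S powr (- (p / 2)) = (S powr (hdim / 2)) powr (- (p / hdim))"
    using hdim_pos by (simp add: powr_powr)
  also have "\<dots> \<le> (\<Prod>b\<in>Basis. y b) powr (- (p / hdim))"
    using le True p hdim_pos by (intro powr_mono2') (auto intro: prod_pos)
  also have "\<dots> = (\<Prod>b\<in>Basis. y b powr (- (p / hdim)))"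
    by (rule prod_powr_distrib)
  finally have "ennreal (S powr (- (p / 2))) \<le> (\<Prod>b\<in>Basis. ennreal (y b powr (- (p / hdim))))"
    by (simp add: prod_ennreal ennreal_leI)
  with True S show ?thesis by (simp add: sing_powr_def)
qed

abbreviation cube :: "'e measure" where "cube \<equiv> restrict_space lborel (cbox 0 One)"

lemma nn_integral_cube:
  "(\<integral>\<^sup>+z. f z \<partial>cube) = (\<integral>\<^sup>+z. f z * indicator (cbox 0 One) z \<partial>lborel)"
  by (subst nn_integral_restrict_space) auto

lemma nn_integral_cube_prod:
  fixes f :: "'e \<Rightarrow> real \<Rightarrow> ennreal"
  assumes [measurable]: "\<And>b. b \<in> Basis \<Longrightarrow> f b \<in> borel_measurable borel"
  shows "(\<integral>\<^sup>+z. (\<Prod>b\<in>Basis. f b (z \<bullet> b)) \<partial>cube) = (\<Prod>b\<in>Basis. \<integral>\<^sup>+x. f b x * indicator {0..1} x \<partial>lborel)"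
proof -
  have "indicator (cbox 0 One) z = (\<Prod>b\<in>Basis. indicator {0..1} (z \<bullet> b) :: ennreal)" for z :: 'e
  proof (cases "z \<in> cbox 0 One")
    case True
    then show ?thesis by (auto simp: mem_box indicator_def)
  next
    case False
    then obtain b where "b \<in> Basis" "z \<bullet> b \<notin> {0..1}" by (auto simp: mem_box)
    then have "\<exists>b\<in>Basis. indicator {0..1} (z \<bullet> b) = (0 :: ennreal)" by (auto simp: indicator_def)
    then show ?thesis using False by (simp add: prod_zero_iff)
  qed
  then have "(\<integral>\<^sup>+z. (\<Prod>b\<in>Basis. f b (z \<bullet> b)) \<partial>cube) = (\<integral>\<^sup>+z. (\<Prod>b\<in>Basis. f b (z \<bullet> b) * indicator {0..1} (z \<bullet> b)) \<partial>lborel)"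
    by (simp add: nn_integral_cube prod.distrib)
  also have "\<dots> = (\<Prod>b\<in>Basis. \<integral>\<^sup>+x. f b x * indicator {0..1} x \<partial>lborel)"
    by (rule nn_integral_lborel_prod) measurable
  finally show ?thesis .
qed

text \<open>
  By the lower bounds on variances and prediction errors, the integrand is at most a product over the
  coordinates of powers of \<open>z\<^sub>b\<close> and of the smaller of \<open>\<bar>z\<^sub>b - z'\<^sub>b\<bar>\<close> and \<open>\<bar>z'\<^sub>b\<bar>\<close>, each with exponent
  \<open>- p / hdim > -1\<close>.  A power of a minimum is at most a sum of two powers, and the integral over the
  cube factorises.
\<close>

lemma cdet_integral_finite:
  assumes p: "p > 0" "p < hdim"
  shows "(\<integral>\<^sup>+z. (\<integral>\<^sup>+z'. sing_powr (cdet z z') (p / 2) \<partial>cube) \<partial>cube) < \<infinity>"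
proof -
  define a where "a = p / hdim"
  have a: "a < 1" "a \<ge> 0" using p hdim_pos by (auto simp: a_def)
  define g where "g x = sing_powr \<bar>x\<bar> a" for x
  have [measurable]: "g \<in> borel_measurable borel" unfolding g_def by measurable
  define J where "J = (\<integral>\<^sup>+x. g x * indicator {-1..1} x \<partial>lborel)"
  have J: "J < \<infinity>" unfolding J_def g_def by (rule nn_integral_sing_powr_finite[OF a(1)])
  have J0: "(\<integral>\<^sup>+x. g x * indicator {0..1} x \<partial>lborel) \<le> J"
    unfolding J_def by (intro nn_integral_mono mult_left_mono) (auto split: split_indicator)
  have J1: "(\<integral>\<^sup>+x. g (u - x) * indicator {0..1} x \<partial>lborel) \<le> J" if "u \<in> {0..1}" for u
  proof -
    have "(\<integral>\<^sup>+x. g (u - x) * indicator {0..1} x \<partial>lborel) \<le> (\<integral>\<^sup>+x. g (u + (-1) * x) * indicator {-1..1} (u + (-1) * x) \<partial>lborel)"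
      using that by (intro nn_integral_mono) (auto split: split_indicator)
    also have "\<dots> = J"
      unfolding J_def by (subst nn_integral_real_affine[of "\<lambda>x. g x * indicator {-1..1} x" "-1" u]) auto
    finally show ?thesis .
  qed
  define C where "C = sing_powr (c2 * c2) (p / 2)"
  have C: "C < \<infinity>" using c2_pos by (simp add: C_def sing_powr_def)
  have bound: "sing_powr (cdet z z') (p / 2) \<le>
      (C * (\<Prod>b\<in>Basis. g (z \<bullet> b))) * (\<Prod>b\<in>Basis. g (z \<bullet> b - z' \<bullet> b) + g (z' \<bullet> b))"
    if z: "z \<in> cbox 0 One" and z': "z' \<in> cbox 0 One" for z z'
  proof -
    define S where "S = (\<Sum>b\<in>Basis. \<bar>z \<bullet> b\<bar> powr (2 * h b))"
    define T where "T = (\<Sum>b\<in>Basis. min (\<bar>(z - z') \<bullet> b\<bar> powr (2 * h b)) (\<bar>z' \<bullet> b\<bar> powr (2 * h b)))"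
    have ST: "S \<ge> 0" "T \<ge> 0" unfolding S_def T_def by (auto intro!: sum_nonneg)
    have "(c2 * S) * (c2 * T) \<le> R z z * (c2 * T)"
      using diag_ge[OF z] ST c2_pos unfolding S_def[symmetric] by (intro mult_right_mono) auto
    also have "\<dots> \<le> cdet z z'" using cdet_ge[OF z z'] by (simp add: T_def)
    finally have "sing_powr (cdet z z') (p / 2) \<le> sing_powr ((c2 * S) * (c2 * T)) (p / 2)"
      using p by (intro sing_powr_antimono) auto
    also have "(c2 * S) * (c2 * T) = (c2 * c2) * (S * T)" by simp
    also have "sing_powr ((c2 * c2) * (S * T)) (p / 2) \<le> C * sing_powr (S * T) (p / 2)"
      unfolding C_def using c2_pos ST by (intro sing_powr_mult_le) auto
    also have "\<dots> \<le> C * (sing_powr S (p / 2) * sing_powr T (p / 2))"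
      using ST by (intro mult_left_mono sing_powr_mult_le) auto
    also have "\<dots> \<le> C * ((\<Prod>b\<in>Basis. sing_powr \<bar>z \<bullet> b\<bar> (p / hdim)) * (\<Prod>b\<in>Basis. sing_powr (min \<bar>(z - z') \<bullet> b\<bar> \<bar>z' \<bullet> b\<bar>) (p / hdim)))"
    proof (intro mult_left_mono mult_mono sing_powr_le_prod p(1))
      show "\<bar>z \<bullet> b\<bar> powr (2 * h b) \<le> S" if "b \<in> Basis" for b
        unfolding S_def using that by (intro member_le_sum[of b Basis "\<lambda>b. \<bar>z \<bullet> b\<bar> powr (2 * h b)"]) auto
      show "min \<bar>(z - z') \<bullet> b\<bar> \<bar>z' \<bullet> b\<bar> powr (2 * h b) \<le> T" if b: "b \<in> Basis" for b
      proof -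
        have "min \<bar>(z - z') \<bullet> b\<bar> \<bar>z' \<bullet> b\<bar> powr (2 * h b) \<le> min (\<bar>(z - z') \<bullet> b\<bar> powr (2 * h b)) (\<bar>z' \<bullet> b\<bar> powr (2 * h b))"
          using h_pos[OF b] by (intro min.boundedI powr_mono2) auto
        also have "\<dots> \<le> T"
          unfolding T_def using b
          by (intro member_le_sum[of b Basis "\<lambda>b. min (\<bar>(z - z') \<bullet> b\<bar> powr (2 * h b)) (\<bar>z' \<bullet> b\<bar> powr (2 * h b))"]) auto
        finally show ?thesis .
      qed
    qed auto
    also have "\<dots> \<le> C * ((\<Prod>b\<in>Basis. g (z \<bullet> b)) * (\<Prod>b\<in>Basis. g (z \<bullet> b - z' \<bullet> b) + g (z' \<bullet> b)))"
      unfolding a_def[symmetric] g_def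
      by (intro mult_left_mono prod_mono_ennreal) (auto simp: inner_diff_left intro: sing_powr_min_le)
    finally show ?thesis by (simp add: mult.assoc)
  qed
  have "(\<integral>\<^sup>+z. (\<integral>\<^sup>+z'. sing_powr (cdet z z') (p / 2) \<partial>cube) \<partial>cube)
    \<le> (\<integral>\<^sup>+z. (\<integral>\<^sup>+z'. (C * (\<Prod>b\<in>Basis. g (z \<bullet> b))) * (\<Prod>b\<in>Basis. g (z \<bullet> b - z' \<bullet> b) + g (z' \<bullet> b)) \<partial>cube) \<partial>cube)"
    by (intro nn_integral_mono bound) (auto simp: space_restrict_space)
  also have "\<dots> \<le> (\<integral>\<^sup>+z. (C * (J + J) ^ DIM('e)) * (\<Prod>b\<in>Basis. g (z \<bullet> b)) \<partial>cube)"
  proof (rule nn_integral_mono)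
    fix z assume "z \<in> space cube"
    then have z: "z \<in> cbox 0 One" by (simp add: space_restrict_space)
    have "(\<integral>\<^sup>+z'. (C * (\<Prod>b\<in>Basis. g (z \<bullet> b))) * (\<Prod>b\<in>Basis. g (z \<bullet> b - z' \<bullet> b) + g (z' \<bullet> b)) \<partial>cube)
       = (C * (\<Prod>b\<in>Basis. g (z \<bullet> b))) * (\<integral>\<^sup>+z'. (\<Prod>b\<in>Basis. g (z \<bullet> b - z' \<bullet> b) + g (z' \<bullet> b)) \<partial>cube)"
      by (rule nn_integral_cmult) (rule measurable_restrict_space1, measurable)
    also have "\<dots> \<le> (C * (\<Prod>b\<in>Basis. g (z \<bullet> b))) * (J + J) ^ DIM('e)"
    proof (rule mult_left_mono)
      have "(\<integral>\<^sup>+z'. (\<Prod>b\<in>Basis. g (z \<bullet> b - z' \<bullet> b) + g (z' \<bullet> b)) \<partial>cube)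
         = (\<Prod>b\<in>Basis. \<integral>\<^sup>+x. (g (z \<bullet> b - x) + g x) * indicator {0..1} x \<partial>lborel)"
        using nn_integral_cube_prod[of "\<lambda>b x. g (z \<bullet> b - x) + g x"] by simp
      also have "\<dots> \<le> (\<Prod>b\<in>(Basis :: 'e set). J + J)"
      proof (rule prod_mono_ennreal)
        fix b :: 'e assume b: "b \<in> Basis"
        have "(\<integral>\<^sup>+x. (g (z \<bullet> b - x) + g x) * indicator {0..1} x \<partial>lborel)
           = (\<integral>\<^sup>+x. g (z \<bullet> b - x) * indicator {0..1} x \<partial>lborel) + (\<integral>\<^sup>+x. g x * indicator {0..1} x \<partial>lborel)"
          unfolding distrib_right by (rule nn_integral_add) auto
        also have "\<dots> \<le> J + J" using z b by (intro add_mono J1 J0) (auto simp: mem_box)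
        finally show "(\<integral>\<^sup>+x. (g (z \<bullet> b - x) + g x) * indicator {0..1} x \<partial>lborel) \<le> J + J" .
      qed
      finally show "(\<integral>\<^sup>+z'. (\<Prod>b\<in>Basis. g (z \<bullet> b - z' \<bullet> b) + g (z' \<bullet> b)) \<partial>cube) \<le> (J + J) ^ DIM('e)"
        by simp
    qed simp
    finally show "(\<integral>\<^sup>+z'. (C * (\<Prod>b\<in>Basis. g (z \<bullet> b))) * (\<Prod>b\<in>Basis. g (z \<bullet> b - z' \<bullet> b) + g (z' \<bullet> b)) \<partial>cube)
      \<le> (C * (J + J) ^ DIM('e)) * (\<Prod>b\<in>Basis. g (z \<bullet> b))"
      by (simp only: mult_ac)
  qed
  also have "\<dots> = (C * (J + J) ^ DIM('e)) * (\<integral>\<^sup>+z. (\<Prod>b\<in>Basis. g (z \<bullet> b)) \<partial>cube)"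
    by (rule nn_integral_cmult) (rule measurable_restrict_space1, measurable)
  also have "\<dots> = (C * (J + J) ^ DIM('e)) * (\<Prod>b\<in>(Basis :: 'e set). \<integral>\<^sup>+x. g x * indicator {0..1} x \<partial>lborel)"
    using nn_integral_cube_prod[of "\<lambda>b. g"] by simp
  also have "\<dots> \<le> (C * (J + J) ^ DIM('e)) * J ^ DIM('e)"
    using J0 by (intro mult_left_mono) (auto intro!: power_mono)
  also have "\<dots> < \<infinity>" using C J by (simp add: ennreal_mult_less_top power_less_top_ennreal)
  finally show ?thesis .
qed

lemma R_measurable_fun:
  assumes "f \<in> measurable N borel" "g \<in> measurable N borel"
  shows "(\<lambda>x. R (f x) (g x)) \<in> borel_measurable N"
proof -
  have "(\<lambda>(z, z'). R z z') \<in> borel_measurable (borel \<Otimes>\<^sub>M borel)"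
    using borel_measurable_continuous_onI[OF R_continuous] by (simp add: borel_prod)
  from measurable_compose[OF measurable_Pair[OF assms] this] show ?thesis by simp
qed

text \<open>
  The determinant is at most \<open>R z z\<close> times the error of the predictor with \<open>\<alpha> = 1\<close>.
\<close>

lemma cdet_le_increment: "cdet z z' \<le> R z z * (R z z - 2 * R z z' + R z' z')"
  using zero_le_power2[of "R z z - R z z'"] by (simp add: cdet_def power2_eq_square algebra_simps)

text \<open>
  A box adapted to the exponents: for \<open>w\<close> in it, the increment bound at displacement \<open>w\<close> is of order
  \<open>4\<^sup>-\<^sup>k\<close>.  The factor 1/4 keeps \<open>z + w\<close> inside the unit cube when all coordinates of \<open>z\<close> are at most 1/2.
\<close>

definition dyadic_box :: "nat \<Rightarrow> 'e set" where
  "dyadic_box k = cbox 0 (\<Sum>b\<in>Basis. (2 powr (- real k / h b) / 4) *\<^sub>R b)"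

lemma mem_dyadic_box: "w \<in> dyadic_box k \<longleftrightarrow> (\<forall>b\<in>Basis. 0 \<le> w \<bullet> b \<and> w \<bullet> b \<le> 2 powr (- real k / h b) / 4)"
  by (simp add: dyadic_box_def mem_box)

lemma dyadic_box_antimono: "k \<le> l \<Longrightarrow> dyadic_box l \<subseteq> dyadic_box k"
proof
  fix w assume kl: "k \<le> l" and w: "w \<in> dyadic_box l"
  have "2 powr (- real l / h b) \<le> 2 powr (- real k / h b)" if "b \<in> Basis" for b
    using kl h_pos[OF that] by (intro powr_mono divide_right_mono) auto
  moreover have "0 \<le> w \<bullet> b" "w \<bullet> b \<le> 2 powr (- real l / h b) / 4" if "b \<in> Basis" for b
    using w that unfolding mem_dyadic_box by auto
  ultimately have "0 \<le> w \<bullet> b \<and> w \<bullet> b \<le> 2 powr (- real k / h b) / 4" if "b \<in> Basis" for b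
    using that by (meson divide_right_mono order_trans zero_le_numeral)
  then show "w \<in> dyadic_box k" unfolding mem_dyadic_box by blast
qed

lemma emeasure_dyadic_box: "emeasure lborel (dyadic_box k) = ennreal ((1 / 4) ^ DIM('e) * 2 powr (- real k * hdim))"
proof -
  have "emeasure lborel (dyadic_box k) = ennreal (\<Prod>b\<in>(Basis :: 'e set). 2 powr (- real k / h b) / 4)"
    unfolding dyadic_box_def by (subst emeasure_lborel_cbox) auto
  also have "(\<Prod>b\<in>(Basis :: 'e set). 2 powr (- real k / h b) / 4)
     = (\<Prod>b\<in>(Basis :: 'e set). 1 / 4) * (\<Prod>b\<in>(Basis :: 'e set). 2 powr (- real k / h b))"
    unfolding prod.distrib[symmetric] by simp
  also have "(\<Prod>b\<in>(Basis :: 'e set). 2 powr (- real k / h b)) = 2 powr (- real k * hdim)"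
    by (simp add: powr_sum[symmetric] hdim_def sum_distrib_left sum_negf)
  finally show ?thesis by simp
qed

lemma emeasure_dyadic_shell:
  "emeasure lborel (dyadic_box k - dyadic_box (Suc k))
    = ennreal ((1 / 4) ^ DIM('e) * (1 - 2 powr (- hdim)) * 2 powr (- real k * hdim))"
proof -
  have "emeasure lborel (dyadic_box k - dyadic_box (Suc k)) = emeasure lborel (dyadic_box k) - emeasure lborel (dyadic_box (Suc k))"
    by (intro emeasure_Diff dyadic_box_antimono) (auto simp: emeasure_dyadic_box, auto simp: dyadic_box_def)
  also have "\<dots> = ennreal ((1 / 4) ^ DIM('e) * 2 powr (- real k * hdim) - (1 / 4) ^ DIM('e) * 2 powr (- real (Suc k) * hdim))"
    unfolding emeasure_dyadic_box by (rule ennreal_minus) simp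
  also have "2 powr (- real (Suc k) * hdim) = 2 powr (- real k * hdim) * 2 powr (- hdim)"
    unfolding powr_add[symmetric] by (simp add: algebra_simps)
  finally show ?thesis by (simp add: algebra_simps)
qed

lemma diag_bounded:
  obtains s where "s > 0" "\<And>z. z \<in> cbox 0 One \<Longrightarrow> R z z \<le> s"
proof -
  have "continuous_on (cbox 0 One) (\<lambda>z. case (z, z) of (z, z') \<Rightarrow> R z z')"
    by (rule continuous_on_compose2[OF R_continuous]) (auto intro!: continuous_intros)
  then have "continuous_on (cbox 0 One) (\<lambda>z. R z z)" by simp
  then have "bounded ((\<lambda>z. R z z) ` cbox 0 One)"
    by (intro compact_imp_bounded compact_continuous_image) auto
  then obtain s where s: "s > 0" and le: "\<forall>z\<in>cbox 0 One. norm (R z z) \<le> s"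
    unfolding bounded_pos by blast
  show thesis
  proof (rule that[OF s])
    fix z :: 'e assume "z \<in> cbox 0 One"
    then have "norm (R z z) \<le> s" using le by blast
    then show "R z z \<le> s" by simp
  qed
qed

text \<open>
  On the subcube with coordinates between 1/4 and 1/2 the variance is bounded away from 0.  A small
  increment therefore makes the determinant small while the covariance stays bounded below: twice
  the covariance is the sum of the variances minus the mean square increment.
\<close>

lemma near_diagonal_bounds:
  obtains A m k0 where "A > 0" "m > 0"
    "\<And>k z w. k0 \<le> k \<Longrightarrow> z \<in> cbox ((1/4) *\<^sub>R One) ((1/2) *\<^sub>R One) \<Longrightarrow> w \<in> dyadic_box k \<Longrightarrow>
       z + w \<in> cbox 0 One \<and> m \<le> R z (z + w) \<and> cdet z (z + w) \<le> A * 2 powr (- 2 * real k)"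
proof -
  obtain s where s: "s > 0" "\<And>z. z \<in> cbox 0 One \<Longrightarrow> R z z \<le> s"
    by (rule diag_bounded) blast
  define N where "N = c1 * real DIM('e)"
  have N: "N > 0" using c1_pos by (simp add: N_def)
  define m0 where "m0 = c2 * (\<Sum>b\<in>(Basis :: 'e set). (1 / 4) powr (2 * h b))"
  have m0: "m0 > 0" unfolding m0_def using c2_pos by (intro mult_pos_pos sum_pos) auto
  have ge: "m0 \<le> R z z" if "z \<in> cbox ((1/4) *\<^sub>R One) One" for z
  proof -
    have z: "z \<in> cbox 0 One" using that by (fastforce simp: mem_box)
    have "m0 \<le> c2 * (\<Sum>b\<in>Basis. \<bar>z \<bullet> b\<bar> powr (2 * h b))"
      unfolding m0_def using c2_pos that h_pos
      by (intro mult_left_mono sum_mono powr_mono2) (auto simp: mem_box intro: less_imp_le)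
    then show ?thesis using diag_ge[OF z] by simp
  qed
  have "(\<lambda>k. N * 2 powr (- 2 * real k)) \<longlonglongrightarrow> N * 0"
  proof (intro tendsto_mult tendsto_const)
    have "(\<lambda>k. (1 / 4 :: real) ^ k) \<longlonglongrightarrow> 0" by (rule LIMSEQ_realpow_zero) auto
    moreover have "(1 / 4 :: real) ^ k = 2 powr (- 2 * real k)" for k
    proof -
      have "2 powr (- 2 * real k) = (2 powr (- 2)) powr real k" by (simp only: powr_powr)
      then show ?thesis by (simp add: powr_minus powr_realpow)
    qed
    ultimately show "(\<lambda>k. 2 powr (- 2 * real k) :: real) \<longlonglongrightarrow> 0" by simp
  qed
  then have "eventually (\<lambda>k. N * 2 powr (- 2 * real k) < m0) sequentially"
    using m0 by (intro order_tendstoD(2)) auto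
  then obtain k0 where k0: "\<And>k. k0 \<le> k \<Longrightarrow> N * 2 powr (- 2 * real k) < m0"
    unfolding eventually_sequentially by blast
  have "z + w \<in> cbox 0 One \<and> m0 / 2 \<le> R z (z + w) \<and> cdet z (z + w) \<le> (s * N) * 2 powr (- 2 * real k)"
    if k: "k0 \<le> k" and z: "z \<in> cbox ((1/4) *\<^sub>R One) ((1/2) *\<^sub>R One)" and w: "w \<in> dyadic_box k" for k z w
  proof -
    have wb: "0 \<le> w \<bullet> b" "w \<bullet> b \<le> 2 powr (- real k / h b)" "w \<bullet> b \<le> 1/4" if b: "b \<in> Basis" for b
    proof -
      have "2 powr (- real k / h b) \<le> 2 powr 0"
        using h_pos[OF b] by (intro powr_mono) auto
      then show "0 \<le> w \<bullet> b" "w \<bullet> b \<le> 2 powr (- real k / h b)" "w \<bullet> b \<le> 1/4"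
        using w b powr_gt_zero[of 2 "- real k / h b"] unfolding mem_dyadic_box by force+
    qed
    have zI: "z \<in> cbox ((1/4) *\<^sub>R One) One" "z \<in> cbox 0 One" using z by (fastforce simp: mem_box)+
    have zwI: "z + w \<in> cbox ((1/4) *\<^sub>R One) One" "z + w \<in> cbox 0 One"
      using z wb by (fastforce simp: mem_box inner_add_left)+
    define E where "E = R z z - 2 * R z (z + w) + R (z + w) (z + w)"
    have "E \<le> c1 * (\<Sum>b\<in>Basis. \<bar>(z - (z + w)) \<bullet> b\<bar> powr (2 * h b))"
      unfolding E_def by (intro increment_le zI zwI)
    also have "\<dots> \<le> c1 * (\<Sum>b\<in>(Basis :: 'e set). 2 powr (- 2 * real k))"
    proof (intro mult_left_mono sum_mono)
      fix b :: 'e assume b: "b \<in> Basis"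
      have "\<bar>(z - (z + w)) \<bullet> b\<bar> powr (2 * h b) \<le> (2 powr (- real k / h b)) powr (2 * h b)"
        using wb[OF b] h_pos[OF b] by (intro powr_mono2) auto
      also have "\<dots> = 2 powr (- 2 * real k)" using h_pos[OF b] by (simp add: powr_powr mult.commute)
      finally show "\<bar>(z - (z + w)) \<bullet> b\<bar> powr (2 * h b) \<le> 2 powr (- 2 * real k)" .
    qed (use c1_pos in simp)
    finally have E: "E \<le> N * 2 powr (- 2 * real k)" by (simp add: N_def mult.assoc)
    have "m0 / 2 \<le> R z (z + w)"
      using ge[OF zI(1)] ge[OF zwI(1)] E k0[OF k] unfolding E_def by linarith
    moreover have "cdet z (z + w) \<le> (s * N) * 2 powr (- 2 * real k)"
    proof -
      have "cdet z (z + w) \<le> R z z * E" unfolding E_def by (rule cdet_le_increment)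
      also have "\<dots> \<le> R z z * (N * 2 powr (- 2 * real k))" using E R_diag_nonneg by (rule mult_left_mono)
      also have "\<dots> \<le> s * (N * 2 powr (- 2 * real k))" using s(2)[OF zI(2)] N by (intro mult_right_mono) auto
      finally show ?thesis by (simp add: mult.assoc)
    qed
    ultimately show ?thesis using zwI(2) by blast
  qed
  then show thesis using that[of "s * N" "m0 / 2" k0] s(1) N m0 by simp
qed

text \<open>
  The shell between consecutive dyadic boxes around \<open>z\<close> has volume of order \<open>2\<close> to the power
  \<open>- k hdim\<close>, and there the integrand is at least of order \<open>2\<close> to the power \<open>k p\<close>.  So every shell
  contributes at least \<open>\<kappa>\<close>, for each \<open>z\<close> in a set of positive volume.  The restriction to
  \<open>m \<le> R z z'\<close> lets the result also be used with the factor \<open>R\<^sup>2\<close> in the integrand.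
\<close>

lemma cdet_integral_infinite:
  assumes p: "hdim \<le> p"
  obtains m where "m > 0"
    "(\<integral>\<^sup>+z. (\<integral>\<^sup>+z'. sing_powr (cdet z z') (p / 2) * indicator {z'. m \<le> R z z'} z' \<partial>cube) \<partial>cube) = \<infinity>"
proof -
  obtain A m k0 where A: "A > 0" and m: "m > 0" and near:
    "\<And>k z w. k0 \<le> k \<Longrightarrow> z \<in> cbox ((1/4) *\<^sub>R One) ((1/2) *\<^sub>R One) \<Longrightarrow> w \<in> dyadic_box k \<Longrightarrow>
       z + w \<in> cbox 0 One \<and> m \<le> R z (z + w) \<and> cdet z (z + w) \<le> A * 2 powr (- 2 * real k)"
    by (rule near_diagonal_bounds) blast
  define Z where "Z = cbox ((1/4) *\<^sub>R One) ((1/2) *\<^sub>R One :: 'e)"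
  have p0: "p > 0" using p hdim_pos by simp
  define \<kappa> where "\<kappa> = A powr (- (p / 2)) * ((1 / 4) ^ DIM('e) * (1 - 2 powr (- hdim)))"
  have \<kappa>: "\<kappa> > 0" unfolding \<kappa>_def using A hdim_pos by (auto intro!: mult_pos_pos powr_less_one)
  have inner: "(\<integral>\<^sup>+z'. sing_powr (cdet z z') (p / 2) * indicator {z'. m \<le> R z z'} z' \<partial>cube) = \<infinity>" if z: "z \<in> Z" for z
  proof (rule ccontr)
    define f where "f z' = sing_powr (cdet z z') (p / 2) * indicator {z'. m \<le> R z z'} z' * indicator (cbox 0 One) z'" for z'
    have [measurable]: "(\<lambda>z'. R z z') \<in> borel_measurable borel" "(\<lambda>z'. R z' z') \<in> borel_measurable borel"
      by (intro R_measurable_fun; simp)+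
    have f [measurable]: "f \<in> borel_measurable borel" unfolding f_def cdet_def by measurable
    define g where "g w = f (z + w)" for w
    have g [measurable]: "g \<in> borel_measurable borel" unfolding g_def by measurable
    \<comment> \<open>In terms of the displacement \<open>w = z' - z\<close>, the integrand is the density of a measure \<open>\<nu>\<close>, and the
      shells are disjoint sets of \<open>\<nu>\<close>-measure at least \<open>\<kappa>\<close>.\<close>
    define \<nu> where "\<nu> = density lborel g"
    define S where "S k = dyadic_box (k0 + k) - dyadic_box (Suc (k0 + k))" for k
    have S [measurable]: "S k \<in> sets borel" for k unfolding S_def dyadic_box_def by auto
    have shell: "ennreal \<kappa> \<le> emeasure \<nu> (S k)" for k
    proof -
      have "\<kappa> \<le> \<kappa> * 2 powr (real (k0 + k) * (p - hdim))"
        using \<kappa> p ge_one_powr_ge_zero[of 2 "real (k0 + k) * (p - hdim)"] by simp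
      also have "2 powr (real (k0 + k) * (p - hdim)) = (2 powr (- 2 * real (k0 + k))) powr (- (p / 2)) * 2 powr (- real (k0 + k) * hdim)"
        unfolding powr_powr powr_add[symmetric] by (simp add: algebra_simps)
      also have "\<kappa> * \<dots> = (A * 2 powr (- 2 * real (k0 + k))) powr (- (p / 2)) * ((1 / 4) ^ DIM('e) * (1 - 2 powr (- hdim)) * 2 powr (- real (k0 + k) * hdim))"
        by (simp add: \<kappa>_def powr_mult mult_ac)
      finally have "ennreal \<kappa> \<le> ennreal ((A * 2 powr (- 2 * real (k0 + k))) powr (- (p / 2))) * emeasure lborel (S k)"
        unfolding S_def emeasure_dyadic_shell by (subst ennreal_mult'[symmetric]) (auto intro: ennreal_leI)
      also have "\<dots> = (\<integral>\<^sup>+w. sing_powr (A * 2 powr (- 2 * real (k0 + k))) (p / 2) * indicator (S k) w \<partial>lborel)"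
        using A by (subst nn_integral_cmult_indicator) (auto simp: sing_powr_def)
      also have "\<dots> \<le> (\<integral>\<^sup>+w. g w * indicator (S k) w \<partial>lborel)"
      proof (intro nn_integral_mono)
        fix w
        show "sing_powr (A * 2 powr (- 2 * real (k0 + k))) (p / 2) * indicator (S k) w \<le> g w * indicator (S k) w"
        proof (cases "w \<in> S k")
          case True
          then have "w \<in> dyadic_box (k0 + k)" by (simp add: S_def)
          from near[OF _ z[unfolded Z_def] this] have "z + w \<in> cbox 0 One" "m \<le> R z (z + w)"
            "cdet z (z + w) \<le> A * 2 powr (- 2 * real (k0 + k))" by auto
          with True p0 show ?thesis
            by (simp add: g_def f_def sing_powr_antimono del: mem_box)
        qed simp
      qed
      also have "\<dots> = emeasure \<nu> (S k)" unfolding \<nu>_def by (rule emeasure_density[symmetric]) auto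
      finally show ?thesis .
    qed
    have disj: "disjoint_family S"
      unfolding disjoint_family_on_def
    proof (intro ballI impI)
      have *: "S k \<inter> S l = {}" if "k < l" for k l
        using dyadic_box_antimono[of "Suc (k0 + k)" "k0 + l"] that by (auto simp: S_def)
      fix k l :: nat assume "k \<noteq> l"
      with *[of k l] *[of l k] show "S k \<inter> S l = {}" by (cases "k < l") auto
    qed
    assume fin: "(\<integral>\<^sup>+z'. sing_powr (cdet z z') (p / 2) * indicator {z'. m \<le> R z z'} z' \<partial>cube) \<noteq> \<infinity>"
    have "(\<integral>\<^sup>+z'. sing_powr (cdet z z') (p / 2) * indicator {z'. m \<le> R z z'} z' \<partial>cube) = (\<integral>\<^sup>+z'. f z' \<partial>lborel)"
      by (simp add: nn_integral_cube f_def)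
    also have "\<dots> = (\<integral>\<^sup>+w. g w \<partial>lborel)"
      by (subst lborel_distr_plus[of z, symmetric], subst nn_integral_distr) (auto simp: g_def[abs_def])
    also have "\<dots> = emeasure \<nu> UNIV" unfolding \<nu>_def by (subst emeasure_density) auto
    finally obtain r where r: "emeasure \<nu> UNIV = ennreal r" "r \<ge> 0"
      using fin by (cases "emeasure \<nu> UNIV") auto
    obtain K :: nat where K: "r / \<kappa> < real K" using reals_Archimedean2 by blast
    have "ennreal (real K * \<kappa>) = (\<Sum>k<K. ennreal \<kappa>)"
      using \<kappa> by (simp add: ennreal_mult ennreal_of_nat_eq_real_of_nat)
    also have "\<dots> \<le> (\<Sum>k<K. emeasure \<nu> (S k))" by (intro sum_mono shell)
    also have "\<dots> = emeasure \<nu> (\<Union>k<K. S k)"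
      using disj by (intro sum_emeasure) (auto simp: \<nu>_def disjoint_family_on_def)
    also have "\<dots> \<le> emeasure \<nu> UNIV" by (rule emeasure_mono) (auto simp: \<nu>_def)
    finally have "real K * \<kappa> \<le> r" using r by simp
    with K \<kappa> show False by (simp add: field_simps)
  qed
  have vol: "emeasure lborel Z > 0"
    unfolding Z_def by (subst emeasure_lborel_cbox) (auto intro!: prod_pos simp: inner_diff_left)
  have "(\<integral>\<^sup>+z. \<infinity> * indicator Z z \<partial>cube) \<le>
     (\<integral>\<^sup>+z. (\<integral>\<^sup>+z'. sing_powr (cdet z z') (p / 2) * indicator {z'. m \<le> R z z'} z' \<partial>cube) \<partial>cube)"
    using inner by (intro nn_integral_mono) (auto split: split_indicator)
  moreover have "(\<integral>\<^sup>+z. \<infinity> * indicator Z z \<partial>cube) = \<infinity>"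
  proof -
    have sub: "Z \<subseteq> cbox 0 One" unfolding Z_def by (intro subset_box_imp) auto
    have "(\<integral>\<^sup>+z. \<infinity> * indicator Z z \<partial>cube) = (\<integral>\<^sup>+z. \<infinity> * indicator Z z \<partial>lborel)"
      unfolding nn_integral_cube using sub by (intro nn_integral_cong) (auto split: split_indicator)
    also have "\<dots> = \<infinity> * emeasure lborel Z" by (rule nn_integral_cmult_indicator) (auto simp: Z_def)
    finally show ?thesis using vol by (simp add: ennreal_top_mult)
  qed
  ultimately show thesis using m that[of m] by (simp add: top_unique)
qed

end

section \<open>Existence of the local time\<close>

lemma sing_powr_eq_inverse:
  assumes "q > 0" shows "sing_powr x q = inverse (ennreal (max 0 x powr q))"
  using assms by (auto simp: sing_powr_def powr_minus inverse_ennreal max_def)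

lemma tendsto_sing_powr:
  assumes f: "(f \<longlongrightarrow> x) F" and q: "q > 0"
  shows "((\<lambda>i. sing_powr (f i) q) \<longlongrightarrow> sing_powr x q) F"
proof -
  have "continuous_on UNIV (\<lambda>y. inverse y :: ennreal)"
    by (intro continuous_on_inverse_ennreal continuous_on_id)
  moreover have "((\<lambda>i. ennreal (max 0 (f i) powr q)) \<longlongrightarrow> ennreal (max 0 x powr q)) F"
    using q by (intro tendsto_ennrealI tendsto_powr' tendsto_max tendsto_const f) (auto intro: always_eventually)
  ultimately show ?thesis
    unfolding sing_powr_eq_inverse[OF q] by (rule continuous_on_tendsto_compose) auto
qed

locale anisotropic_gaussian_field =
  gaussian_vector_field M U R "cbox 0 One" + anisotropic_kernel R h c1 c2
  for M :: "'w measure" and U :: "'e::euclidean_space \<Rightarrow> 'w \<Rightarrow> real ^ 'd" and R h c1 c2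
begin

definition rdet :: "real \<Rightarrow> real \<Rightarrow> real \<Rightarrow> 'e \<times> 'e \<Rightarrow> real" where
  "rdet \<epsilon> \<delta> \<rho> p = (R (fst p) (fst p) + \<epsilon>) * (R (snd p) (snd p) + \<delta>) - \<rho>\<^sup>2 * (R (fst p) (snd p))\<^sup>2"

text \<open>
  As \<open>\<epsilon>\<close> and \<open>\<delta>\<close> decrease to 0 and \<open>\<rho>\<close> increases to 1 the determinant decreases, so this integral
  increases.  If the local time exists, then at \<open>(0, 0, 1)\<close> it is its second moment, and at \<open>(0, 0, \<rho>)\<close> the sum of the
  squared norms of its chaos components with weights \<open>\<rho>\<^sup>n\<close>.
\<close>

definition kint :: "real \<Rightarrow> real \<Rightarrow> real \<Rightarrow> ennreal" where
  "kint \<epsilon> \<delta> \<rho> = ennreal ((2 * pi) powr (- real CARD('d)))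
     * (\<integral>\<^sup>+p. sing_powr (rdet \<epsilon> \<delta> \<rho> p) (real CARD('d) / 2) \<partial>(Q \<Otimes>\<^sub>M Q))"

lemma Q_eq_cube: "Q = cube"
  by (simp add: Q_def)

lemma rdet_0_0_1: "rdet 0 0 1 p = cdet (fst p) (snd p)"
  by (simp add: rdet_def cdet_def)

lemma rdet_mono:
  assumes "0 \<le> \<epsilon>" "\<epsilon> \<le> \<epsilon>'" "0 \<le> \<delta>" "\<delta> \<le> \<delta>'" "0 \<le> \<rho>'" "\<rho>' \<le> \<rho>"
  shows "rdet \<epsilon> \<delta> \<rho> p \<le> rdet \<epsilon>' \<delta>' \<rho>' p"
  unfolding rdet_def using assms R_nonneg
  by (intro diff_mono mult_mono mult_right_mono power_mono add_mono add_nonneg_nonneg) auto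

lemma rdet_measurable [measurable]: "rdet \<epsilon> \<delta> \<rho> \<in> borel_measurable (Q \<Otimes>\<^sub>M Q)"
  unfolding rdet_def[abs_def] by measurable

lemma nn_integral_QQ:
  assumes "(\<lambda>p. f (fst p) (snd p)) \<in> borel_measurable (Q \<Otimes>\<^sub>M Q)"
  shows "(\<integral>\<^sup>+p. f (fst p) (snd p) \<partial>(Q \<Otimes>\<^sub>M Q)) = (\<integral>\<^sup>+z. (\<integral>\<^sup>+z'. f z z' \<partial>Q) \<partial>Q)"
proof -
  interpret Q: finite_measure Q by (rule finite_measure_Q)
  show ?thesis using Q.nn_integral_fst[OF assms] by simp
qed

lemma kint_mono:
  assumes "0 \<le> \<epsilon>" "\<epsilon> \<le> \<epsilon>'" "0 \<le> \<delta>" "\<delta> \<le> \<delta>'" "0 \<le> \<rho>'" "\<rho>' \<le> \<rho>"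
  shows "kint \<epsilon>' \<delta>' \<rho>' \<le> kint \<epsilon> \<delta> \<rho>"
  unfolding kint_def
  by (intro mult_left_mono nn_integral_mono sing_powr_antimono rdet_mono assms) auto

lemma kint_tendsto:
  assumes "\<And>n p. rdet (a (Suc n)) (a (Suc n)) (r (Suc n)) p \<le> rdet (a n) (a n) (r n) p"
    and a: "a \<longlonglongrightarrow> \<alpha>" and r: "r \<longlonglongrightarrow> \<rho>"
  shows "(\<lambda>n. kint (a n) (a n) (r n)) \<longlonglongrightarrow> kint \<alpha> \<alpha> \<rho>"
  unfolding kint_def
proof (intro ennreal_tendsto_cmult nn_integral_LIMSEQ)
  show "incseq (\<lambda>n p. sing_powr (rdet (a n) (a n) (r n) p) (real CARD('d) / 2))"
    by (intro incseq_SucI le_funI sing_powr_antimono assms) simp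
  show "(\<lambda>n. sing_powr (rdet (a n) (a n) (r n) p) (real CARD('d) / 2)) \<longlonglongrightarrow> sing_powr (rdet \<alpha> \<alpha> \<rho> p) (real CARD('d) / 2)" for p
    unfolding rdet_def by (intro tendsto_sing_powr tendsto_intros a r) simp
qed auto

text \<open>
  A fixed sequence decreasing to 0, along which monotone convergence is applied.
\<close>

definition eta :: "nat \<Rightarrow> real" where "eta n = 1 / real (Suc n)"

lemma eta_pos: "eta n > 0" by (simp add: eta_def)

lemma eta_tendsto: "eta \<longlonglongrightarrow> 0"
  unfolding eta_def divide_inverse mult_1 by (rule LIMSEQ_inverse_real_of_nat)

lemma eta_antimono: "m \<le> n \<Longrightarrow> eta n \<le> eta m"
  by (simp add: eta_def frac_le)

lemma eta_at_right: "filterlim eta (at_right 0) sequentially"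
proof -
  have "eta n \<noteq> 0" for n using eta_pos[of n] by simp
  then show ?thesis
    unfolding filterlim_at by (auto intro!: always_eventually eta_tendsto simp: eta_pos)
qed

lemma kint_eta_tendsto:
  assumes "0 \<le> \<rho>" shows "(\<lambda>n. kint (eta n) (eta n) \<rho>) \<longlonglongrightarrow> kint 0 0 \<rho>"
  using assms
  by (intro kint_tendsto[where r = "\<lambda>_. \<rho>"] rdet_mono eta_tendsto tendsto_const eta_antimono less_imp_le[OF eta_pos]) auto

lemma kint_rho_tendsto: "(\<lambda>n. kint 0 0 (1 - eta n)) \<longlonglongrightarrow> kint 0 0 1"
proof (rule kint_tendsto)
  show "rdet 0 0 (1 - eta (Suc n)) p \<le> rdet 0 0 (1 - eta n) p" for n p
    using eta_antimono[of n "Suc n"] by (intro rdet_mono) (auto simp: eta_def)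
  show "(\<lambda>n. 1 - eta n) \<longlonglongrightarrow> 1" using tendsto_diff[OF tendsto_const eta_tendsto, of 1] by simp
qed simp

lemma nn_integral_kernel:
  assumes "\<epsilon> > 0" "\<delta> > 0" "0 \<le> \<rho>" "\<rho> \<le> 1"
  shows "(\<integral>\<^sup>+z. (\<integral>\<^sup>+z'. ennreal (kernel \<epsilon> \<delta> \<rho> z z') \<partial>Q) \<partial>Q) = kint \<epsilon> \<delta> \<rho>"
proof -
  have eq: "ennreal (kernel \<epsilon> \<delta> \<rho> z z') = ennreal ((2 * pi) powr (- real CARD('d))) * sing_powr (rdet \<epsilon> \<delta> \<rho> (z, z')) (real CARD('d) / 2)" for z z'
  proof -
    have "rdet \<epsilon> \<delta> \<rho> (z, z') > 0" unfolding rdet_def using regularised_Cauchy_Schwarz[OF assms, of z z'] by simp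
    then show ?thesis by (simp add: kernel_def sing_powr_def ennreal_mult' rdet_def)
  qed
  have "(\<integral>\<^sup>+z. (\<integral>\<^sup>+z'. ennreal (kernel \<epsilon> \<delta> \<rho> z z') \<partial>Q) \<partial>Q)
    = (\<integral>\<^sup>+p. ennreal ((2 * pi) powr (- real CARD('d))) * sing_powr (rdet \<epsilon> \<delta> \<rho> (fst p, snd p)) (real CARD('d) / 2) \<partial>(Q \<Otimes>\<^sub>M Q))"
    unfolding eq by (rule nn_integral_QQ[symmetric]) simp
  also have "\<dots> = kint \<epsilon> \<delta> \<rho>" unfolding kint_def by (simp add: nn_integral_cmult)
  finally show ?thesis .
qed

abbreviation L_approx :: "real \<Rightarrow> 'w \<Rightarrow> real" where
  "L_approx \<equiv> approx_local_time U (cbox 0 One)"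

lemma L_approx_inner: "\<epsilon> > 0 \<Longrightarrow> \<delta> > 0 \<Longrightarrow> ennreal (\<integral>\<omega>. L_approx \<epsilon> \<omega> * L_approx \<delta> \<omega> \<partial>M) = kint \<epsilon> \<delta> 1"
  using approx_local_time_inner nn_integral_kernel by simp

lemma L_approx_nonneg: "0 \<le> L_approx \<epsilon> \<omega>"
  unfolding approx_local_time_def set_lebesgue_integral_def
  by (intro Bochner_Integration.integral_nonneg) (auto simp: heat_kernel_def)

lemma L_approx_inner_nonneg: "0 \<le> (\<integral>\<omega>. L_approx \<epsilon> \<omega> * L_approx \<delta> \<omega> \<partial>M)"
  by (intro Bochner_Integration.integral_nonneg mult_nonneg_nonneg L_approx_nonneg)

text \<open>
  Finiteness of the integral is part of the conclusion: it is the limit of the second moments of the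
  regularised local times, which converge if the local time exists.
\<close>

lemma local_time_second_moment:
  assumes L: "is_local_time_at_0 M U (cbox 0 One) L"
  shows "kint 0 0 1 = ennreal (\<integral>\<omega>. (L \<omega>)\<^sup>2 \<partial>M)"
proof -
  have "L2_tendsto M (\<lambda>n. L_approx (eta n)) L sequentially"
    using L unfolding is_local_time_at_0_def by (rule L2_tendsto_subseq[OF _ eta_at_right])
  from tendsto_ennrealI[OF L2_tendsto_square[OF this]]
  have "(\<lambda>n. kint (eta n) (eta n) 1) \<longlonglongrightarrow> ennreal (\<integral>\<omega>. (L \<omega>)\<^sup>2 \<partial>M)"
    by (simp add: power2_eq_square L_approx_inner eta_pos)
  with kint_eta_tendsto[of 1] show ?thesis by (intro LIMSEQ_unique) auto
qed

text \<open>
  For \<open>\<epsilon>, \<delta> \<le> eta n\<close> all inner products lie between the value at \<open>eta n\<close> and the finite limit \<open>\<beta>\<close>.  The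
  squared distance \<open>\<parallel>L\<^sub>\<epsilon>\<parallel>\<^sup>2 - 2 \<langle>L\<^sub>\<epsilon>, L\<^sub>\<delta>\<rangle> + \<parallel>L\<^sub>\<delta>\<parallel>\<^sup>2\<close> is then at most \<open>2 (\<beta> - I (eta n) (eta n))\<close>.
\<close>

lemma local_time_exists:
  assumes fin: "kint 0 0 1 < \<infinity>"
  shows "\<exists>L. is_local_time_at_0 M U (cbox 0 One) L"
proof -
  obtain \<beta> where \<beta>: "kint 0 0 1 = ennreal \<beta>" "\<beta> \<ge> 0" using fin by (cases "kint 0 0 1") auto
  define I where "I \<epsilon> \<delta> = (\<integral>\<omega>. L_approx \<epsilon> \<omega> * L_approx \<delta> \<omega> \<partial>M)" for \<epsilon> \<delta>
  have I_eq: "ennreal (I \<epsilon> \<delta>) = kint \<epsilon> \<delta> 1" if "\<epsilon> > 0" "\<delta> > 0" for \<epsilon> \<delta>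
    unfolding I_def by (rule L_approx_inner[OF that])
  have I0: "0 \<le> I \<epsilon> \<delta>" for \<epsilon> \<delta> unfolding I_def by (rule L_approx_inner_nonneg)
  have upper: "I \<epsilon> \<delta> \<le> \<beta>" if "\<epsilon> > 0" "\<delta> > 0" for \<epsilon> \<delta>
  proof -
    have "ennreal (I \<epsilon> \<delta>) \<le> ennreal \<beta>"
      unfolding I_eq[OF that] \<beta>(1)[symmetric] using that by (intro kint_mono) auto
    then show ?thesis using \<beta>(2) by simp
  qed
  have lower: "I (eta n) (eta n) \<le> I \<epsilon> \<delta>" if "\<epsilon> > 0" "\<delta> > 0" "\<epsilon> \<le> eta n" "\<delta> \<le> eta n" for \<epsilon> \<delta> n
  proof -
    have "ennreal (I (eta n) (eta n)) \<le> ennreal (I \<epsilon> \<delta>)"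
      unfolding I_eq[OF that(1,2)] I_eq[OF eta_pos eta_pos] using that by (intro kint_mono) auto
    then show ?thesis using I0 by simp
  qed
  have "(\<lambda>n. ennreal (I (eta n) (eta n))) \<longlonglongrightarrow> ennreal \<beta>"
    using kint_eta_tendsto[of 1] \<beta> by (simp add: I_eq eta_pos)
  then have lim: "(\<lambda>n. I (eta n) (eta n)) \<longlonglongrightarrow> \<beta>"
    by (rule tendsto_ennrealD) (auto simp: \<beta> I0)
  note LL = approx_local_time_L2
  have cauchy: "\<exists>n. \<forall>\<epsilon> \<delta>. 0 < \<epsilon> \<longrightarrow> \<epsilon> \<le> eta n \<longrightarrow> 0 < \<delta> \<longrightarrow> \<delta> \<le> eta n \<longrightarrow> (\<integral>\<omega>. (L_approx \<epsilon> \<omega> - L_approx \<delta> \<omega>)\<^sup>2 \<partial>M) \<le> e"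
    if e: "e > 0" for e
  proof -
    have "eventually (\<lambda>n. \<beta> - e / 2 < I (eta n) (eta n)) sequentially"
      using lim e by (intro order_tendstoD(1)) auto
    then obtain n where n: "\<beta> - e / 2 < I (eta n) (eta n)" unfolding eventually_sequentially by blast
    have "(\<integral>\<omega>. (L_approx \<epsilon> \<omega> - L_approx \<delta> \<omega>)\<^sup>2 \<partial>M) \<le> e"
      if "0 < \<epsilon>" "\<epsilon> \<le> eta n" "0 < \<delta>" "\<delta> \<le> eta n" for \<epsilon> \<delta>
    proof -
      have "(\<integral>\<omega>. (L_approx \<epsilon> \<omega> - L_approx \<delta> \<omega>)\<^sup>2 \<partial>M) = I \<epsilon> \<epsilon> + 2 * (-1) * I \<epsilon> \<delta> + (-1)\<^sup>2 * I \<delta> \<delta>"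
        using L2_integral_square_add[OF LL[OF that(1)] LL[OF that(3)], of "-1"]
        by (simp add: I_def power2_eq_square)
      with upper[OF that(1) that(1)] upper[OF that(3) that(3)] lower[OF that(1) that(3) that(2) that(4)] n
      show ?thesis by simp
    qed
    then show ?thesis by blast
  qed
  have "\<exists>L. L2_tendsto M (\<lambda>n. L_approx (eta n)) L sequentially"
  proof (rule L2_complete[OF LL[OF eta_pos]])
    fix e :: real assume "e > 0"
    from cauchy[OF this] obtain n where "\<forall>\<epsilon> \<delta>. 0 < \<epsilon> \<longrightarrow> \<epsilon> \<le> eta n \<longrightarrow> 0 < \<delta> \<longrightarrow> \<delta> \<le> eta n \<longrightarrow> (\<integral>\<omega>. (L_approx \<epsilon> \<omega> - L_approx \<delta> \<omega>)\<^sup>2 \<partial>M) \<le> e" ..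
    then have "\<forall>k\<ge>n. \<forall>l\<ge>n. (\<integral>\<omega>. (L_approx (eta k) \<omega> - L_approx (eta l) \<omega>)\<^sup>2 \<partial>M) \<le> e"
      using eta_pos eta_antimono by blast
    then show "\<exists>N. \<forall>k\<ge>N. \<forall>l\<ge>N. (\<integral>\<omega>. (L_approx (eta k) \<omega> - L_approx (eta l) \<omega>)\<^sup>2 \<partial>M) \<le> e" ..
  qed
  then obtain L where L: "L2_tendsto M (\<lambda>n. L_approx (eta n)) L sequentially" ..
  have LL2: "L \<in> L2 M" using L by (simp add: L2_tendsto_def)
  have "((\<lambda>\<epsilon>. \<integral>\<omega>. (L_approx \<epsilon> \<omega> - L \<omega>)\<^sup>2 \<partial>M) \<longlongrightarrow> 0) (at_right 0)"
  proof (rule tendstoI)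
    fix e :: real assume e: "e > 0"
    then have "e / 2 > 0" by simp
    from cauchy[OF this] obtain n where n: "\<And>\<epsilon> \<delta>. 0 < \<epsilon> \<Longrightarrow> \<epsilon> \<le> eta n \<Longrightarrow> 0 < \<delta> \<Longrightarrow> \<delta> \<le> eta n \<Longrightarrow>
      (\<integral>\<omega>. (L_approx \<epsilon> \<omega> - L_approx \<delta> \<omega>)\<^sup>2 \<partial>M) \<le> e / 2" by blast
    have "dist (\<integral>\<omega>. (L_approx \<epsilon> \<omega> - L \<omega>)\<^sup>2 \<partial>M) 0 < e" if \<epsilon>: "0 < \<epsilon>" "\<epsilon> < eta n" for \<epsilon>
    proof -
      have "L2_tendsto M (\<lambda>k \<omega>. 1 * L_approx \<epsilon> \<omega> + (-1) * L_approx (eta k) \<omega>) (\<lambda>\<omega>. 1 * L_approx \<epsilon> \<omega> + (-1) * L \<omega>) sequentially"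
        by (intro L2_tendsto_lincomb L2_tendsto_const LL L \<epsilon>)
      from L2_tendsto_square[OF this]
      have "(\<lambda>k. \<integral>\<omega>. (L_approx \<epsilon> \<omega> - L_approx (eta k) \<omega>)\<^sup>2 \<partial>M) \<longlonglongrightarrow> (\<integral>\<omega>. (L_approx \<epsilon> \<omega> - L \<omega>)\<^sup>2 \<partial>M)" by simp
      moreover have "(\<integral>\<omega>. (L_approx \<epsilon> \<omega> - L_approx (eta k) \<omega>)\<^sup>2 \<partial>M) \<le> e / 2" if "n \<le> k" for k
        by (rule n[OF \<epsilon>(1) less_imp_le[OF \<epsilon>(2)] eta_pos eta_antimono[OF that]])
      ultimately have "(\<integral>\<omega>. (L_approx \<epsilon> \<omega> - L \<omega>)\<^sup>2 \<partial>M) \<le> e / 2"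
        by (intro LIMSEQ_le_const2) auto
      then show ?thesis using e by simp
    qed
    then show "eventually (\<lambda>\<epsilon>. dist (\<integral>\<omega>. (L_approx \<epsilon> \<omega> - L \<omega>)\<^sup>2 \<partial>M) 0 < e) (at_right 0)"
      unfolding eventually_at_right_field using eta_pos[of n] by blast
  qed
  moreover have "eventually (\<lambda>\<epsilon>. L_approx \<epsilon> \<in> L2 M) (at_right 0)"
    using eventually_at_right_less[of "0::real"] by eventually_elim (rule LL)
  ultimately show ?thesis using LL2 unfolding is_local_time_at_0_def L2_tendsto_def by blast
qed

lemma kint_finite_iff: "kint 0 0 1 < \<infinity> \<longleftrightarrow> real CARD('d) < hdim"
proof -
  have eq: "kint 0 0 1 = ennreal ((2 * pi) powr (- real CARD('d))) *
     (\<integral>\<^sup>+z. (\<integral>\<^sup>+z'. sing_powr (cdet z z') (real CARD('d) / 2) \<partial>cube) \<partial>cube)"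
    unfolding kint_def rdet_0_0_1 Q_eq_cube[symmetric]
    by (subst nn_integral_QQ[where f = "\<lambda>z z'. sing_powr (cdet z z') (real CARD('d) / 2)"])
      (simp_all add: cdet_def)
  show ?thesis
  proof
    assume "real CARD('d) < hdim"
    then have "(\<integral>\<^sup>+z. (\<integral>\<^sup>+z'. sing_powr (cdet z z') (real CARD('d) / 2) \<partial>cube) \<partial>cube) < \<infinity>"
      by (intro cdet_integral_finite) auto
    then show "kint 0 0 1 < \<infinity>" unfolding eq by (simp add: ennreal_mult_less_top)
  next
    assume fin: "kint 0 0 1 < \<infinity>"
    show "real CARD('d) < hdim"
    proof (rule ccontr)
      assume "\<not> real CARD('d) < hdim"
      then have "hdim \<le> real CARD('d)" by simp
      from cdet_integral_infinite[OF this]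
      obtain m where inf: "(\<integral>\<^sup>+z. (\<integral>\<^sup>+z'. sing_powr (cdet z z') (real CARD('d) / 2) * indicator {z'. m \<le> R z z'} z' \<partial>cube) \<partial>cube) = \<infinity>"
        by blast
      have "(\<integral>\<^sup>+z. (\<integral>\<^sup>+z'. sing_powr (cdet z z') (real CARD('d) / 2) * indicator {z'. m \<le> R z z'} z' \<partial>cube) \<partial>cube)
          \<le> (\<integral>\<^sup>+z. (\<integral>\<^sup>+z'. sing_powr (cdet z z') (real CARD('d) / 2) \<partial>cube) \<partial>cube)"
        by (intro nn_integral_mono) (auto split: split_indicator)
      then have "(\<integral>\<^sup>+z. (\<integral>\<^sup>+z'. sing_powr (cdet z z') (real CARD('d) / 2) \<partial>cube) \<partial>cube) = \<infinity>"
        unfolding inf by (simp add: top_unique)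
      then show False using fin unfolding eq by (simp add: ennreal_mult_top)
    qed
  qed
qed

theorem local_time_exists_iff:
  "(\<exists>L. is_local_time_at_0 M U (cbox 0 One) L) \<longleftrightarrow> real CARD('d) < hdim"
proof
  assume "\<exists>L. is_local_time_at_0 M U (cbox 0 One) L"
  then obtain L where "is_local_time_at_0 M U (cbox 0 One) L" ..
  from local_time_second_moment[OF this] have "kint 0 0 1 < \<infinity>" by simp
  then show "real CARD('d) < hdim" by (simp only: kint_finite_iff)
next
  assume "real CARD('d) < hdim"
  then show "\<exists>L. is_local_time_at_0 M U (cbox 0 One) L"
    by (intro local_time_exists) (simp only: kint_finite_iff)
qed

end

section \<open>Chaos expansion of the local time\<close>

subsection \<open>Projections\<close>

lemma is_projection_l2norm_le:
  assumes P: "is_projection M V F P" and V: "V \<subseteq> L2 M"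
  shows "l2norm M P \<le> l2norm M F"
proof -
  have PL: "P \<in> L2 M" and FL: "F \<in> L2 M" using P V by (auto simp: is_projection_def)
  have "(l2norm M P)\<^sup>2 = (\<integral>\<omega>. P \<omega> * P \<omega> \<partial>M)"
    unfolding l2norm_power2 by (simp add: power2_eq_square)
  also have "\<dots> = (\<integral>\<omega>. F \<omega> * P \<omega> \<partial>M)" using P by (simp add: is_projection_def)
  also have "\<dots> \<le> l2norm M F * l2norm M P" using L2_Cauchy_Schwarz[OF FL PL] by simp
  finally have "l2norm M P * l2norm M P \<le> l2norm M F * l2norm M P" by (simp add: power2_eq_square)
  then show ?thesis
    using l2norm_nonneg[of M P] l2norm_nonneg[of M F] by (cases "l2norm M P = 0") auto
qed

lemma is_projection_diff:
  assumes P: "is_projection M V F P" "is_projection M V G S" and V: "closed_subspace M V"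
  shows "is_projection M V (\<lambda>\<omega>. F \<omega> - G \<omega>) (\<lambda>\<omega>. P \<omega> - S \<omega>)"
proof -
  have VL: "V \<subseteq> L2 M" using V by (simp add: closed_subspace_def)
  have L: "F \<in> L2 M" "G \<in> L2 M" "P \<in> V" "S \<in> V" using P by (auto simp: is_projection_def)
  have "(\<lambda>\<omega>. 1 * P \<omega> + (-1) * S \<omega>) \<in> V" by (rule closed_subspace_lincomb[OF V L(3,4)])
  moreover have "(\<integral>\<omega>. (F \<omega> - G \<omega>) * W \<omega> \<partial>M) = (\<integral>\<omega>. (P \<omega> - S \<omega>) * W \<omega> \<partial>M)" if W: "W \<in> V" for W
  proof -
    have "W \<in> L2 M" "P \<in> L2 M" "S \<in> L2 M" using W VL L by auto
    then show ?thesis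
      using P W by (simp add: left_diff_distrib L2_mult_integrable L is_projection_def)
  qed
  ultimately show ?thesis using L2_diff[OF L(1,2)] by (simp add: is_projection_def)
qed

lemma is_projection_square_diff_le:
  assumes P: "is_projection M V F P" "is_projection M V G S" and V: "closed_subspace M V"
  shows "\<bar>(\<integral>\<omega>. (P \<omega>)\<^sup>2 \<partial>M) - (\<integral>\<omega>. (S \<omega>)\<^sup>2 \<partial>M)\<bar>
    \<le> l2norm M (\<lambda>\<omega>. F \<omega> - G \<omega>) * (l2norm M F + l2norm M G)"
proof -
  have VL: "V \<subseteq> L2 M" using V by (simp add: closed_subspace_def)
  have PL: "P \<in> L2 M" "S \<in> L2 M" using P VL by (auto simp: is_projection_def)
  have D: "l2norm M (\<lambda>\<omega>. P \<omega> - S \<omega>) \<le> l2norm M (\<lambda>\<omega>. F \<omega> - G \<omega>)"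
    by (rule is_projection_l2norm_le[OF is_projection_diff[OF P V] VL])
  have "l2norm M P \<le> l2norm M (\<lambda>\<omega>. P \<omega> - S \<omega>) + l2norm M S"
    using l2norm_triangle[OF L2_diff[OF PL] PL(2)] by simp
  moreover have "l2norm M S \<le> l2norm M (\<lambda>\<omega>. P \<omega> - S \<omega>) + l2norm M P"
    using l2norm_triangle[OF L2_diff[OF PL(2,1)] PL(1)] by (simp add: l2norm_commute[of M S P])
  ultimately have d: "\<bar>l2norm M P - l2norm M S\<bar> \<le> l2norm M (\<lambda>\<omega>. F \<omega> - G \<omega>)" using D by linarith
  have "\<bar>(l2norm M P)\<^sup>2 - (l2norm M S)\<^sup>2\<bar> = \<bar>l2norm M P - l2norm M S\<bar> * (l2norm M P + l2norm M S)"
    by (simp add: power2_eq_square square_diff_square_factored abs_mult l2norm_nonneg)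
  also have "\<dots> \<le> l2norm M (\<lambda>\<omega>. F \<omega> - G \<omega>) * (l2norm M F + l2norm M G)"
    using is_projection_l2norm_le[OF P(1) VL] is_projection_l2norm_le[OF P(2) VL]
    by (intro mult_mono add_mono d) (auto simp: l2norm_nonneg)
  finally show ?thesis by (simp add: l2norm_power2)
qed

text \<open>
  Hence the components in any chaos expansion have the norms of the projections, and \<open>D1\<close> may be tested
  on projections.
\<close>

lemma (in gaussian_space) chaos_expansion_is_projection:
  assumes "chaos_expansion M G F Fn"
  shows "is_projection M (chaos M G n) F (Fn n)"
proof -
  have C: "\<And>n. Fn n \<in> chaos M G n" and lim: "L2_tendsto M (\<lambda>m \<omega>. \<Sum>n<m. Fn n \<omega>) F sequentially"
    using assms by (auto simp: chaos_expansion_def)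
  have "(\<integral>\<omega>. F \<omega> * W \<omega> \<partial>M) = (\<integral>\<omega>. Fn n \<omega> * W \<omega> \<partial>M)" if W: "W \<in> chaos M G n" for W
  proof -
    note WL = chaos_L2[OF W]
    have "(\<lambda>m. \<integral>\<omega>. (\<Sum>k<m. Fn k \<omega>) * W \<omega> \<partial>M) \<longlonglongrightarrow> (\<integral>\<omega>. F \<omega> * W \<omega> \<partial>M)"
      by (intro L2_tendsto_inner lim L2_tendsto_const WL)
    moreover have "(\<integral>\<omega>. (\<Sum>k<m. Fn k \<omega>) * W \<omega> \<partial>M) = (\<integral>\<omega>. Fn n \<omega> * W \<omega> \<partial>M)" if "n < m" for m
    proof -
      have "(\<integral>\<omega>. (\<Sum>k<m. Fn k \<omega>) * W \<omega> \<partial>M) = (\<Sum>k<m. \<integral>\<omega>. Fn k \<omega> * W \<omega> \<partial>M)"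
        unfolding sum_distrib_right
        by (rule Bochner_Integration.integral_sum) (rule L2_mult_integrable[OF chaos_L2[OF C] WL])
      also have "\<dots> = (\<Sum>k\<in>{n}. \<integral>\<omega>. Fn k \<omega> * W \<omega> \<partial>M)"
        using that chaos_orthogonal[OF C W] by (intro sum.mono_neutral_right) auto
      finally show ?thesis by simp
    qed
    then have "eventually (\<lambda>m. (\<integral>\<omega>. (\<Sum>k<m. Fn k \<omega>) * W \<omega> \<partial>M) = (\<integral>\<omega>. Fn n \<omega> * W \<omega> \<partial>M)) sequentially"
      by (rule eventually_mono[OF eventually_gt_at_top[of n]])
    ultimately have "(\<lambda>m::nat. \<integral>\<omega>. Fn n \<omega> * W \<omega> \<partial>M) \<longlonglongrightarrow> (\<integral>\<omega>. F \<omega> * W \<omega> \<partial>M)"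
      by (rule Lim_transform_eventually)
    then show ?thesis by (simp add: LIMSEQ_const_iff)
  qed
  moreover have "F \<in> L2 M" using lim by (simp add: L2_tendsto_def)
  ultimately show ?thesis using C by (simp add: is_projection_def)
qed

text \<open>
  Parseval's identity for the projections suffices, since the squared distance of \<open>F\<close> to a partial sum is
  the difference of the squared norms.
\<close>

lemma (in gaussian_space) chaos_expansionI:
  assumes P: "\<And>n. is_projection M (chaos M G n) F (P n)"
    and s: "(\<lambda>n. \<integral>\<omega>. (P n \<omega>)\<^sup>2 \<partial>M) sums (\<integral>\<omega>. (F \<omega>)\<^sup>2 \<partial>M)"
  shows "chaos_expansion M G F P"
  unfolding chaos_expansion_def L2_tendsto_def
proof (intro conjI allI always_eventually)
  show C: "P n \<in> chaos M G n" for n using P[of n] by (simp add: is_projection_def)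
  show FL: "F \<in> L2 M" using P[of 0] by (simp add: is_projection_def)
  note PL = chaos_L2[OF C]
  show SL: "(\<lambda>\<omega>. \<Sum>n<m. P n \<omega>) \<in> L2 M" for m by (intro L2_sum PL) simp
  have FP: "(\<integral>\<omega>. F \<omega> * P n \<omega> \<partial>M) = (\<integral>\<omega>. (P n \<omega>)\<^sup>2 \<partial>M)" for n
    using P[of n] C[of n] by (simp add: is_projection_def power2_eq_square)
  have PP: "(\<integral>\<omega>. P n \<omega> * P k \<omega> \<partial>M) = (if n = k then \<integral>\<omega>. (P n \<omega>)\<^sup>2 \<partial>M else 0)" for n k
    using chaos_orthogonal[OF C C, of k n] by (auto simp: power2_eq_square)
  have "(\<integral>\<omega>. ((\<Sum>n<m. P n \<omega>) - F \<omega>)\<^sup>2 \<partial>M) = (\<integral>\<omega>. (F \<omega>)\<^sup>2 \<partial>M) - (\<Sum>n<m. \<integral>\<omega>. (P n \<omega>)\<^sup>2 \<partial>M)" for m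
  proof -
    have "(\<integral>\<omega>. ((\<Sum>n<m. P n \<omega>) - F \<omega>)\<^sup>2 \<partial>M) = (\<integral>\<omega>. (F \<omega> + (-1) * (\<Sum>n<m. P n \<omega>))\<^sup>2 \<partial>M)"
      by (simp add: power2_commute)
    also have "\<dots> = (\<integral>\<omega>. (F \<omega>)\<^sup>2 \<partial>M) - 2 * (\<integral>\<omega>. F \<omega> * (\<Sum>n<m. P n \<omega>) \<partial>M) + (\<integral>\<omega>. (\<Sum>n<m. P n \<omega>)\<^sup>2 \<partial>M)"
      by (subst L2_integral_square_add[OF FL SL]) simp
    also have "(\<integral>\<omega>. F \<omega> * (\<Sum>n<m. P n \<omega>) \<partial>M) = (\<Sum>n<m. \<integral>\<omega>. (P n \<omega>)\<^sup>2 \<partial>M)"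
      unfolding sum_distrib_left FP[symmetric]
      by (rule Bochner_Integration.integral_sum) (rule L2_mult_integrable[OF FL PL])
    also have "(\<integral>\<omega>. (\<Sum>n<m. P n \<omega>)\<^sup>2 \<partial>M) = (\<Sum>n<m. \<Sum>k<m. \<integral>\<omega>. P n \<omega> * P k \<omega> \<partial>M)"
      by (simp add: power2_eq_square sum_product Bochner_Integration.integral_sum Bochner_Integration.integrable_sum L2_mult_integrable[OF PL PL])
    also have "\<dots> = (\<Sum>n<m. \<integral>\<omega>. (P n \<omega>)\<^sup>2 \<partial>M)"
      unfolding PP by (simp add: sum.delta)
    finally show ?thesis by simp
  qed
  moreover have "(\<lambda>m. (\<integral>\<omega>. (F \<omega>)\<^sup>2 \<partial>M) - (\<Sum>n<m. \<integral>\<omega>. (P n \<omega>)\<^sup>2 \<partial>M)) \<longlonglongrightarrow> (\<integral>\<omega>. (F \<omega>)\<^sup>2 \<partial>M) - (\<integral>\<omega>. (F \<omega>)\<^sup>2 \<partial>M)"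
    using s unfolding sums_def by (intro tendsto_intros)
  ultimately show "(\<lambda>m. \<integral>\<omega>. ((\<Sum>n<m. P n \<omega>) - F \<omega>)\<^sup>2 \<partial>M) \<longlonglongrightarrow> 0" by simp
qed

subsection \<open>Weighted sums of the chaos components\<close>

context anisotropic_gaussian_field
begin

abbreviation wiener_chaos :: "nat \<Rightarrow> ('w \<Rightarrow> real) set" where
  "wiener_chaos \<equiv> chaos M (coordinate_values U)"

text \<open>
  The identity holds for the regularised local times.  The squared norms of their projections converge
  uniformly in the degree, and \<open>\<rho> < 1\<close> makes the weights summable, so the left-hand sides converge;
  the right-hand sides converge monotonically.
\<close>

lemma local_time_chaos_sums:
  assumes L: "is_local_time_at_0 M U (cbox 0 One) L"
    and P: "\<And>n. is_projection M (wiener_chaos n) L (P n)"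
    and \<rho>: "0 \<le> \<rho>" "\<rho> < 1"
  obtains s where "(\<lambda>n. \<rho> ^ n * (\<integral>\<omega>. (P n \<omega>)\<^sup>2 \<partial>M)) sums s" "0 \<le> s" "ennreal s = kint 0 0 \<rho>"
proof -
  define F where "F k = L_approx (eta k)" for k
  have F: "L2_tendsto M F L sequentially"
    using L unfolding is_local_time_at_0_def F_def by (rule L2_tendsto_subseq[OF _ eta_at_right])
  have FL: "F k \<in> L2 M" for k unfolding F_def by (rule approx_local_time_L2[OF eta_pos])
  have LL: "L \<in> L2 M" using F by (simp add: L2_tendsto_def)
  have "\<exists>S. is_projection M (wiener_chaos n) (F k) S" for n k
    by (rule projection_exists[OF closed_subspace_chaos FL])
  then obtain S where S: "\<And>n k. is_projection M (wiener_chaos n) (F k) (S n k)" by metis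
  define a where "a n = (\<integral>\<omega>. (P n \<omega>)\<^sup>2 \<partial>M)" for n
  define b where "b n k = (\<integral>\<omega>. (S n k \<omega>)\<^sup>2 \<partial>M)" for n k
  define e where "e k = l2norm M (\<lambda>\<omega>. F k \<omega> - L \<omega>) * (l2norm M (F k) + l2norm M L)" for k
  have ab: "\<bar>b n k - a n\<bar> \<le> e k" for n k
    unfolding a_def b_def e_def by (rule is_projection_square_diff_le[OF S P closed_subspace_chaos])
  have e0: "e k \<ge> 0" for k unfolding e_def by (simp add: l2norm_nonneg)
  have e: "e \<longlonglongrightarrow> 0"
  proof -
    have "(\<lambda>k. l2norm M (F k)) \<longlonglongrightarrow> l2norm M L"
      unfolding l2norm_def by (intro tendsto_real_sqrt L2_tendsto_square F)
    then have "e \<longlonglongrightarrow> 0 * (l2norm M L + l2norm M L)"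
      unfolding e_def using F unfolding L2_tendsto_iff_l2norm by (intro tendsto_intros) auto
    then show ?thesis by simp
  qed
  have "\<exists>s. (\<lambda>n. \<rho> ^ n * b n k) sums s \<and> 0 \<le> s \<and> ennreal s = kint (eta k) (eta k) \<rho>" for k
  proof (rule approx_local_time_chaos_sums[OF eta_pos \<rho>(1) less_imp_le[OF \<rho>(2)] S[unfolded F_def], of k])
    fix s
    assume "(\<lambda>n. \<rho> ^ n * (\<integral>\<omega>. (S n k \<omega>)\<^sup>2 \<partial>M)) sums s" "0 \<le> s"
      "ennreal s = (\<integral>\<^sup>+z. (\<integral>\<^sup>+z'. ennreal (kernel (eta k) (eta k) \<rho> z z') \<partial>Q) \<partial>Q)"
    then show ?thesis
      unfolding b_def nn_integral_kernel[OF eta_pos eta_pos \<rho>(1) less_imp_le[OF \<rho>(2)]] by blast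
  qed
  then obtain s where s: "\<And>k. (\<lambda>n. \<rho> ^ n * b n k) sums s k" "\<And>k. 0 \<le> s k" "\<And>k. ennreal (s k) = kint (eta k) (eta k) \<rho>"
    by metis
  have geo: "(\<lambda>n. \<rho> ^ n) sums (1 / (1 - \<rho>))" using \<rho> by (intro geometric_sums) simp
  have a0: "0 \<le> a n" for n by (simp add: a_def)
  have "summable (\<lambda>n. \<rho> ^ n * a n)"
  proof (rule summable_comparison_test)
    show "summable (\<lambda>n. \<rho> ^ n * (l2norm M L)\<^sup>2)" using geo by (intro summable_mult2) (simp add: sums_iff)
    have "a n \<le> (l2norm M L)\<^sup>2" for n
      unfolding a_def l2norm_power2[symmetric]
      by (intro power_mono is_projection_l2norm_le[OF P] l2norm_nonneg) (use chaos_L2 in blast)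
    then have "norm (\<rho> ^ n * a n) \<le> \<rho> ^ n * (l2norm M L)\<^sup>2" for n
      using \<rho> a0 by (simp add: abs_mult mult_left_mono)
    then show "\<exists>N. \<forall>n\<ge>N. norm (\<rho> ^ n * a n) \<le> \<rho> ^ n * (l2norm M L)\<^sup>2" by blast
  qed
  then obtain t where t: "(\<lambda>n. \<rho> ^ n * a n) sums t" by (auto simp: summable_def)
  have t0: "0 \<le> t" using t \<rho> a0 by (intro sums_le[OF _ sums_zero t]) auto
  have "\<bar>s k - t\<bar> \<le> e k / (1 - \<rho>)" for k
  proof -
    have d: "(\<lambda>n. \<rho> ^ n * b n k - \<rho> ^ n * a n) sums (s k - t)" by (intro sums_diff s t)
    have g: "(\<lambda>n. e k * \<rho> ^ n) sums (e k * (1 / (1 - \<rho>)))" by (intro sums_mult geo)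
    have le: "\<bar>\<rho> ^ n * b n k - \<rho> ^ n * a n\<bar> \<le> e k * \<rho> ^ n" for n
    proof -
      have "\<bar>\<rho> ^ n * b n k - \<rho> ^ n * a n\<bar> = \<bar>b n k - a n\<bar> * \<rho> ^ n"
        using \<rho> unfolding right_diff_distrib[symmetric] abs_mult by simp
      then show ?thesis using ab[of n k] \<rho> by (simp add: mult_right_mono)
    qed
    have "s k - t \<le> e k * (1 / (1 - \<rho>))" by (rule sums_le[OF _ d g]) (use le in \<open>simp add: abs_le_iff\<close>)
    moreover have "- (s k - t) \<le> e k * (1 / (1 - \<rho>))"
      by (rule sums_le[OF _ sums_minus[OF d] g]) (use le in \<open>simp add: abs_le_iff\<close>)
    ultimately show ?thesis by simp
  qed
  then have ev: "eventually (\<lambda>k. norm (s k - t) \<le> e k / (1 - \<rho>)) sequentially"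
    by (intro always_eventually allI) simp
  have "(\<lambda>k. e k / (1 - \<rho>)) \<longlonglongrightarrow> 0"
    using tendsto_divide[OF e tendsto_const, of "1 - \<rho>"] \<rho> by simp
  from Lim_null_comparison[OF ev this] have "(\<lambda>k. s k - t) \<longlonglongrightarrow> 0" .
  then have "s \<longlonglongrightarrow> t" by (simp add: LIM_zero_iff)
  then have "(\<lambda>k. kint (eta k) (eta k) \<rho>) \<longlonglongrightarrow> ennreal t" using tendsto_ennrealI[of s t] s(3) by simp
  with kint_eta_tendsto[OF \<rho>(1)] have "ennreal t = kint 0 0 \<rho>" by (rule LIMSEQ_unique[rotated])
  then show thesis using that[of t] t t0 unfolding a_def by blast
qed

text \<open>
  Let \<open>\<rho>\<close> increase to 1 in the weighted sums: the limit is \<open>kint 0 0 1\<close>, the second moment.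
\<close>

lemma local_time_Parseval:
  assumes L: "is_local_time_at_0 M U (cbox 0 One) L"
    and P: "\<And>n. is_projection M (wiener_chaos n) L (P n)"
  shows "(\<lambda>n. \<integral>\<omega>. (P n \<omega>)\<^sup>2 \<partial>M) sums (\<integral>\<omega>. (L \<omega>)\<^sup>2 \<partial>M)"
proof -
  define a where "a n = (\<integral>\<omega>. (P n \<omega>)\<^sup>2 \<partial>M)" for n
  define \<beta> where "\<beta> = (\<integral>\<omega>. (L \<omega>)\<^sup>2 \<partial>M)"
  have \<beta>: "kint 0 0 1 = ennreal \<beta>" "0 \<le> \<beta>"
    using local_time_second_moment[OF L] by (auto simp: \<beta>_def)
  have a0: "0 \<le> a n" for n by (simp add: a_def)
  have "\<exists>s. (\<lambda>n. \<rho> ^ n * a n) sums s \<and> 0 \<le> s \<and> ennreal s = kint 0 0 \<rho>" if "0 \<le> \<rho>" "\<rho> < 1" for \<rho>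
    by (rule local_time_chaos_sums[OF L P that, folded a_def]) blast
  then obtain s where s: "\<And>\<rho>. 0 \<le> \<rho> \<Longrightarrow> \<rho> < 1 \<Longrightarrow> (\<lambda>n. \<rho> ^ n * a n) sums s \<rho>"
    "\<And>\<rho>. 0 \<le> \<rho> \<Longrightarrow> \<rho> < 1 \<Longrightarrow> 0 \<le> s \<rho>" "\<And>\<rho>. 0 \<le> \<rho> \<Longrightarrow> \<rho> < 1 \<Longrightarrow> ennreal (s \<rho>) = kint 0 0 \<rho>" by metis
  define r where "r n = 1 - eta n" for n
  have r: "0 \<le> r n" "r n < 1" for n by (auto simp: r_def eta_def)
  have r1: "r \<longlonglongrightarrow> 1" unfolding r_def using tendsto_diff[OF tendsto_const eta_tendsto, of 1] by simp
  have part: "(\<Sum>n<N. a n) \<le> \<beta>" for N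
  proof (rule LIMSEQ_le_const2)
    show "(\<lambda>k. \<Sum>n<N. r k ^ n * a n) \<longlonglongrightarrow> (\<Sum>n<N. a n)"
    proof -
      have "(\<lambda>k. \<Sum>n<N. r k ^ n * a n) \<longlonglongrightarrow> (\<Sum>n<N. 1 ^ n * a n)"
        by (intro tendsto_intros r1)
      then show ?thesis by simp
    qed
    have "(\<Sum>n<N. r k ^ n * a n) \<le> \<beta>" for k
    proof -
      have "(\<Sum>n<N. r k ^ n * a n) \<le> s (r k)" using r a0 by (intro sum_le_sums s) auto
      moreover have "ennreal (s (r k)) \<le> ennreal \<beta>"
        unfolding s(3)[OF r] \<beta>(1)[symmetric] using r[of k] by (intro kint_mono) auto
      ultimately show ?thesis using \<beta>(2) by simp
    qed
    then show "\<exists>M. \<forall>k\<ge>M. (\<Sum>n<N. r k ^ n * a n) \<le> \<beta>" by blast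
  qed
  have "sum a {..n} \<le> \<beta>" for n
    using part[of "Suc n"] unfolding lessThan_Suc_atMost .
  then have sa: "summable a" by (rule bounded_imp_summable[OF a0])
  have "suminf a \<le> \<beta>" using sa part by (intro suminf_le_const) auto
  moreover have "\<beta> \<le> suminf a"
  proof (rule LIMSEQ_le_const2)
    have "(\<lambda>k. ennreal (s (r k))) \<longlonglongrightarrow> ennreal \<beta>" using kint_rho_tendsto by (simp add: s(3)[OF r] \<beta>(1) r_def[symmetric])
    then show "(\<lambda>k. s (r k)) \<longlonglongrightarrow> \<beta>" by (rule tendsto_ennrealD) (auto simp: \<beta> s(2)[OF r])
    have "s (r k) \<le> suminf a" for k
    proof (rule sums_le[OF _ s(1)[OF r] summable_sums[OF sa]])
      show "r k ^ n * a n \<le> a n" for n using r[of k] a0[of n] by (simp add: mult_left_le_one_le power_le_one)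
    qed
    then show "\<exists>N. \<forall>k\<ge>N. s (r k) \<le> suminf a" by blast
  qed
  ultimately have "suminf a = \<beta>" by simp
  then show ?thesis using summable_sums[OF sa] by (simp add: a_def[abs_def] \<beta>_def)
qed

end

section \<open>Membership of the local time in the first-order space\<close>

text \<open>
  The mean value theorem for \<open>x \<mapsto> (A - x\<^sup>2 B)\<^sup>-\<^sup>q\<close> on the interval from \<open>\<rho>\<close> to 1.  The derivative
  \<open>2 q x B (A - x\<^sup>2 B)\<^sup>-\<^sup>q\<^sup>-\<^sup>1\<close> increases in \<open>x\<close>, so its values at the end points bound the difference
  quotient.
\<close>

lemma powr_difference_bounds:
  fixes A B \<rho> q :: real
  assumes B: "0 \<le> B" "B < A" and \<rho>: "0 \<le> \<rho>" "\<rho> < 1" and q: "q > 0"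
  shows "(A - B) powr (- q) \<le> (A - \<rho>\<^sup>2 * B) powr (- q) + (1 - \<rho>) * (2 * q * B) * (A - B) powr (- (q + 1))"
    and "(A - \<rho>\<^sup>2 * B) powr (- q) + (1 - \<rho>) * \<rho> * (2 * q * B) * (A - \<rho>\<^sup>2 * B) powr (- (q + 1)) \<le> (A - B) powr (- q)"
proof -
  have le: "x\<^sup>2 * B \<le> y\<^sup>2 * B" if "0 \<le> x" "x \<le> y" for x y :: real
    using that B by (intro mult_right_mono power_mono) auto
  have pos: "A - x\<^sup>2 * B > 0" if "0 \<le> x" "x \<le> 1" for x :: real
    using le[OF that] B by simp
  define f' where "f' x = 2 * q * x * B * (A - x\<^sup>2 * B) powr (- (q + 1))" for x
  have "\<exists>x>\<rho>. x < 1 \<and> (A - 1\<^sup>2 * B) powr (- q) - (A - \<rho>\<^sup>2 * B) powr (- q) = (1 - \<rho>) * f' x"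
  proof (rule MVT2[OF \<rho>(2)])
    fix x assume "\<rho> \<le> x" "x \<le> 1"
    with \<rho> have p: "A - x\<^sup>2 * B > 0" by (intro pos) auto
    show "((\<lambda>x. (A - x\<^sup>2 * B) powr (- q)) has_real_derivative f' x) (at x)"
      unfolding f'_def using p
      by (auto intro!: derivative_eq_intros simp: powr_diff powr_minus field_simps)
  qed
  then obtain x where x: "\<rho> < x" "x < 1" and eq: "(A - B) powr (- q) - (A - \<rho>\<^sup>2 * B) powr (- q) = (1 - \<rho>) * f' x"
    by auto
  have "f' x \<le> 2 * q * 1 * B * (A - B) powr (- (q + 1))"
    unfolding f'_def using x \<rho> B q le[of x 1] pos[of x]
    by (intro mult_mono powr_mono2') auto
  then have "(1 - \<rho>) * f' x \<le> (1 - \<rho>) * (2 * q * B * (A - B) powr (- (q + 1)))"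
    using \<rho> by (intro mult_left_mono) auto
  with eq show "(A - B) powr (- q) \<le> (A - \<rho>\<^sup>2 * B) powr (- q) + (1 - \<rho>) * (2 * q * B) * (A - B) powr (- (q + 1))"
    by (simp add: mult.assoc)
  have "2 * q * \<rho> * B * (A - \<rho>\<^sup>2 * B) powr (- (q + 1)) \<le> f' x"
    unfolding f'_def using x \<rho> B q le[of \<rho> x] pos[of x]
    by (intro mult_mono powr_mono2') auto
  then have "(1 - \<rho>) * (2 * q * \<rho> * B * (A - \<rho>\<^sup>2 * B) powr (- (q + 1))) \<le> (1 - \<rho>) * f' x"
    using \<rho> by (intro mult_left_mono) auto
  moreover have "(1 - \<rho>) * (2 * q * \<rho> * B * (A - \<rho>\<^sup>2 * B) powr (- (q + 1)))
      = (1 - \<rho>) * \<rho> * (2 * q * B) * (A - \<rho>\<^sup>2 * B) powr (- (q + 1))"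
    by (simp only: mult_ac)
  ultimately show "(A - \<rho>\<^sup>2 * B) powr (- q) + (1 - \<rho>) * \<rho> * (2 * q * B) * (A - \<rho>\<^sup>2 * B) powr (- (q + 1)) \<le> (A - B) powr (- q)"
    using eq by linarith
qed

text \<open>
  For \<open>A = B > 0\<close> both sides are infinite, and for \<open>A = B = 0\<close> the two powers on the two sides agree.
\<close>

lemma sing_powr_difference_upper:
  assumes B: "0 \<le> B" "B \<le> A" and \<rho>: "0 \<le> \<rho>" "\<rho> < 1" and q: "q > 0"
  shows "sing_powr (A - B) q \<le> sing_powr (A - \<rho>\<^sup>2 * B) q + ennreal (1 - \<rho>) * (ennreal (2 * q * B) * sing_powr (A - B) (q + 1))"
proof (cases "B < A")
  case True
  have "\<rho>\<^sup>2 * B \<le> 1 * B" using \<rho> B by (intro mult_right_mono power_le_one) auto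
  with True have "A - \<rho>\<^sup>2 * B > 0" by simp
  with True show ?thesis
    using powr_difference_bounds(1)[OF B(1) True \<rho> q] \<rho> q B
    by (simp add: sing_powr_def ennreal_mult'[symmetric] ennreal_plus[symmetric] mult.assoc del: ennreal_plus)
next
  case False
  then have AB: "A = B" using B by simp
  show ?thesis
  proof (cases "B = 0")
    case True
    then show ?thesis using AB by (simp add: sing_powr_def)
  next
    case False
    then have "ennreal (1 - \<rho>) * (ennreal (2 * q * B) * sing_powr (A - B) (q + 1)) = \<infinity>"
      using AB B \<rho> q by (simp add: sing_powr_def ennreal_mult_top)
    then show ?thesis by simp
  qed
qed

lemma sing_powr_difference_lower:
  assumes B: "0 \<le> B" "B \<le> A" and \<rho>: "0 \<le> \<rho>" "\<rho> < 1" and q: "q > 0"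
  shows "sing_powr (A - \<rho>\<^sup>2 * B) q + ennreal ((1 - \<rho>) * \<rho>) * (ennreal (2 * q * B) * sing_powr (A - \<rho>\<^sup>2 * B) (q + 1)) \<le> sing_powr (A - B) q"
proof (cases "B < A")
  case True
  have "\<rho>\<^sup>2 * B \<le> 1 * B" using \<rho> B by (intro mult_right_mono power_le_one) auto
  with True have "A - \<rho>\<^sup>2 * B > 0" by simp
  with True show ?thesis
    using powr_difference_bounds(2)[OF B(1) True \<rho> q] \<rho> q B
    by (simp add: sing_powr_def ennreal_mult'[symmetric] ennreal_plus[symmetric] mult.assoc del: ennreal_plus)
qed (simp add: sing_powr_def)

context anisotropic_gaussian_field
begin

text \<open>
  Differentiating the integrand of \<open>kint 0 0 \<rho>\<close> in \<open>\<rho>\<close> gives \<open>\<rho>\<close> times the integrand of \<open>dint \<rho>\<close>.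
\<close>

definition dint :: "real \<Rightarrow> ennreal" where
  "dint \<rho> = ennreal ((2 * pi) powr (- real CARD('d))) * (\<integral>\<^sup>+p. ennreal (real CARD('d) * (R (fst p) (snd p))\<^sup>2)
     * sing_powr (rdet 0 0 \<rho> p) (real CARD('d) / 2 + 1) \<partial>(Q \<Otimes>\<^sub>M Q))"

lemma dint_integrand_measurable [measurable]:
  "(\<lambda>p. ennreal (real CARD('d) * (R (fst p) (snd p))\<^sup>2) * sing_powr (rdet 0 0 \<rho> p) q) \<in> borel_measurable (Q \<Otimes>\<^sub>M Q)"
  by measurable

lemma kint_le_kint_plus_dint:
  assumes \<rho>: "0 \<le> \<rho>" "\<rho> < 1"
  shows "kint 0 0 1 \<le> kint 0 0 \<rho> + ennreal (1 - \<rho>) * dint 1"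
proof -
  define c where "c = ennreal ((2 * pi) powr (- real CARD('d)))"
  have "kint 0 0 1 \<le> c * (\<integral>\<^sup>+p. sing_powr (rdet 0 0 \<rho> p) (real CARD('d) / 2)
     + ennreal (1 - \<rho>) * (ennreal (real CARD('d) * (R (fst p) (snd p))\<^sup>2) * sing_powr (rdet 0 0 1 p) (real CARD('d) / 2 + 1)) \<partial>(Q \<Otimes>\<^sub>M Q))"
    unfolding kint_def c_def
  proof (intro mult_left_mono nn_integral_mono)
    fix p
    show "sing_powr (rdet 0 0 1 p) (real CARD('d) / 2) \<le> sing_powr (rdet 0 0 \<rho> p) (real CARD('d) / 2)
     + ennreal (1 - \<rho>) * (ennreal (real CARD('d) * (R (fst p) (snd p))\<^sup>2) * sing_powr (rdet 0 0 1 p) (real CARD('d) / 2 + 1))"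
      using sing_powr_difference_upper[OF zero_le_power2 R_CS[of "fst p" "snd p"] \<rho>, of "real CARD('d) / 2"]
      by (simp add: rdet_def)
  qed simp
  also have "\<dots> = kint 0 0 \<rho> + ennreal (1 - \<rho>) * dint 1"
    unfolding kint_def dint_def c_def
    by (subst nn_integral_add) (auto simp: nn_integral_cmult distrib_left mult.left_commute)
  finally show ?thesis .
qed

lemma kint_plus_dint_le_kint:
  assumes \<rho>: "0 \<le> \<rho>" "\<rho> < 1"
  shows "kint 0 0 \<rho> + ennreal ((1 - \<rho>) * \<rho>) * dint \<rho> \<le> kint 0 0 1"
proof -
  define c where "c = ennreal ((2 * pi) powr (- real CARD('d)))"
  have "kint 0 0 \<rho> + ennreal ((1 - \<rho>) * \<rho>) * dint \<rho> = c * (\<integral>\<^sup>+p. sing_powr (rdet 0 0 \<rho> p) (real CARD('d) / 2)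
     + ennreal ((1 - \<rho>) * \<rho>) * (ennreal (real CARD('d) * (R (fst p) (snd p))\<^sup>2) * sing_powr (rdet 0 0 \<rho> p) (real CARD('d) / 2 + 1)) \<partial>(Q \<Otimes>\<^sub>M Q))"
    unfolding kint_def dint_def c_def
    by (subst nn_integral_add) (auto simp: nn_integral_cmult distrib_left mult.left_commute)
  also have "\<dots> \<le> kint 0 0 1"
    unfolding kint_def c_def
  proof (intro mult_left_mono nn_integral_mono)
    fix p
    show "sing_powr (rdet 0 0 \<rho> p) (real CARD('d) / 2)
     + ennreal ((1 - \<rho>) * \<rho>) * (ennreal (real CARD('d) * (R (fst p) (snd p))\<^sup>2) * sing_powr (rdet 0 0 \<rho> p) (real CARD('d) / 2 + 1))
       \<le> sing_powr (rdet 0 0 1 p) (real CARD('d) / 2)"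
      using sing_powr_difference_lower[OF zero_le_power2 R_CS[of "fst p" "snd p"] \<rho>, of "real CARD('d) / 2"]
      by (simp add: rdet_def)
  qed simp
  finally show ?thesis .
qed

lemma dint_tendsto: "(\<lambda>n. dint (1 - eta n)) \<longlonglongrightarrow> dint 1"
  unfolding dint_def
proof (rule ennreal_tendsto_cmult[OF _ nn_integral_LIMSEQ])
  have r1: "(\<lambda>n. 1 - eta n) \<longlonglongrightarrow> 1" using tendsto_diff[OF tendsto_const eta_tendsto, of 1] by simp
  show "incseq (\<lambda>n p. ennreal (real CARD('d) * (R (fst p) (snd p))\<^sup>2) * sing_powr (rdet 0 0 (1 - eta n) p) (real CARD('d) / 2 + 1))"
  proof (intro incseq_SucI le_funI mult_left_mono sing_powr_antimono)
    show "rdet 0 0 (1 - eta (Suc n)) p \<le> rdet 0 0 (1 - eta n) p" for n p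
      using eta_antimono[of n "Suc n"] by (intro rdet_mono) (auto simp: eta_def)
  qed auto
  show "(\<lambda>n. ennreal (real CARD('d) * (R (fst p) (snd p))\<^sup>2) * sing_powr (rdet 0 0 (1 - eta n) p) (real CARD('d) / 2 + 1))
    \<longlonglongrightarrow> ennreal (real CARD('d) * (R (fst p) (snd p))\<^sup>2) * sing_powr (rdet 0 0 1 p) (real CARD('d) / 2 + 1)" for p
    unfolding rdet_def by (intro ennreal_tendsto_cmult tendsto_sing_powr tendsto_intros r1) auto
qed auto

text \<open>
  The factor \<open>R\<^sup>2\<close> is bounded on the cube, and at least \<open>m\<^sup>2\<close> on the set where the integral diverges; so
  only the exponent \<open>- (d + 2) / 2\<close> of the determinant matters.
\<close>

lemma dint_finite_iff: "dint 1 < \<infinity> \<longleftrightarrow> real CARD('d) + 2 < hdim"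
proof -
  define p where "p = real CARD('d) + 2"
  have p2: "real CARD('d) / 2 + 1 = p / 2" by (simp add: p_def)
  have d: "real CARD('d) > 0" by simp
  have eq: "dint 1 = ennreal ((2 * pi) powr (- real CARD('d))) *
     (\<integral>\<^sup>+z. (\<integral>\<^sup>+z'. ennreal (real CARD('d) * (R z z')\<^sup>2) * sing_powr (cdet z z') (p / 2) \<partial>cube) \<partial>cube)"
    unfolding dint_def rdet_0_0_1 Q_eq_cube[symmetric] p2
    by (subst nn_integral_QQ[where f = "\<lambda>z z'. ennreal (real CARD('d) * (R z z')\<^sup>2) * sing_powr (cdet z z') (p / 2)"])
      (simp_all add: cdet_def)
  have cmult: "(\<integral>\<^sup>+z. (\<integral>\<^sup>+z'. ennreal c * (sing_powr (cdet z z') (p / 2) * indicator {z'. m \<le> R z z'} z') \<partial>cube) \<partial>cube)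
      = ennreal c * (\<integral>\<^sup>+z. (\<integral>\<^sup>+z'. sing_powr (cdet z z') (p / 2) * indicator {z'. m \<le> R z z'} z' \<partial>cube) \<partial>cube)" for c m
  proof -
    have m [measurable]: "(\<lambda>p'. sing_powr (cdet (fst p') (snd p')) (p / 2) * indicator {z'. m \<le> R (fst p') z'} (snd p')) \<in> borel_measurable (Q \<Otimes>\<^sub>M Q)"
      unfolding cdet_def indicator_def by measurable
    have "(\<integral>\<^sup>+z. (\<integral>\<^sup>+z'. ennreal c * (sing_powr (cdet z z') (p / 2) * indicator {z'. m \<le> R z z'} z') \<partial>Q) \<partial>Q)
      = (\<integral>\<^sup>+p'. ennreal c * (sing_powr (cdet (fst p') (snd p')) (p / 2) * indicator {z'. m \<le> R (fst p') z'} (snd p')) \<partial>(Q \<Otimes>\<^sub>M Q))"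
      by (rule nn_integral_QQ[symmetric]) measurable
    also have "\<dots> = ennreal c * (\<integral>\<^sup>+p'. sing_powr (cdet (fst p') (snd p')) (p / 2) * indicator {z'. m \<le> R (fst p') z'} (snd p') \<partial>(Q \<Otimes>\<^sub>M Q))"
      by (rule nn_integral_cmult) measurable
    also have "(\<integral>\<^sup>+p'. sing_powr (cdet (fst p') (snd p')) (p / 2) * indicator {z'. m \<le> R (fst p') z'} (snd p') \<partial>(Q \<Otimes>\<^sub>M Q))
      = (\<integral>\<^sup>+z. (\<integral>\<^sup>+z'. sing_powr (cdet z z') (p / 2) * indicator {z'. m \<le> R z z'} z' \<partial>Q) \<partial>Q)"
      by (rule nn_integral_QQ[OF m])
    finally show ?thesis by (simp add: Q_eq_cube)
  qed
  show ?thesis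
  proof
    assume "real CARD('d) + 2 < hdim"
    then have fin: "(\<integral>\<^sup>+z. (\<integral>\<^sup>+z'. sing_powr (cdet z z') (p / 2) \<partial>cube) \<partial>cube) < \<infinity>"
      by (intro cdet_integral_finite) (auto simp: p_def)
    obtain s where s: "s > 0" "\<And>z. z \<in> cbox 0 One \<Longrightarrow> R z z \<le> s" by (rule diag_bounded) blast
    have "(\<integral>\<^sup>+z. (\<integral>\<^sup>+z'. ennreal (real CARD('d) * (R z z')\<^sup>2) * sing_powr (cdet z z') (p / 2) \<partial>cube) \<partial>cube)
      \<le> (\<integral>\<^sup>+z. (\<integral>\<^sup>+z'. ennreal (real CARD('d) * (s * s)) * (sing_powr (cdet z z') (p / 2) * indicator {z'. - s \<le> R z z'} z') \<partial>cube) \<partial>cube)"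
    proof (intro nn_integral_mono)
      fix z z' assume "z \<in> space cube" "z' \<in> space cube"
      then have zz: "z \<in> cbox 0 One" "z' \<in> cbox 0 One" by (auto simp: space_restrict_space)
      have "(R z z')\<^sup>2 \<le> R z z * R z' z'" by (rule R_CS)
      also have "\<dots> \<le> s * s" using s zz R_diag_nonneg by (intro mult_mono) auto
      finally have le: "(R z z')\<^sup>2 \<le> s * s" .
      then have "\<bar>R z z'\<bar> \<le> \<bar>s\<bar>" by (simp only: abs_le_square_iff power2_eq_square[of s])
      with s(1) have "\<bar>R z z'\<bar> \<le> s" by simp
      then have "- s \<le> R z z'" by simp
      then show "ennreal (real CARD('d) * (R z z')\<^sup>2) * sing_powr (cdet z z') (p / 2)
        \<le> ennreal (real CARD('d) * (s * s)) * (sing_powr (cdet z z') (p / 2) * indicator {z'. - s \<le> R z z'} z')"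
        using le by (simp add: mult_right_mono ennreal_leI)
    qed
    also have "\<dots> \<le> ennreal (real CARD('d) * (s * s)) * (\<integral>\<^sup>+z. (\<integral>\<^sup>+z'. sing_powr (cdet z z') (p / 2) \<partial>cube) \<partial>cube)"
      unfolding cmult by (intro mult_left_mono nn_integral_mono) (auto split: split_indicator)
    also have "\<dots> < \<infinity>" using fin by (simp add: ennreal_mult_less_top)
    finally show "dint 1 < \<infinity>" unfolding eq by (simp add: ennreal_mult_less_top)
  next
    assume fin: "dint 1 < \<infinity>"
    show "real CARD('d) + 2 < hdim"
    proof (rule ccontr)
      assume "\<not> real CARD('d) + 2 < hdim"
      then have "hdim \<le> p" by (simp add: p_def)
      from cdet_integral_infinite[OF this] obtain m where m: "m > 0" and
        inf: "(\<integral>\<^sup>+z. (\<integral>\<^sup>+z'. sing_powr (cdet z z') (p / 2) * indicator {z'. m \<le> R z z'} z' \<partial>cube) \<partial>cube) = \<infinity>"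
        by blast
      have "(\<integral>\<^sup>+z. (\<integral>\<^sup>+z'. ennreal (real CARD('d) * m\<^sup>2) * (sing_powr (cdet z z') (p / 2) * indicator {z'. m \<le> R z z'} z') \<partial>cube) \<partial>cube)
        \<le> (\<integral>\<^sup>+z. (\<integral>\<^sup>+z'. ennreal (real CARD('d) * (R z z')\<^sup>2) * sing_powr (cdet z z') (p / 2) \<partial>cube) \<partial>cube)"
        using m by (intro nn_integral_mono) (auto split: split_indicator intro!: mult_right_mono ennreal_leI power_mono)
      moreover have "ennreal (real CARD('d) * m\<^sup>2) * (\<infinity> :: ennreal) = \<infinity>"
        using m by (simp add: ennreal_mult_top)
      ultimately have "(\<integral>\<^sup>+z. (\<integral>\<^sup>+z'. ennreal (real CARD('d) * (R z z')\<^sup>2) * sing_powr (cdet z z') (p / 2) \<partial>cube) \<partial>cube) = \<infinity>"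
        unfolding cmult inf by (simp add: top_unique)
      then show False using fin unfolding eq by (simp add: ennreal_mult_top)
    qed
  qed
qed

lemma one_minus_power_le: "0 \<le> \<rho> \<Longrightarrow> \<rho> \<le> 1 \<Longrightarrow> 1 - \<rho> ^ n \<le> (1 - \<rho>) * real n" for \<rho> :: real
  using Bernoulli_inequality[of "\<rho> - 1" n] by (simp add: algebra_simps)

text \<open>
  By Bernoulli's inequality \<open>\<Sum> (1 - \<rho>\<^sup>n) a\<^sub>n \<le> (1 - \<rho>) \<Sum> n a\<^sub>n\<close>.  The left-hand side is
  \<open>kint 0 0 1 - kint 0 0 \<rho>\<close>, which is at least \<open>(1 - \<rho>) \<rho> dint \<rho>\<close>.  Divide by \<open>1 - \<rho>\<close> and let \<open>\<rho>\<close>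
  increase to 1.
\<close>

lemma summable_weighted_imp_dint_finite:
  assumes L: "is_local_time_at_0 M U (cbox 0 One) L"
    and P: "\<And>n. is_projection M (wiener_chaos n) L (P n)"
    and s: "summable (\<lambda>n. real n * (\<integral>\<omega>. (P n \<omega>)\<^sup>2 \<partial>M))"
  shows "dint 1 < \<infinity>"
proof -
  define a where "a n = (\<integral>\<omega>. (P n \<omega>)\<^sup>2 \<partial>M)" for n
  define \<beta> where "\<beta> = (\<integral>\<omega>. (L \<omega>)\<^sup>2 \<partial>M)"
  have \<beta>: "kint 0 0 1 = ennreal \<beta>" using local_time_second_moment[OF L] by (simp add: \<beta>_def)
  have a: "a sums \<beta>" using local_time_Parseval[OF L P] by (simp add: a_def[abs_def] \<beta>_def)
  define S where "S = (\<Sum>n. real n * a n)"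
  have S: "(\<lambda>n. real n * a n) sums S" using s unfolding S_def a_def by (rule summable_sums)
  have a0: "0 \<le> a n" for n by (simp add: a_def)
  have S0: "0 \<le> S" using S a0 by (intro sums_le[OF _ sums_zero S]) auto
  have "dint (1 - eta (Suc n)) \<le> ennreal (2 * S)" for n
  proof -
    \<comment> \<open>Starting at \<open>eta 1 = 1 / 2\<close> gives \<open>\<rho> \<ge> 1 / 2\<close>, which accounts for the constant 2.\<close>
    define \<rho> where "\<rho> = 1 - eta (Suc n)"
    have \<rho>: "1 / 2 \<le> \<rho>" "0 \<le> \<rho>" "\<rho> < 1" by (auto simp: \<rho>_def eta_def field_simps)
    obtain t where t: "(\<lambda>n. \<rho> ^ n * a n) sums t" "0 \<le> t" "ennreal t = kint 0 0 \<rho>"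
      using local_time_chaos_sums[OF L P \<rho>(2,3)] unfolding a_def by blast
    have "\<beta> - t \<le> (1 - \<rho>) * S"
    proof (rule sums_le[OF _ sums_diff[OF a t(1)] sums_mult[OF S]])
      show "a n - \<rho> ^ n * a n \<le> (1 - \<rho>) * (real n * a n)" for n
        using mult_right_mono[OF one_minus_power_le[OF \<rho>(2) less_imp_le[OF \<rho>(3)], of n] a0[of n]]
        by (simp add: algebra_simps)
    qed
    then have "\<beta> \<le> t + (1 - \<rho>) * S" by simp
    then have "ennreal \<beta> \<le> ennreal (t + (1 - \<rho>) * S)" by (rule ennreal_leI)
    also have "\<dots> = ennreal t + ennreal ((1 - \<rho>) * S)"
      using \<rho> S0 t(2) by (intro ennreal_plus) auto
    finally have "ennreal \<beta> \<le> ennreal t + ennreal ((1 - \<rho>) * S)" .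
    with kint_plus_dint_le_kint[OF \<rho>(2,3)]
    have "ennreal t + ennreal ((1 - \<rho>) * \<rho>) * dint \<rho> \<le> ennreal t + ennreal ((1 - \<rho>) * S)"
      unfolding t(3)[symmetric] \<beta> by (rule order_trans)
    then have le: "ennreal ((1 - \<rho>) * \<rho>) * dint \<rho> \<le> ennreal ((1 - \<rho>) * S)"
      by (simp add: ennreal_add_left_cancel_le)
    have pos: "(1 - \<rho>) * \<rho> > 0" using \<rho> by (intro mult_pos_pos) auto
    show ?thesis
    proof (cases "dint \<rho>")
      case (real x)
      have "ennreal ((1 - \<rho>) * \<rho> * x) \<le> ennreal ((1 - \<rho>) * S)"
        using le real pos by (simp add: ennreal_mult' del: ennreal_le_iff)
      then have "(1 - \<rho>) * (\<rho> * x) \<le> (1 - \<rho>) * S" using S0 \<rho> by (simp add: mult.assoc)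
      then have "\<rho> * x \<le> S" using \<rho> by simp
      moreover have "1 / 2 * x \<le> \<rho> * x" using \<rho> real by (intro mult_right_mono) auto
      ultimately have "x \<le> 2 * S" by simp
      then show ?thesis using real by (simp add: \<rho>_def[symmetric] ennreal_leI)
    next
      case top
      have "ennreal ((1 - \<rho>) * \<rho>) * dint \<rho> = \<infinity>"
        using \<rho> unfolding top by (simp add: ennreal_mult_top)
      with le show ?thesis by (simp add: top_unique)
    qed
  qed
  then have "dint 1 \<le> ennreal (2 * S)"
    by (intro LIMSEQ_le_const2[OF LIMSEQ_Suc[OF dint_tendsto]]) auto
  then show ?thesis by (simp add: le_less_trans)
qed

text \<open>
  Conversely \<open>(1 - \<rho>\<^sup>n) / (1 - \<rho>) = 1 + \<rho> + \<dots> + \<rho>\<^sup>n\<^sup>-\<^sup>1\<close> increases to \<open>n\<close>, and the partial sums weighted by it are at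
  most \<open>(kint 0 0 1 - kint 0 0 \<rho>) / (1 - \<rho>) \<le> dint 1\<close>.
\<close>

lemma dint_finite_imp_summable_weighted:
  assumes L: "is_local_time_at_0 M U (cbox 0 One) L"
    and P: "\<And>n. is_projection M (wiener_chaos n) L (P n)"
    and fin: "dint 1 < \<infinity>"
  shows "summable (\<lambda>n. real n * (\<integral>\<omega>. (P n \<omega>)\<^sup>2 \<partial>M))"
proof -
  define a where "a n = (\<integral>\<omega>. (P n \<omega>)\<^sup>2 \<partial>M)" for n
  define \<beta> where "\<beta> = (\<integral>\<omega>. (L \<omega>)\<^sup>2 \<partial>M)"
  have \<beta>: "kint 0 0 1 = ennreal \<beta>" using local_time_second_moment[OF L] by (simp add: \<beta>_def)
  have a: "a sums \<beta>" using local_time_Parseval[OF L P] by (simp add: a_def[abs_def] \<beta>_def)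
  have a0: "0 \<le> a n" for n by (simp add: a_def)
  obtain C where C: "dint 1 = ennreal C" "0 \<le> C" using fin by (cases "dint 1") auto
  have le: "(\<Sum>n<N. (\<Sum>j<n. \<rho> ^ j) * a n) \<le> C" if \<rho>: "0 \<le> \<rho>" "\<rho> < 1" for \<rho> N
  proof -
    obtain t where t: "(\<lambda>n. \<rho> ^ n * a n) sums t" "0 \<le> t" "ennreal t = kint 0 0 \<rho>"
      using local_time_chaos_sums[OF L P \<rho>] unfolding a_def by blast
    have "ennreal \<beta> \<le> ennreal (t + (1 - \<rho>) * C)"
      using kint_le_kint_plus_dint[OF \<rho>] \<rho> t(2) C(2)
      unfolding \<beta> t(3)[symmetric] C(1) by (simp add: ennreal_mult')
    moreover have "0 \<le> t + (1 - \<rho>) * C" using t(2) C(2) \<rho> by simp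
    ultimately have "\<beta> \<le> t + (1 - \<rho>) * C" by (simp only: ennreal_le_iff)
    then have b: "\<beta> - t \<le> (1 - \<rho>) * C" by simp
    have "(1 - \<rho>) * (\<Sum>n<N. (\<Sum>j<n. \<rho> ^ j) * a n) = (\<Sum>n<N. a n - \<rho> ^ n * a n)"
      unfolding sum_distrib_left
    proof (rule sum.cong[OF refl])
      show "(1 - \<rho>) * ((\<Sum>j<n. \<rho> ^ j) * a n) = a n - \<rho> ^ n * a n" for n
        unfolding mult.assoc[symmetric] one_diff_power_eq[symmetric] by (simp add: left_diff_distrib)
    qed
    also have "\<dots> \<le> \<beta> - t"
    proof (rule sum_le_sums[OF sums_diff[OF a t(1)]])
      show "0 \<le> a n - \<rho> ^ n * a n" for n
        using \<rho> a0[of n] by (simp add: mult_left_le_one_le power_le_one)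
    qed
    also note b
    finally show ?thesis using \<rho> by simp
  qed
  have "(\<Sum>n<N. real n * a n) \<le> C" for N
  proof (rule LIMSEQ_le_const2)
    have r1: "(\<lambda>k. 1 - eta k) \<longlonglongrightarrow> 1" using tendsto_diff[OF tendsto_const eta_tendsto, of 1] by simp
    have "(\<lambda>k. \<Sum>n<N. (\<Sum>j<n. (1 - eta k) ^ j) * a n) \<longlonglongrightarrow> (\<Sum>n<N. (\<Sum>j<n. 1 ^ j) * a n)"
      by (intro tendsto_intros r1)
    then show "(\<lambda>k. \<Sum>n<N. (\<Sum>j<n. (1 - eta k) ^ j) * a n) \<longlonglongrightarrow> (\<Sum>n<N. real n * a n)" by simp
    have "(\<Sum>n<N. (\<Sum>j<n. (1 - eta k) ^ j) * a n) \<le> C" for k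
      by (rule le) (auto simp: eta_def)
    then show "\<exists>K. \<forall>k\<ge>K. (\<Sum>n<N. (\<Sum>j<n. (1 - eta k) ^ j) * a n) \<le> C" by blast
  qed
  from this[of "Suc _"] show ?thesis
    unfolding a_def[symmetric] lessThan_Suc_atMost
    by (intro bounded_imp_summable[of _ C]) (auto simp: a0)
qed

theorem local_time_in_D1_iff:
  "(\<exists>L. is_local_time_at_0 M U (cbox 0 One) L \<and> L \<in> D1 M (coordinate_values U))
    \<longleftrightarrow> real CARD('d) + 2 < hdim"
proof
  assume "\<exists>L. is_local_time_at_0 M U (cbox 0 One) L \<and> L \<in> D1 M (coordinate_values U)"
  then obtain L Fn where L: "is_local_time_at_0 M U (cbox 0 One) L"
    and ex: "chaos_expansion M (coordinate_values U) L Fn"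
    and s: "summable (\<lambda>n. real n * (\<integral>\<omega>. \<bar>Fn n \<omega>\<bar>\<^sup>2 \<partial>M))"
    unfolding D1_def by blast
  have "dint 1 < \<infinity>"
    using summable_weighted_imp_dint_finite[OF L chaos_expansion_is_projection[OF ex]] s by simp
  then show "real CARD('d) + 2 < hdim" by (simp only: dint_finite_iff)
next
  assume h: "real CARD('d) + 2 < hdim"
  then have "real CARD('d) < hdim" by simp
  then obtain L where L: "is_local_time_at_0 M U (cbox 0 One) L" using local_time_exists_iff by blast
  have LL: "L \<in> L2 M" using L by (simp add: is_local_time_at_0_def L2_tendsto_def)
  have "\<exists>P. is_projection M (wiener_chaos n) L P" for n
    by (rule projection_exists[OF closed_subspace_chaos LL])
  then obtain P where P: "\<And>n. is_projection M (wiener_chaos n) L (P n)" by metis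
  have "dint 1 < \<infinity>" using h by (simp only: dint_finite_iff)
  from dint_finite_imp_summable_weighted[OF L P this]
  have "summable (\<lambda>n. real n * (\<integral>\<omega>. \<bar>P n \<omega>\<bar>\<^sup>2 \<partial>M))" by simp
  with chaos_expansionI[OF P local_time_Parseval[OF L P]] LL have "L \<in> D1 M (coordinate_values U)"
    unfolding D1_def by blast
  with L show "\<exists>L. is_local_time_at_0 M U (cbox 0 One) L \<and> L \<in> D1 M (coordinate_values U)" by blast
qed

end

section \<open>Covariances of the given fields\<close>

subsection \<open>Conditional variance and linear prediction\<close>

text \<open>
  Subtracting a multiple of \<open>Z\<close> from \<open>Y\<close> does not change \<open>Y - E[Y | Z]\<close>, and the mean square of
  \<open>V - E[V | Z]\<close> is at most that of \<open>V = Y - \<alpha> Z\<close>.  An almost sure lower bound on the conditional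
  variance is thus a lower bound on every linear prediction error.
\<close>

lemma (in prob_space) cond_variance_le_prediction_error:
  assumes Y: "Y \<in> L2 M" and Z: "Z \<in> L2 M"
    and \<kappa>: "AE \<omega> in M. \<kappa> \<le> cond_variance M Y Z \<omega>"
  shows "\<kappa> \<le> (\<integral>\<omega>. (Y \<omega> - \<alpha> * Z \<omega>)\<^sup>2 \<partial>M)"
proof -
  define F where "F = vimage_algebra (space M) Z borel"
  have [measurable]: "Y \<in> borel_measurable M" "Z \<in> borel_measurable M" using Y Z by (auto intro: L2_borel)
  have "subalgebra M F"
  proof -
    have "sets F \<subseteq> sets M"
      unfolding F_def using measurable_iff_sets[of Z M borel] by simp
    then show ?thesis by (simp add: subalgebra_def F_def)
  qed
  then interpret F: finite_measure_subalgebra M F by unfold_locales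
  have ZF: "Z \<in> borel_measurable F" unfolding F_def by (rule measurable_vimage_algebra1) simp
  define V where "V \<omega> = Y \<omega> - \<alpha> * Z \<omega>" for \<omega>
  have VL: "V \<in> L2 M" unfolding V_def by (intro L2_diff L2_scale Y Z)
  have [measurable]: "V \<in> borel_measurable M" using VL by (rule L2_borel)
  define G where "G = real_cond_exp M F V"
  define W where "W = real_cond_exp M F Y"
  have [measurable]: "G \<in> borel_measurable M" "W \<in> borel_measurable M" unfolding G_def W_def by simp_all
  note int = L2_integrable[OF Y] L2_integrable[OF Z] L2_integrable[OF VL]
  have "AE \<omega> in M. G \<omega> = W \<omega> - \<alpha> * Z \<omega>"
    using F.real_cond_exp_diff[OF int(1) integrable_mult_right[OF int(2), of \<alpha>]]
      F.real_cond_exp_cmult[OF int(2), of \<alpha>] F.real_cond_exp_F_meas[OF int(2) ZF]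
    unfolding G_def W_def V_def by eventually_elim simp
  then have YW: "AE \<omega> in M. (Y \<omega> - W \<omega>)\<^sup>2 = (V \<omega> - G \<omega>)\<^sup>2"
    by eventually_elim (simp add: V_def)
  have V2: "integrable M (\<lambda>\<omega>. (V \<omega>)\<^sup>2)" using VL by (rule L2_square_integrable)
  have GL: "G \<in> L2 M"
  proof -
    have "AE \<omega> in M. (G \<omega>)\<^sup>2 \<le> real_cond_exp M F (\<lambda>\<omega>. (V \<omega>)\<^sup>2) \<omega>"
      unfolding G_def
      by (rule F.real_cond_exp_jensens_inequality(2)[OF int(3), of UNIV]) (auto simp: V2 convex_power2)
    then have "integrable M (\<lambda>\<omega>. (G \<omega>)\<^sup>2)"
      by (intro Bochner_Integration.integrable_bound[OF F.real_cond_exp_int(1)[OF V2]]) (auto elim!: eventually_mono)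
    then show ?thesis by (simp add: L2_def)
  qed
  have inner: "(\<integral>\<omega>. V \<omega> * G \<omega> \<partial>M) = (\<integral>\<omega>. (G \<omega>)\<^sup>2 \<partial>M)"
  proof -
    have "G \<in> borel_measurable F" unfolding G_def by simp
    from F.real_cond_exp_intg(2)[OF L2_mult_integrable[OF GL VL] this]
    show ?thesis unfolding G_def[symmetric] by (simp add: power2_eq_square mult.commute)
  qed
  have VG2: "integrable M (\<lambda>\<omega>. (V \<omega> - G \<omega>)\<^sup>2)" by (rule L2_square_integrable[OF L2_diff[OF VL GL]])
  have YW2: "integrable M (\<lambda>\<omega>. (Y \<omega> - W \<omega>)\<^sup>2)"
    by (rule integrable_cong_AE[THEN iffD2, OF _ _ YW VG2]) simp_all
  have "\<kappa> = (\<integral>\<omega>. \<kappa> \<partial>M)" by (simp add: prob_space)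
  also have "\<dots> \<le> (\<integral>\<omega>. cond_variance M Y Z \<omega> \<partial>M)"
    using \<kappa> F.real_cond_exp_int(1)[OF YW2]
    unfolding cond_variance_def Let_def F_def[symmetric] W_def[symmetric] by (intro integral_mono_AE) simp_all
  also have "\<dots> = (\<integral>\<omega>. (Y \<omega> - W \<omega>)\<^sup>2 \<partial>M)"
    using F.real_cond_exp_int(2)[OF YW2]
    unfolding cond_variance_def Let_def F_def[symmetric] W_def[symmetric] .
  also have "\<dots> = (\<integral>\<omega>. (V \<omega> + (-1) * G \<omega>)\<^sup>2 \<partial>M)"
    by (rule integral_cong_AE) (use YW in auto)
  also have "\<dots> = (\<integral>\<omega>. (V \<omega>)\<^sup>2 \<partial>M) - (\<integral>\<omega>. (G \<omega>)\<^sup>2 \<partial>M)"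
    unfolding L2_integral_square_add[OF VL GL] inner by simp
  also have "\<dots> \<le> (\<integral>\<omega>. (V \<omega>)\<^sup>2 \<partial>M)" by simp
  finally show ?thesis by (simp add: V_def)
qed

subsection \<open>Moment generating functions\<close>

text \<open>
  Scale to the standard normal density and complete the square; in the degenerate case both sides of
  the formula are 1.
\<close>

lemma (in prob_space) centered_gaussian_rv_mgf:
  assumes Y: "centered_gaussian_rv M Y"
  shows "Y \<in> L2 M" and "integrable M (\<lambda>\<omega>. exp (Y \<omega>))"
    and "(\<integral>\<omega>. exp (Y \<omega>) \<partial>M) = exp ((\<integral>\<omega>. (Y \<omega>)\<^sup>2 \<partial>M) / 2)"
proof -
  have [measurable]: "Y \<in> borel_measurable M" using Y by (simp add: centered_gaussian_rv_def)
  have "Y \<in> L2 M \<and> integrable M (\<lambda>\<omega>. exp (Y \<omega>)) \<and> (\<integral>\<omega>. exp (Y \<omega>) \<partial>M) = exp ((\<integral>\<omega>. (Y \<omega>)\<^sup>2 \<partial>M) / 2)"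
  proof (cases "AE \<omega> in M. Y \<omega> = 0")
    case True
    then have 1: "AE \<omega> in M. exp (Y \<omega>) = 1" and 2: "AE \<omega> in M. (Y \<omega>)\<^sup>2 = 0" by (auto elim!: eventually_mono)
    have "integrable M (\<lambda>\<omega>. exp (Y \<omega>))" "integrable M (\<lambda>\<omega>. (Y \<omega>)\<^sup>2)"
      using integrable_cong_AE[OF _ _ 1] integrable_cong_AE[OF _ _ 2] by auto
    moreover have "(\<integral>\<omega>. exp (Y \<omega>) \<partial>M) = 1" "(\<integral>\<omega>. (Y \<omega>)\<^sup>2 \<partial>M) = 0"
      using integral_cong_AE[OF _ _ 1] integral_cong_AE[OF _ _ 2] by (auto simp: prob_space)
    ultimately show ?thesis by (simp add: L2_def)
  next
    case False
    then obtain \<sigma> where \<sigma>: "\<sigma> > 0" and D: "distributed M lborel Y (normal_density 0 \<sigma>)"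
      using Y by (auto simp: centered_gaussian_rv_def)
    have Z: "distributed M lborel (\<lambda>\<omega>. Y \<omega> / \<sigma>) std_normal_density"
      using normal_standard_normal_convert[OF \<sigma>, of Y 0] D by simp
    have "integrable M (\<lambda>\<omega>. (Y \<omega>)\<^sup>2)"
      using distributed_integrable[OF D, of "\<lambda>x. x\<^sup>2"] integrable_normal_moment[OF \<sigma>, of 0 2] by simp
    moreover have "(\<integral>\<omega>. (Y \<omega>)\<^sup>2 \<partial>M) = \<sigma>\<^sup>2"
      using normal_distributed_variance[OF \<sigma> D] normal_distributed_expectation[OF \<sigma> D] by simp
    moreover have nn: "(\<integral>\<^sup>+\<omega>. ennreal (exp (Y \<omega>)) \<partial>M) = ennreal (exp (\<sigma>\<^sup>2 / 2))"
    proof -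
      have "(\<integral>\<^sup>+\<omega>. ennreal (exp (Y \<omega>)) \<partial>M) = (\<integral>\<^sup>+\<omega>. ennreal (exp (\<sigma> * (Y \<omega> / \<sigma>))) \<partial>M)"
        using \<sigma> by simp
      also have "\<dots> = (\<integral>\<^sup>+x. std_normal_density x * ennreal (exp (\<sigma> * x)) \<partial>lborel)"
        by (rule distributed_nn_integral[OF Z, symmetric]) simp
      also have "\<dots> = (\<integral>\<^sup>+x. ennreal (exp (\<sigma> * x)) \<partial>std_normal)"
        by (rule nn_integral_density[symmetric]) simp_all
      also have "\<dots> = ennreal (exp (\<sigma>\<^sup>2 / 2))"
        using std_normal_nn_integral_exp_quadratic[of 0 \<sigma>] by simp
      finally show ?thesis .
    qed
    moreover have "integrable M (\<lambda>\<omega>. exp (Y \<omega>))"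
      unfolding integrable_iff_bounded using nn by simp
    moreover from nn have "(\<integral>\<omega>. exp (Y \<omega>) \<partial>M) = exp (\<sigma>\<^sup>2 / 2)"
      by (subst integral_eq_nn_integral) auto
    ultimately show ?thesis by (simp add: L2_def)
  qed
  then show "Y \<in> L2 M" "integrable M (\<lambda>\<omega>. exp (Y \<omega>))" "(\<integral>\<omega>. exp (Y \<omega>) \<partial>M) = exp ((\<integral>\<omega>. (Y \<omega>)\<^sup>2 \<partial>M) / 2)" by blast+
qed

definition covariance :: "'v measure \<Rightarrow> ('t \<Rightarrow> 'v \<Rightarrow> real) \<Rightarrow> 't \<Rightarrow> 't \<Rightarrow> real" where
  "covariance M X s t = (\<integral>\<omega>. X s \<omega> * X t \<omega> \<partial>M)"

text \<open>
  The map \<open>f\<close> may identify indices, as the projections of a finite set of pairs \<open>(s, t)\<close> do.  Collecting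
  the coefficients turns a family indexed by pairs into a finite linear combination of distinct values
  of the field.
\<close>

lemma sum_regroup:
  fixes c :: "'a \<Rightarrow> real"
  assumes "finite T"
  shows "(\<Sum>z\<in>T. c z * g (f z)) = (\<Sum>s\<in>f ` T. (\<Sum>z\<in>T. if f z = s then c z else 0) * g s)"
proof -
  have "(\<Sum>s\<in>f ` T. (\<Sum>z\<in>T. if f z = s then c z else 0) * g s) = (\<Sum>s\<in>f ` T. \<Sum>z\<in>T. if f z = s then c z * g s else 0)"
    unfolding sum_distrib_right by (intro sum.cong refl) auto
  also have "\<dots> = (\<Sum>z\<in>T. \<Sum>s\<in>f ` T. if f z = s then c z * g s else 0)" by (rule sum.swap)
  also have "\<dots> = (\<Sum>z\<in>T. c z * g (f z))"
    using assms by (intro sum.cong refl) (simp add: sum.delta')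
  finally show ?thesis by simp
qed

lemma centered_gaussian_field_lincomb:
  "centered_gaussian_field M X \<Longrightarrow> finite T \<Longrightarrow> centered_gaussian_rv M (\<lambda>\<omega>. \<Sum>t\<in>T. c t * X t \<omega>)"
  by (simp add: centered_gaussian_field_def)

lemma centered_gaussian_field_L2:
  assumes X: "centered_gaussian_field M X"
  shows "X t \<in> L2 M"
proof -
  interpret prob_space M using X by (simp add: centered_gaussian_field_def)
  from centered_gaussian_rv_mgf(1)[OF centered_gaussian_field_lincomb[OF X, of "{t}" "\<lambda>_. 1"]]
  show ?thesis by simp
qed

lemma integral_square_lincomb:
  assumes X: "\<And>t. X t \<in> L2 M"
  shows "(\<integral>\<omega>. (\<Sum>z\<in>T. c z * X (f z) \<omega>)\<^sup>2 \<partial>M) = (\<Sum>z\<in>T. \<Sum>z'\<in>T. c z * c z' * covariance M X (f z) (f z'))"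
proof -
  have "(\<integral>\<omega>. (\<Sum>z\<in>T. c z * X (f z) \<omega>)\<^sup>2 \<partial>M)
    = (\<integral>\<omega>. (\<Sum>z\<in>T. \<Sum>z'\<in>T. (c z * c z') * (X (f z) \<omega> * X (f z') \<omega>)) \<partial>M)"
    by (simp add: power2_eq_square sum_product mult_ac)
  also have "\<dots> = (\<Sum>z\<in>T. \<Sum>z'\<in>T. c z * c z' * covariance M X (f z) (f z'))"
    unfolding covariance_def
    by (simp add: Bochner_Integration.integral_sum Bochner_Integration.integrable_sum L2_mult_integrable[OF X X] integrable_mult_right)
  finally show ?thesis .
qed

lemma centered_gaussian_field_mgf:
  assumes X: "centered_gaussian_field M X" and T: "finite T"
  shows "integrable M (\<lambda>\<omega>. exp (\<Sum>z\<in>T. c z * X (f z) \<omega>))"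
    and "(\<integral>\<omega>. exp (\<Sum>z\<in>T. c z * X (f z) \<omega>) \<partial>M) = exp ((\<Sum>z\<in>T. \<Sum>z'\<in>T. c z * c z' * covariance M X (f z) (f z')) / 2)"
proof -
  interpret prob_space M using X by (simp add: centered_gaussian_field_def)
  have "centered_gaussian_rv M (\<lambda>\<omega>. \<Sum>z\<in>T. c z * X (f z) \<omega>)"
    unfolding sum_regroup[OF T, of c "\<lambda>s. X s _"]
    by (rule centered_gaussian_field_lincomb[OF X finite_imageI[OF T]])
  from centered_gaussian_rv_mgf(2,3)[OF this]
  show "integrable M (\<lambda>\<omega>. exp (\<Sum>z\<in>T. c z * X (f z) \<omega>))"
    and "(\<integral>\<omega>. exp (\<Sum>z\<in>T. c z * X (f z) \<omega>) \<partial>M) = exp ((\<Sum>z\<in>T. \<Sum>z'\<in>T. c z * c z' * covariance M X (f z) (f z')) / 2)"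
    unfolding integral_square_lincomb[where X = X and c = c and f = f and T = T, OF centered_gaussian_field_L2[OF X]]
    by blast+
qed

text \<open>
  The coordinates are independent, so the exponential of a sum over coordinates has the product of the
  expectations; each factor depends only on the law of a coordinate, which is that of \<open>X0\<close>.
\<close>

lemma gaussian_random_field_mgf:
  fixes X :: "real ^ 'n \<Rightarrow> 'w \<Rightarrow> real ^ 'd" and X0 :: "real ^ 'n \<Rightarrow> 'v \<Rightarrow> real"
  assumes X: "gaussian_random_field M X M0 X0" and T: "finite T"
  shows "integrable M (\<lambda>\<omega>. exp (\<Sum>z\<in>T. \<Sum>i\<in>UNIV. c z i * X (f z) \<omega> $ i))"
    and "(\<integral>\<omega>. exp (\<Sum>z\<in>T. \<Sum>i\<in>UNIV. c z i * X (f z) \<omega> $ i) \<partial>M)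
      = exp ((\<Sum>i\<in>UNIV. \<Sum>z\<in>T. \<Sum>z'\<in>T. c z i * c z' i * covariance M0 X0 (f z) (f z')) / 2)"
proof -
  interpret prob_space M using X by (simp add: gaussian_random_field_def)
  have X0: "centered_gaussian_field M0 X0" using X by (simp add: gaussian_random_field_def)
  have ind: "indep_vars (\<lambda>_. Pi\<^sub>M UNIV (\<lambda>_. borel)) (\<lambda>i \<omega> t. X t \<omega> $ i) UNIV"
    using X by (simp add: gaussian_random_field_def)
  have law: "distr M (Pi\<^sub>M UNIV (\<lambda>_. borel)) (\<lambda>\<omega> t. X t \<omega> $ i) = distr M0 (Pi\<^sub>M UNIV (\<lambda>_. borel)) (\<lambda>\<omega> t. X0 t \<omega>)" for i
    using X by (simp add: gaussian_random_field_def)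
  have rv: "(\<lambda>\<omega> t. X t \<omega> $ i) \<in> measurable M (Pi\<^sub>M UNIV (\<lambda>_. borel))" for i
    using ind by (auto simp: indep_vars_def2)
  have rv0: "(\<lambda>\<omega> t. X0 t \<omega>) \<in> measurable M0 (Pi\<^sub>M UNIV (\<lambda>_. borel))"
    by (rule measurable_PiM_single') (auto intro: L2_borel centered_gaussian_field_L2[OF X0])
  define \<phi> where "\<phi> i x = exp (\<Sum>z\<in>T. c z i * x (f z))" for i and x :: "real ^ 'n \<Rightarrow> real"
  have \<phi> [measurable]: "\<phi> i \<in> borel_measurable (Pi\<^sub>M UNIV (\<lambda>_. borel))" for i
    unfolding \<phi>_def by measurable
  have int: "integrable M (\<lambda>\<omega>. \<phi> i (\<lambda>t. X t \<omega> $ i))" for i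
  proof -
    have "integrable M0 (\<lambda>\<omega>. \<phi> i (\<lambda>t. X0 t \<omega>))"
      unfolding \<phi>_def by (rule centered_gaussian_field_mgf(1)[OF X0 T])
    then have "integrable (distr M (Pi\<^sub>M UNIV (\<lambda>_. borel)) (\<lambda>\<omega> t. X t \<omega> $ i)) (\<phi> i)"
      unfolding law by (subst integrable_distr_eq[OF rv0 \<phi>])
    then show ?thesis by (subst (asm) integrable_distr_eq[OF rv \<phi>])
  qed
  have val: "(\<integral>\<omega>. \<phi> i (\<lambda>t. X t \<omega> $ i) \<partial>M) = exp ((\<Sum>z\<in>T. \<Sum>z'\<in>T. c z i * c z' i * covariance M0 X0 (f z) (f z')) / 2)" for i
  proof -
    have "(\<integral>\<omega>. \<phi> i (\<lambda>t. X t \<omega> $ i) \<partial>M) = (\<integral>\<omega>. \<phi> i (\<lambda>t. X0 t \<omega>) \<partial>M0)"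
      using integral_distr[OF rv \<phi>, of i i] integral_distr[OF rv0 \<phi>, of i] law[of i] by simp
    also have "\<dots> = exp ((\<Sum>z\<in>T. \<Sum>z'\<in>T. c z i * c z' i * covariance M0 X0 (f z) (f z')) / 2)"
      unfolding \<phi>_def by (rule centered_gaussian_field_mgf(2)[OF X0 T])
    finally show ?thesis .
  qed
  have ind': "indep_vars (\<lambda>_. borel) (\<lambda>i \<omega>. \<phi> i (\<lambda>t. X t \<omega> $ i)) UNIV"
    by (rule indep_vars_compose2[OF ind]) simp
  have prod: "exp (\<Sum>z\<in>T. \<Sum>i\<in>UNIV. c z i * X (f z) \<omega> $ i) = (\<Prod>i\<in>UNIV. \<phi> i (\<lambda>t. X t \<omega> $ i))" for \<omega>
    unfolding \<phi>_def by (subst sum.swap) (rule exp_sum, simp)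
  show "integrable M (\<lambda>\<omega>. exp (\<Sum>z\<in>T. \<Sum>i\<in>UNIV. c z i * X (f z) \<omega> $ i))"
    unfolding prod by (rule indep_vars_integrable[OF _ ind' int]) simp
  show "(\<integral>\<omega>. exp (\<Sum>z\<in>T. \<Sum>i\<in>UNIV. c z i * X (f z) \<omega> $ i) \<partial>M)
      = exp ((\<Sum>i\<in>UNIV. \<Sum>z\<in>T. \<Sum>z'\<in>T. c z i * c z' i * covariance M0 X0 (f z) (f z')) / 2)"
    unfolding prod by (subst indep_vars_lebesgue_integral[OF _ ind' int])
      (simp_all only: val sum_divide_distrib exp_sum[OF finite] finite)
qed

lemma gaussian_random_field_borel:
  fixes X :: "real ^ 'n \<Rightarrow> 'w \<Rightarrow> real ^ 'd"
  assumes X: "gaussian_random_field M X M0 X0"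
  shows "X t \<in> borel_measurable M"
proof -
  interpret prob_space M using X by (simp add: gaussian_random_field_def)
  have "(\<lambda>\<omega> t. X t \<omega> $ i) \<in> measurable M (Pi\<^sub>M UNIV (\<lambda>_. borel))" for i
    using X by (auto simp: gaussian_random_field_def indep_vars_def2)
  from measurable_compose[OF this measurable_component_singleton[of t]]
  have "(\<lambda>\<omega>. X t \<omega> $ i) \<in> borel_measurable M" for i by simp
  then show ?thesis
    by (intro borel_measurable_euclidean_space[THEN iffD2]) (auto simp: Basis_vec_def inner_axis)
qed

text \<open>
  A measurable function of the whole field generates no events outside the sigma-algebra of the field,
  so independence of the fields passes to such functions.
\<close>

lemma field_functional_preimages:
  assumes "\<phi> \<in> borel_measurable (Pi\<^sub>M UNIV (\<lambda>_. borel))"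
  shows "{(\<lambda>\<omega>. \<phi> (\<lambda>t. X t \<omega>)) -` A \<inter> space M | A. A \<in> sets borel} \<subseteq> field_sigma M X"
proof -
  have "(\<lambda>\<omega> t. X t \<omega>) \<in> measurable (vimage_algebra (space M) (\<lambda>\<omega> t. X t \<omega>) (Pi\<^sub>M UNIV (\<lambda>_. borel))) (Pi\<^sub>M UNIV (\<lambda>_. borel))"
    by (rule measurable_vimage_algebra1) (simp add: space_PiM)
  from measurable_sets[OF measurable_compose[OF this assms]]
  show ?thesis unfolding field_sigma_def by auto
qed

lemma (in prob_space) independent_fields_expectation_mult:
  fixes X :: "real ^ 'n \<Rightarrow> 'a \<Rightarrow> real ^ 'd" and Y :: "real ^ 'm \<Rightarrow> 'a \<Rightarrow> real ^ 'd"
  assumes ind: "independent_fields M X Y"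
    and \<phi>: "\<phi> \<in> borel_measurable (Pi\<^sub>M UNIV (\<lambda>_. borel))" and \<psi>: "\<psi> \<in> borel_measurable (Pi\<^sub>M UNIV (\<lambda>_. borel))"
    and int: "integrable M (\<lambda>\<omega>. \<phi> (\<lambda>t. X t \<omega>))" "integrable M (\<lambda>\<omega>. \<psi> (\<lambda>t. Y t \<omega>) :: real)"
  shows "integrable M (\<lambda>\<omega>. \<phi> (\<lambda>t. X t \<omega>) * \<psi> (\<lambda>t. Y t \<omega>))"
    and "(\<integral>\<omega>. \<phi> (\<lambda>t. X t \<omega>) * \<psi> (\<lambda>t. Y t \<omega>) \<partial>M) = (\<integral>\<omega>. \<phi> (\<lambda>t. X t \<omega>) \<partial>M) * (\<integral>\<omega>. \<psi> (\<lambda>t. Y t \<omega>) \<partial>M)"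
proof -
  have sig: "sigma_sets (space M) {(\<lambda>\<omega>. F (\<lambda>t. Z t \<omega>)) -` A \<inter> space M | A. A \<in> sets borel} \<subseteq> field_sigma M Z"
    if "F \<in> borel_measurable (Pi\<^sub>M UNIV (\<lambda>_. borel))" for F :: "('t \<Rightarrow> real ^ 'd) \<Rightarrow> real" and Z :: "'t \<Rightarrow> 'a \<Rightarrow> real ^ 'd"
    using field_functional_preimages[OF that, of Z M]
      sets.sigma_sets_subset[of _ "vimage_algebra (space M) (\<lambda>\<omega> t. Z t \<omega>) (Pi\<^sub>M UNIV (\<lambda>_. borel))"]
    unfolding field_sigma_def by simp
  have "indep_var borel (\<lambda>\<omega>. \<phi> (\<lambda>t. X t \<omega>)) borel (\<lambda>\<omega>. \<psi> (\<lambda>t. Y t \<omega>))"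
    unfolding indep_var_eq
  proof (intro conjI)
    show "random_variable borel (\<lambda>\<omega>. \<phi> (\<lambda>t. X t \<omega>))" "random_variable borel (\<lambda>\<omega>. \<psi> (\<lambda>t. Y t \<omega>))"
      using int by auto
    show "indep_set (sigma_sets (space M) {(\<lambda>\<omega>. \<phi> (\<lambda>t. X t \<omega>)) -` A \<inter> space M | A. A \<in> sets borel})
      (sigma_sets (space M) {(\<lambda>\<omega>. \<psi> (\<lambda>t. Y t \<omega>)) -` A \<inter> space M | A. A \<in> sets borel})"
      using ind[unfolded independent_fields_def indep_set_def] sig[OF \<phi>, of X] sig[OF \<psi>, of Y]
      unfolding indep_set_def by (elim indep_sets_mono_sets) (auto split: bool.splits)
  qed
  from indep_var_integrable[OF this int] indep_var_lebesgue_integral[OF this int]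
  show "integrable M (\<lambda>\<omega>. \<phi> (\<lambda>t. X t \<omega>) * \<psi> (\<lambda>t. Y t \<omega>))"
    and "(\<integral>\<omega>. \<phi> (\<lambda>t. X t \<omega>) * \<psi> (\<lambda>t. Y t \<omega>) \<partial>M) = (\<integral>\<omega>. \<phi> (\<lambda>t. X t \<omega>) \<partial>M) * (\<integral>\<omega>. \<psi> (\<lambda>t. Y t \<omega>) \<partial>M)"
    by auto
qed

section \<open>The difference of two independent fields\<close>

lemma sum_Basis_prod:
  "(\<Sum>b\<in>(Basis :: ('a::euclidean_space \<times> 'b::euclidean_space) set). f b) = (\<Sum>u\<in>Basis. f (u, 0)) + (\<Sum>v\<in>Basis. f (0, v))"
proof -
  have "(\<Sum>b\<in>(Basis :: ('a \<times> 'b) set). f b) = (\<Sum>b\<in>(\<lambda>u. (u, 0)) ` Basis. f b) + (\<Sum>b\<in>(\<lambda>v. (0, v)) ` Basis. f b)"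
    unfolding Basis_prod_def by (rule sum.union_disjoint) auto
  also have "(\<Sum>b\<in>(\<lambda>u. (u, 0 :: 'b)) ` (Basis :: 'a set). f b) = (\<Sum>u\<in>Basis. f (u, 0))"
    by (subst sum.reindex) (auto simp: inj_on_def)
  also have "(\<Sum>b\<in>(\<lambda>v. (0 :: 'a, v)) ` (Basis :: 'b set). f b) = (\<Sum>v\<in>Basis. f (0, v))"
    by (subst sum.reindex) (auto simp: inj_on_def)
  finally show ?thesis .
qed

lemma sum_Basis_vec: "(\<Sum>u\<in>(Basis :: (real ^ 'n) set). f u) = (\<Sum>j\<in>UNIV. f (axis j 1))"
proof -
  have "(Basis :: (real ^ 'n) set) = range (\<lambda>j. axis j 1)" by (auto simp: Basis_vec_def)
  then have "(\<Sum>u\<in>(Basis :: (real ^ 'n) set). f u) = sum f (range (\<lambda>j. axis j 1))" by (rule arg_cong)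
  also have "\<dots> = (\<Sum>j\<in>UNIV. f (axis j 1))"
    by (subst sum.reindex) (auto simp: inj_on_def axis_eq_axis)
  finally show ?thesis .
qed

lemma unit_cube_Times: "(unit_cube :: (real ^ 'n) set) \<times> (unit_cube :: (real ^ 'm) set) = cbox 0 One"
proof (rule set_eqI)
  fix z :: "(real ^ 'n) \<times> (real ^ 'm)"
  have "z \<in> cbox 0 One \<longleftrightarrow> (\<forall>b\<in>Basis. 0 \<le> z \<bullet> b \<and> z \<bullet> b \<le> 1)"
    by (simp add: mem_box)
  also have "\<dots> \<longleftrightarrow> (\<forall>j. 0 \<le> fst z $ j \<and> fst z $ j \<le> 1) \<and> (\<forall>j. 0 \<le> snd z $ j \<and> snd z $ j \<le> 1)"
    unfolding Basis_prod_def ball_Un ball_simps Basis_vec_def by (simp add: inner_axis inner_prod_def)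
  finally have "z \<in> cbox 0 One \<longleftrightarrow> (\<forall>j. 0 \<le> fst z $ j \<and> fst z $ j \<le> 1) \<and> (\<forall>j. 0 \<le> snd z $ j \<and> snd z $ j \<le> 1)" .
  then show "z \<in> unit_cube \<times> unit_cube \<longleftrightarrow> z \<in> cbox 0 One"
    by (cases z) (auto simp: unit_cube_def mem_box_cart)
qed

lemma covariance_increment:
  assumes "\<And>t. X t \<in> L2 M"
  shows "(\<integral>\<omega>. (X t \<omega> - \<alpha> * X s \<omega>)\<^sup>2 \<partial>M) = covariance M X t t - 2 * \<alpha> * covariance M X s t + \<alpha>\<^sup>2 * covariance M X s s"
  using L2_integral_square_add[OF assms assms, where t = "- \<alpha>"]
  by (simp add: covariance_def power2_eq_square mult.commute)

lemma condition_C1_covariance: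
  assumes "condition_C1 M X H" and X: "\<And>t. X t \<in> L2 M"
  obtains c where "c > 0" "\<And>s t. s \<in> unit_cube \<Longrightarrow> t \<in> unit_cube \<Longrightarrow>
    covariance M X s s - 2 * covariance M X s t + covariance M X t t \<le> c * (\<Sum>j\<in>UNIV. \<bar>s $ j - t $ j\<bar> powr (2 * H $ j))"
proof -
  obtain c where c: "c > 0" and le: "\<And>s t. s \<in> unit_cube \<Longrightarrow> t \<in> unit_cube \<Longrightarrow>
    (\<integral>\<omega>. (X s \<omega> - X t \<omega>)\<^sup>2 \<partial>M) \<le> c * (\<Sum>j\<in>UNIV. \<bar>s $ j - t $ j\<bar> powr (2 * H $ j))"
    using assms(1) unfolding condition_C1_def by blast
  have "(\<integral>\<omega>. (X s \<omega> - X t \<omega>)\<^sup>2 \<partial>M) = covariance M X s s - 2 * covariance M X s t + covariance M X t t" for s t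
    using covariance_increment[OF X, where \<alpha> = 1] by (simp add: covariance_def mult.commute)
  with le show thesis by (intro that[OF c]) simp
qed

lemma condition_C2_covariance:
  assumes "condition_C2 M X H" and X: "\<And>t. X t \<in> L2 M" and M: "prob_space M"
  obtains c where "c > 0" "\<And>s t \<alpha>. s \<in> unit_cube \<Longrightarrow> t \<in> unit_cube \<Longrightarrow>
    c * (\<Sum>j\<in>UNIV. min (\<bar>s $ j - t $ j\<bar> powr (2 * H $ j)) (\<bar>t $ j\<bar> powr (2 * H $ j)))
      \<le> covariance M X t t - 2 * \<alpha> * covariance M X s t + \<alpha>\<^sup>2 * covariance M X s s"
proof -
  interpret prob_space M by (rule M)
  obtain c where c: "c > 0" and ae: "\<And>s t. s \<in> unit_cube \<Longrightarrow> t \<in> unit_cube \<Longrightarrow>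
    AE \<omega> in M. c * (\<Sum>j\<in>UNIV. min (\<bar>s $ j - t $ j\<bar> powr (2 * H $ j)) (\<bar>t $ j\<bar> powr (2 * H $ j)))
       \<le> cond_variance M (X t) (X s) \<omega>"
    using assms(1) unfolding condition_C2_def by blast
  show thesis
    by (rule that[OF c]) (unfold covariance_increment[OF X, symmetric], intro cond_variance_le_prediction_error X ae)
qed

lemma measurable_coordinate_component:
  "(\<lambda>x. x t $ i) \<in> borel_measurable (Pi\<^sub>M UNIV (\<lambda>_. borel :: (real ^ 'd) measure))"
proof -
  have "(\<lambda>x. x t) \<in> Pi\<^sub>M UNIV (\<lambda>_. borel :: (real ^ 'd) measure) \<rightarrow>\<^sub>M borel" by simp
  from measurable_compose[OF this borel_measurable_vec_nth] show ?thesis .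
qed

text \<open>
  By independence, the moment generating function of the difference is the product of those of \<open>XH\<close>
  and of \<open>- XK\<close>, so the covariances add.
\<close>

lemma gaussian_vector_field_difference:
  fixes XH :: "real ^ 'n1 \<Rightarrow> 'w \<Rightarrow> real ^ 'd" and XK :: "real ^ 'n2 \<Rightarrow> 'w \<Rightarrow> real ^ 'd"
    and XH0 :: "real ^ 'n1 \<Rightarrow> 'u \<Rightarrow> real" and XK0 :: "real ^ 'n2 \<Rightarrow> 'v \<Rightarrow> real"
  assumes X: "gaussian_random_field M XH MH XH0" and Y: "gaussian_random_field M XK MK XK0"
    and ind: "independent_fields M XH XK"
  shows "gaussian_vector_field M (difference_field XH XK)
    (\<lambda>z z'. covariance MH XH0 (fst z) (fst z') + covariance MK XK0 (snd z) (snd z')) (cbox 0 One)"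
proof -
  interpret prob_space M using X by (simp add: gaussian_random_field_def)
  show ?thesis
  proof
    show "difference_field XH XK z \<in> borel_measurable M" for z
      using gaussian_random_field_borel[OF X, of "fst z"] gaussian_random_field_borel[OF Y, of "snd z"]
      by (cases z) (simp add: difference_field_def)
    show "covariance MH XH0 (fst z) (fst z') + covariance MK XK0 (snd z) (snd z')
      = covariance MH XH0 (fst z') (fst z) + covariance MK XK0 (snd z') (snd z)" for z z'
      by (simp add: covariance_def mult.commute)
    show "continuous_on (cbox 0 One) (\<lambda>z. difference_field XH XK z \<omega>)" if "\<omega> \<in> space M" for \<omega>
    proof -
      have X': "continuous_on unit_cube (\<lambda>t. XH t \<omega>)" and Y': "continuous_on unit_cube (\<lambda>t. XK t \<omega>)"
        using X Y that by (auto simp: gaussian_random_field_def)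
      have "continuous_on (unit_cube \<times> unit_cube) (\<lambda>z. XH (fst z) \<omega> - XK (snd z) \<omega>)"
        by (intro continuous_on_diff continuous_on_compose2[OF X'] continuous_on_compose2[OF Y'] continuous_intros) auto
      then show ?thesis by (simp add: unit_cube_Times difference_field_def split_beta')
    qed
    show "continuous_on UNIV (\<lambda>(z :: (real ^ 'n1) \<times> (real ^ 'n2), z').
       covariance MH XH0 (fst z) (fst z') + covariance MK XK0 (snd z) (snd z'))"
    proof -
      have cX: "continuous_on UNIV (\<lambda>p. covariance MH XH0 (fst p) (snd p))"
        and cY: "continuous_on UNIV (\<lambda>p. covariance MK XK0 (fst p) (snd p))"
        using X Y by (simp_all add: gaussian_random_field_def continuous_covariance_def covariance_def split_beta')
      have "continuous_on UNIV (\<lambda>p :: ((real ^ 'n1) \<times> (real ^ 'n2)) \<times> ((real ^ 'n1) \<times> (real ^ 'n2)).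
        covariance MH XH0 (fst (fst (fst p), fst (snd p))) (snd (fst (fst p), fst (snd p)))
        + covariance MK XK0 (fst (snd (fst p), snd (snd p))) (snd (snd (fst p), snd (snd p))))"
        by (intro continuous_on_add continuous_on_compose2[OF cX] continuous_on_compose2[OF cY] continuous_intros) auto
      then show ?thesis by (simp add: split_beta')
    qed
    fix T :: "((real ^ 'n1) \<times> (real ^ 'n2)) set" and c :: "(real ^ 'n1) \<times> (real ^ 'n2) \<Rightarrow> 'd \<Rightarrow> real"
    assume T: "finite T"
    define \<phi> where "\<phi> x = exp (\<Sum>z\<in>T. \<Sum>i\<in>UNIV. c z i * x (fst z) $ i)" for x :: "real ^ 'n1 \<Rightarrow> real ^ 'd"
    define \<psi> where "\<psi> x = exp (\<Sum>z\<in>T. \<Sum>i\<in>UNIV. (- c z i) * x (snd z) $ i)" for x :: "real ^ 'n2 \<Rightarrow> real ^ 'd"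
    have m: "\<phi> \<in> borel_measurable (Pi\<^sub>M UNIV (\<lambda>_. borel))" "\<psi> \<in> borel_measurable (Pi\<^sub>M UNIV (\<lambda>_. borel))"
      unfolding \<phi>_def[abs_def] \<psi>_def[abs_def]
      by - (rule measurable_compose[OF _ borel_measurable_exp], intro borel_measurable_sum borel_measurable_times borel_measurable_const measurable_coordinate_component)+
    have int: "integrable M (\<lambda>\<omega>. \<phi> (\<lambda>t. XH t \<omega>))" "integrable M (\<lambda>\<omega>. \<psi> (\<lambda>t. XK t \<omega>))"
      unfolding \<phi>_def \<psi>_def by (rule gaussian_random_field_mgf(1)[OF X T], rule gaussian_random_field_mgf(1)[OF Y T])
    have eq: "exp (\<Sum>z\<in>T. \<Sum>i\<in>UNIV. c z i * difference_field XH XK z \<omega> $ i) = \<phi> (\<lambda>t. XH t \<omega>) * \<psi> (\<lambda>t. XK t \<omega>)" for \<omega>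
      unfolding \<phi>_def \<psi>_def exp_add[symmetric] sum.distrib[symmetric]
      by (simp add: difference_field_def split_beta' right_diff_distrib)
    note mult = independent_fields_expectation_mult[OF ind m int]
    show "integrable M (\<lambda>\<omega>. exp (\<Sum>z\<in>T. \<Sum>i\<in>UNIV. c z i * difference_field XH XK z \<omega> $ i))"
      unfolding eq by (rule mult(1))
    have "(\<integral>\<omega>. exp (\<Sum>z\<in>T. \<Sum>i\<in>UNIV. c z i * difference_field XH XK z \<omega> $ i) \<partial>M)
      = exp ((\<Sum>i\<in>UNIV. \<Sum>z\<in>T. \<Sum>z'\<in>T. c z i * c z' i * covariance MH XH0 (fst z) (fst z')) / 2)
      * exp ((\<Sum>i\<in>UNIV. \<Sum>z\<in>T. \<Sum>z'\<in>T. (- c z i) * (- c z' i) * covariance MK XK0 (snd z) (snd z')) / 2)"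
      unfolding eq mult(2) unfolding \<phi>_def \<psi>_def
      by (simp only: gaussian_random_field_mgf(2)[OF X T] gaussian_random_field_mgf(2)[OF Y T])
    also have "\<dots> = exp ((\<Sum>i\<in>UNIV. \<Sum>z\<in>T. \<Sum>z'\<in>T. c z i * c z' i *
        (covariance MH XH0 (fst z) (fst z') + covariance MK XK0 (snd z) (snd z'))) / 2)"
      unfolding exp_add[symmetric] add_divide_distrib[symmetric] sum.distrib[symmetric]
      by (simp add: distrib_left)
    finally show "(\<integral>\<omega>. exp (\<Sum>z\<in>T. \<Sum>i\<in>UNIV. c z i * difference_field XH XK z \<omega> $ i) \<partial>M)
      = exp ((\<Sum>i\<in>UNIV. \<Sum>z\<in>T. \<Sum>z'\<in>T. c z i * c z' i *
        (covariance MH XH0 (fst z) (fst z') + covariance MK XK0 (snd z) (snd z'))) / 2)" .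
  qed (auto simp: compact_cbox)
qed

text \<open>
  The difference field is an anisotropic Gaussian field on the unit cube of the product space, with
  the entries of \<open>(H, K)\<close> as exponents: the sums in the two conditions split along the two groups of
  coordinates, and the extreme ones of the two pairs of constants serve both groups.
\<close>

theorem theorem2p13:
  fixes M :: "'w measure" and MH :: "'u measure" and MK :: "'v measure"
    and XH :: "real ^ 'n1 \<Rightarrow> 'w \<Rightarrow> real ^ 'd"
    and XK :: "real ^ 'n2 \<Rightarrow> 'w \<Rightarrow> real ^ 'd"
    and XH0 :: "real ^ 'n1 \<Rightarrow> 'u \<Rightarrow> real"
    and XK0 :: "real ^ 'n2 \<Rightarrow> 'v \<Rightarrow> real"
    and H :: "real ^ 'n1" and K :: "real ^ 'n2"
  assumes "\<forall>j. 0 < H $ j \<and> H $ j < 1"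
    and "\<forall>j. 0 < K $ j \<and> K $ j < 1"
    and "gaussian_random_field M XH MH XH0"
    and "gaussian_random_field M XK MK XK0"
    and "independent_fields M XH XK"
    and "condition_C1 MH XH0 H" and "condition_C2 MH XH0 H"
    and "condition_C1 MK XK0 K" and "condition_C2 MK XK0 K"
  shows "((\<exists>L. is_intersection_local_time M XH XK L) \<longleftrightarrow>
           (\<Sum>j\<in>UNIV. 1 / H $ j) + (\<Sum>j\<in>UNIV. 1 / K $ j) > real CARD('d))
       \<and> ((\<exists>L. is_intersection_local_time M XH XK L \<and>
               L \<in> D1 M (coordinate_values (difference_field XH XK))) \<longleftrightarrow>
           (\<Sum>j\<in>UNIV. 1 / H $ j) + (\<Sum>j\<in>UNIV. 1 / K $ j) > real CARD('d) + 2)"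
proof -
  define RH where "RH = covariance MH XH0"
  define RK where "RK = covariance MK XK0"
  define R where "R = (\<lambda>(z :: (real ^ 'n1) \<times> (real ^ 'n2)) z'. RH (fst z) (fst z') + RK (snd z) (snd z'))"
  define h where "h b = (H, K) \<bullet> b" for b
  have GH: "centered_gaussian_field MH XH0" and GK: "centered_gaussian_field MK XK0"
    using assms(3,4) by (auto simp: gaussian_random_field_def)
  have PH: "prob_space MH" and PK: "prob_space MK" using GH GK by (auto simp: centered_gaussian_field_def)
  note LH = centered_gaussian_field_L2[OF GH] and LK = centered_gaussian_field_L2[OF GK]
  obtain a where a: "a > 0" "\<And>s t. s \<in> unit_cube \<Longrightarrow> t \<in> unit_cube \<Longrightarrow>
    RH s s - 2 * RH s t + RH t t \<le> a * (\<Sum>j\<in>UNIV. \<bar>s $ j - t $ j\<bar> powr (2 * H $ j))"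
    using condition_C1_covariance[OF assms(6) LH] unfolding RH_def by blast
  obtain a' where a': "a' > 0" "\<And>s t. s \<in> unit_cube \<Longrightarrow> t \<in> unit_cube \<Longrightarrow>
    RK s s - 2 * RK s t + RK t t \<le> a' * (\<Sum>j\<in>UNIV. \<bar>s $ j - t $ j\<bar> powr (2 * K $ j))"
    using condition_C1_covariance[OF assms(8) LK] unfolding RK_def by blast
  obtain b where b: "b > 0" "\<And>s t \<alpha>. s \<in> unit_cube \<Longrightarrow> t \<in> unit_cube \<Longrightarrow>
    b * (\<Sum>j\<in>UNIV. min (\<bar>s $ j - t $ j\<bar> powr (2 * H $ j)) (\<bar>t $ j\<bar> powr (2 * H $ j)))
      \<le> RH t t - 2 * \<alpha> * RH s t + \<alpha>\<^sup>2 * RH s s"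
    using condition_C2_covariance[OF assms(7) LH PH] unfolding RH_def by blast
  obtain b' where b': "b' > 0" "\<And>s t \<alpha>. s \<in> unit_cube \<Longrightarrow> t \<in> unit_cube \<Longrightarrow>
    b' * (\<Sum>j\<in>UNIV. min (\<bar>s $ j - t $ j\<bar> powr (2 * K $ j)) (\<bar>t $ j\<bar> powr (2 * K $ j)))
      \<le> RK t t - 2 * \<alpha> * RK s t + \<alpha>\<^sup>2 * RK s s"
    using condition_C2_covariance[OF assms(9) LK PK] unfolding RK_def by blast
  have cube: "z \<in> cbox 0 One \<longleftrightarrow> fst z \<in> unit_cube \<and> snd z \<in> unit_cube" for z :: "(real ^ 'n1) \<times> (real ^ 'n2)"
    unfolding unit_cube_Times[symmetric] by (cases z) auto
  have sums: "(\<Sum>b\<in>Basis. f b) = (\<Sum>j\<in>UNIV. f (axis j 1, 0)) + (\<Sum>j\<in>UNIV. f (0, axis j 1))"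
    for f :: "(real ^ 'n1) \<times> (real ^ 'n2) \<Rightarrow> real"
    by (simp add: sum_Basis_prod sum_Basis_vec)
  interpret gaussian_vector_field M "difference_field XH XK" R "cbox 0 One"
    using gaussian_vector_field_difference[OF assms(3,4,5)] unfolding R_def RH_def RK_def .
  interpret anisotropic_kernel R h "max a a'" "min b b'"
  proof
    show "continuous_on UNIV (\<lambda>(z, z'). R z z')" by (rule R_cont)
    show "0 \<le> R z z" for z by (rule R_nonneg)
    show "(R z z')\<^sup>2 \<le> R z z * R z' z'" for z z' by (rule R_Cauchy_Schwarz)
    show "0 < h b" if "b \<in> Basis" for b
      using that assms(1,2) unfolding h_def Basis_prod_def Basis_vec_def by (auto simp: inner_axis inner_prod_def)
    show "0 < max a a'" "0 < min b b'" using a(1) b(1) b'(1) by auto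
    fix z z' :: "(real ^ 'n1) \<times> (real ^ 'n2)"
    assume z: "z \<in> cbox 0 One" "z' \<in> cbox 0 One"
    have "R z z - 2 * R z z' + R z' z' \<le> a * (\<Sum>j\<in>UNIV. \<bar>fst z $ j - fst z' $ j\<bar> powr (2 * H $ j))
      + a' * (\<Sum>j\<in>UNIV. \<bar>snd z $ j - snd z' $ j\<bar> powr (2 * K $ j))"
      using a(2)[of "fst z" "fst z'"] a'(2)[of "snd z" "snd z'"] z unfolding cube R_def by simp
    also have "\<dots> \<le> max a a' * (\<Sum>j\<in>UNIV. \<bar>fst z $ j - fst z' $ j\<bar> powr (2 * H $ j))
      + max a a' * (\<Sum>j\<in>UNIV. \<bar>snd z $ j - snd z' $ j\<bar> powr (2 * K $ j))"
      by (intro add_mono mult_right_mono) (auto intro: sum_nonneg)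
    also have "\<dots> = max a a' * (\<Sum>b\<in>Basis. \<bar>(z - z') \<bullet> b\<bar> powr (2 * h b))"
      unfolding sums h_def by (simp add: inner_prod_def inner_axis distrib_left)
    finally show "R z z - 2 * R z z' + R z' z' \<le> max a a' * (\<Sum>b\<in>Basis. \<bar>(z - z') \<bullet> b\<bar> powr (2 * h b))" .
    fix \<alpha> :: real
    have "min b b' * (\<Sum>b\<in>Basis. min (\<bar>(z - z') \<bullet> b\<bar> powr (2 * h b)) (\<bar>z' \<bullet> b\<bar> powr (2 * h b)))
      = min b b' * (\<Sum>j\<in>UNIV. min (\<bar>fst z $ j - fst z' $ j\<bar> powr (2 * H $ j)) (\<bar>fst z' $ j\<bar> powr (2 * H $ j)))
      + min b b' * (\<Sum>j\<in>UNIV. min (\<bar>snd z $ j - snd z' $ j\<bar> powr (2 * K $ j)) (\<bar>snd z' $ j\<bar> powr (2 * K $ j)))"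
      unfolding sums h_def by (simp add: inner_prod_def inner_axis distrib_left)
    also have "\<dots> \<le> b * (\<Sum>j\<in>UNIV. min (\<bar>fst z $ j - fst z' $ j\<bar> powr (2 * H $ j)) (\<bar>fst z' $ j\<bar> powr (2 * H $ j)))
      + b' * (\<Sum>j\<in>UNIV. min (\<bar>snd z $ j - snd z' $ j\<bar> powr (2 * K $ j)) (\<bar>snd z' $ j\<bar> powr (2 * K $ j)))"
      by (intro add_mono mult_right_mono) (auto intro: sum_nonneg)
    also have "\<dots> \<le> R z' z' - 2 * \<alpha> * R z z' + \<alpha>\<^sup>2 * R z z"
      using b(2)[of "fst z" "fst z'" \<alpha>] b'(2)[of "snd z" "snd z'" \<alpha>] z unfolding cube R_def
      by (simp add: distrib_left)
    finally show "min b b' * (\<Sum>b\<in>Basis. min (\<bar>(z - z') \<bullet> b\<bar> powr (2 * h b)) (\<bar>z' \<bullet> b\<bar> powr (2 * h b)))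
      \<le> R z' z' - 2 * \<alpha> * R z z' + \<alpha>\<^sup>2 * R z z" .
  qed
  interpret anisotropic_gaussian_field M "difference_field XH XK" R h "max a a'" "min b b'" ..
  have "hdim = (\<Sum>j\<in>UNIV. 1 / H $ j) + (\<Sum>j\<in>UNIV. 1 / K $ j)"
    unfolding hdim_def sums h_def by (simp add: inner_prod_def inner_axis)
  then show ?thesis
    using local_time_exists_iff local_time_in_D1_iff
    unfolding is_intersection_local_time_def unit_cube_Times by simp
qed

end
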